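(* Let $(X,x)$ be a pointed cubical Kan complex and $n\ge0$. There is an isomorphism $\pi_n(X,x)\cong\pi_n(|X|,x)$, natural in $(X,x)$, between the $n$-th cubical homotopy group of $(X,x)$ and the $n$-th homotopy group of the geometric realization $|X|$ (an isomorphism of groups for $n\ge1$, a bijection of sets for $n=0$).
   Context: Cubes: $\square$ is the category whose objects are the posets $[1]^n=\{0\le 1\}^n$, $n\ge 0$, with morphisms generated under composition (inside posets) by the faces $\partial_{i,\varepsilon}\colon [1]^{n-1}\to[1]^n$ inserting $\varepsilon\in\{0,1\}$ as $i$-th coordinate, the degeneracies $\sigma_i\colon[1]^n\to[1]^{n-1}$ deleting the $i$-th coordinate, and the connections $\gamma_{i,0},\gamma_{i,1}\colon[1]^n\to[1]^{n-1}$ ($1\le i\le n-1$) replacing $x_i,x_{i+1}$ by their maximum, resp. minimum. A cubical set is a functor $\square^{op}\to\mathsf{Set}$; operators act on the right. $\square^n$ is the representable at $[1]^n$. The open box $\sqcap^n_{i,\varepsilon}\subseteq\square^n$ is the union of the images of all faces $\partial_{j,\eta}$ with $(j,\eta)\ne(i,\varepsilon)$. The geometric product $\otimes$ is the left Kan extension of $[1]^m\otimes[1]^n=[1]^{m+n}$, and $\hom_R(X,-)$ is the right adjoint of $X\otimes -$. A Kan complex is a cubical set $X$ such that every map $\sqcap^n_{i,\varepsilon}\to X$ extends to $\square^n\to X$. The geometric realization $|-|\colon\mathsf{cSet}\to\mathsf{Top}$ is the left Kan extension along the Yoneda embedding of the functor $\square\to\mathsf{Top}$, $[1]^n\mapsto[0,1]^n$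 (with faces, degeneracies, connections acting by coordinate insertion, deletion, max, min). Cubical homotopy groups of a pointed Kan complex $(X,x)$: $\Omega(X,x)$ is the pullback of $(x,x)\colon\square^0\to X\times X$ along $(\partial_{1,0}^*,\partial_{1,1}^* )\colon\hom_R(\square^1,X)\to X\times X$, pointed at $x\sigma_1$ (so a $k$-cube of $\Omega(X,x)$ is a $(k+1)$-cube of $X$ whose $\partial_{1,0}$- and $\partial_{1,1}$-faces are degenerate at $x$); $\Omega^0(X,x)=(X,x)$ and $\Omega^n(X,x)=\Omega(\Omega^{n-1}(X,x))$. $\pi_0(X)$ is the colimit of $X\colon\square^{op}\to\mathsf{Set}$ and $\pi_n(X,x)=\pi_0(\Omega^n(X,x))$. Group structure on $\pi_1(X,x)$: for $1$-cubes $f,g$ with both end-points $x$, $[f][g]=[s\partial_{2,0}]$ for any $2$-cube $s$ with $s\partial_{1,0}=f$, $s\partial_{2,1}=g$, $s\partial_{1,1}=x\sigma_1$; for $n\ge1$, $\pi_n(X,x)=\pi_1(\Omega^{n-1}(X,x))$ carries the resulting group structure. *)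

theory Defs
  imports "HOL-Analysis.Analysis" "HOL-Algebra.Group"
begin

section \<open>The box category\<close>

text \<open>
  Points of the poset $[1]^n$ and of the topological cube $[0,1]^n$ are extensional functions on
  \<open>{1..n}\<close>, with \<open>False\<close> and \<open>True\<close> as the elements $0 \le 1$ of the poset $[1]$.
  Face, degeneracy and connection are given by one formula for both kinds of cube; \<open>n\<close> is the
  dimension of the target for a face, and of the source for a degeneracy or connection.
\<close>

definition vert :: "nat \<Rightarrow> (nat \<Rightarrow> bool) set" where
  "vert n = {1..n} \<rightarrow>\<^sub>E (UNIV :: bool set)"

definition cell :: "nat \<Rightarrow> (nat \<Rightarrow> real) set" where
  "cell n = {1..n} \<rightarrow>\<^sub>E {0..1::real}"

definition face_fun :: "nat \<Rightarrow> nat \<Rightarrow> 'l \<Rightarrow> (nat \<Rightarrow> 'l) \<Rightarrow> nat \<Rightarrow> 'l" where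
  "face_fun n i e x = (\<lambda>j\<in>{1..n}. if j < i then x j else if j = i then e else x (j - 1))"

definition degen_fun :: "nat \<Rightarrow> nat \<Rightarrow> (nat \<Rightarrow> 'l) \<Rightarrow> nat \<Rightarrow> 'l" where
  "degen_fun n i x = (\<lambda>j\<in>{1..n-1}. if j < i then x j else x (j + 1))"

definition conn_fun :: "nat \<Rightarrow> nat \<Rightarrow> bool \<Rightarrow> (nat \<Rightarrow> 'l::linorder) \<Rightarrow> nat \<Rightarrow> 'l" where
  "conn_fun n i \<epsilon> x =
     (\<lambda>j\<in>{1..n-1}. if j < i then x j
                   else if j = i then (if \<epsilon> then min (x i) (x (i + 1)) else max (x i) (x (i + 1)))
                   else x (j + 1))"

type_synonym box_map = "(nat \<Rightarrow> bool) \<Rightarrow> (nat \<Rightarrow> bool)"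

definition box_id :: "nat \<Rightarrow> box_map" where
  "box_id n = (\<lambda>x\<in>vert n. x)"

definition box_face :: "nat \<Rightarrow> nat \<Rightarrow> bool \<Rightarrow> box_map" where
  "box_face n i \<epsilon> = (\<lambda>x\<in>vert (n - 1). face_fun n i \<epsilon> x)"

definition box_degen :: "nat \<Rightarrow> nat \<Rightarrow> box_map" where
  "box_degen n i = (\<lambda>x\<in>vert n. degen_fun n i x)"

definition box_conn :: "nat \<Rightarrow> nat \<Rightarrow> bool \<Rightarrow> box_map" where
  "box_conn n i \<epsilon> = (\<lambda>x\<in>vert n. conn_fun n i \<epsilon> x)"

text \<open>\<open>box_hom m n \<phi>\<close>: \<open>\<phi>\<close> is a morphism $[1]^m \to [1]^n$ of the box category.\<close>

inductive box_hom :: "nat \<Rightarrow> nat \<Rightarrow> box_map \<Rightarrow> bool" where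
  id: "box_hom n n (box_id n)"
| face: "i \<in> {1..n} \<Longrightarrow> box_hom (n - 1) n (box_face n i \<epsilon>)"
| degen: "i \<in> {1..n} \<Longrightarrow> box_hom n (n - 1) (box_degen n i)"
| conn: "i \<in> {1..n-1} \<Longrightarrow> box_hom n (n - 1) (box_conn n i \<epsilon>)"
| comp: "box_hom l m \<phi> \<Longrightarrow> box_hom m n \<psi> \<Longrightarrow> box_hom l n (compose (vert l) \<psi> \<phi>)"

text \<open>The unique morphism $[1]^k \to [1]^0$, a composite of degeneracies.\<close>

definition box_bang :: "nat \<Rightarrow> box_map" where
  "box_bang k = (\<lambda>x\<in>vert k. restrict x {})"

text \<open>The monoidal product of morphisms $[1]^m \to [1]^n$ and $[1]^{m'} \to [1]^{n'}$, on
  $[1]^m \otimes [1]^{m'} = [1]^{m+m'}$.\<close>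

definition box_tensor :: "nat \<Rightarrow> nat \<Rightarrow> box_map \<Rightarrow> nat \<Rightarrow> nat \<Rightarrow> box_map \<Rightarrow> box_map" where
  "box_tensor m n \<phi> m' n' \<psi> =
     (\<lambda>x\<in>vert (m + m'). \<lambda>j\<in>{1..n+n'}.
        if j \<le> n then \<phi> (restrict x {1..m}) j
        else \<psi> (\<lambda>i\<in>{1..m'}. x (m + i)) (j - n))"

section \<open>The functor from the box category to topological spaces\<close>

text \<open>
  \<open>box_top_graph m n \<phi> \<psi>\<close> is the graph of the action of $[1]^n \mapsto [0,1]^n$ on morphisms:
  it sends generators to the maps of topological cubes given by the same formula and
  preserves identities and composition. It is single-valued by \<open>box_top_graph_unique\<close> below.
\<close>

type_synonym cell_map = "(nat \<Rightarrow> real) \<Rightarrow> (nat \<Rightarrow> real)"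

inductive box_top_graph :: "nat \<Rightarrow> nat \<Rightarrow> box_map \<Rightarrow> cell_map \<Rightarrow> bool" where
  id: "box_top_graph n n (box_id n) (\<lambda>t\<in>cell n. t)"
| face: "i \<in> {1..n} \<Longrightarrow>
    box_top_graph (n - 1) n (box_face n i \<epsilon>) (\<lambda>t\<in>cell (n - 1). face_fun n i (of_bool \<epsilon>) t)"
| degen: "i \<in> {1..n} \<Longrightarrow>
    box_top_graph n (n - 1) (box_degen n i) (\<lambda>t\<in>cell n. degen_fun n i t)"
| conn: "i \<in> {1..n-1} \<Longrightarrow>
    box_top_graph n (n - 1) (box_conn n i \<epsilon>) (\<lambda>t\<in>cell n. conn_fun n i \<epsilon> t)"
| comp: "box_top_graph l m \<phi> \<phi>' \<Longrightarrow> box_top_graph m n \<psi> \<psi>' \<Longrightarrow>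
    box_top_graph l n (compose (vert l) \<psi> \<phi>) (compose (cell l) \<psi>' \<phi>')"

definition box_top :: "nat \<Rightarrow> nat \<Rightarrow> box_map \<Rightarrow> cell_map" where
  "box_top m n \<phi> = (THE \<psi>. box_top_graph m n \<phi> \<psi>)"

lemma box_top_graph_total:
  assumes "box_hom m n \<phi>"
  shows "\<exists>\<psi>. box_top_graph m n \<phi> \<psi>"
  using assms by induction (blast intro: box_top_graph.intros)+

definition threshold :: "nat \<Rightarrow> real \<Rightarrow> (nat \<Rightarrow> real) \<Rightarrow> nat \<Rightarrow> bool" where
  "threshold n c t = (\<lambda>j\<in>{1..n}. c \<le> t j)"

lemma threshold_vert [simp]: "threshold n c t \<in> vert n"
  by (simp add: threshold_def vert_def)

lemma max_bool: "max a b \<longleftrightarrow> a \<or> b" for a b :: bool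
  by (auto simp: max_def)

lemma min_bool: "min a b \<longleftrightarrow> a \<and> b" for a b :: bool
  by (auto simp: min_def)

text \<open>Each threshold is a lattice homomorphism from $[0,1]$ to $[1]$ preserving the end points,
  so it commutes with all operators.\<close>

lemma box_top_graph_threshold:
  assumes "box_top_graph m n \<phi> \<psi>"
  shows "\<psi> \<in> cell m \<rightarrow>\<^sub>E cell n \<and>
    (\<forall>t\<in>cell m. \<forall>c\<in>{0<..1}. threshold n c (\<psi> t) = \<phi> (threshold m c t))"
  using assms
proof induction
  case (id n)
  have "(\<lambda>t\<in>cell n. t) \<in> cell n \<rightarrow>\<^sub>E cell n"
    by (rule restrict_PiE_iff[THEN iffD2]) simp
  moreover have "threshold n c ((\<lambda>t\<in>cell n. t) t) = box_id n (threshold n c t)"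
    if "t \<in> cell n" for c t
    using that by (simp add: box_id_def)
  ultimately show ?case by blast
next
  case (face i n \<epsilon>)
  have "face_fun n i (of_bool \<epsilon>) t \<in> cell n" if "t \<in> cell (n - 1)" for t
  proof -
    have *: "t j \<in> {0..1}" if "j \<in> {1..n-1}" for j
      using \<open>t \<in> cell (n - 1)\<close> that unfolding cell_def by (rule PiE_mem)
    show ?thesis
      unfolding face_fun_def cell_def restrict_PiE_iff
    proof (intro ballI)
      fix j assume j: "j \<in> {1..n}"
      have "j - 1 \<in> {1..n-1}" if "j > i"
        using j that face by auto
      with j show "(if j < i then t j else if j = i then of_bool \<epsilon> else t (j - 1)) \<in> {0..1}"
        using face *[of j] *[of "j - 1"] by (cases j i rule: linorder_cases) auto
    qed
  qed
  moreover have "threshold n c (face_fun n i (of_bool \<epsilon>) t) = face_fun n i \<epsilon> (threshold (n - 1) c t)"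
    if "c \<in> {0<..1}" for c t
    using that face by (cases \<epsilon>) (auto simp: face_fun_def threshold_def fun_eq_iff)
  ultimately show ?case
    by (intro conjI ballI restrict_PiE_iff[THEN iffD2]) (simp_all add: box_face_def)
next
  case (degen i n)
  have "degen_fun n i t \<in> cell (n - 1)" if "t \<in> cell n" for t
  proof -
    have "t j \<in> {0..1}" if "j \<in> {1..n}" for j
      using \<open>t \<in> cell n\<close> that unfolding cell_def by (rule PiE_mem)
    then show ?thesis
      unfolding degen_fun_def cell_def restrict_PiE_iff using degen by auto
  qed
  moreover have "threshold (n - 1) c (degen_fun n i t) = degen_fun n i (threshold n c t)" for c t
    using degen by (auto simp: degen_fun_def threshold_def fun_eq_iff)
  ultimately show ?case
    by (intro conjI ballI restrict_PiE_iff[THEN iffD2]) (simp_all add: box_degen_def)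
next
  case (conn i n \<epsilon>)
  have "conn_fun n i \<epsilon> t \<in> cell (n - 1)" if "t \<in> cell n" for t
  proof -
    have "t j \<in> {0..1}" if "j \<in> {1..n}" for j
      using \<open>t \<in> cell n\<close> that unfolding cell_def by (rule PiE_mem)
    then show ?thesis
      unfolding conn_fun_def cell_def restrict_PiE_iff using conn by (auto simp: min_def max_def)
  qed
  moreover have "threshold (n - 1) c (conn_fun n i \<epsilon> t) = conn_fun n i \<epsilon> (threshold n c t)" for c t
    using conn
    by (auto simp: conn_fun_def threshold_def fun_eq_iff le_max_iff_disj max_bool min_bool)
  ultimately show ?case
    by (intro conjI ballI restrict_PiE_iff[THEN iffD2]) (simp_all add: box_conn_def)
next
  case (comp l m \<phi> \<phi>' n \<psi> \<psi>')
  have 1: "\<phi>' t \<in> cell m" if "t \<in> cell l" for t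
    using comp.IH(1)[THEN conjunct1] that by (rule PiE_mem)
  have 2: "\<psi>' t \<in> cell n" if "t \<in> cell m" for t
    using comp.IH(2)[THEN conjunct1] that by (rule PiE_mem)
  show ?case
    unfolding compose_def
    using comp.IH 1 2 by (intro conjI ballI restrict_PiE_iff[THEN iffD2]) simp_all
qed

lemma threshold_inj:
  assumes "s \<in> cell n" "t \<in> cell n"
    and "\<And>c. c \<in> {0<..1} \<Longrightarrow> threshold n c s = threshold n c t"
  shows "s = t"
proof (rule PiE_ext[OF assms(1,2)[unfolded cell_def]])
  fix j assume j: "j \<in> {1..n}"
  have st: "s j \<in> {0..1}" "t j \<in> {0..1}"
    using PiE_mem[OF assms(1)[unfolded cell_def] j] PiE_mem[OF assms(2)[unfolded cell_def] j] by auto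
  have *: "c \<le> s j \<longleftrightarrow> c \<le> t j" if "c \<in> {0<..1}" for c
    using fun_cong[OF assms(3)[OF that], of j] j by (simp add: threshold_def)
  show "s j = t j"
    using *[of "s j"] *[of "t j"] st by (auto simp: order_le_less)
qed

lemma box_top_graph_unique:
  assumes "box_top_graph m n \<phi> \<psi>" "box_top_graph m n \<phi> \<psi>'"
  shows "\<psi> = \<psi>'"
proof (rule PiE_ext)
  show "\<psi> \<in> cell m \<rightarrow>\<^sub>E cell n" "\<psi>' \<in> cell m \<rightarrow>\<^sub>E cell n"
    using assms[THEN box_top_graph_threshold] by blast+
next
  fix t assume t: "t \<in> cell m"
  show "\<psi> t = \<psi>' t"
  proof (rule threshold_inj[where n = n])
    show "\<psi> t \<in> cell n" "\<psi>' t \<in> cell n"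
      using PiE_mem[OF conjunct1[OF box_top_graph_threshold] t] assms by blast+
    show "threshold n c (\<psi> t) = threshold n c (\<psi>' t)" if "c \<in> {0<..1}" for c
      using box_top_graph_threshold[OF assms(1)] box_top_graph_threshold[OF assms(2)] t that
      by simp
  qed
qed

lemma box_top_eqI: "box_top_graph m n \<phi> \<psi> \<Longrightarrow> box_top m n \<phi> = \<psi>"
  unfolding box_top_def using box_top_graph_unique by blast

lemma box_top_compose:
  assumes "box_hom l m \<phi>" "box_hom m n \<psi>"
  shows "box_top l n (compose (vert l) \<psi> \<phi>) = compose (cell l) (box_top m n \<psi>) (box_top l m \<phi>)"
proof -
  obtain \<phi>' \<psi>' where *: "box_top_graph l m \<phi> \<phi>'" "box_top_graph m n \<psi> \<psi>'"
    using assms box_top_graph_total by blast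
  from box_top_eqI[OF box_top_graph.comp[OF *]] show ?thesis
    by (simp only: *[THEN box_top_eqI])
qed

section \<open>Cubical sets\<close>

text \<open>For \<open>\<phi>\<close> a morphism $[1]^m \to [1]^n$ and \<open>x\<close> an \<open>n\<close>-cube, \<open>act X m n x \<phi>\<close> is the
  \<open>m\<close>-cube $x\varphi$.\<close>

record 'a cset =
  cubes :: "nat \<Rightarrow> 'a set"
  act :: "nat \<Rightarrow> nat \<Rightarrow> 'a \<Rightarrow> box_map \<Rightarrow> 'a"

definition cubical_set :: "'a cset \<Rightarrow> bool" where
  "cubical_set X \<longleftrightarrow>
     (\<forall>m n \<phi>. box_hom m n \<phi> \<longrightarrow> (\<forall>x\<in>cubes X n. act X m n x \<phi> \<in> cubes X m)) \<and>
     (\<forall>n. \<forall>x\<in>cubes X n. act X n n x (box_id n) = x) \<and>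
     (\<forall>l m n \<phi> \<psi>. box_hom l m \<phi> \<longrightarrow> box_hom m n \<psi> \<longrightarrow>
        (\<forall>x\<in>cubes X n. act X l n x (compose (vert l) \<psi> \<phi>) = act X l m (act X m n x \<psi>) \<phi>))"

definition cset_map :: "'a cset \<Rightarrow> 'b cset \<Rightarrow> (nat \<Rightarrow> 'a \<Rightarrow> 'b) \<Rightarrow> bool" where
  "cset_map X Y f \<longleftrightarrow>
     (\<forall>n. f n \<in> cubes X n \<rightarrow> cubes Y n) \<and>
     (\<forall>m n \<phi>. box_hom m n \<phi> \<longrightarrow> (\<forall>x\<in>cubes X n. f m (act X m n x \<phi>) = act Y m n (f n x) \<phi>))"

definition std_cube :: "nat \<Rightarrow> box_map cset" where
  "std_cube n = \<lparr>cubes = (\<lambda>m. {\<phi>. box_hom m n \<phi>}), act = (\<lambda>l m \<phi> \<psi>. compose (vert l) \<phi> \<psi>)\<rparr>"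

definition open_box :: "nat \<Rightarrow> nat \<Rightarrow> bool \<Rightarrow> box_map cset" where
  "open_box n i \<epsilon> =
     \<lparr>cubes = (\<lambda>m. {compose (vert m) (box_face n j \<eta>) \<psi> | j \<eta> \<psi>.
                      j \<in> {1..n} \<and> (j, \<eta>) \<noteq> (i, \<epsilon>) \<and> box_hom m (n - 1) \<psi>}),
      act = act (std_cube n)\<rparr>"

definition kan_complex :: "'a cset \<Rightarrow> bool" where
  "kan_complex X \<longleftrightarrow> cubical_set X \<and>
     (\<forall>n i \<epsilon> f. i \<in> {1..n} \<longrightarrow> cset_map (open_box n i \<epsilon>) X f \<longrightarrow>
        (\<exists>g. cset_map (std_cube n) X g \<and>
             (\<forall>m. \<forall>\<phi>\<in>cubes (open_box n i \<epsilon>) m. g m \<phi> = f m \<phi>)))"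

definition pointed_kan :: "'a cset \<Rightarrow> 'a \<Rightarrow> bool" where
  "pointed_kan X x \<longleftrightarrow> kan_complex X \<and> x \<in> cubes X 0"

definition pointed_map :: "'a cset \<Rightarrow> 'a \<Rightarrow> 'b cset \<Rightarrow> 'b \<Rightarrow> (nat \<Rightarrow> 'a \<Rightarrow> 'b) \<Rightarrow> bool" where
  "pointed_map X x Y y F \<longleftrightarrow> cset_map X Y F \<and> F 0 x = y"

section \<open>Quotients\<close>

definition generated_equiv :: "'a set \<Rightarrow> ('a \<Rightarrow> 'a \<Rightarrow> bool) \<Rightarrow> 'a rel" where
  "generated_equiv A r = {(a, b) \<in> A \<times> A. equivclp (\<lambda>a b. a \<in> A \<and> b \<in> A \<and> r a b) a b}"

lemma equiv_generated_equiv: "equiv A (generated_equiv A r)"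
proof (rule equivI)
  show "generated_equiv A r \<subseteq> A \<times> A"
    by (auto simp: generated_equiv_def)
  show "refl_on A (generated_equiv A r)"
    by (auto simp: generated_equiv_def refl_on_def)
  show "sym (generated_equiv A r)"
    by (auto simp: generated_equiv_def sym_def intro: equivclp_sym)
  show "trans (generated_equiv A r)"
    by (auto simp: generated_equiv_def trans_def intro: equivclp_trans)
qed

definition coinduced_topology :: "'a topology \<Rightarrow> ('a \<Rightarrow> 'b) \<Rightarrow> 'b topology" where
  "coinduced_topology T q =
     topology (\<lambda>U. U \<subseteq> q ` topspace T \<and> openin T {t \<in> topspace T. q t \<in> U})"

lemma openin_coinduced_topology:
  "openin (coinduced_topology T q) U \<longleftrightarrow>
     U \<subseteq> q ` topspace T \<and> openin T {t \<in> topspace T. q t \<in> U}"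
proof -
  have 1: "{t \<in> topspace T. q t \<in> U \<inter> V} = {t \<in> topspace T. q t \<in> U} \<inter> {t \<in> topspace T. q t \<in> V}"
    for U V by blast
  have 2: "{t \<in> topspace T. q t \<in> \<Union>\<K>} = (\<Union>K\<in>\<K>. {t \<in> topspace T. q t \<in> K})" for \<K>
    by blast
  have "istopology (\<lambda>U. U \<subseteq> q ` topspace T \<and> openin T {t \<in> topspace T. q t \<in> U})"
    unfolding istopology_def 1 2 by blast
  then show ?thesis
    by (simp add: coinduced_topology_def topology_inverse')
qed

lemma quotient_map_coinduced: "quotient_map T (coinduced_topology T q) q"
proof -
  have "topspace (coinduced_topology T q) = q ` topspace T"
  proof
    show "topspace (coinduced_topology T q) \<subseteq> q ` topspace T"
      by (metis openin_coinduced_topology openin_topspace)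
    have "{t \<in> topspace T. q t \<in> q ` topspace T} = topspace T"
      by blast
    then show "q ` topspace T \<subseteq> topspace (coinduced_topology T q)"
      by (simp add: openin_coinduced_topology openin_subset)
  qed
  then show ?thesis
    by (auto simp: quotient_map_def openin_coinduced_topology)
qed

section \<open>Geometric realization\<close>

text \<open>
  The left Kan extension along the Yoneda embedding is the coend of $X_n \times [0,1]^n$ with
  $X_n$ discrete: the quotient of the disjoint union of copies of $[0,1]^n$, one for each
  \<open>n\<close>-cube, by the identifications $(x\varphi, t) \sim (x, |\varphi|(t))$.
\<close>

abbreviation cell_top :: "nat \<Rightarrow> (nat \<Rightarrow> real) topology" where
  "cell_top n \<equiv> product_topology (\<lambda>_. top_of_set {0..1::real}) {1..n}"

lemma topspace_cell_top: "topspace (cell_top n) = cell n"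
  by (simp add: cell_def)

type_synonym 'a real_pt = "((nat \<times> 'a) \<times> (nat \<Rightarrow> real)) set"

definition pre_real :: "'a cset \<Rightarrow> ((nat \<times> 'a) \<times> (nat \<Rightarrow> real)) topology" where
  "pre_real X = sum_topology (\<lambda>(n, x). cell_top n) (SIGMA n:UNIV. cubes X n)"

definition real_rel :: "'a cset \<Rightarrow> ((nat \<times> 'a) \<times> (nat \<Rightarrow> real)) rel" where
  "real_rel X = generated_equiv (topspace (pre_real X))
     (\<lambda>a b. \<exists>m n \<phi> x t. box_hom m n \<phi> \<and> x \<in> cubes X n \<and> t \<in> cell m \<and>
        a = ((m, act X m n x \<phi>), t) \<and> b = ((n, x), box_top m n \<phi> t))"

definition realization :: "'a cset \<Rightarrow> 'a real_pt topology" where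
  "realization X = coinduced_topology (pre_real X) (\<lambda>a. real_rel X `` {a})"

definition real_vertex :: "'a cset \<Rightarrow> 'a \<Rightarrow> 'a real_pt" where
  "real_vertex X x = real_rel X `` {((0, x), \<lambda>j. undefined)}"

text \<open>Here and below, a map of quotients induced by \<open>f\<close> sends a class \<open>A\<close> to the saturation of
  the image of \<open>A\<close> under \<open>f\<close>, which is a single class when \<open>f\<close> respects the relations.\<close>

definition real_map :: "'a cset \<Rightarrow> 'b cset \<Rightarrow> (nat \<Rightarrow> 'a \<Rightarrow> 'b) \<Rightarrow> 'a real_pt \<Rightarrow> 'b real_pt" where
  "real_map X Y F p = real_rel Y `` ((\<lambda>((n, x), t). ((n, F n x), t)) ` p)"

section \<open>Cubical homotopy groups\<close>

text \<open>
  By the Yoneda lemma a \<open>k\<close>-cube of the right adjoint $\mathrm{hom}_R(\square^1, X)$ is a map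
  $\square^1 \otimes \square^k = \square^{1+k} \to X$, that is, a \<open>(1+k)\<close>-cube of \<open>X\<close>,
  and an operator $\varphi$ acts as $\mathrm{id} \otimes \varphi$.
\<close>

definition path_cset :: "'a cset \<Rightarrow> 'a cset" where
  "path_cset X =
     \<lparr>cubes = (\<lambda>k. cubes X (1 + k)),
      act = (\<lambda>m n s \<phi>. act X (1 + m) (1 + n) s (box_tensor 1 1 (box_id 1) m n \<phi>))\<rparr>"

definition loop_cset :: "'a cset \<Rightarrow> 'a \<Rightarrow> 'a cset" where
  "loop_cset X x = (path_cset X)
     \<lparr>cubes := \<lambda>k. {s \<in> cubes (path_cset X) k.
        \<forall>\<epsilon>. act X k (1 + k) s (box_face (1 + k) 1 \<epsilon>) = act X k 0 x (box_bang k)}\<rparr>"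

definition loop_pointed :: "'a cset \<times> 'a \<Rightarrow> 'a cset \<times> 'a" where
  "loop_pointed = (\<lambda>(X, x). (loop_cset X x, act X 1 0 x (box_degen 1 1)))"

definition iter_loop :: "nat \<Rightarrow> 'a cset \<times> 'a \<Rightarrow> 'a cset \<times> 'a" where
  "iter_loop n = loop_pointed ^^ n"

text \<open>The colimit of \<open>X\<close> as a functor to sets.\<close>

definition cs_pi0_rel :: "'a cset \<Rightarrow> (nat \<times> 'a) rel" where
  "cs_pi0_rel X = generated_equiv (SIGMA n:UNIV. cubes X n)
     (\<lambda>a b. \<exists>m n \<phi> x. box_hom m n \<phi> \<and> x \<in> cubes X n \<and> a = (m, act X m n x \<phi>) \<and> b = (n, x))"

definition cs_pi0 :: "'a cset \<Rightarrow> (nat \<times> 'a) set set" where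
  "cs_pi0 X = (SIGMA n:UNIV. cubes X n) // cs_pi0_rel X"

definition cs_pi :: "nat \<Rightarrow> 'a cset \<Rightarrow> 'a \<Rightarrow> (nat \<times> 'a) set set" where
  "cs_pi n X x = cs_pi0 (fst (iter_loop n (X, x)))"

text \<open>
  A loop \<open>f\<close> of \<open>X\<close> at \<open>x\<close>, being a \<open>0\<close>-cube of the loop object, appears as \<open>(0, f)\<close> in
  the colimit.
\<close>

definition cs_pi1_group :: "'a cset \<Rightarrow> 'a \<Rightarrow> (nat \<times> 'a) set monoid" where
  "cs_pi1_group X x =
     \<lparr>carrier = cs_pi0 (loop_cset X x),
      monoid.mult = (\<lambda>A B. cs_pi0_rel (loop_cset X x) ``
        {(0, act X 1 2 s (box_face 2 2 False)) | s.
           s \<in> cubes X 2 \<and>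
           (0, act X 1 2 s (box_face 2 1 False)) \<in> A \<and>
           (0, act X 1 2 s (box_face 2 2 True)) \<in> B \<and>
           act X 1 2 s (box_face 2 1 True) = act X 1 0 x (box_degen 1 1)}),
      one = cs_pi0_rel (loop_cset X x) `` {(0, act X 1 0 x (box_degen 1 1))}\<rparr>"

definition cs_pi_group :: "nat \<Rightarrow> 'a cset \<Rightarrow> 'a \<Rightarrow> (nat \<times> 'a) set monoid" where
  "cs_pi_group n X x = (case iter_loop (n - 1) (X, x) of (Z, z) \<Rightarrow> cs_pi1_group Z z)"

text \<open>The map on \<open>k\<close>-cubes of the loop objects induced by \<open>F\<close> is \<open>F\<close> on \<open>(1+k)\<close>-cubes.\<close>

definition loop_map :: "(nat \<Rightarrow> 'a \<Rightarrow> 'b) \<Rightarrow> nat \<Rightarrow> 'a \<Rightarrow> 'b" where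
  "loop_map F = (\<lambda>k. F (1 + k))"

definition cs_pi_map ::
    "nat \<Rightarrow> 'b cset \<Rightarrow> 'b \<Rightarrow> (nat \<Rightarrow> 'a \<Rightarrow> 'b) \<Rightarrow> (nat \<times> 'a) set \<Rightarrow> (nat \<times> 'b) set" where
  "cs_pi_map n Y y F A =
     cs_pi0_rel (fst (iter_loop n (Y, y))) `` ((\<lambda>(k, s). (k, (loop_map ^^ n) F k s)) ` A)"

section \<open>Homotopy groups of topological spaces\<close>

definition cell_bdry :: "nat \<Rightarrow> (nat \<Rightarrow> real) set" where
  "cell_bdry n = {t \<in> cell n. \<exists>i\<in>{1..n}. t i = 0 \<or> t i = 1}"

definition spheroids :: "nat \<Rightarrow> 'b topology \<Rightarrow> 'b \<Rightarrow> ((nat \<Rightarrow> real) \<Rightarrow> 'b) set" where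
  "spheroids n T p =
     {f \<in> extensional (cell n). continuous_map (cell_top n) T f \<and> (\<forall>t\<in>cell_bdry n. f t = p)}"

definition top_pi_rel :: "nat \<Rightarrow> 'b topology \<Rightarrow> 'b \<Rightarrow> ((nat \<Rightarrow> real) \<Rightarrow> 'b) rel" where
  "top_pi_rel n T p = {(f, g) \<in> spheroids n T p \<times> spheroids n T p.
     homotopic_with (\<lambda>h. \<forall>t\<in>cell_bdry n. h t = p) (cell_top n) T f g}"

definition top_pi :: "nat \<Rightarrow> 'b topology \<Rightarrow> 'b \<Rightarrow> ((nat \<Rightarrow> real) \<Rightarrow> 'b) set set" where
  "top_pi n T p = spheroids n T p // top_pi_rel n T p"

definition spheroid_concat ::
    "nat \<Rightarrow> ((nat \<Rightarrow> real) \<Rightarrow> 'b) \<Rightarrow> ((nat \<Rightarrow> real) \<Rightarrow> 'b) \<Rightarrow> (nat \<Rightarrow> real) \<Rightarrow> 'b" where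
  "spheroid_concat n f g =
     (\<lambda>t\<in>cell n. if t 1 \<le> 1 / 2 then f (t(1 := 2 * t 1)) else g (t(1 := 2 * t 1 - 1)))"

definition top_pi_group :: "nat \<Rightarrow> 'b topology \<Rightarrow> 'b \<Rightarrow> ((nat \<Rightarrow> real) \<Rightarrow> 'b) set monoid" where
  "top_pi_group n T p =
     \<lparr>carrier = top_pi n T p,
      monoid.mult = (\<lambda>A B. top_pi_rel n T p `` {spheroid_concat n f g | f g. f \<in> A \<and> g \<in> B}),
      one = top_pi_rel n T p `` {\<lambda>t\<in>cell n. p}\<rparr>"

definition top_pi_map ::
    "nat \<Rightarrow> 'c topology \<Rightarrow> 'c \<Rightarrow> ('b \<Rightarrow> 'c) \<Rightarrow>
     ((nat \<Rightarrow> real) \<Rightarrow> 'b) set \<Rightarrow> ((nat \<Rightarrow> real) \<Rightarrow> 'c) set" where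
  "top_pi_map n T p h A = top_pi_rel n T p `` ((\<lambda>f. compose (cell n) h f) ` A)"

end

theory Submission
  imports Defs
begin

text \<open>Over a cubical Kan complex \<open>X\<close> one can choose, naturally in an \<open>N\<close>-cube \<open>x\<close> and a singular cube
 \<open>g\<close> of $[0,1]^N$, a cube \<open>r(x,g)\<close> of \<open>X\<close> together with a homotopy from \<open>|x| g\<close> to \<open>|r(x,g)|\<close>; both are
 standard when \<open>g\<close> comes from a box morphism. Pinching the unit interval near its end points makes every
 map $[0,1]^M \to |X|$ locally of the form \<open>|x| g\<close>, hence a sufficiently fine grid of such lifts covers it,
 with matching faces. A natural filling of squares composes a grid in \<open>X\<close> into a single cube of
 $\Omega^M X$. Applied to a spheroid this gives surjectivity of the comparison map, applied to a homotopy
 injectivity. Cubical composition uses the last coordinate and composition of spheroids the first,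
 which is why the comparison swaps the two.\<close>

text \<open>Strict equality shapes the proof: neighbouring lifts can be merged only if their common
  faces are equal cubes, whereas two charts of a map into \<open>realization X\<close> agree on an
  overlap only up to the identifications of a coend. The lifts \<open>r\<close> and homotopies
  \<open>h\<close> must therefore be functorial both in the cube of \<open>X\<close> and in the
  singular cube, so that they respect \<open>deq\<close>. This is obtained by choosing values on
  non-degenerate cubes only, which needs the Eilenberg--Zilber property in the presence of
  connections: an epimorphism of cubes is determined by its sections. One pinch makes local lifts
  exist, a second makes overlapping lifts \<open>deq\<close>-equal. Over a single cube, the values
  on operators and on singular cubes in the boundary are forced; they extend to all singular cubes
  because the first coordinate can be contracted by a minimum, which is a connection and so sends
  operators to operators. Composition in \<open>X\<close> and in its singular complex is chosen
  compatibly and with a strict unit law, so that a grid with one nontrivial cell merges to exactly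
  that cell.\<close>

declare One_nat_def [simp del]

section \<open>Elementary calculus of box morphisms: values on coordinates and cubical
  identities\<close>

abbreviation "vcomp n == compose (vert n)"

lemma vert_iff: "x:vert n \<longleftrightarrow> (ALL j. j ~: {1..n} --> x j = undefined)"
 by (auto simp: vert_def extensional_def)

lemma vert_restrict [simp]: "(\<lambda>j\<in>{1..n}. f j):vert n"
 by (auto simp: vert_iff)

lemma vert_upd: "x:vert n ==> i:{1..n} ==> x(i := b):vert n"
 by (auto simp: vert_iff)

lemma vert_eqI: "x:vert n ==> y:vert n ==> (!!j. j:{1..n} ==> x j = y j) ==> x = y"
 by (rule ext) (metis vert_iff)

lemma fun_vert: "face_fun n i e x:vert n" "degen_fun n i x:vert (n - 1)"
 "conn_fun n i e x:vert (n - 1)"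
 by (simp_all only: face_fun_def degen_fun_def conn_fun_def vert_restrict)

lemma hom_PiE: "box_hom m n f ==> f:vert m \<rightarrow>\<^sub>E vert n"
proof (induction rule: box_hom.induct)
 case (comp l m f n g)
 thus ?case by (auto simp: compose_def Pi_def extensional_def)
next
 case (id n)
 show ?case unfolding box_id_def restrict_PiE_iff by simp
qed (unfold box_face_def box_degen_def box_conn_def restrict_PiE_iff, (intro ballI fun_vert)+)

lemma hom_vert: "box_hom m n f ==> x:vert m ==> f x:vert n"
 using hom_PiE by (rule PiE_mem)

lemma box_eqI:
 assumes "f:vert m \<rightarrow>\<^sub>E vert n" "g:vert m \<rightarrow>\<^sub>E vert n"
  and "!!x j. x:vert m ==> j:{1..n} ==> f x j = g x j"
 shows "f = g"
 using assms(1,2)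
proof (rule PiE_ext)
 fix x assume "x:vert m"
 with assms show "f x = g x" by (intro vert_eqI) auto
qed

lemma hom_eqI:
 assumes "box_hom m n f" "box_hom m n g"
  and "!!x j. x:vert m ==> j:{1..n} ==> f x j = g x j"
 shows "f = g"
 using hom_PiE[OF assms(1)] hom_PiE[OF assms(2)] assms(3) by (rule box_eqI)

lemma face_hom: "i:{1..n} ==> n = Suc m ==> box_hom m n (box_face n i e)"
 using box_hom.face[of i n e] by simp

lemma degen_hom: "i:{1..n} ==> n = Suc m ==> box_hom n m (box_degen n i)"
 using box_hom.degen[of i n] by simp

lemma conn_hom: "i:{1..m} ==> n = Suc m ==> box_hom n m (box_conn n i e)"
 using box_hom.conn[of i n e] by simp

lemma box_hom_compose_id:
 assumes "box_hom m n f"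
 shows "vcomp m f (box_id m) = f" "vcomp m (box_id n) f = f"
 using hom_PiE[OF assms]
 by (auto simp: compose_def box_id_def fun_eq_iff PiE_def extensional_def)

lemma compose_vert_assoc:
 assumes "box_hom k l f"
 shows "vcomp k (vcomp l z g) f = vcomp k z (vcomp k g f)"
 using hom_vert[OF assms] by (auto simp: compose_def)

lemma box_id_apply [simp]: "x:vert n ==> box_id n x = x"
 by (simp add: box_id_def)

lemma box_face_apply:
 "x:vert (n - 1) ==> j:{1..n} ==>
  box_face n i e x j = (if j < i then x j else if j = i then e else x (j - 1))"
 by (simp add: box_face_def face_fun_def)

lemma box_degen_apply:
 "x:vert n ==> j:{1..n - 1} ==> box_degen n i x j = (if j < i then x j else x (j + 1))"
 by (simp add: box_degen_def degen_fun_def)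

lemma box_conn_apply:
 "x:vert n ==> j:{1..n - 1} ==> box_conn n i e x j =
   (if j < i then x j else if j = i then (if e then x i & x (i + 1) else x i | x (i + 1))
   else x (j + 1))"
 by (auto simp: box_conn_def conn_fun_def max_bool min_bool)

lemma box_face_Suc:
 "x:vert n ==> 1 <= j ==> j <= Suc n ==>
  box_face (Suc n) i e x j = (if j < i then x j else if j = i then e else x (j - 1))"
 by (rule box_face_apply) auto

lemma box_degen_Suc:
 "x:vert (Suc n) ==> 1 <= j ==> j <= n ==> box_degen (Suc n) i x j = (if j < i then x j else x (j + 1))"
 by (rule box_degen_apply) auto

lemma box_conn_Suc:
 "x:vert (Suc n) ==> 1 <= j ==> j <= n ==> box_conn (Suc n) i e x j =
   (if j < i then x j else if j = i then (if e then x i & x (i + 1) else x i | x (i + 1))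
   else x (j + 1))"
 by (rule box_conn_apply) auto

lemma compose_vert [simp]: "x:vert l ==> vcomp l g f x = g (f x)"
 by (simp add: compose_eq)

lemma degen_face: "i:{1..Suc n} ==>
  vcomp n (box_degen (Suc n) i) (box_face (Suc n) i e) = box_id n"
 by (rule hom_eqI[of n n])
   (auto intro!: box_hom.intros face_hom degen_hom simp: box_face_apply box_degen_apply hom_vert[OF face_hom])

lemma face_face:
 assumes "1 <= i" "i < j" "j <= Suc (Suc n)"
 shows "vcomp n (box_face (Suc (Suc n)) j d) (box_face (Suc n) i e) =
  vcomp n (box_face (Suc (Suc n)) i e) (box_face (Suc n) (j - 1) d)"
proof (rule hom_eqI)
 let ?S = "Suc n"
 let ?b = "box_face ?S (j - 1) d"
 let ?a = "Suc ?S"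
 let ?i = "box_face ?S i e"
 show "box_hom n ?a (vcomp n (box_face ?a j d) ?i)"
  "box_hom n ?a (vcomp n (box_face ?a i e) ?b)"
  using assms by (auto intro!: box_hom.comp face_hom)
 have "box_hom n ?S ?i" "box_hom n ?S ?b"
  using assms by (auto intro!: face_hom)
 note v = this[THEN hom_vert]
 fix x k assume x: "x:vert n" and k: "k:{1..Suc ?S}"
 have app: "box_face ?a i' e' y k = (if k < i' then y k else if k = i' then e' else y (k - 1))"
  if "y:vert ?S" for i' e' y
  using that k by (simp add: box_face_apply)
 have app': "box_face ?S i' e' x l = (if l < i' then x l else if l = i' then e' else x (l - 1))"
  if "l:{1..Suc n}" for i' e' l
  using that x by (simp add: box_face_apply)
 obtain l j' where l: "k = Suc l" "j = Suc j'" using k assms by (cases k; cases j) auto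
 show "vcomp n (box_face ?a j d) ?i x k =
  vcomp n (box_face ?a i e) ?b x k"
  unfolding compose_vert[OF x] app[OF v(1)[OF x]] app[OF v(2)[OF x]]
  using k assms by (auto simp: app' l)
qed

section \<open>Monotonicity and supports of box morphisms\<close>

text \<open>The support of output \<open>j\<close>. For box morphisms these supports are disjoint
  and ordered like the outputs, which replaces an explicit normal form for operators.\<close>

definition affects :: "nat => box_map => nat => nat => bool" where
 "affects m f i j = ((EX x:vert m. f (x(i := False)) j ~= f (x(i := True)) j))"

lemma box_hom_mono:
 assumes "box_hom m n f" "x:vert m" "y:vert m" "!!i. i:{1..m} ==> x i ==> y i"
  and "j:{1..n}" "f x j"
 shows "f y j"
 using assms
proof (induction arbitrary: x y j rule: box_hom.induct)
 case (comp l m f n g)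
 have "f x:vert m" "f y:vert m"
  using comp.hyps comp.prems hom_vert by blast+
 moreover have "g (f x) j" using comp.prems by simp
 moreover have "f y i" if "i:{1..m}" "f x i" for i
  using comp.IH(1) comp.prems(1-3) that by blast
 ultimately have "g (f y) j" using comp.IH(2) comp.prems(4) by blast
 thus ?case using comp.prems by simp
next
 case (face i n e)
 have "y (j - 1)" if "x (j - 1)" "i < j"
  using face.prems(3)[of "j - 1"] that face.hyps face.prems(4) by fastforce
 moreover have "y j" if "x j" "j:{1..n - 1}" using face.prems(3)[of j] that by blast
 ultimately show ?case using face.hyps face.prems(1,2,4,5)
  unfolding box_face_apply[OF face.prems(1,4)] box_face_apply[OF face.prems(2,4)]
  by auto
next
 case (degen i n)
 thus ?case by (auto simp: box_degen_apply)
next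
 case (conn i n e)
 thus ?case by (auto simp: box_conn_apply split: if_splits)
qed auto

text \<open>Induction on the number of coordinates in which the two vertices differ: a differing
  coordinate lies outside the support, so correcting it leaves output \<open>j\<close>
  alone.\<close>

lemma affects_dep:
 assumes "x:vert m" "y:vert m" "!!i. i:{1..m} ==> affects m f i j ==> x i = y i"
 shows "f x j = f y j"
proof -
 have "f x j = f z j" if "z:vert m" "ALL i:{1..m}. affects m f i j --> x i = z i"
  "card {i:{1..m}. x i ~= z i} = N" for z N
  using that
 proof (induction N arbitrary: z)
  case 0
  hence "{i:{1..m}. x i ~= z i} = {}" by simp
  hence "x = z" by (intro vert_eqI[OF assms(1) 0(1)]) auto
  thus ?case by simp
 next
  case (Suc N)
  then obtain i where i: "i:{1..m}" "x i ~= z i"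
   by (metis (mono_tags, lifting) Collect_empty_eq card.empty nat.distinct(1))
  let ?z = "z(i := x i)"
  have "{i:{1..m}. x i ~= z i} = insert i {k:{1..m}. x k ~= ?z k}" using i by auto
  moreover have "i ~: {k:{1..m}. x k ~= ?z k}" by simp
  ultimately have "card {k:{1..m}. x k ~= ?z k} = N" using Suc.prems(3) by simp
  moreover have "?z:vert m" using Suc.prems(1) i(1) by (rule vert_upd)
  moreover have "ALL i:{1..m}. affects m f i j --> x i = ?z i" using Suc.prems(2) by simp
  ultimately have "f x j = f ?z j" by (intro Suc.IH)
  also have "f ?z j = f z j"
  proof -
   have "~ affects m f i j" using Suc.prems(2) i by auto
   hence "f (z(i := False)) j = f (z(i := True)) j"
    using Suc.prems(1) by (auto simp: affects_def)
   moreover have "z = z(i := z i)" by simp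
   ultimately show ?thesis by (metis (full_types))
  qed
  finally show ?case .
 qed
 thus ?thesis using assms by blast
qed

lemma affects_face: "affects (n - 1) (box_face n k e) i j ==> i:{1..n - 1} ==> j:{1..n} ==>
  i = (if j < k then j else j - 1) & j ~= k"
 unfolding affects_def by (elim bexE) (simp add: box_face_apply[OF vert_upd] split: if_splits)

lemma affects_degen: "affects n (box_degen n k) i j ==> i:{1..n} ==> j:{1..n - 1} ==> i = (if j < k then j else j + 1)"
 unfolding affects_def by (elim bexE) (simp add: box_degen_apply[OF vert_upd] split: if_splits)

lemma affects_conn: "affects n (box_conn n k e) i j ==> i:{1..n} ==> j:{1..n - 1} ==>
  i = (if j < k then j else j + 1) | i = k & j = k"
 unfolding affects_def by (elim bexE) (auto simp: box_conn_apply[OF vert_upd] split: if_splits)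

text \<open>Every generator reads its inputs in order. In a composite, an input can influence an
  output only through some intermediate coordinate (\<open>step\<close>), to which both induction
  hypotheses apply.\<close>

lemma box_hom_ordered:
 assumes "box_hom m n f" "i:{1..m}" "i':{1..m}" "j:{1..n}" "j':{1..n}" "j < j'"
  "affects m f i j" "affects m f i' j'"
 shows "i < i'"
 using assms
proof (induction arbitrary: i i' j j' rule: box_hom.induct)
 case (id n)
 thus ?case by (auto simp: affects_def vert_upd split: if_splits)
next
 case (face k n e)
 hence "i = (if j < k then j else j - 1)" "j ~= k" "i' = (if j' < k then j' else j' - 1)" "j' ~= k"
  by (metis affects_face)+
 thus ?case using face.prems(1-5) by (auto split: if_splits; linarith)
next
 case (degen k n)
 hence "i = (if j < k then j else j + 1)" "i' = (if j' < k then j' else j' + 1)"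
  by (metis affects_degen)+
 thus ?case using degen.prems(1-5) by auto
next
 case (conn k n e)
 hence "i = (if j < k then j else j + 1) | i = k & j = k"
  "i' = (if j' < k then j' else j' + 1) | i' = k & j' = k"
  by (metis affects_conn)+
 thus ?case using conn.prems(1-5) by (auto split: if_splits)
next
 case (comp l m f n g)
 have step: "EX a:{1..m}. affects l f i a & affects m g a j"
  if "i:{1..l}" "j:{1..n}" and af: "affects l (vcomp l g f) i j" for i j
 proof -
  from af that obtain x where x: "x:vert l"
   "g (f (x(i := False))) j ~= g (f (x(i := True))) j"
   by (auto simp: affects_def vert_upd)
  have v: "f (x(i := b)):vert m" for b
   by (rule hom_vert[OF comp.hyps(1) vert_upd[OF x(1) that(1)]])
  obtain a where a: "a:{1..m}" "affects m g a j" "f (x(i := False)) a ~= f (x(i := True)) a"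
   using affects_dep[OF v v] x by blast
  hence "affects l f i a" using x by (auto simp: affects_def)
  with a show ?thesis by blast
 qed
 obtain a a' where a: "a:{1..m}" "affects l f i a" "affects m g a j"
  "a':{1..m}" "affects l f i' a'" "affects m g a' j'"
  using step comp.prems by metis
 hence "a < a'" using comp.IH(2) comp.prems by blast
 thus ?case using comp.IH(1) a comp.prems by blast
qed

text \<open>The box category has no diagonals: if \<open>j < j'\<close>, the ordering of supports
  with equal inputs would give \<open>i < i\<close>.\<close>

lemma box_hom_supp_unique:
 assumes "box_hom m n f" "i:{1..m}" "j:{1..n}" "j':{1..n}"
  "affects m f i j" "affects m f i j'"
 shows "j = j'"
 using box_hom_ordered[OF assms(1,2,2,3,4)] box_hom_ordered[OF assms(1,2,2,4,3)] assms(5,6)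
 by (meson less_irrefl nat_neq_iff)

section \<open>The Eilenberg--Zilber property\<close>

definition vtop :: "nat => nat => bool" where "vtop m = (\<lambda>i\<in>{1..m}. True)"
definition vbot :: "nat => nat => bool" where "vbot m = (\<lambda>i\<in>{1..m}. False)"

lemma vtop_vert [simp]: "vtop m:vert m" and vbot_vert [simp]: "vbot m:vert m"
 by (simp_all only: vtop_def vbot_def vert_restrict)

text \<open>Encodes the split epimorphisms (see \<open>box_epi_section_ex\<close>): no output
  coordinate is constant. For monotone maps it suffices to look at the top and bottom
  vertices.\<close>

definition box_epi :: "nat => nat => box_map => bool" where
 "box_epi m n s = (box_hom m n s & (ALL j:{1..n}. s (vtop m) j & ~ s (vbot m) j))"

lemma epi_hom: "box_epi m n s ==> box_hom m n s"
 by (simp add: box_epi_def)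

lemma box_epi_id: "box_epi n n (box_id n)"
 by (auto simp: box_epi_def box_hom.id) (auto simp: vtop_def vbot_def)

lemma box_const_coord:
 assumes "box_hom m n f" "j:{1..n}" "~ f (vtop m) j | f (vbot m) j" "x:vert m"
 shows "f x j = f (vtop m) j"
 using box_hom_mono[OF assms(1) assms(4) vtop_vert _ assms(2)]
  box_hom_mono[OF assms(1) vbot_vert assms(4) _ assms(2)]
  box_hom_mono[OF assms(1) vbot_vert vtop_vert _ assms(2)] assms(3)
 by (auto simp: vtop_def vbot_def)

lemma box_face_factor:
 assumes "box_hom m (Suc n) f" "j:{1..Suc n}" "!!x. x:vert m ==> f x j = e"
 shows "f = vcomp m (box_face (Suc n) j e) (vcomp m (box_degen (Suc n) j) f)"
proof (rule hom_eqI[OF assms(1)])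
 let ?v = "vcomp m (box_degen (Suc n) j) f"
 have d: "box_hom m n ?v"
  by (rule box_hom.comp[OF assms(1)]) (rule degen_hom[OF assms(2) refl])
 show "box_hom m (Suc n) (vcomp m (box_face (Suc n) j e) ?v)"
  by (rule box_hom.comp[OF d]) (rule face_hom[OF assms(2) refl])
 fix x k assume x: "x:vert m" and k: "k:{1..Suc n}"
 have v: "f x:vert (Suc n)" using assms x hom_vert by blast
 have v': "box_degen (Suc n) j (f x):vert n"
  using hom_vert[OF d x] x by simp
 obtain l where l: "k = Suc l" using k by (cases k) auto
 show "f x k = vcomp m (box_face (Suc n) j e) ?v x k"
  using x k assms(2,3) by (auto simp: box_face_Suc[OF v'] box_degen_Suc[OF v] l Suc_eq_plus1[symmetric])
qed

text \<open>A constant output can be deleted and reinserted by a face. Splitting off this one face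
  is all that the Eilenberg--Zilber arguments require.\<close>

lemma not_epi_factor:
 assumes "box_hom m n f" "~ box_epi m n f"
 obtains j e n' g where "n = Suc n'" "j:{1..n}" "box_hom m n' g"
  "f = vcomp m (box_face n j e) g"
proof -
 obtain j where j: "j:{1..n}" "~ f (vtop m) j | f (vbot m) j"
  using assms by (auto simp: box_epi_def)
 then obtain n' where n: "n = Suc n'" by (cases n) auto
 let ?v = "vcomp m (box_degen n j) f"
 have "f = vcomp m (box_face n j (f (vtop m) j)) ?v"
  using box_face_factor[of m n' f j] box_const_coord[OF assms(1) j] assms(1) j(1) n by blast
 moreover have "box_hom m n' ?v"
  using j n by (auto intro!: box_hom.comp[OF assms(1)] degen_hom)
 ultimately show ?thesis using that n j by blast
qed

lemma box_epi_sensitive: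
 assumes "box_epi m n s" "j:{1..n}"
 shows "EX i:{1..m}. affects m s i j"
proof (rule ccontr)
 assume "~ ?thesis"
 hence no: "~ affects m s i j" if "i:{1..m}" for i using that by blast
 have "s (vtop m) j = s (vbot m) j"
  by (rule affects_dep[OF vtop_vert vbot_vert]) (simp add: no)
 thus False using assms by (auto simp: box_epi_def)
qed

lemma strict_mono_on_ge:
 assumes "!!j j'. j:{1..n} ==> j':{1..n} ==> j < j' ==> i j < i j'"
  "!!j. j:{1..n} ==> i j:{1..m}" "j:{1..n}"
 shows "j <= i (j::nat) & i j + (n - j) <= (m::nat)"
proof
 have "k:{1..n} --> k <= i k" for k
 proof (induction k)
  case (Suc k)
  show ?case
  proof (cases "k = 0")
   case True thus ?thesis using assms(2)[of "Suc 0"] by auto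
  next
   case False
   thus ?thesis using Suc assms(1)[of k "Suc k"] by auto
  qed
 qed auto
 thus "j <= i j" using assms(3) by blast
 have "l < n --> i (n - l) + l <= m" for l
 proof (induction l)
  case 0
  thus ?case using assms(2)[of n] by auto
 next
  case (Suc l)
  show ?case
  proof
   assume l: "Suc l < n"
   hence "i (n - Suc l) < i (n - l)" by (intro assms(1)) auto
   thus "i (n - Suc l) + Suc l <= m" using Suc by auto
  qed
 qed
 from this[of "n - j"] show "i j + (n - j) <= m" using assms(3) by auto
qed

text \<open>Choosing one input from the support of each output gives a strictly increasing map from
  outputs to inputs. In equal dimensions it is the identity, every support is a single coordinate,
  and the values at the extreme vertices leave only the identity morphism.\<close>

lemma box_epi_le:
 assumes "box_epi m n s"
 shows "n <= m" and "n = m ==> s = box_id n"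
proof -
 have h: "box_hom m n s" using assms by (rule epi_hom)
 obtain a where a: "!!j. j:{1..n} ==> a j:{1..m} & affects m s (a j) j"
  using box_epi_sensitive[OF assms] by metis
 have sm: "a j < a j'" if "j:{1..n}" "j':{1..n}" "j < j'" for j j'
  using box_hom_ordered[OF h] a that by blast
 have ge: "j <= a j & a j + (n - j) <= m" if "j:{1..n}" for j
  using strict_mono_on_ge[of n a m j] sm a that by blast
 show "n <= m"
 proof (cases "n = 0")
  case False
  thus ?thesis using ge[of 1] by auto
 qed auto
 assume nm: "n = m"
 have aj: "a j = j" if "j:{1..n}" for j using ge[OF that] nm by auto
 show "s = box_id n"
 proof (rule hom_eqI)
  show "box_hom m n s" by fact
  show "box_hom m n (box_id n)" using nm box_hom.id by simp
  fix x j assume x: "x:vert m" and j: "j:{1..n}"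
  have only: "i = j" if "i:{1..m}" "affects m s i j" for i
   using box_hom_supp_unique[OF h that(1) j _ that(2)] a aj nm that by metis
  have "s x j = x j"
  proof (cases "x j")
   case True
   have "s x j = s (vtop m) j"
   proof (rule affects_dep[OF x vtop_vert])
    fix i assume i: "i:{1..m}" "affects m s i j"
    from only[OF this] True i(1) show "x i = vtop m i" by (simp add: vtop_def)
   qed
   thus ?thesis using assms j True by (auto simp: box_epi_def)
  next
   case False
   have "s x j = s (vbot m) j"
   proof (rule affects_dep[OF x vbot_vert])
    fix i assume i: "i:{1..m}" "affects m s i j"
    from only[OF this] False i(1) show "x i = vbot m i" by (simp add: vbot_def)
   qed
   thus ?thesis using assms j False by (auto simp: box_epi_def)
  qed
  thus "s x j = box_id n x j" using x nm by simp
 qed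
qed

text \<open>Induction on \<open>m\<close>: a coordinate outside the image of \<open>a\<close> is
  inserted by a face with value \<open>w i0\<close>, after renumbering \<open>a\<close> and
  \<open>w\<close> around it. If no coordinate is outside, \<open>a\<close> is the identity.\<close>

lemma box_hom_embedding:
 assumes "!!j j'. j:{1..n} ==> j':{1..n} ==> j < j' ==> a j < a j'"
  "!!j. j:{1..n} ==> a j:{1..m}"
 shows "EX d. box_hom n m d & (ALL t:vert n. (ALL j:{1..n}. d t (a j) = t j) &
  (ALL i:{1..m} - a ` {1..n}. d t i = w i))"
 using assms
proof (induction m arbitrary: a w)
 case 0
 hence "n = 0" using 0(2)[of 1] by (cases n) auto
 thus ?case using box_hom.id[of 0] by auto
next
 case (Suc m)
 have ge: "j <= a j & a j + (n - j) <= Suc m" if "j:{1..n}" for j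
  using strict_mono_on_ge[of n a "Suc m" j] Suc.prems that by blast
 show ?case
 proof (cases "{1..Suc m} <= a ` {1..n}")
  case True
  hence "Suc m <= n"
   by (metis card_atLeastAtMost card_image_le card_mono diff_Suc_1 finite_atLeastAtMost finite_imageI le_trans)
  moreover have "n <= Suc m"
   using ge[of n] by (cases "n = 0") auto
  ultimately have n: "n = Suc m" by simp
  have a: "a j = j" if "j:{1..n}" for j using ge[OF that] n by auto
  hence "a ` {1..n} = {1..n}" by force
  with n a show ?thesis
   by (intro exI[of _ "box_id n"]) (auto simp: box_hom.id)
 next
  case False
  then obtain i0 where i0: "i0:{1..Suc m}" "i0 ~: a ` {1..n}" by blast
  define a' where "a' j = (if a j < i0 then a j else a j - 1)" for j
  define w' where "w' i = (if i < i0 then w i else w (i + 1))" for i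
  have ne: "a j ~= i0" if "j:{1..n}" for j using i0 that by blast
  have a'm: "a' j < a' j'" if "j:{1..n}" "j':{1..n}" "j < j'" for j j'
   using Suc.prems(1)[OF that] ne[OF that(1)] ne[OF that(2)] by (auto simp: a'_def)
  have a'r: "a' j:{1..m}" if "j:{1..n}" for j
   using Suc.prems(2)[OF that] ne[OF that] i0(1) by (auto simp: a'_def)
  have "EX d. box_hom n m d & (ALL t:vert n. (ALL j:{1..n}. d t (a' j) = t j) &
    (ALL i:{1..m} - a' ` {1..n}. d t i = w' i))"
   by (rule Suc.IH) (fact a'm a'r)+
  then obtain d where d0: "box_hom n m d & (ALL t:vert n. (ALL j:{1..n}. d t (a' j) = t j) &
    (ALL i:{1..m} - a' ` {1..n}. d t i = w' i))" ..
  hence d: "box_hom n m d" "!!t j. t:vert n ==> j:{1..n} ==> d t (a' j) = t j"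
   "!!t i. t:vert n ==> i:{1..m} - a' ` {1..n} ==> d t i = w' i"
   by simp_all
  let ?d = "vcomp n (box_face (Suc m) i0 (w i0)) d"
  have h: "box_hom n (Suc m) ?d"
   using d(1) i0(1) by (auto intro!: box_hom.comp face_hom)
  have app: "?d t i = (if i < i0 then d t i else if i = i0 then w i0 else d t (i - 1))"
   if "t:vert n" "i:{1..Suc m}" for t i
   using that hom_vert[OF d(1)] by (simp add: box_face_apply)
  have "?d t (a j) = t j" if "t:vert n" "j:{1..n}" for t j
   using app[OF that(1) Suc.prems(2)[OF that(2)]] d(2)[OF that] ne[OF that(2)]
   by (auto simp: a'_def)
  moreover have "?d t i = w i" if t: "t:vert n" and i: "i:{1..Suc m} - a ` {1..n}" for t i
  proof (cases i i0 rule: linorder_cases)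
   case less
   have "i ~: a' ` {1..n}"
    using i less ne by (force simp: a'_def split: if_splits)
   hence "d t i = w' i" using d(3)[OF t, of i] less i i0(1) by auto
   with less show ?thesis using app[OF t, of i] i by (simp add: w'_def)
  next
   case greater
   have "i - 1 ~: a' ` {1..n}"
   proof
    assume "i - 1:a' ` {1..n}"
    then obtain j where j: "j:{1..n}" "i - 1 = a' j" by blast
    with greater ne[OF j(1)] have "i = a j"
     by (auto simp: a'_def split: if_splits)
    thus False using i j(1) by blast
   qed
   moreover have "i - 1:{1..m}" using greater i i0(1) by auto
   ultimately have "d t (i - 1) = w' (i - 1)" using d(3)[OF t, of "i - 1"] by simp
   with greater show ?thesis using app[OF t, of i] i by (cases i) (auto simp: w'_def Suc_eq_plus1[symmetric])
  qed (use app[OF t] i in auto)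
  ultimately show ?thesis using h by blast
 qed
qed

text \<open>A witness that input \<open>i\<close> affects output \<open>j\<close>, with the
  direction of the change included; monotonicity provides such a witness for every affecting
  input.\<close>

definition sensitive :: "nat => box_map => nat => (nat => bool) => nat => bool" where
 "sensitive m s j v i = (v:vert m & i:{1..m} & (ALL b. s (v(i := b)) j = b))"

lemma affects_sensitive:
 assumes "box_hom m n s" "j:{1..n}" "i:{1..m}" "affects m s i j"
 obtains v where "sensitive m s j v i"
proof -
 obtain x where x: "x:vert m" "s (x(i := False)) j ~= s (x(i := True)) j"
  using assms(4) by (auto simp: affects_def)
 have "s (x(i := True)) j" if "s (x(i := False)) j"
  by (rule box_hom_mono[OF assms(1) vert_upd[OF x(1) assms(3)] vert_upd[OF x(1) assms(3)] _ assms(2) that])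
   (simp)
 with x have "s (x(i := b)) j = b" for b by (cases b) auto
 with x assms(3) show ?thesis by (intro that[of x]) (auto simp: sensitive_def)
qed

lemma sensitive_affects: "sensitive m s j v i ==> affects m s i j"
 by (auto simp: sensitive_def affects_def)

text \<open>The section writes \<open>t j\<close> into one chosen input from the support of each
  output \<open>j\<close> and freezes the other inputs of that support at a witness vertex. Supports
  are disjoint, so the choices do not interfere. The witness for one output is prescribed from
  outside; this is what later tells two epimorphisms apart.\<close>

lemma box_epi_section:
 assumes epi: "box_epi m n c" and s: "sensitive m c j0 v0 i0" "j0:{1..n}"
 obtains d where "box_hom n m d" "vcomp n c d = box_id n"
  "!!t. t:vert n ==> d t i0 = t j0"
  "!!t i. t:vert n ==> affects m c i j0 ==> i:{1..m} ==> i ~= i0 ==> d t i = v0 i"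
proof -
 have h: "box_hom m n c" using epi by (rule epi_hom)
 have "EX v i. sensitive m c j v i & (j = j0 --> v = v0 & i = i0)" if "j:{1..n}" for j
  using affects_sensitive[OF h that] box_epi_sensitive[OF epi that] s(1) by metis
 then obtain v a where va: "!!j. j:{1..n} ==> sensitive m c j (v j) (a j)"
  "v j0 = v0" "a j0 = i0"
  using s(2) by metis
 have ar: "a j:{1..m}" and aff: "affects m c (a j) j" if "j:{1..n}" for j
  using va(1)[OF that] sensitive_affects by (auto simp: sensitive_def)
 have sm: "a j < a j'" if "j:{1..n}" "j':{1..n}" "j < j'" for j j'
  using box_hom_ordered[OF h ar[OF that(1)] ar[OF that(2)] that aff[OF that(1)] aff[OF that(2)]] .
 define w where "w i = v (THE j. j:{1..n} & affects m c i j) i" for i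
 have w: "w i = v j i" if "j:{1..n}" "i:{1..m}" "affects m c i j" for i j
 proof -
  have "(THE j. j:{1..n} & affects m c i j) = j"
   using that box_hom_supp_unique[OF h] by blast
  thus ?thesis by (simp add: w_def)
 qed
 have "EX d. box_hom n m d & (ALL t:vert n. (ALL j:{1..n}. d t (a j) = t j) &
   (ALL i:{1..m} - a ` {1..n}. d t i = w i))"
  by (rule box_hom_embedding) (fact sm ar)+
 then obtain d where d0: "box_hom n m d & (ALL t:vert n. (ALL j:{1..n}. d t (a j) = t j) &
   (ALL i:{1..m} - a ` {1..n}. d t i = w i))" ..
 hence d: "box_hom n m d" "!!t j. t:vert n ==> j:{1..n} ==> d t (a j) = t j"
  "!!t i. t:vert n ==> i:{1..m} - a ` {1..n} ==> d t i = w i"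
  by simp_all
 have dv: "d t i = v j i" if "t:vert n" "i:{1..m}" "j:{1..n}" "affects m c i j" "i ~= a j" for t i j
 proof -
  have "i ~: a ` {1..n}"
   using box_hom_supp_unique[OF h that(2,3) _ that(4)] that(5) aff by blast
  thus ?thesis using d(3)[OF that(1), of i] that w by auto
 qed
 have "c (d t) j = t j" if t: "t:vert n" and j: "j:{1..n}" for t j
 proof -
  have vj: "v j:vert m" using va(1)[OF j] by (simp add: sensitive_def)
  have "c (d t) j = c ((v j)(a j := t j)) j"
  proof (rule affects_dep[OF hom_vert[OF d(1) t] vert_upd[OF vj ar[OF j]]])
   fix i assume i: "i:{1..m}" "affects m c i j"
   show "d t i = ((v j)(a j := t j)) i"
    using dv[OF t i(1) j i(2)] d(2)[OF t j] by (cases "i = a j") simp_all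
  qed
  also have "\<dots> = t j" using va(1)[OF j] by (simp add: sensitive_def)
  finally show ?thesis .
 qed
 hence "vcomp n c d = box_id n"
  using box_hom.comp[OF d(1) h] box_hom.id
  by (intro hom_eqI[of n n]) auto
 with d(1) show ?thesis
  using that[of d] d(2)[OF _ s(2)] dv[OF _ _ s(2)] va by simp
qed

text \<open>An epimorphism is determined by its sections, which gives the uniqueness half of the
  Eilenberg--Zilber property. \<open>aff\<close> compares supports, \<open>sens\<close> transfers
  witnesses, and \<open>le\<close> compares values by descending to a minimal vertex at which the
  output is true.\<close>

lemma box_epi_eqI:
 assumes "box_epi m n r" "box_epi m n r'"
  and s: "!!d. box_hom n m d ==> vcomp n r d = box_id n \<longleftrightarrow> vcomp n r' d = box_id n"
 shows "r = r'"
proof -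
 have aff: "affects m r' i j"
  if e: "box_epi m n r" "box_epi m n r'" "i:{1..m}" "j:{1..n}" "affects m r i j"
  and s: "!!d. box_hom n m d ==> vcomp n r d = box_id n ==> vcomp n r' d = box_id n"
  for r r' i j
 proof -
  obtain v where v: "sensitive m r j v i"
   using affects_sensitive[OF epi_hom[OF e(1)] e(4,3,5)] .
  obtain d where d: "box_hom n m d" "vcomp n r d = box_id n"
   "!!t. t:vert n ==> d t i = t j"
   "!!t i'. t:vert n ==> affects m r i' j ==> i':{1..m} ==> i' ~= i ==> d t i' = v i'"
   using box_epi_section[OF e(1) v e(4)] by blast
  have c: "vcomp n r' d = box_id n" using s d by blast
  let ?t = "%b. (vbot n)(j := b)"
  have tv: "?t b:vert n" for b using e(4) by (intro vert_upd) auto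
  have b: "r' (d (?t b)) j = b" for b
   using fun_cong[OF c, of "?t b"] tv[of b] by simp
  have "EX i':{1..m}. affects m r' i' j & d (?t False) i' ~= d (?t True) i'"
  proof (rule ccontr)
   assume "~ ?thesis"
   hence "d (?t False) i' = d (?t True) i'" if "i':{1..m}" "affects m r' i' j" for i'
    using that by blast
   hence "r' (d (?t False)) j = r' (d (?t True)) j"
    by (rule affects_dep[OF hom_vert[OF d(1) tv] hom_vert[OF d(1) tv]])
   thus False unfolding b by simp
  qed
  then obtain i' where i': "i':{1..m}" "affects m r' i' j" "d (?t False) i' ~= d (?t True) i'" by blast
  have "i' = i"
  proof (rule ccontr)
   \<comment> \<open>A section is itself a box morphism, so its single input \<open>j\<close> cannot
     move both \<open>i\<close> and \<open>i'\<close>.\<close>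
   assume ne: "i' ~= i"
   have da: "affects n d j i'"
    using i' by (auto simp: affects_def)
   have di: "affects n d j i"
    using d(3)[OF tv[of False]] d(3)[OF tv[of True]]
    by (auto simp: affects_def)
   show False using box_hom_supp_unique[OF d(1) e(4) i'(1) e(3) da di] ne by simp
  qed
  with i' show ?thesis by simp
 qed
 have supp: "affects m r i j \<longleftrightarrow> affects m r' i j" if "i:{1..m}" "j:{1..n}" for i j
  using aff[OF assms(1,2) that] aff[OF assms(2,1) that] s by blast
 have sens: "r' (v(i := b)) j = b" if v: "sensitive m r j v i" and j: "j:{1..n}"
  and e: "box_epi m n r" "box_epi m n r'"
  and s: "!!d. box_hom n m d ==> vcomp n r d = box_id n ==> vcomp n r' d = box_id n"
  and su: "!!i. i:{1..m} ==> affects m r' i j ==> affects m r i j" for v i j b r r'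
 proof -
  obtain d where d: "box_hom n m d" "vcomp n r d = box_id n"
   "!!t. t:vert n ==> d t i = t j"
   "!!t i'. t:vert n ==> affects m r i' j ==> i':{1..m} ==> i' ~= i ==> d t i' = v i'"
   using box_epi_section[OF e(1) v j] by blast
  have c: "vcomp n r' d = box_id n" using s d by blast
  let ?t = "(vbot n)(j := b)"
  have tv: "?t:vert n" using j by (intro vert_upd) auto
  have vm: "v(i := b):vert m" using v by (intro vert_upd) (auto simp: sensitive_def)
  have "r' (v(i := b)) j = r' (d ?t) j"
  proof (rule affects_dep[OF vm hom_vert[OF d(1) tv]])
   fix i' assume i': "i':{1..m}" "affects m r' i' j"
   from d(3)[OF tv] d(4)[OF tv su[OF i'] i'(1)]
   show "(v(i := b)) i' = d ?t i'" by (cases "i' = i") simp_all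
  qed
  also have "\<dots> = b" using fun_cong[OF c, of ?t] tv by simp
  finally show ?thesis .
 qed
 have le: "r' x j" if e: "box_epi m n r" "box_epi m n r'" and x: "x:vert m" "r x j" and j: "j:{1..n}"
  and s: "!!d. box_hom n m d ==> vcomp n r d = box_id n ==> vcomp n r' d = box_id n"
  and su: "!!i. i:{1..m} ==> affects m r' i j ==> affects m r i j" for r r' x j
  using x
 proof (induction "card {i:{1..m}. x i}" arbitrary: x rule: less_induct)
  case less
  have h: "box_hom m n r" "box_hom m n r'" using e epi_hom by blast+
  show ?case
  proof (cases "EX i:{1..m}. x i & r (x(i := False)) j")
   case True
   then obtain i where i: "i:{1..m}" "x i" "r (x(i := False)) j" by blast
   have "{k:{1..m}. (x(i := False)) k} \<subset> {i:{1..m}. x i}" using i by auto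
   hence "card {k:{1..m}. (x(i := False)) k} < card {i:{1..m}. x i}"
    by (intro psubset_card_mono) auto
   hence "r' (x(i := False)) j"
    using less.hyps[of "x(i := False)"] i vert_upd[OF less.prems(1) i(1)] by blast
   thus ?thesis
    by (intro box_hom_mono[OF h(2) vert_upd[OF less.prems(1) i(1)] less.prems(1) _ j]) (auto split: if_splits)
  next
   \<comment> \<open>At a minimal vertex every true input is critical, hence gives a witness in the
     sense of \<open>sensitive\<close>, and \<open>sens\<close> applies.\<close>
   case False
   have "x ~= vbot m" using less.prems e(1) j by (auto simp: box_epi_def)
   then obtain i where i: "i:{1..m}" "x i"
    using vert_eqI[OF less.prems(1) vbot_vert] by (auto simp: vbot_def)
   have xi: "x(i := True) = x" using i by (simp add: fun_upd_idem_iff)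
   have "r (x(i := b)) j = b" for b
    using xi False i less.prems by (cases b) auto
   hence "sensitive m r j x i"
    using i less.prems by (auto simp: sensitive_def)
   from sens[OF this j e s su, of True] xi show ?thesis by simp
  qed
 qed
 show ?thesis
 proof (rule hom_eqI[OF epi_hom[OF assms(1)] epi_hom[OF assms(2)]])
  fix x j assume "x:vert m" "j:{1..n}"
  thus "r x j = r' x j"
   using le[OF assms(1,2), of x j] le[OF assms(2,1), of x j] s supp by blast
 qed
qed

lemma box_epi_section_ex:
 assumes "box_epi m n s"
 obtains d where "box_hom n m d" "vcomp n s d = box_id n"
proof (cases "n = 0")
 case True
 have "EX d. box_hom 0 m d" using box_hom_embedding[of 0 "%_. 0" m "%_. False"] by auto
 then obtain d where d: "box_hom n m d" using True by blast
 have "vcomp n s d = box_id n"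
  using True by (intro hom_eqI[OF box_hom.comp[OF d epi_hom[OF assms]] box_hom.id]) auto
 with d that show ?thesis by blast
next
 case False
 hence 1: "1:{1..n}" by simp
 obtain i where i: "i:{1..m}" "affects m s i 1" using box_epi_sensitive[OF assms 1] by blast
 obtain v where v: "sensitive m s 1 v i" by (rule affects_sensitive[OF epi_hom[OF assms] 1 i])
 show ?thesis by (rule box_epi_section[OF assms v 1]) (rule that)
qed

lemma box_epi_comp:
 assumes "box_epi l m s" "box_epi m n t"
 shows "box_epi l n (vcomp l t s)"
proof -
 have "s (vtop l) = vtop m" "s (vbot l) = vbot m"
  using assms(1) hom_vert[OF epi_hom[OF assms(1)]]
  by (auto intro!: vert_eqI[of _ m]) (auto simp: box_epi_def vtop_def[of m] vbot_def[of m])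
 thus ?thesis using assms by (auto simp: box_epi_def intro: box_hom.comp)
qed

text \<open>All operators from lower dimensions are excluded, not only degeneracies and connections;
  thus a representation of least dimension is non-degenerate at once.\<close>

definition nondeg :: "'a cset => nat => 'a => bool" where
 "nondeg X n y = (y:cubes X n &
   (ALL l<n. ALL z:cubes X l. ALL t. box_hom n l t --> y ~= act X n l z t))"

lemma act_in: "cubical_set X ==> box_hom m n f ==> x:cubes X n ==> act X m n x f:cubes X m"
 by (auto simp: cubical_set_def)

lemma act_id: "cubical_set X ==> x:cubes X n ==> act X n n x (box_id n) = x"
 by (auto simp: cubical_set_def)

lemma act_comp: "cubical_set X ==> box_hom l m f ==> box_hom m n g ==> x:cubes X n ==>
  act X l m (act X m n x g) f = act X l n x (vcomp l g f)"
 by (auto simp: cubical_set_def)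

lemma nondeg_cube: "nondeg X n y ==> y:cubes X n"
 by (simp add: nondeg_def)

text \<open>Take a representation of \<open>x\<close> in the least possible dimension: if
  \<open>y\<close> were degenerate, or \<open>s\<close> had a constant output, the dimension could
  be lowered.\<close>

lemma EZ_ex:
 assumes X: "cubical_set X" "x:cubes X n"
 obtains k y s where "nondeg X k y" "box_epi n k s" "x = act X n k y s"
proof -
 let ?P = "%k. EX y:cubes X k. EX s. box_hom n k s & x = act X n k y s"
 have "?P n" using act_id[OF X] X(2) box_hom.id by metis
 define k where "k = (LEAST k. ?P k)"
 have "?P k" unfolding k_def using \<open>?P n\<close> by (rule LeastI)
 then obtain y s where y: "y:cubes X k" "box_hom n k s" "x = act X n k y s" by blast
 have min: "~ ?P l" if "l < k" for l using that not_less_Least k_def by blast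
 have "nondeg X k y"
  unfolding nondeg_def
 proof (intro conjI allI impI ballI notI)
  fix l z t assume "l < k" "z:cubes X l" "box_hom k l t" "y = act X k l z t"
  hence "?P l" using y act_comp[OF X(1) y(2)] box_hom.comp[OF y(2)] by metis
  with min \<open>l < k\<close> show False by blast
 qed fact
 moreover have "box_epi n k s"
 proof (rule ccontr)
  assume "~ box_epi n k s"
  then obtain j e k' g where f: "k = Suc k'" "j:{1..k}" "box_hom n k' g"
   "s = vcomp n (box_face k j e) g" using not_epi_factor[OF y(2)] by metis
  have hf: "box_hom k' k (box_face k j e)" using f by (intro face_hom)
  have "?P k'"
   using act_comp[OF X(1) f(3) hf y(1)] act_in[OF X(1) hf y(1)] f y(3) by metis
  thus False using min f by simp
 qed
 ultimately show ?thesis using y that by blast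
qed

text \<open>Restricting along a section of one epimorphism writes one core as an operator on the
  other. Non-degeneracy in both directions makes the dimensions equal and the operator the identity.
  The two epimorphisms then have the same sections, and \<open>box_epi_eqI\<close> applies.\<close>

lemma EZ_unique:
 assumes X: "cubical_set X" and y: "nondeg X k y" "nondeg X k' y'"
  and e: "box_epi n k s" "box_epi n k' s'" and eq: "act X n k y s = act X n k' y' s'"
 shows "k = k' & y = y' & s = s'"
proof -
 have 1: "k <= k' & (k = k' --> y = y' & vcomp k s' d = box_id k)"
  if y: "nondeg X k y" "nondeg X k' y'"
  and e: "box_epi n k s" "box_epi n k' s'" and eq: "act X n k y s = act X n k' y' s'"
  and d: "box_hom k n d" "vcomp k s d = box_id k" for k k' y y' s s' d
 proof -
  note c = y[THEN nondeg_cube] and h = e[THEN epi_hom]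
  let ?t = "vcomp k s' d"
  have ht: "box_hom k k' ?t" using d(1) h(2) by (rule box_hom.comp)
  have yt: "y = act X k k' y' ?t"
   using act_comp[OF X d(1) h(1) c(1)] act_comp[OF X d(1) h(2) c(2)] act_id[OF X c(1)] eq d(2) by simp
  have le: "k <= k'"
   using y(1) c(2) ht yt by (auto simp: nondeg_def not_less[symmetric])
  have "box_epi k k' ?t" if "k = k'"
  proof (rule ccontr)
   assume "~ box_epi k k' ?t"
   then obtain j b k'' g where f: "k' = Suc k''" "j:{1..k'}" "box_hom k k'' g"
    "?t = vcomp k (box_face k' j b) g" using not_epi_factor[OF ht] by metis
   have hf: "box_hom k'' k' (box_face k' j b)" using f by (intro face_hom)
   have "y = act X k k'' (act X k'' k' y' (box_face k' j b)) g"
    using act_comp[OF X f(3) hf c(2)] yt f(4) by simp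
   thus False
    using y(1)[unfolded nondeg_def, THEN conjunct2, rule_format, OF _ act_in[OF X hf c(2)] f(3)] f(1) that
    by simp
  qed
  hence "k = k' --> ?t = box_id k" using box_epi_le(2) by metis
  thus ?thesis using le yt act_id[OF X c(2)] by auto
 qed
 let ?b = "box_id k"
 obtain d d' where d: "box_hom k n d" "vcomp k s d = ?b"
  "box_hom k' n d'" "vcomp k' s' d' = box_id k'"
  using box_epi_section_ex[OF e(1)] box_epi_section_ex[OF e(2)] by metis
 from 1[OF y e eq d(1,2)] 1[OF y(2,1) e(2,1) eq[symmetric] d(3,4)]
 have k: "k = k'" "y = y'" by simp_all
 moreover have "s = s'"
 proof (rule box_epi_eqI[OF e(1)])
  show "box_epi n k s'" using e k by simp
  show "vcomp k s d = ?b \<longleftrightarrow> vcomp k s' d = ?b" if d: "box_hom k n d" for d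
  proof
   assume "vcomp k s d = ?b"
   from 1[OF y e eq d this] k show "vcomp k s' d = ?b" by simp
  next
   assume *: "vcomp k s' d = ?b"
   from 1[OF y(2,1) e(2,1) eq[symmetric], of d] d * k show "vcomp k s d = ?b" by simp
  qed
 qed
 ultimately show ?thesis by simp
qed

abbreviation "ct == cell_top"
abbreviation "cts X == continuous_map X euclideanreal"

section \<open>The action on topological cubes\<close>

lemma cell_iff: "t:cell n \<longleftrightarrow> (ALL j:{1..n}. 0 <= t j & t j <= 1) & (ALL j. j ~: {1..n} --> t j = undefined)"
 by (auto simp: cell_def Pi_def extensional_def)

lemma cellI: "(!!j. j:{1..n} ==> 0 <= f j & f j <= 1) ==> (\<lambda>j\<in>{1..n}. f j):cell n"
 by (auto simp: cell_iff)

lemma cell_bounds: "t:cell n ==> j:{1..n} ==> 0 <= t j & t j <= 1"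
 by (auto simp: cell_iff)

lemma cell_eqI: "s:cell n ==> t:cell n ==> (!!j. j:{1..n} ==> s j = t j) ==> s = t"
 by (rule ext) (metis cell_iff)

lemma PiE_cell [simp]: "({1..n} \<rightarrow>\<^sub>E {0..1::real}) = cell n"
 by (simp add: cell_def)

lemma box_top_graph_box_top: "box_hom m n f ==> box_top_graph m n f (box_top m n f)"
 using box_top_graph_total box_top_eqI by metis

lemma box_top_PiE: "box_hom m n f ==> box_top m n f:cell m \<rightarrow>\<^sub>E cell n"
 using box_top_graph_threshold[OF box_top_graph_box_top] by blast

lemma box_top_cell: "box_hom m n f ==> t:cell m ==> box_top m n f t:cell n"
 using box_top_PiE by (rule PiE_mem)

lemma box_top_thr:
 "box_hom m n f ==> t:cell m ==> c:{0<..1} ==> threshold n c (box_top m n f t) = f (threshold m c t)"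
 using box_top_graph_threshold[OF box_top_graph_box_top] by blast

text \<open>Thresholds separate points and intertwine \<open>box_top\<close> with the action on
  vertices, so a formula for the real action may be verified on Boolean coordinates.\<close>

lemma box_topI:
 assumes "box_hom m n f" "t:cell m" "s:cell n"
  and "!!c. c:{0<..1} ==> threshold n c s = f (threshold m c t)"
 shows "box_top m n f t = s"
 using assms box_top_thr box_top_cell by (intro threshold_inj[of _ n]) auto

lemma box_top_id: "t:cell n ==> box_top n n (box_id n) t = t"
 by (simp add: box_top_eqI[OF box_top_graph.id])

lemma box_top_face: "i:{1..Suc n} ==> t:cell n ==>
  box_top n (Suc n) (box_face (Suc n) i e) t = face_fun (Suc n) i (of_bool e) t"
 using box_top_eqI[OF box_top_graph.face[of i "Suc n" e]] by simp

lemma box_top_degen: "i:{1..Suc n} ==> t:cell (Suc n) ==>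
  box_top (Suc n) n (box_degen (Suc n) i) t = degen_fun (Suc n) i t"
 using box_top_eqI[OF box_top_graph.degen[of i "Suc n"]] by simp

lemma box_top_conn: "i:{1..n} ==> t:cell (Suc n) ==>
  box_top (Suc n) n (box_conn (Suc n) i e) t = conn_fun (Suc n) i e t"
 using box_top_eqI[OF box_top_graph.conn[of i "Suc n" e]] by simp

lemma box_top_comp: "box_hom l m f ==> box_hom m n g ==> t:cell l ==>
  box_top l n (vcomp l g f) t = box_top m n g (box_top l m f t)"
 by (simp add: box_top_compose compose_eq)

lemma face_fun_cell: "i:{1..Suc n} ==> t:cell n ==> face_fun (Suc n) i (of_bool e) t:cell (Suc n)"
 using box_top_face box_top_cell[OF face_hom] by metis

lemma degen_fun_cell: "i:{1..Suc n} ==> t:cell (Suc n) ==> degen_fun (Suc n) i t:cell n"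
 using box_top_degen box_top_cell[OF degen_hom] by metis

lemma cts_cellI:
 assumes "!!x. x:topspace X ==> f x:cell n"
  and "!!j. j:{1..n} ==> cts X (%x. f x j)"
 shows "continuous_map X (ct n) f"
 unfolding continuous_map_componentwise continuous_map_in_subtopology
 using assms by (auto simp: cell_iff extensional_def)

lemma cts_proj: "j:{1..n} ==> cts (ct n) (%t. t j)"
 using continuous_map_product_projection[of j "{1..n}" "%_. top_of_set {0..1::real}"]
 by (simp add: continuous_map_in_subtopology)

lemma cts_comp_proj:
 "continuous_map X (ct n) f ==> j:{1..n} ==> cts X (%x. f x j)"
 using continuous_map_compose[OF _ cts_proj] by (auto simp: o_def)

lemma box_top_graph_continuous:
 assumes "box_top_graph m n f g"
 shows "continuous_map (ct m) (ct n) g"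
 using assms
proof induction
 case (id n)
 thus ?case by (rule continuous_map_eq[OF continuous_map_id]) (simp)
next
 case (face i n e)
 have c: "cts (ct (n - 1)) (%t. face_fun n i (of_bool e) t j)" if "j:{1..n}" for j
 proof (cases "j <= i")
  case True
  thus ?thesis
   using that face cts_proj[of j "n - 1"] by (cases "j = i") (auto simp: face_fun_def)
 next
  case False
  hence "j - 1:{1..n - 1}" using that face by (simp; arith)
  thus ?thesis using cts_proj[of "j - 1" "n - 1"] False
   by (auto simp: face_fun_def)
 qed
 show ?case
  using box_top_graph_threshold[OF box_top_graph.face[OF face, of e]]
  by (intro cts_cellI) (auto intro!: continuous_map_eq[OF c])
next
 case (degen i n)
 have c: "cts (ct n) (%t. degen_fun n i t j)" if "j:{1..n - 1}" for j
  using that degen cts_proj[of j n] cts_proj[of "j + 1" n]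
  by (cases "j < i") (auto simp: degen_fun_def)
 show ?case
  using box_top_graph_threshold[OF box_top_graph.degen[OF degen]]
  by (intro cts_cellI) (auto intro!: continuous_map_eq[OF c])
next
 case (conn i n e)
 have c: "cts (ct n) (%t. conn_fun n i e t j)" if "j:{1..n - 1}" for j
  using that conn cts_proj[of j n] cts_proj[of "j + 1" n]
   cts_proj[of i n] cts_proj[of "i + 1" n]
  by (cases "j < i"; cases "j = i"; cases e)
   (auto simp: conn_fun_def intro!: continuous_map_real_min continuous_map_real_max)
 show ?case
  using box_top_graph_threshold[OF box_top_graph.conn[OF conn, of e]]
  by (intro cts_cellI) (auto intro!: continuous_map_eq[OF c])
next
 case (comp l m f f' n g g')
 show ?case
  by (rule continuous_map_eq[OF continuous_map_compose[OF comp.IH]]) (simp add: compose_eq)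
qed

lemma cts_box_top:
 "box_hom m n f ==> continuous_map (ct m) (ct n) (box_top m n f)"
 by (rule box_top_graph_continuous[OF box_top_graph_box_top])

text \<open>What commuting with the generators asks of a coordinatewise map: fixed end points for
  faces, monotonicity for connections. Continuity is kept apart because the discontinuous maps
  \<open>sq\<close> are used as well.\<close>

definition end_mono :: "(real => real) => bool" where
 "end_mono w = (mono_on {0..1} w & w:{0..1} \<rightarrow> {0..1} & w 0 = 0 & w 1 = 1)"

definition wmap :: "nat => (real => real) => (nat => real) => nat => real" where
 "wmap n w t = (\<lambda>j\<in>{1..n}. w (t j))"

lemma wmap_cell: "end_mono w ==> t:cell n ==> wmap n w t:cell n"
 unfolding wmap_def by (rule cellI) (auto simp: end_mono_def Pi_iff dest: cell_bounds)

lemma box_top_wmap: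
 assumes w: "end_mono w" and h: "box_hom m n f" and t: "t:cell m"
 shows "box_top m n f (wmap m w t) = wmap n w (box_top m n f t)"
proof -
 have "g (wmap m w t) = wmap n w (g t)" if "box_top_graph m n f g" "t:cell m" for g
  using that
 proof (induction arbitrary: t)
  case (id n)
  thus ?case using wmap_cell[OF w] by simp
 next
  case (face i n e)
  have "j - 1:{1..n - 1}" if "j:{1..n}" "i < j" for j using that face.hyps by auto
  moreover have "j:{1..n - 1}" if "j:{1..n}" "j < i" for j using that face.hyps by auto
  ultimately show ?case using wmap_cell[OF w face.prems] face w
   by (auto simp: face_fun_def wmap_def fun_eq_iff end_mono_def restrict_def)
 next
  case (degen i n)
  thus ?case using wmap_cell[OF w degen.prems]
   by (auto simp: degen_fun_def wmap_def fun_eq_iff restrict_def)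
 next
  case (conn i n e)
  let ?t = "t (i + 1)"
  have *: "t i:{0..1}" "?t:{0..1}"
   using cell_bounds[OF conn.prems] conn.hyps by auto
  have mono: "w a <= w b" if "a <= b" "a:{0..1}" "b:{0..1}" for a b
   using w that by (auto simp: end_mono_def mono_on_def)
  have "w (min (t i) ?t) = min (w (t i)) (w ?t)"
   "w (max (t i) ?t) = max (w (t i)) (w ?t)"
   using mono[of "t i" ?t] mono[of ?t "t i"] * by (auto simp: min_def max_def)
  thus ?case using wmap_cell[OF w conn.prems] conn
   by (auto simp: conn_fun_def wmap_def fun_eq_iff restrict_def)
 next
  case (comp l m f f' n g g')
  have "f' t:cell m" using box_top_graph_threshold[OF comp.hyps(1)] comp.prems PiE_mem by metis
  thus ?case using comp wmap_cell[OF w] by (simp add: compose_eq)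
 qed
 thus ?thesis using box_top_graph_box_top[OF h] t by blast
qed

section \<open>Tensoring with an identity\<close>

definition drp :: "nat => nat => (nat => 'l) => nat => 'l" where
 "drp m a x = (\<lambda>i\<in>{1..a}. x (m + i))"

text \<open>The operator of an \<open>m\<close>-fold path object: it acts on the coordinates behind
  the first \<open>m\<close>, which are path directions.\<close>

definition tens :: "nat => nat => nat => box_map => box_map" where
 "tens m a b f = box_tensor m m (box_id m) a b f"

lemma drp_vert [simp]: "drp m a x:vert a"
 by (simp add: drp_def)

lemma drp_apply: "1 <= i ==> i <= a ==> drp m a x i = x (m + i)"
 by (simp add: drp_def)

lemma drp_cell: "t:cell (m + a) ==> drp m a t:cell a"
 unfolding drp_def by (rule cellI) (auto simp: cell_iff)

lemma tens_apply: "x:vert (m + a) ==> 1 <= j ==> j <= m + b ==>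
  tens m a b f x j = (if j <= m then x j else f (drp m a x) (j - m))"
 by (simp add: tens_def box_tensor_def drp_def)

lemma tens_PiE: "tens m a b f:vert (m + a) \<rightarrow>\<^sub>E vert (m + b)"
 unfolding tens_def box_tensor_def restrict_PiE_iff by (intro ballI vert_restrict)

lemma tens_eqI:
 assumes "g:vert (m + a) \<rightarrow>\<^sub>E vert (m + b)"
  and "!!x j. x:vert (m + a) ==> 1 <= j ==> j <= m + b ==> (if j <= m then x j else f (drp m a x) (j - m)) = g x j"
 shows "tens m a b f = g"
 by (rule box_eqI[OF tens_PiE assms(1)]) (use assms(2) in \<open>simp add: tens_apply\<close>)

lemma tens_face: "i:{1..Suc n} ==> tens m n (Suc n) (box_face (Suc n) i e) = box_face (Suc (m + n)) (m + i) e"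
 by (rule tens_eqI)
  (use hom_PiE[OF face_hom[of "m + i" "Suc (m + n)" "m + n"]] in \<open>auto simp: box_face_Suc drp_apply\<close>)

lemma tens_hom:
 assumes "box_hom a b f"
 shows "box_hom (m + a) (m + b) (tens m a b f)"
 using assms
proof induction
 case (id n)
 have "tens m n n (box_id n) = box_id (m + n)"
  by (rule box_eqI[OF tens_PiE hom_PiE[OF box_hom.id]]) (auto simp: tens_apply drp_apply)
 thus ?case using box_hom.id by simp
next
 case (face i n e)
 then obtain k where n: "n = Suc k" by (cases n) auto
 thus ?case using tens_face[of i k m e] face face_hom[of "m + i" "Suc (m + k)" "m + k" e] by simp
next
 case (degen i n)
 then obtain k where n: "n = Suc k" by (cases n) auto
 have h: "box_hom (m + n) (m + k) (box_degen (m + n) (m + i))" using degen n by (intro degen_hom) auto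
 have "tens m n k (box_degen n i) = box_degen (m + n) (m + i)"
  by (rule tens_eqI[OF hom_PiE[OF h]]) (use degen n in \<open>auto simp: box_degen_Suc drp_apply\<close>)
 thus ?case using h n by simp
next
 case (conn i n e)
 then obtain k where n: "n = Suc k" by (cases n) auto
 have h: "box_hom (m + n) (m + k) (box_conn (m + n) (m + i) e)" using conn n by (intro conn_hom) auto
 have "tens m n k (box_conn n i e) = box_conn (m + n) (m + i) e"
  by (rule tens_eqI[OF hom_PiE[OF h]]) (use conn n in \<open>auto simp: box_conn_Suc drp_apply\<close>)
 thus ?case using h n by simp
next
 case (comp l k f n g)
 have dt: "drp m k (tens m l k f x) = f (drp m l x)" if "x:vert (m + l)" for x
  using that hom_vert[OF comp.hyps(1)] PiE_mem[OF tens_PiE that]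
  by (intro vert_eqI[of _ k]) (auto simp: tens_apply drp_apply)
 have "tens m l n (vcomp l g f) = vcomp (m + l) (tens m k n g) (tens m l k f)"
  using PiE_mem[OF tens_PiE[of m l k f]]
  by (intro box_eqI[OF tens_PiE hom_PiE[OF box_hom.comp[OF comp.IH]]])
   (simp add: tens_apply dt)
 thus ?case using box_hom.comp[OF comp.IH] by simp
qed

lemma drp_tens: "x:vert (m + a) ==> box_hom a b f ==> drp m b (tens m a b f x) = f (drp m a x)"
 using hom_vert[of a b f] PiE_mem[OF tens_PiE, of x m a b f]
 by (intro vert_eqI[of _ b]) (auto simp: tens_apply drp_apply)

lemma tens_id: "tens m n n (box_id n) = box_id (m + n)"
 by (rule box_eqI[OF tens_PiE hom_PiE[OF box_hom.id]]) (auto simp: tens_apply drp_apply)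

lemma tens_comp: "box_hom l k f ==> box_hom k n g ==>
  tens m l n (vcomp l g f) = vcomp (m + l) (tens m k n g) (tens m l k f)"
 using PiE_mem[OF tens_PiE[of m l k f]]
 by (intro box_eqI[OF tens_PiE hom_PiE[OF box_hom.comp[OF tens_hom tens_hom]]])
   (simp_all add: tens_apply drp_tens)

lemma tens_tens: "tens m' (m + a) (m + b) (tens m a b f) = tens (m' + m) a b f"
proof (rule box_eqI[OF tens_PiE])
 show "tens (m' + m) a b f:vert (m' + (m + a)) \<rightarrow>\<^sub>E vert (m' + (m + b))"
  using tens_PiE[of "m' + m" a b f] by (simp add: add.assoc)
 fix x j assume x: "x:vert (m' + (m + a))" and j: "j:{1..m' + (m + b)}"
 have "drp m a (drp m' (m + a) x) = drp (m' + m) a x"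
  by (rule vert_eqI[of _ a]) (auto simp: drp_apply add.assoc)
 thus "tens m' (m + a) (m + b) (tens m a b f) x j = tens (m' + m) a b f x j"
  using x j by (cases "j <= m'") (auto simp: tens_apply add.assoc drp_apply)
qed

lemma face_tens:
 assumes i: "i:{1..Suc m}" and h: "box_hom a b p"
 shows "vcomp (m + a) (tens (Suc m) a b p) (box_face (Suc (m + a)) i e) =
  vcomp (m + a) (box_face (Suc (m + b)) i e) (tens m a b p)"
proof (rule box_eqI)
 let ?S = "Suc (m + b)"
 let ?m = "m + a"
 let ?b = "box_face (Suc ?m) i e"
 let ?t = "tens (Suc m) a b p"
 let ?v = "vert ?m \<rightarrow>\<^sub>E vert ?S"
 let ?i = "box_face ?S i e"
 have f: "box_hom ?m (Suc ?m) ?b"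
  "box_hom (m + b) ?S ?i"
  using i by (auto intro!: face_hom)
 have t: "box_hom (Suc ?m) ?S ?t"
  using tens_hom[OF h, of "Suc m"] by simp
 show "vcomp ?m ?t ?b:?v"
  using box_hom.comp[OF f(1) t] by (rule hom_PiE)
 show "vcomp ?m ?i (tens m a b p):?v"
  using box_hom.comp[OF tens_hom[OF h] f(2)] by (rule hom_PiE)
 fix x j assume x: "x:vert ?m" and j: "j:{1..Suc (m + b)}"
 note v = hom_vert[OF f(1) x] hom_vert[OF tens_hom[OF h] x]
 have dr: "drp (Suc m) a (box_face (Suc ?m) i e x) = drp m a x"
  using x i by (intro vert_eqI[of _ a]) (auto simp: drp_apply box_face_Suc)
 obtain l where l: "j = Suc l" using j by (cases j) auto
 show "vcomp ?m ?t ?b x j =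
  vcomp ?m ?i (tens m a b p) x j"
  using x i j v unfolding l by (cases "l <= m") (auto simp: tens_apply box_face_Suc dr)
qed

lemma box_top_tens:
 assumes h: "box_hom a b f" and t: "t:cell (m + a)"
 shows "box_top (m + a) (m + b) (tens m a b f) t =
  (\<lambda>j\<in>{1..m + b}. if j <= m then t j else box_top a b f (drp m a t) (j - m))"
proof (rule box_topI[OF tens_hom[OF h] t])
 let ?l = "\<lambda>j\<in>{1..m + b}. if j <= m then t j else box_top a b f (drp m a t) (j - m)"
 have d: "drp m a t:cell a" using t by (rule drp_cell)
 show "?l:cell (m + b)"
 proof (rule cellI)
  fix j assume j: "j:{1..m + b}"
  let ?i = "if j <= m then t j else box_top a b f (drp m a t) (j - m)"
  show "0 <= ?i &
   ?i <= 1"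
  proof (cases "j <= m")
   case True
   thus ?thesis using cell_bounds[OF t, of j] j by simp
  next
   case False
   hence "j - m:{1..b}" using j by (simp; arith)
   thus ?thesis using cell_bounds[OF box_top_cell[OF h d]] False by simp
  qed
 qed
 fix c :: real assume c: "c:{0<..1}"
 have "drp m a (threshold (m + a) c t) = threshold a c (drp m a t)"
  by (rule vert_eqI[of _ a]) (auto simp: drp_apply threshold_def)
 thus "threshold (m + b) c ?l =
   tens m a b f (threshold (m + a) c t)"
  using box_top_thr[OF h d c, symmetric] PiE_mem[OF tens_PiE, of _ m a b f]
  by (intro vert_eqI[of _ "m + b"]) (auto simp: tens_apply threshold_def)
qed

section \<open>Faces and shifted operators in a cubical set\<close>

abbreviation fc :: "'a cset => nat => 'a => nat => bool => 'a" where
 "fc X n x i e == act X n (Suc n) x (box_face (Suc n) i e)"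

abbreviation tn :: "'a cset => nat => nat => nat => 'a => box_map => 'a" where
 "tn X m a b x f == act X (m + a) (m + b) x (tens m a b f)"

lemma fc_in: "cubical_set X ==> x:cubes X (Suc n) ==> 1 <= i ==> i <= Suc n ==> fc X n x i e:cubes X n"
 by (rule act_in) (auto intro: face_hom)

lemma fc_fc:
 assumes "cubical_set X" "x:cubes X (Suc (Suc n))" "1 <= i" "i < j" "j <= Suc (Suc n)"
 shows "fc X n (fc X (Suc n) x j d) i e = fc X n (fc X (Suc n) x i e) (j - 1) d"
proof -
 let ?S = "{1..Suc (Suc n)}"
 have "i:{1..Suc n}" "j:?S" "i:?S"
  using assms by auto
 moreover have "j - 1:{1..Suc n}"
  using assms by (simp; arith)
 ultimately have "i:{1..Suc n}" "j:?S" "i:?S" "j - 1:{1..Suc n}" .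
 note h = this[THEN face_hom[OF _ refl]]
 show ?thesis
  using act_comp[OF assms(1) h(1,2) assms(2), of d e] act_comp[OF assms(1) h(4,3) assms(2), of e d]
  by (simp add: face_face assms)
qed

lemma tn_in: "cubical_set X ==> x:cubes X (m + b) ==> box_hom a b f ==> tn X m a b x f:cubes X (m + a)"
 by (rule act_in) (auto intro: tens_hom)

lemma tn_id: "cubical_set X ==> x:cubes X (m + n) ==> tn X m n n x (box_id n) = x"
 by (simp add: tens_id act_id)

lemma tn_comp: "cubical_set X ==> x:cubes X (m + c) ==> box_hom a b f ==> box_hom b c g ==>
  tn X m a b (tn X m b c x g) f = tn X m a c x (vcomp a g f)"
 by (simp add: act_comp tens_hom tens_comp)

lemma fc_tn: "cubical_set X ==> x:cubes X (Suc m + b) ==> box_hom a b f ==> 1 <= i ==> i <= Suc m ==>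
  fc X (m + a) (tn X (Suc m) a b x f) i e = tn X m a b (fc X (m + b) x i e) f"
 using tens_hom[of a b f "Suc m"] tens_hom[of a b f m]
 by (simp add: act_comp face_hom face_tens)

lemma tn_face: "1 <= i ==> i <= Suc n ==> tn X m n (Suc n) x (box_face (Suc n) i e) = fc X (m + n) x (m + i) e"
 by (simp add: tens_face)

text \<open>The \<open>m\<close>-fold path object. A natural family of \<open>(m + n)\<close>-cubes
  of \<open>E\<close> is a map into it, so such families can be built by the general construction of
  sections.\<close>

definition pth :: "nat => 'a cset => 'a cset" where
 "pth m E = \<lparr>cubes = (%n. cubes E (m + n)), act = (%a b x f. tn E m a b x f)\<rparr>"

lemma pth_simps [simp]: "cubes (pth m E) n = cubes E (m + n)" "act (pth m E) a b x f = tn E m a b x f"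
 by (simp_all add: pth_def)

lemma cubical_set_pth: "cubical_set E ==> cubical_set (pth m E)"
 unfolding cubical_set_def[of "pth m E"] by (simp add: tn_in tn_id tn_comp)

declare Suc_eq_plus1 [symmetric, simp]

section \<open>Filling compatible families of faces\<close>

text \<open>The Kan condition in terms of faces instead of maps out of an open box, the form in
  which fillers are used throughout. Double faces exist only for \<open>n = Suc n'\<close>, hence
  the form of the compatibility clause.\<close>

definition kanE :: "'a cset => bool" where
 "kanE E = (cubical_set E & (ALL n i c v. i:{1..Suc n} -->
   (ALL j:{1..Suc n}. ALL d. (j, d) ~= (i, c) --> v j d:cubes E n) -->
   (ALL n' j k d h. n = Suc n' --> 1 <= j --> j < k --> k <= Suc n --> (j, d) ~= (i, c) --> (k, h) ~= (i, c) -->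
    fc E n' (v k h) j d = fc E n' (v j d) (k - 1) h) -->
   (EX e:cubes E (Suc n). ALL j:{1..Suc n}. ALL d. (j, d) ~= (i, c) --> fc E n e j d = v j d)))"

lemma kanE_cset: "kanE E ==> cubical_set E"
 by (simp add: kanE_def)

lemma kanE_fill:
 assumes "kanE E" "i:{1..Suc n}"
  and "!!j d. j:{1..Suc n} ==> (j, d) ~= (i, c) ==> v j d:cubes E n"
  and "!!n' j k d h. n = Suc n' ==> 1 <= j ==> j < k ==> k <= Suc n ==> (j, d) ~= (i, c) ==> (k, h) ~= (i, c) ==>
    fc E n' (v k h) j d = fc E n' (v j d) (k - 1) h"
 obtains e where "e:cubes E (Suc n)"
  "!!j d. j:{1..Suc n} ==> (j, d) ~= (i, c) ==> fc E n e j d = v j d"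
proof -
 have "EX e:cubes E (Suc n). ALL j:{1..Suc n}. ALL d. (j, d) ~= (i, c) --> fc E n e j d = v j d"
  using assms(1)[unfolded kanE_def, THEN conjunct2, rule_format, OF assms(2), of c v] assms(3,4) by simp
 thus ?thesis using that by blast
qed

lemma degen_degen:
 assumes "1 <= j" "j < k" "k <= Suc (Suc n)"
 shows "vcomp (Suc (Suc n)) (box_degen (Suc n) (k - 1)) (box_degen (Suc (Suc n)) j) =
  vcomp (Suc (Suc n)) (box_degen (Suc n) j) (box_degen (Suc (Suc n)) k)"
proof -
 let ?S = "Suc n"
 let ?a = "Suc ?S"
 have "j:{1..Suc n}" "j:{1..Suc ?S}" "k:{1..Suc ?S}"
  using assms by auto
 moreover have "k - 1:{1..Suc n}" using assms by (simp; arith)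
 ultimately have h: "box_hom ?S n (box_degen ?S j)" "box_hom ?a ?S (box_degen ?a j)"
  "box_hom ?a ?S (box_degen ?a k)" "box_hom ?S n (box_degen ?S (k - 1))"
  by (auto intro: degen_hom)
 show ?thesis
 proof (rule hom_eqI[OF box_hom.comp[OF h(2,4)] box_hom.comp[OF h(3,1)]])
  fix x l assume x: "x:vert ?a" and l: "l:{1..n}"
  note v = hom_vert[OF h(2) x] hom_vert[OF h(3) x]
  obtain k' where k: "k = Suc k'" using assms by (cases k) auto
  show "vcomp ?a (box_degen ?S (k - 1)) (box_degen ?a j) x l =
   vcomp ?a (box_degen ?S j) (box_degen ?a k) x l"
   using x l assms v unfolding k by (auto simp: box_degen_Suc)
 qed
qed

lemma const_coord_factor:
 assumes h: "box_hom m (Suc n) f" "box_hom m n g" and j: "j:{1..Suc n}"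
  and c: "!!x. x:vert m ==> f x j = e" and g: "g = vcomp m (box_degen (Suc n) j) f"
  and X: "cubical_set X" "x:cubes X (Suc n)"
 shows "act X m (Suc n) x f = act X m n (fc X n x j e) g"
 using box_face_factor[OF h(1) j c] act_comp[OF X(1) h(2) face_hom[OF j refl] X(2)] g by simp

text \<open>A compatible family defines a map on the open box: a cube of the box has some coordinate
  \<open>j\<close> with constant value \<open>b\<close> and is sent to the restriction of
  \<open>v j b\<close> along its remaining coordinates. The filler is the value of the extension at
  the identity.\<close>

lemma kan_complex_kanE:
 assumes "kan_complex X"
 shows "kanE X"
proof -
 have X: "cubical_set X" using assms by (simp add: kan_complex_def)
 have "EX e:cubes X (Suc n). ALL j:{1..Suc n}. ALL b. (j, b) ~= (i, u) --> fc X n e j b = v j b"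
  if i: "i:{1..Suc n}" and v: "ALL j:{1..Suc n}. ALL b. (j, b) ~= (i, u) --> v j b:cubes X n"
   and comp: "ALL n' j k b th. n = Suc n' --> 1 <= j --> j < k --> k <= Suc n --> (j, b) ~= (i, u) --> (k, th) ~= (i, u) -->
    fc X n' (v k th) j b = fc X n' (v j b) (k - 1) th" for n i u v
 proof -
  define ok where "ok m ph p \<longleftrightarrow> (case p of (j, b) => j:{1..Suc n} & (j, b) ~= (i, u) & (ALL x:vert m. ph x j = b))"
   for m and ph :: box_map and p
  let ?S = "Suc n"
  let ?o = "open_box ?S i u"
  define h where "h m ph p = (case p of (j, b) => act X m n (v j b) (vcomp m (box_degen ?S j) ph))"
   for m ph p
  let ?N = "{1..Suc n}"
  define f where "f m ph = h m ph (SOME p. ok m ph p)" for m ph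
  have dg: "box_hom m n (vcomp m (box_degen ?S j) ph)" if "box_hom m ?S ph" "j:?N" for m ph j
   using box_hom.comp[OF that(1) degen_hom[OF that(2) refl]] .
  \<comment> \<open>With two constant coordinates both values reduce to the common double face,
    restricted along \<open>?c\<close>.\<close>
  have lt: "h m ph (j, b) = h m ph (k, th)"
   if ph: "box_hom m ?S ph" and p: "ok m ph (j, b)" "ok m ph (k, th)" and jk: "j < k" for m ph j b k th
  proof -
   have r: "j:?N" "k:?N" "(j, b) ~= (i, u)" "(k, th) ~= (i, u)"
    and cj: "!!x. x:vert m ==> ph x j = b" and ck: "!!x. x:vert m ==> ph x k = th"
    using p by (auto simp: ok_def)
   obtain n' where n: "n = Suc n'" using r jk by (cases n) auto
   let ?n = "Suc n'"
   obtain k' where k': "k = Suc k'" using jk by (cases k) auto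
   have r': "j:{1..Suc n'}" "k - 1:{1..Suc n'}" using r jk unfolding n k' by auto
   let ?pj = "vcomp m (box_degen ?S j) ph" and ?pk = "vcomp m (box_degen ?S k) ph"
   have hj: "box_hom m ?n ?pj" and hk: "box_hom m ?n ?pk"
    using dg[OF ph r(1)] dg[OF ph r(2)] n by auto
   let ?c = "vcomp m (box_degen ?n j) ?pk"
   have hc: "box_hom m n' ?c" by (rule box_hom.comp[OF hk degen_hom[OF r'(1) refl]])
   have c_eq: "?c = vcomp m (box_degen ?n (k - 1)) ?pj"
   proof -
    have "vcomp m (vcomp ?S (box_degen ?n j) (box_degen ?S k)) ph =
     vcomp m (vcomp ?S (box_degen ?n (k - 1)) (box_degen ?S j)) ph"
     using degen_degen[of j k n'] r jk n by auto
    thus ?thesis by (simp only: compose_vert_assoc[OF ph])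
   qed
   have vj: "v j b:cubes X ?n" and vk: "v k th:cubes X ?n" using v r n by auto
   have e1: "?pj x (k - 1) = th" and e2: "?pk x j = b" if "x:vert m" for x
   proof -
    have v: "ph x:vert (Suc ?n)" using hom_vert[OF ph that] n by simp
    show "?pj x (k - 1) = th"
     using jk r'(2) ck[OF that] unfolding n k' compose_vert[OF that] by (simp add: box_degen_Suc[OF v])
    show "?pk x j = b"
     using jk r'(1) cj[OF that] unfolding n k' compose_vert[OF that] by (simp add: box_degen_Suc[OF v])
   qed
   have "h m ph (j, b) = act X m n' (fc X n' (v j b) (k - 1) th) ?c"
    using const_coord_factor[OF hj hc r'(2) e1 c_eq X vj] n by (simp add: h_def)
   also have "\<dots> = act X m n' (fc X n' (v k th) j b) ?c"
    using comp r jk n by simp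
   also have "\<dots> = h m ph (k, th)"
    using const_coord_factor[OF hk hc r'(1) e2 refl X vk] n by (simp add: h_def)
   finally show ?thesis .
  qed
  have wd: "h m ph p = h m ph q" if ph: "box_hom m ?S ph" and p: "ok m ph p" "ok m ph q" for m ph p q
  proof -
   obtain j b k th where pq: "p = (j, b)" "q = (k, th)" by (cases p; cases q)
   show ?thesis
   proof (cases j k rule: linorder_cases)
    case equal
    have "ph (vtop m) j = b" "ph (vtop m) k = th" using p pq by (simp_all add: ok_def)
    hence "p = q" using pq equal by simp
    thus ?thesis by simp
   qed (use lt[OF ph] p pq in \<open>auto simp: eq_commute\<close>)
  qed
  have f_eq: "f m ph = h m ph p" if "box_hom m ?S ph" "ok m ph p" for m ph p
   unfolding f_def using wd[OF that(1) someI[of "ok m ph", OF that(2)] that(2)] .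
  have ob: "EX p. ok m ph p & box_hom m ?S ph" if "ph:cubes ?o m" for m ph
  proof -
   obtain j b ps where j: "j:?N" "(j, b) ~= (i, u)" "box_hom m n ps"
    "ph = vcomp m (box_face ?S j b) ps"
    using \<open>ph : _\<close> unfolding open_box_def by auto
   have "box_hom m ?S ph" using box_hom.comp[OF j(3) face_hom[OF j(1) refl]] j(4) by simp
   moreover have "ok m ph (j, b)"
    using j hom_vert[OF j(3)] unfolding ok_def by (auto simp: box_face_Suc)
   ultimately show ?thesis by blast
  qed
  have h_in: "h m ph p:cubes X m" if "box_hom m ?S ph" "ok m ph p" for m ph p
  proof -
   obtain j b where p: "p = (j, b)" by (cases p)
   with that have j: "j:?N" "(j, b) ~= (i, u)" by (auto simp: ok_def)
   show ?thesis using act_in[OF X dg[OF that(1) j(1)]] v j p by (simp add: h_def)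
  qed
  have f_map: "cset_map ?o X f"
   unfolding cset_map_def
  proof (intro conjI allI impI ballI)
   fix m show "f m:cubes ?o m \<rightarrow> cubes X m"
    using ob f_eq h_in by (metis Pi_I)
  next
   fix l m z ph assume chi: "box_hom l m z" and ph: "ph:cubes ?o m"
   let ?v = "vcomp l ph z"
   obtain j b where p: "ok m ph (j, b)" and hph: "box_hom m ?S ph" using ob[OF ph] by auto
   have j: "j:?N" "(j, b) ~= (i, u)" using p by (auto simp: ok_def)
   have ac: "act ?o l m ph z = ?v"
    by (simp add: open_box_def std_cube_def)
   have hc: "box_hom l ?S ?v" by (rule box_hom.comp[OF chi hph])
   have p': "ok l ?v (j, b)"
    using p hom_vert[OF chi] by (auto simp: ok_def)
   have "f l ?v = act X l n (v j b) (vcomp l (box_degen ?S j) ?v)"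
    using f_eq[OF hc p'] by (simp add: h_def)
   also have "\<dots> = act X l n (v j b) (vcomp l (vcomp m (box_degen ?S j) ph) z)"
    by (simp only: compose_vert_assoc[OF chi])
   also have "\<dots> = act X l m (f m ph) z"
    using act_comp[OF X chi dg[OF hph j(1)]] v j f_eq[OF hph p] by (simp add: h_def)
   finally show "f l (act ?o l m ph z) = act X l m (f m ph) z"
    by (simp add: ac)
  qed
  from assms have "i:{1..Suc n} --> cset_map ?o X f -->
    (EX g. cset_map (std_cube ?S) X g &
       (ALL m. ALL ph:cubes ?o m. g m ph = f m ph))"
   unfolding kan_complex_def by simp
  with i f_map obtain g where g0: "cset_map (std_cube ?S) X g &
       (ALL m. ALL ph:cubes ?o m. g m ph = f m ph)" by auto
  hence g: "cset_map (std_cube ?S) X g"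
   "!!m ph. ph:cubes ?o m ==> g m ph = f m ph"
   by simp_all
  let ?e = "g ?S (box_id ?S)"
  have idc: "(box_id ?S):cubes (std_cube ?S) ?S"
   by (simp add: std_cube_def box_hom.id)
  have "?e:cubes X ?S" using g(1) idc by (auto simp: cset_map_def)
  moreover have "fc X n ?e j b = v j b" if j: "j:?N" "(j, b) ~= (i, u)" for j b
  proof -
   let ?d = "box_face ?S j b"
   have hd: "box_hom n ?S ?d" using face_hom[OF j(1) refl] .
   have cd: "?d:cubes ?o n"
   proof -
    have "?d = vcomp n ?d (box_id n)" "box_hom n (Suc n - 1) (box_id n)"
     using box_hom_compose_id(1)[OF hd] box_hom.id by auto
    thus ?thesis using j unfolding open_box_def by auto
   qed
   have "fc X n ?e j b = g n (act (std_cube ?S) n ?S (box_id ?S) ?d)"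
    using g(1) hd idc unfolding cset_map_def by metis
   also have "act (std_cube ?S) n ?S (box_id ?S) ?d = ?d"
    using box_hom_compose_id(2)[OF hd] by (simp add: std_cube_def)
   also have "g n ?d = f n ?d" by (rule g(2)[OF cd])
   also have "ok n ?d (j, b)"
    using j unfolding ok_def by (auto simp: box_face_Suc)
   from f_eq[OF hd this] have "f n ?d = act X n n (v j b) (vcomp n (box_degen ?S j) ?d)"
    by (simp add: h_def)
   also have "\<dots> = v j b" using degen_face[OF j(1)] act_id[OF X] v j by simp
   finally show ?thesis .
  qed
  ultimately show ?thesis by blast
 qed
 thus ?thesis using X by (simp add: kanE_def)
qed

section \<open>Singular cubes\<close>

definition Sing :: "'b topology => ((nat => real) => 'b) cset" where
 "Sing T = \<lparr>cubes = (%n. {f:extensional (cell n). continuous_map (ct n) T f}),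
   act = (%m n f p. compose (cell m) f (box_top m n p))\<rparr>"

lemma Sing_cubes: "f:cubes (Sing T) n \<longleftrightarrow> f:extensional (cell n) & continuous_map (ct n) T f"
 by (simp add: Sing_def)

lemma Sing_act: "act (Sing T) m n f p = compose (cell m) f (box_top m n p)"
 by (simp add: Sing_def)

lemma Sing_act_apply: "t:cell m ==> act (Sing T) m n f p t = f (box_top m n p t)"
 by (simp add: Sing_def compose_eq)

lemma Sing_eqI: "f:cubes (Sing T) n ==> g:cubes (Sing T) n ==> (!!t. t:cell n ==> f t = g t) ==> f = g"
 by (rule extensionalityI[of _ "cell n"]) (auto simp: Sing_cubes)

lemma SingI: "continuous_map (ct n) T f ==> (\<lambda>t\<in>cell n. f t):cubes (Sing T) n"
 unfolding Sing_cubes by auto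

lemma Sing_topspace: "f:cubes (Sing T) n ==> t:cell n ==> f t:topspace T"
 unfolding Sing_cubes using continuous_map_image_subset_topspace by fastforce

lemma Sing_composeI:
 assumes "f:cubes (Sing T) n" "continuous_map (ct m) (ct n) g"
 shows "compose (cell m) f g:cubes (Sing T) m"
 unfolding compose_def
proof (rule SingI)
 show "continuous_map (ct m) T (%x. f (g x))"
  using continuous_map_compose[OF assms(2), of T f] assms(1) by (simp add: Sing_cubes o_def)
qed

lemma Sing_cset: "cubical_set (Sing T)"
 unfolding cubical_set_def
proof (intro conjI allI impI ballI)
 let ?S = "Sing T"
 show in': "act ?S m n x f:cubes ?S m" if "box_hom m n f" "x:cubes ?S n" for m n f x
  unfolding Sing_act by (rule Sing_composeI[OF that(2) cts_box_top[OF that(1)]])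
 show "act ?S n n x (box_id n) = x" if "x:cubes ?S n" for n x
  by (rule Sing_eqI[OF in'[OF box_hom.id that] that]) (simp add: Sing_act_apply box_top_id)
 show "act ?S l n x (vcomp l g f) = act ?S l m (act ?S m n x g) f"
  if "box_hom l m f" "box_hom m n g" "x:cubes ?S n" for l m n f g x
  using that by (intro Sing_eqI[OF in' in'])
   (auto simp: Sing_act_apply box_top_comp box_top_cell intro: box_hom.comp in')
qed

lemma Sing_fc: "f:cubes (Sing T) (Suc n) ==> 1 <= i ==> i <= Suc n ==> t:cell n ==>
  fc (Sing T) n f i e t = f (face_fun (Suc n) i (of_bool e) t)"
 by (simp add: Sing_act_apply box_top_face)

lemma continuous_map_Max:
 assumes "finite A" "!!j. j:A ==> cts X (%x. f x j)"
 shows "cts X (%x. Max (insert 0 (f x ` A)))"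
 using assms
proof (induction A)
 case (insert a A)
 let ?x = "%x. max (f x a) (Max (insert 0 (f x ` A)))"
 have "(%x. Max (insert 0 (f x ` insert a A))) = ?x"
  using insert.hyps by (simp add: insert_commute[of 0])
 moreover have "cts X ?x"
  using insert by (intro continuous_map_real_max) auto
 ultimately show ?case by simp
qed simp

text \<open>Radial projection from a point just beyond the centre of the missing face.\<close>

lemma open_box_retraction:
 assumes i: "i:{1..Suc n}"
 obtains R where "continuous_map (ct (Suc n)) (ct (Suc n)) R"
  "!!t. t:cell (Suc n) ==> EX j:{1..Suc n}. EX d. (j, d) ~= (i, e) & R t j = of_bool d"
  "!!t j d. t:cell (Suc n) ==> j:{1..Suc n} ==> (j, d) ~= (i, e) ==> t j = of_bool d ==> R t = t"
proof -
 let ?c = "ct (Suc n)"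
 let ?S = "cell (Suc n)"
 define A where "A = {1..Suc n} - {i}"
 define h where "h t = (if e then t i else 1 - t i)" for t :: "nat => real"
 define M where "M t = Max (insert 0 ((%j. 2 * \<bar>t j - 1 / 2\<bar>) ` A))" for t :: "nat => real"
 \<comment> \<open>The centre of projection has \<open>h = 2\<close> and all other coordinates
   \<open>1 / 2\<close>; on the missing face \<open>h = 1\<close>. The displacement from the centre
   is divided by \<open>D\<close>: division by \<open>M t\<close> reaches a side wall, division by
   \<open>1 - h t / 2\<close> the wall opposite the missing face. The larger divisor belongs to the
   wall that the ray meets first.\<close>
 define D where "D t = max (M t) (1 - h t / 2)" for t
 define h' where "h' t = 2 - (2 - h t) / D t" for t
 define R where "R t = (\<lambda>j\<in>{1..Suc n}. if j = i then (if e then h' t else 1 - h' t) else 1 / 2 + (t j - 1 / 2) / D t)" for t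
 have fA: "finite A" by (simp add: A_def)
 have h01: "0 <= h t & h t <= 1" if "t:?S" for t
  using cell_bounds[OF that i] by (auto simp: h_def)
 have Mge: "2 * \<bar>t j - 1 / 2\<bar> <= M t" if "j:A" for t j
  unfolding M_def using fA that by (intro Max_ge) auto
 have M0: "0 <= M t" for t unfolding M_def using fA by (intro Max_ge) auto
 have M1: "M t <= 1" if "t:?S" for t
 proof -
  have "2 * \<bar>t j - 1 / 2\<bar> <= 1" if "j:A" for j
   using cell_bounds[OF \<open>t : _\<close>, of j] that by (auto simp: A_def abs_if)
  thus ?thesis unfolding M_def using fA by (intro Max.boundedI) auto
 qed
 have D: "D t >= 1 / 2" "D t <= 1" "D t >= M t" "D t >= 1 - h t / 2" if "t:?S" for t
 proof -
  show 1: "D t >= M t" "D t >= 1 - h t / 2" by (simp_all add: D_def)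
  show "D t >= 1 / 2" using 1(2) h01[OF that] by linarith
  show "D t <= 1" using h01[OF that] M1[OF that] by (simp add: D_def)
 qed
 have Rj: "0 <= 1 / 2 + (t j - 1 / 2) / D t & 1 / 2 + (t j - 1 / 2) / D t <= 1"
  if "t:?S" "j:A" for t j
 proof -
  have "2 * \<bar>t j - 1 / 2\<bar> <= D t" using Mge[OF that(2), of t] D(3)[OF that(1)] by linarith
  hence "\<bar>(t j - 1 / 2) / D t\<bar> <= 1 / 2"
   using D(1)[OF that(1)] by (simp add: abs_divide)
  thus ?thesis by linarith
 qed
 have h'01: "0 <= h' t & h' t <= 1" if "t:?S" for t
 proof -
  have "2 - h t <= 2 * D t" using D(4)[OF that] by linarith
  hence "(2 - h t) / D t <= 2" using D(1)[OF that] by (simp add: divide_le_eq)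
  moreover have "1 <= (2 - h t) / D t" using D(1,2)[OF that] h01[OF that] by simp
  ultimately show ?thesis by (simp add: h'_def)
 qed
 have Rc: "R t:?S" if "t:?S" for t
  unfolding R_def using h'01[OF that] Rj[OF that] by (intro cellI) (auto simp: A_def)
 have pr: "cts ?c (%t. t j)" if "j:{1..Suc n}" for j
  using cts_proj[OF that] .
 have ch: "cts ?c h"
  unfolding h_def using pr[OF i] by (cases e) (auto intro!: continuous_intros)
 have cM: "cts ?c M"
  unfolding M_def using pr
  by (intro continuous_map_Max[OF fA, of _ "%t j. 2 * \<bar>t j - 1 / 2\<bar>"] continuous_intros) (auto simp: A_def)
 have cD: "cts ?c D"
  unfolding D_def by (intro continuous_intros ch cM) auto
 have D0: "D t ~= 0" if "t:topspace ?c" for t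
  using D(1)[of t] that by auto
 have ch': "cts ?c h'"
  unfolding h'_def by (intro continuous_intros ch cD) (use D0 in auto)
 have "continuous_map ?c ?c R"
 proof (rule cts_cellI)
  show "R t:?S" if "t:topspace ?c" for t
   using Rc[of t] that by simp
  fix j assume j: "j:{1..Suc n}"
  have "cts ?c (%t. 1 - h' t)"
   by (intro continuous_intros ch') auto
  moreover have "cts ?c (%t. 1 / 2 + (t j - 1 / 2) / D t)"
   by (intro continuous_intros cD pr[OF j]) (use D0 in auto)
  ultimately show "cts ?c (%t. R t j)"
   using j ch' by (cases "j = i"; cases e) (simp_all add: R_def)
 qed
 moreover have "EX j:{1..Suc n}. EX d. (j, d) ~= (i, e) & R t j = of_bool d" if t: "t:?S" for t
 proof (cases "M t >= 1 - h t / 2")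
  case True
  hence DM: "D t = M t" by (simp add: D_def)
  have "M t:insert 0 ((%j. 2 * \<bar>t j - 1 / 2\<bar>) ` A)"
   unfolding M_def using fA by (intro Max_in) auto
  moreover have "M t > 0" using D(1)[OF t] DM by linarith
  ultimately obtain j where j: "j:A" "M t = 2 * \<bar>t j - 1 / 2\<bar>" by auto
  let ?t = "t j - 1 / 2"
  have "?t / D t = 1 / 2 | ?t / D t = - 1 / 2"
  proof (cases "t j > 1 / 2")
   case True
   hence "D t = 2 * ?t" using DM j(2) by simp
   thus ?thesis using True by simp
  next
   case False
   hence "D t = - 2 * ?t" "t j ~= 1 / 2" using DM j(2) \<open>M t > 0\<close> by auto
   thus ?thesis by (simp add: field_simps)
  qed
  moreover have "R t j = 1 / 2 + ?t / D t" using j(1) by (simp add: R_def A_def)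
  ultimately have "R t j = 1 | R t j = 0" by argo
  hence "R t j = of_bool True | R t j = of_bool False" by simp
  thus ?thesis using j(1) by (auto simp: A_def)
 next
  case False
  hence "D t = 1 - h t / 2" by (simp add: D_def)
  hence "h' t = 0" using D(1)[OF t] by (simp add: h'_def field_simps)
  hence "R t i = of_bool (~ e)" using i by (auto simp: R_def)
  thus ?thesis by (intro bexI[OF _ i] exI[of _ "~ e"]) simp
 qed
 moreover have "R t = t" if t: "t:?S" and j: "j:{1..Suc n}" "(j, d) ~= (i, e)" "t j = of_bool d" for t j d
 proof -
  have "D t = 1"
  proof (cases "j = i")
   case True
   hence "h t = 0" using j by (cases d; cases e) (auto simp: h_def)
   thus ?thesis using M1[OF t] by (simp add: D_def)
  next
   case False
   hence "M t >= 1" using Mge[of j t] j by (cases d) (auto simp: A_def)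
   thus ?thesis using M1[OF t] h01[OF t] by (simp add: D_def)
  qed
  thus ?thesis
   by (intro cell_eqI[OF Rc[OF t] t]) (auto simp: R_def h'_def h_def)
 qed
 ultimately show ?thesis using that by blast
qed

text \<open>Retract onto the open box and evaluate the prescribed face there. The finitely many
  closed pieces, on which a given coordinate of \<open>R t\<close> is a given end point, are glued
  by the pasting lemma.\<close>

lemma kanE_Sing: "kanE (Sing T)"
proof -
 let ?T = "Sing T"
 have "EX e:cubes ?T (Suc n). ALL j:{1..Suc n}. ALL c. (j, c) ~= (i, b) --> fc ?T n e j c = v j c"
  if i: "i:{1..Suc n}" and v: "ALL j:{1..Suc n}. ALL c. (j, c) ~= (i, b) --> v j c:cubes ?T n"
   and comp: "ALL n' j k c h. n = Suc n' --> 1 <= j --> j < k --> k <= Suc n --> (j, c) ~= (i, b) --> (k, h) ~= (i, b) -->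
    fc ?T n' (v k h) j c = fc ?T n' (v j c) (k - 1) h" for n i b v
 proof -
  obtain R where R: "continuous_map (ct (Suc n)) (ct (Suc n)) R"
   "!!t. t:cell (Suc n) ==> EX j:{1..Suc n}. EX c. (j, c) ~= (i, b) & R t j = of_bool c"
   "!!t j c. t:cell (Suc n) ==> j:{1..Suc n} ==> (j, c) ~= (i, b) ==> t j = of_bool c ==> R t = t"
   by (rule open_box_retraction[OF i, of b]) (rule that)
  have Rc: "R t:cell (Suc n)" if "t:cell (Suc n)" for t
   using continuous_map_image_subset_topspace[OF R(1)] that by auto
  define g where "g p t = (case p of (j, c) => v j c (degen_fun (Suc n) j t))" for p :: "nat \<times> bool" and t
  let ?S = "Suc n"
  let ?N = "{1..Suc n}"
  have lt: "g (j, c) t = g (k, h) t"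
   if t: "t:cell ?S" and jk: "1 <= j" "j < k" "k <= ?S" "(j, c) ~= (i, b)" "(k, h) ~= (i, b)"
    and e: "t j = of_bool c" "t k = of_bool h" for t j k c h
  proof -
   let ?k = "degen_fun ?S k t"
   obtain n' where n: "n = Suc n'" using jk by (cases n) auto
   let ?n = "Suc n'"
   obtain k' where k: "k = Suc k'" using jk by (cases k) auto
   have m: "j:{1..Suc n'}" "k':{1..Suc n'}" "j:?N" "k:?N" using jk k n by auto
   let ?d = "degen_fun ?n j ?k"
   have dk: "?k:cell ?n" using degen_fun_cell[OF m(4) t] n by simp
   have dj: "degen_fun ?S j t:cell ?n" using degen_fun_cell[OF m(3) t] n by simp
   have d: "?d:cell n'" using degen_fun_cell[OF m(1) dk] .
   have 1: "face_fun ?n j (of_bool c) ?d = ?k"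
   proof (rule cell_eqI[OF face_fun_cell[OF m(1) d] dk])
    fix l assume l: "l:{1..Suc n'}"
    then obtain l' where "l = Suc l'" by (cases l) auto
    thus "face_fun ?n j (of_bool c) ?d l = degen_fun ?S k t l"
     using l m jk e unfolding n by (auto simp: face_fun_def degen_fun_def)
   qed
   have 2: "face_fun ?n k' (of_bool h) ?d = degen_fun ?S j t"
   proof (rule cell_eqI[OF face_fun_cell[OF m(2) d] dj])
    fix l assume l: "l:{1..Suc n'}"
    then obtain l' where "l = Suc l'" by (cases l) auto
    thus "face_fun ?n k' (of_bool h) ?d l = degen_fun ?S j t l"
     using l m jk e unfolding n k by (auto simp: face_fun_def degen_fun_def)
   qed
   have vj: "v j c:cubes ?T ?n" and vk: "v k h:cubes ?T ?n"
    using v jk n by auto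
   have "fc ?T n' (v k h) j c ?d = fc ?T n' (v j c) k' h ?d"
    using comp jk n k by auto
   thus ?thesis
    using Sing_fc[OF vk _ _ d, of j c] Sing_fc[OF vj _ _ d, of k' h] m 1 2 by (simp add: g_def)
  qed
  define I where "I = {(j, c). j:{1..Suc n} & (j, c) ~= (i, b)}"
  have fI: "finite I" by (rule finite_subset[of _ "{1..Suc n} \<times> UNIV"]) (auto simp: I_def)
  have wd: "g p t = g q t" if t: "t:cell ?S" and p: "p:I" "t (fst p) = of_bool (snd p)"
   and q: "q:I" "t (fst q) = of_bool (snd q)" for p q t
  proof -
   obtain j c k h where pq: "p = (j, c)" "q = (k, h)" by (cases p; cases q)
   show ?thesis
   proof (cases j k rule: linorder_cases)
    case equal
    thus ?thesis using p q pq by (cases c; cases h) auto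
   next
    case less
    have "1 <= j" "k <= ?S" "(j, c) ~= (i, b)" "(k, h) ~= (i, b)" "t j = of_bool c" "t k = of_bool h"
     using p q unfolding pq I_def by simp_all
    from lt[OF t this(1) less this(2-)] show ?thesis unfolding pq .
   next
    case greater
    have "1 <= k" "j <= ?S" "(k, h) ~= (i, b)" "(j, c) ~= (i, b)" "t k = of_bool h" "t j = of_bool c"
     using p q unfolding pq I_def by simp_all
    from lt[OF t this(1) greater this(2-)] show ?thesis unfolding pq by simp
   qed
  qed
  define e where "e = (\<lambda>t\<in>cell ?S. g (SOME p. p:I & R t (fst p) = of_bool (snd p)) (R t))"
  have e_eq: "e t = g p (R t)" if t: "t:cell ?S" and p: "p:I" "R t (fst p) = of_bool (snd p)" for t p
  proof -
   let ?q = "SOME p. p:I & R t (fst p) = of_bool (snd p)"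
   have q: "?q:I & R t (fst ?q) = of_bool (snd ?q)"
    by (rule someI[of _ p]) (simp add: p)
   have "g ?q (R t) = g p (R t)"
    by (rule wd[OF Rc[OF t] conjunct1[OF q] conjunct2[OF q] p])
   thus ?thesis using t by (simp add: e_def)
  qed
  have cov: "EX p. p:I & R t (fst p) = of_bool (snd p)" if t: "t:cell ?S" for t
  proof -
   obtain j c where "j:?N" "(j, c) ~= (i, b)" "R t j = of_bool c" using R(2)[OF t] by blast
   thus ?thesis by (intro exI[of _ "(j, c)"]) (simp add: I_def)
  qed
  have "continuous_map (ct ?S) T e"
  proof (rule pasting_lemma_closed[OF fI])
   show "closedin (ct ?S) {t:cell ?S. R t (fst p) = of_bool (snd p)}" if "p:I" for p
   proof -
    have "cts (ct ?S) (%t. R t (fst p))"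
     using that by (intro cts_comp_proj[OF R(1)]) (auto simp: I_def)
    from closedin_continuous_map_preimage[OF this, of "{of_bool (snd p)}"]
    show ?thesis by simp
   qed
   show "continuous_map (subtopology (ct ?S) {t:cell ?S. R t (fst p) = of_bool (snd p)}) T (%t. g p (R t))"
    if "p:I" for p
   proof -
    obtain j c where p: "p = (j, c)" by (cases p)
    with that have j: "j:?N" "v j c:cubes ?T n" using v by (auto simp: I_def)
    have "continuous_map (ct ?S) (ct n) (box_top ?S n (box_degen ?S j))"
     using j by (intro cts_box_top degen_hom) auto
    hence "continuous_map (ct ?S) (ct n) (degen_fun ?S j)"
     by (rule continuous_map_eq) (simp add: box_top_degen[OF j(1)])
    from continuous_map_compose[OF continuous_map_compose[OF R(1) this], of T "v j c"] j(2)
    have "continuous_map (ct ?S) T (%t. g p (R t))"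
     by (simp add: Sing_cubes o_def g_def p)
    thus ?thesis by (rule continuous_map_from_subtopology)
   qed
   show "g p (R t) = g q (R t)" if "p:I" "q:I"
    "t:topspace (ct ?S) \<inter> {t:cell ?S. R t (fst p) = of_bool (snd p)} \<inter> {t:cell ?S. R t (fst q) = of_bool (snd q)}"
    for p q t
    using wd[OF Rc, of t p q] that by auto
   show "EX p. p:I & t:{t:cell ?S. R t (fst p) = of_bool (snd p)} & e t = g p (R t)"
    if "t:topspace (ct ?S)" for t
   proof -
    have t: "t:cell ?S" using that by simp
    obtain p where p: "p:I" "R t (fst p) = of_bool (snd p)" using cov[OF t] by blast
    from e_eq[OF t p] p t show ?thesis by (intro exI[of _ p]) simp
   qed
  qed
  hence ein: "e:cubes ?T ?S" by (simp add: Sing_cubes e_def)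
  moreover have "fc ?T n e j c = v j c" if j: "j:?N" "(j, c) ~= (i, b)" for j c
  proof -
   have vj: "v j c:cubes ?T n" using v j by blast
   have j': "1 <= j" "j <= ?S" using j by auto
   show ?thesis
   proof (rule Sing_eqI[OF fc_in[OF Sing_cset ein j'] vj])
    fix t assume t: "t:cell n"
    let ?s = "face_fun ?S j (of_bool c) t"
    have s: "?s:cell ?S" using face_fun_cell[OF j(1) t] .
    have sj: "?s j = of_bool c" using j by (simp add: face_fun_def)
    have Rs: "R ?s = ?s" by (rule R(3)[OF s j sj])
    have "degen_fun ?S j ?s = t"
    proof (rule cell_eqI[OF degen_fun_cell[OF j(1) s] t])
     fix l assume "l:{1..n}"
     thus "degen_fun ?S j ?s l = t l" by (auto simp: degen_fun_def face_fun_def)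
    qed
    thus "fc ?T n e j c t = v j c t"
     using Sing_fc[OF ein j' t, of c] e_eq[OF s, of "(j, c)"] j sj Rs by (simp add: I_def g_def)
   qed
  qed
  ultimately show ?thesis by blast
 qed
 thus ?thesis using Sing_cset by (simp add: kanE_def)
qed

section \<open>Natural sections\<close>

definition ez_form :: "'x cset => nat => 'x => nat \<times> 'x \<times> box_map" where
 "ez_form X n x = (SOME (k, y, s). nondeg X k y & box_epi n k s & x = act X n k y s)"

text \<open>Recursion on dimension: over a non-degenerate cube outside \<open>A\<close> some value
  extending those over the faces is selected, and a degenerate cube inherits the value of its core.
  The test \<open>k < n\<close> guards termination; it succeeds for every degenerate cube of a
  cubical set.\<close>

function chosen_section ::
 "'x cset => 'v cset => (nat => 'x set) => (nat => 'x => 'v) => (nat => 'x => 'v => bool) => nat => 'x => 'v" where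
 "chosen_section X V A sA G n x =
  (if x:A n then sA n x
   else if nondeg X n x then
    (SOME w. w:cubes V n & G n x w &
     (ALL n' i e. n = Suc n' --> 1 <= i --> i <= n -->
       fc V n' w i e = chosen_section X V A sA G n' (fc X n' x i e)))
   else (case ez_form X n x of (k, y, s) =>
    if k < n then act V n k (chosen_section X V A sA G k y) s else undefined))"
 by pat_completeness auto
termination by (relation "Wellfounded.measure (%(X, V, A, sA, G, n, x). n)") auto

declare chosen_section.simps [simp del]

text \<open>A natural choice of values over the cubes of \<open>X\<close> is built dimension by dimension: only the
 values over non-degenerate cubes are chosen, and the Eilenberg--Zilber property makes the rest
 well defined.\<close>

locale natural_section =
 fixes X :: "'x cset" and V :: "'v cset" and A :: "nat => 'x set" and sA :: "nat => 'x => 'v"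
  and G :: "nat => 'x => 'v => bool"
 assumes X: "cubical_set X" and V: "cubical_set V"
  and A_sub: "x:A n ==> x:cubes X n"
  and A_closed: "box_hom m n f ==> x:A n ==> act X m n x f:A m"
  and G_nat: "box_hom m n f ==> x:cubes X n ==> v:cubes V n ==> G n x v ==>
   G m (act X m n x f) (act V m n v f)"
  and sA_in: "x:A n ==> sA n x:cubes V n" and sA_G: "x:A n ==> G n x (sA n x)"
  and sA_nat: "box_hom m n f ==> x:A n ==> sA m (act X m n x f) = act V m n (sA n x) f"
  and ext: "x:cubes X n ==> x ~: A n ==>
   (!!n' i e. n = Suc n' ==> 1 <= i ==> i <= n ==> u i e:cubes V n' & G n' (fc X n' x i e) (u i e)) ==>
   (!!n' i j e d. n = Suc (Suc n') ==> 1 <= i ==> i < j ==> j <= n ==>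
    fc V n' (u j d) i e = fc V n' (u i e) (j - 1) d) ==>
   EX w:cubes V n. G n x w & (ALL n' i e. n = Suc n' --> 1 <= i --> i <= n --> fc V n' w i e = u i e)"
begin

abbreviation "sec == chosen_section X V A sA G"
abbreviation "ez == ez_form X"

lemmas sec_simps = chosen_section.simps[of X V A sA G]
lemmas ez_def = ez_form_def[of X]

lemma ez_eq:
 assumes "nondeg X k y" "box_epi n k s"
 shows "ez n (act X n k y s) = (k, y, s)"
 unfolding ez_def
proof (rule some_equality)
 show "case (k, y, s) of (k', y', s') => nondeg X k' y' & box_epi n k' s' & act X n k y s = act X n k' y' s'"
  using assms by simp
 fix p assume "case p of (k', y', s') => nondeg X k' y' & box_epi n k' s' & act X n k y s = act X n k' y' s'"
 thus "p = (k, y, s)"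
  using EZ_unique[OF X assms(1) _ assms(2)] by (cases p) (simp, metis)
qed

lemma sec_A: "x:A n ==> sec n x = sA n x"
 by (simp add: sec_simps)

text \<open>An epimorphism has a section, so \<open>A\<close>, being closed under operators,
  contains the core of each of its cubes.\<close>

lemma epi_A:
 assumes "x:cubes X n" "box_epi m n f" "act X m n x f:A m"
 shows "x:A n"
proof -
 obtain d where d: "box_hom n m d" "vcomp n f d = box_id n"
  by (rule box_epi_section_ex[OF assms(2)])
 have "act X n m (act X m n x f) d = x"
  using act_comp[OF X d(1) epi_hom[OF assms(2)] assms(1)] act_id[OF X assms(1)] d(2) by simp
 thus ?thesis using A_closed[OF d(1) assms(3)] by simp
qed

lemma sec_degenerate:
 assumes "nondeg X k y" "box_epi n k s" "k < n"
 shows "sec n (act X n k y s) = act V n k (sec k y) s"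
proof (cases "act X n k y s:A n")
 case True
 have "y:A k" by (rule epi_A[OF nondeg_cube[OF assms(1)] assms(2) True])
 thus ?thesis using True sA_nat[OF epi_hom[OF assms(2)]] by (simp add: sec_A)
next
 case False
 have "~ nondeg X n (act X n k y s)"
  using assms nondeg_cube[OF assms(1)] epi_hom[OF assms(2)] unfolding nondeg_def by blast
 thus ?thesis using False assms(3) ez_eq[OF assms(1,2)] sec_simps[of n "act X n k y s"] by simp
qed

text \<open>Over a non-degenerate cube, an operator that is not epimorphic passes through a face,
  where the selected value restricts correctly by choice; an epimorphic one is covered by the rule
  for degenerate cubes. Over a degenerate cube naturality is inherited from the core.\<close>

lemma sec_nat:
 "x:cubes X n ==> sec n x:cubes V n & G n x (sec n x) &
  (ALL m p. box_hom m n p --> sec m (act X m n x p) = act V m n (sec n x) p)"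
proof (induction n arbitrary: x rule: less_induct)
 case (less n)
 let ?s = "sec n x"
 let ?n = "n - 1"
 show ?case
 proof (cases "x:A n")
  case True
  thus ?thesis using sA_in sA_G sA_nat A_closed by (simp add: sec_A)
 next
  case False
  show ?thesis
  proof (cases "nondeg X n x")
   case nd: True
   let ?P = "%w. w:cubes V n & G n x w &
     (ALL n' i e. n = Suc n' --> 1 <= i --> i <= n --> fc V n' w i e = sec n' (fc X n' x i e))"
   have "EX w:cubes V n. G n x w &
     (ALL n' i e. n = Suc n' --> 1 <= i --> i <= n --> fc V n' w i e = sec ?n (fc X ?n x i e))"
   proof (rule ext[OF less.prems False])
    fix n' i e assume n: "n = Suc n'" "1 <= i" "i <= n"
    hence "fc X n' x i e:cubes X n'" using fc_in[OF X] less.prems by simp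
    thus "sec ?n (fc X ?n x i e):cubes V n' & G n' (fc X n' x i e) (sec ?n (fc X ?n x i e))"
     using less.IH[of n'] n by simp
   next
    fix n' i j e d assume n: "n = Suc (Suc n')" "1 <= i" "i < j" "j <= n"
    let ?S = "Suc n'"
    have x: "x:cubes X (Suc ?S)" using less.prems n by simp
    have j: "1 <= j - 1" "j - 1 <= ?S" using n by linarith+
    have f: "fc X ?S x j d:cubes X ?S" "fc X ?S x i e:cubes X ?S"
     using fc_in[OF X x] n by auto
    have h: "box_hom n' ?S (box_face ?S i e)" "box_hom n' ?S (box_face ?S (j - 1) d)"
     using n j by (auto intro: face_hom)
    have "fc V n' (sec ?S (fc X ?S x j d)) i e = sec n' (fc X n' (fc X ?S x j d) i e)"
     using less.IH[of ?S] f(1) h(1) n by simp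
    also have "\<dots> = sec n' (fc X n' (fc X ?S x i e) (j - 1) d)"
     using fc_fc[OF X x] n by simp
    also have "\<dots> = fc V n' (sec ?S (fc X ?S x i e)) (j - 1) d"
     using less.IH[of ?S] f(2) h(2) n by simp
    finally show "fc V n' (sec ?n (fc X ?n x j d)) i e =
      fc V n' (sec ?n (fc X ?n x i e)) (j - 1) d" using n by simp
   qed
   hence "EX w. ?P w" by auto
   have s: "?s = (SOME w. ?P w)" by (subst sec_simps) (simp only: False nd if_False if_True)
   have w: "?P ?s" unfolding s by (rule someI_ex) fact
   have "sec m (act X m n x p) = act V m n ?s p" if p: "box_hom m n p" for m p
   proof (cases "box_epi m n p")
    case True
    show ?thesis
    proof (cases "n = m")
     case eq: True
     hence "p = box_id n" using box_epi_le(2)[OF True] by simp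
     thus ?thesis using eq act_id[OF X less.prems] act_id[OF V] w by simp
    next
     case False
     hence "n < m" using box_epi_le(1)[OF True] by simp
     thus ?thesis by (rule sec_degenerate[OF nd True])
    qed
   next
    case False
    obtain j e n' g where f: "n = Suc n'" "j:{1..n}" "box_hom m n' g"
     "p = vcomp m (box_face n j e) g" by (rule not_epi_factor[OF p False])
    have h: "box_hom n' (Suc n') (box_face (Suc n') j e)" using f by (intro face_hom) auto
    have x: "x:cubes X (Suc n')" using less.prems f by simp
    have "sec m (act X m n x p) = sec m (act X m n' (fc X n' x j e) g)"
     using act_comp[OF X f(3) h x] f(1,4) by simp
    also have "\<dots> = act V m n' (sec n' (fc X n' x j e)) g"
     using less.IH[of n'] f(1,3) act_in[OF X h x] by simp
    also have "\<dots> = act V m n' (fc V n' ?s j e) g"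
     using w f(1,2) by simp
    also have "\<dots> = act V m n ?s p"
     using act_comp[OF V f(3) h] w f(1,4) by simp
    finally show ?thesis .
   qed
   thus ?thesis using w by simp
  next
   case nd: False
   obtain k y r where y: "nondeg X k y" "box_epi n k r" "x = act X n k y r"
    by (rule EZ_ex[OF X less.prems])
   have "k ~= n"
   proof
    assume "k = n"
    hence "r = box_id n" using box_epi_le(2)[OF y(2)] by simp
    thus False using y nd \<open>k = n\<close> act_id[OF X nondeg_cube[OF y(1)]] by simp
   qed
   hence k: "k < n" using box_epi_le(1)[OF y(2)] by simp
   note c = nondeg_cube[OF y(1)] and h = epi_hom[OF y(2)]
   note IH = less.IH[OF k c]
   have s: "?s = act V n k (sec k y) r" using sec_degenerate[OF y(1,2) k] y(3) by simp
   have "sec m (act X m n x p) = act V m n ?s p" if p: "box_hom m n p" for m p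
   proof -
    have "sec m (act X m n x p) = sec m (act X m k y (vcomp m r p))"
     using act_comp[OF X p h c] y(3) by simp
    also have "\<dots> = act V m k (sec k y) (vcomp m r p)"
     using IH box_hom.comp[OF p h] by blast
    also have "\<dots> = act V m n ?s p"
     using act_comp[OF V p h] IH s by simp
    finally show ?thesis .
   qed
   moreover have "?s:cubes V n" using act_in[OF V h] IH s by simp
   moreover have "G n x ?s" using G_nat[OF h c] IH s y(3) by simp
   ultimately show ?thesis by blast
  qed
 qed
qed

lemma section_exists:
 "EX s. (ALL n x. x:cubes X n --> s n x:cubes V n & G n x (s n x)) &
  (ALL m n f x. box_hom m n f --> x:cubes X n --> s m (act X m n x f) = act V m n (s n x) f) &
  (ALL n x. x:A n --> s n x = sA n x)"
 using sec_nat sec_A by (intro exI[of _ sec]) blast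

end

section \<open>Natural box filling\<close>

text \<open>For a non-degenerate \<open>y\<close> of dimension \<open>n\<close>, the data
  \<open>b\<close> give faces in the first \<open>Suc m\<close> directions and the values over the
  faces of \<open>y\<close> give all later ones. One ordinary open box of dimension
  \<open>Suc m + n\<close> is left to fill. Its missing face lies among the first directions, so no
  condition of naturality in \<open>y\<close> is lost.\<close>

lemma natural_filling:
 fixes E :: "'e cset" and Y :: "'y cset"
 assumes E: "kanE E" and Y: "cubical_set Y" and i0: "i0:{1..Suc m}"
  and b_in: "!!i c n y. 1 <= i ==> i <= Suc m ==> (i, c) ~= (i0, c0) ==> y:cubes Y n ==> b i c n y:cubes E (m + n)"
  and b_nat: "!!i c a n y f. 1 <= i ==> i <= Suc m ==> (i, c) ~= (i0, c0) ==> box_hom a n f ==> y:cubes Y n ==>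
   b i c a (act Y a n y f) = tn E m a n (b i c n y) f"
  and b_comp: "!!m' i j c d n y. m = Suc m' ==> 1 <= i ==> i < j ==> j <= Suc m ==>
   (i, c) ~= (i0, c0) ==> (j, d) ~= (i0, c0) ==> y:cubes Y n ==>
   fc E (m' + n) (b j d n y) i c = fc E (m' + n) (b i c n y) (j - 1) d"
  and A_sub: "!!n y. y:A n ==> y:cubes Y n"
  and A_closed: "!!a n f y. box_hom a n f ==> y:A n ==> act Y a n y f:A a"
  and LA_in: "!!n y. y:A n ==> LA n y:cubes E (Suc m + n)"
  and LA_nat: "!!a n f y. box_hom a n f ==> y:A n ==> LA a (act Y a n y f) = tn E (Suc m) a n (LA n y) f"
  and LA_fc: "!!i c n y. 1 <= i ==> i <= Suc m ==> (i, c) ~= (i0, c0) ==> y:A n ==> fc E (m + n) (LA n y) i c = b i c n y"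
 shows "EX L. (ALL n y. y:cubes Y n --> L n y:cubes E (Suc m + n)) &
  (ALL a n f y. box_hom a n f --> y:cubes Y n --> L a (act Y a n y f) = tn E (Suc m) a n (L n y) f) &
  (ALL i c n y. 1 <= i --> i <= Suc m --> (i, c) ~= (i0, c0) --> y:cubes Y n --> fc E (m + n) (L n y) i c = b i c n y) &
  (ALL n y. y:A n --> L n y = LA n y)"
proof -
 let ?V = "pth (Suc m) E"
 define G where "G n y v \<longleftrightarrow> (ALL i c. 1 <= i --> i <= Suc m --> (i, c) ~= (i0, c0) --> fc E (m + n) v i c = b i c n y)" for n y v
 have Ec: "cubical_set E" using E by (rule kanE_cset)
 interpret natural_section Y ?V A LA G
 proof
  fix m' n f x v assume f: "box_hom m' n f" and x: "x:cubes Y n" and v: "v:cubes ?V n" and g: "G n x v"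
  have v': "v:cubes E (Suc m + n)" using v by simp
  show "G m' (act Y m' n x f) (act ?V m' n v f)"
   unfolding G_def
  proof (intro allI impI)
   fix i c assume i: "1 <= i" "i <= Suc m" "(i, c) ~= (i0, c0)"
   thus "fc E (m + m') (act ?V m' n v f) i c = b i c m' (act Y m' n x f)"
    using fc_tn[OF Ec v' f i(1,2)] b_nat[OF i f x] g by (simp add: G_def)
  qed
 next
  fix x n and v :: "nat => bool => 'e"
  let ?m = "m + n"
  assume x: "x:cubes Y n"
   and v: "!!n' i c. n = Suc n' ==> 1 <= i ==> i <= n ==> v i c:cubes ?V n' & G n' (fc Y n' x i c) (v i c)"
   and vc: "!!n' i j c d. n = Suc (Suc n') ==> 1 <= i ==> i < j ==> j <= n ==>
    fc ?V n' (v j d) i c = fc ?V n' (v i c) (j - 1) d"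
  define u where "u i c = (if i <= Suc m then b i c n x else v (i - Suc m) c)" for i c
  have i0': "i0:{1..Suc ?m}" using i0 by auto
  obtain e where e: "e:cubes E (Suc ?m)"
   "!!j d. j:{1..Suc ?m} ==> (j, d) ~= (i0, c0) ==> fc E ?m e j d = u j d"
  proof (rule kanE_fill[OF E i0', of c0 u])
   fix j d assume j: "j:{1..Suc ?m}" "(j, d) ~= (i0, c0)"
   show "u j d:cubes E ?m"
   proof (cases "j <= Suc m")
    case True
    thus ?thesis using b_in[of j d x n] j x by (simp add: u_def)
   next
    case False
    then obtain n' where n: "n = Suc n'" using j by (cases n) auto
    have "1 <= j - Suc m" "j - Suc m <= n" using j False by auto
    thus ?thesis using v[OF n] False n by (simp add: u_def)
   qed
  next
   fix n' j k d q assume n': "?m = Suc n'" and jk: "1 <= j" "j < k" "k <= Suc ?m"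
    and ne: "(j, d) ~= (i0, c0)" "(k, q) ~= (i0, c0)"
   let ?f = "fc E n' (u j d) (k - 1) q"
   let ?E = "fc E n' (u k q) j d"
   \<comment> \<open>Two box directions agree by \<open>b_comp\<close>, a mixed pair by naturality
     of \<open>b\<close>, two directions of \<open>y\<close> by compatibility of the values over its
     faces.\<close>
   consider "k <= Suc m" | "j <= Suc m" "Suc m < k" | "Suc m < j" by linarith
   thus "?E = ?f"
   proof cases
    case 1
    then obtain m' where m: "m = Suc m'" using jk by (cases m) auto
    hence "n' = m' + n" using n' by simp
    thus ?thesis using b_comp[OF m jk(1,2) 1 ne x] 1 jk by (simp add: u_def)
   next
    case 2
    define k' where "k' = k - Suc m"
    have k': "1 <= k'" "k' <= n" "k = Suc m + k'" using 2 jk by (auto simp: k'_def)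
    then obtain n2 where n: "n = Suc n2" by (cases n) auto
    let ?S = "Suc n2"
    have n2: "n' = m + n2" using n n' by simp
    have x': "x:cubes Y ?S" using x n by simp
    have h: "box_hom n2 ?S (box_face ?S k' q)" using k' n by (intro face_hom) auto
    have "?E = fc E (m + n2) (v k' q) j d" using k' n2 by (simp add: u_def)
    also have "\<dots> = b j d n2 (fc Y n2 x k' q)"
     using v[OF n k'(1,2), of q] jk(1) 2(1) ne(1) by (simp add: G_def)
    also have "\<dots> = tn E m n2 ?S (b j d ?S x) (box_face ?S k' q)"
     by (rule b_nat[OF jk(1) 2(1) ne(1) h x'])
    also have "\<dots> = fc E (m + n2) (b j d ?S x) (m + k') q"
     using k' n by (intro tn_face) auto
    also have "\<dots> = ?f" using 2 k' n n2 by (simp add: u_def)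
    finally show ?thesis .
   next
    case 3
    define j' where "j' = j - Suc m"
    define k' where "k' = k - Suc m"
    have jk': "1 <= j'" "j' < k'" "k' <= n" "k = Suc m + k'" "j = Suc m + j'"
     using 3 jk by (auto simp: j'_def k'_def)
    then obtain n2 where n: "n = Suc (Suc n2)" by (cases n; cases "n - 1") auto
    have n2: "n' = Suc m + n2" using n n' by simp
    obtain k2 where k2: "k' = Suc k2" using jk' by (cases k') auto
    have "?E = fc E (Suc m + n2) (v k' q) (Suc m + j') d" using jk' n2 by (simp add: u_def)
    also have "\<dots> = fc ?V n2 (v k' q) j' d"
     using jk' n tn_face[of j' n2 E "Suc m"] by simp
    also have "\<dots> = fc ?V n2 (v j' d) (k' - 1) q" by (rule vc[OF n jk'(1-3)])
    also have "\<dots> = fc E (Suc m + n2) (v j' d) (Suc m + k2) q"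
     using jk' n k2 tn_face[of k2 n2 E "Suc m"] by simp
    also have "\<dots> = ?f" using jk' n2 k2 by (simp add: u_def)
    finally show ?thesis .
   qed
  qed (rule that)
  show "EX w:cubes ?V n. G n x w & (ALL n' i c. n = Suc n' --> 1 <= i --> i <= n --> fc ?V n' w i c = v i c)"
  proof (intro bexI[of _ e] conjI allI impI)
   show "G n x e" using e(2) by (auto simp: G_def u_def)
   fix n' i c assume n: "n = Suc n'" "1 <= i" "i <= n"
   have ne: "(Suc m + i, c) ~= (i0, c0)" using i0 n by auto
   have "fc ?V n' e i c = fc E (Suc m + n') e (Suc m + i) c"
    using tn_face[of i n' E "Suc m"] n by simp
   also have "\<dots> = v i c" using e(2)[of "Suc m + i" c] ne n by (simp add: u_def)
   finally show "fc ?V n' e i c = v i c" .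
  next
   show "e:cubes ?V n" using e(1) by simp
  qed
 next
  show "cubical_set ?V" by (rule cubical_set_pth[OF Ec])
 qed (use Y A_sub A_closed LA_in LA_nat LA_fc in \<open>simp_all add: G_def\<close>)
 from section_exists obtain s where
  s: "(ALL n x. x:cubes Y n --> s n x:cubes ?V n & G n x (s n x)) &
   (ALL m n f x. box_hom m n f --> x:cubes Y n --> s m (act Y m n x f) = act ?V m n (s n x) f) &
   (ALL n x. x:A n --> s n x = LA n x)" ..
 have "fc E (m + n) (s n y) i c = b i c n y"
  if "1 <= i" "i <= Suc m" "(i, c) ~= (i0, c0)" "y:cubes Y n" for i c n y
  using s that by (simp add: G_def)
 with s show ?thesis by (intro exI[of _ s]) simp
qed

section \<open>Points of the realization\<close>

lemma top_pre_real: "topspace (pre_real X) = {((n, x), t). x:cubes X n & t:cell n}"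
 by (auto simp: pre_real_def)

lemma equiv_real_rel: "equiv (topspace (pre_real X)) (real_rel X)"
 unfolding real_rel_def by (rule equiv_generated_equiv)

definition pt :: "'a cset => nat => 'a => (nat => real) => 'a real_pt" where
 "pt X n x t = real_rel X `` {((n, x), t)}"

lemma topspace_realization: "topspace (realization X) = {pt X n x t | n x t. x:cubes X n & t:cell n}"
proof -
 let ?a = "(%a. real_rel X `` {a}) ` topspace (pre_real X)"
 have "topspace (realization X) = ?a"
  unfolding realization_def by (rule quotient_imp_surjective_map[OF quotient_map_coinduced, symmetric])
 also have "\<dots> = {pt X n x t | n x t. x:cubes X n & t:cell n}"
 proof (rule equalityI; rule subsetI)
  fix p assume "p:?a"
  then obtain a where a: "a:topspace (pre_real X)" "p = real_rel X `` {a}" by blast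
  obtain z t where z: "a = (z, t)" by (cases a)
  obtain n x where "z = (n, x)" by (cases z)
  with a z have "x:cubes X n" "t:cell n" "p = pt X n x t"
   by (simp_all add: top_pre_real pt_def)
  thus "p:{pt X n x t | n x t. x:cubes X n & t:cell n}" by blast
 next
  fix p assume "p:{pt X n x t | n x t. x:cubes X n & t:cell n}"
  then obtain n x t where "x:cubes X n" "t:cell n" "p = pt X n x t" by blast
  thus "p:?a"
   unfolding pt_def top_pre_real by (intro image_eqI[of _ _ "((n, x), t)"]) simp_all
 qed
 finally show ?thesis .
qed

lemma pt_in: "x:cubes X n ==> t:cell n ==> pt X n x t:topspace (realization X)"
 by (auto simp: topspace_realization)

lemma pt_act:
 assumes X: "cubical_set X" and "box_hom m n f" "x:cubes X n" "t:cell m"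
 shows "pt X m (act X m n x f) t = pt X n x (box_top m n f t)"
 unfolding pt_def
proof (rule equiv_class_eq[OF equiv_real_rel])
 have "((m, act X m n x f), t):topspace (pre_real X)" "((n, x), box_top m n f t):topspace (pre_real X)"
  using assms by (auto simp: top_pre_real act_in box_top_cell)
 thus "(((m, act X m n x f), t), (n, x), box_top m n f t):real_rel X"
  unfolding real_rel_def generated_equiv_def using assms by (auto intro!: r_into_equivclp)
qed

lemma real_rel_invariant:
 assumes "(a, b):real_rel X"
  and inv: "!!m n p x t. box_hom m n p ==> x:cubes X n ==> t:cell m ==>
   f ((m, act X m n x p), t) = f ((n, x), box_top m n p t)"
 shows "f a = f b"
proof -
 have "f a = f b" if "equivclp r a b" "!!a b. r a b ==> f a = f b" for r
  using that(1) by (induction rule: equivclp_induct) (use that(2) in auto)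
 thus ?thesis
  using assms(1) inv unfolding real_rel_def generated_equiv_def by blast
qed

lemma pt_invariant:
 assumes "pt X n x s = pt X m y t" "x:cubes X n" "s:cell n" "y:cubes X m" "t:cell m"
  and inv: "!!m n p x t. box_hom m n p ==> x:cubes X n ==> t:cell m ==>
   f ((m, act X m n x p), t) = f ((n, x), box_top m n p t)"
 shows "f ((n, x), s) = f ((m, y), t)"
proof -
 have "(((n, x), s), ((m, y), t)):real_rel X"
  by (rule eq_equiv_class[OF assms(1)[unfolded pt_def] equiv_real_rel]) (use assms in \<open>simp add: top_pre_real\<close>)
 thus ?thesis by (rule real_rel_invariant) (rule inv)
qed

text \<open>Induced maps of quotients are defined by saturating an image; this is how they are
  computed on a representative.\<close>

lemma saturation_eq:
 assumes "equiv A r" "a:A" "S <= r `` {a}" "S ~= {}"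
 shows "r `` S = r `` {a}"
proof -
 have "r `` {s} = r `` {a}" if "s:S" for s
  using equiv_class_eq[OF assms(1)] assms(3) that by blast
 moreover have "r `` S = (\<Union>s\<in>S. r `` {s})" by blast
 ultimately show ?thesis using assms(4) by auto
qed

lemma openin_realization:
 assumes "U <= topspace (realization X)"
 shows "openin (realization X) U \<longleftrightarrow>
  (ALL n. ALL x:cubes X n. openin (ct n) {t:cell n. pt X n x t:U})"
proof -
 have im: "U <= (%a. real_rel X `` {a}) ` topspace (pre_real X)"
  using assms unfolding topspace_realization by (force simp: top_pre_real pt_def)
 have sub: "{a:topspace (pre_real X). real_rel X `` {a}:U} <=
   Sigma (SIGMA n:UNIV. cubes X n) (topspace \<circ> (%(n, x). ct n))"
  by (auto simp: top_pre_real)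
 have "openin (realization X) U \<longleftrightarrow> openin (pre_real X) {a:topspace (pre_real X). real_rel X `` {a}:U}"
  using im by (simp add: realization_def openin_coinduced_topology)
 also have "\<dots> \<longleftrightarrow> (ALL i:SIGMA n:UNIV. cubes X n. openin (case i of (n, x) => ct n)
   {t. (i, t):{a:topspace (pre_real X). real_rel X `` {a}:U}})"
  by (simp add: pre_real_def openin_sum_topology)
 also have "\<dots> \<longleftrightarrow> (ALL n. ALL x:cubes X n. openin (ct n) {t:cell n. pt X n x t:U})"
 proof -
  have "{t. ((n, x), t):{a:topspace (pre_real X). real_rel X `` {a}:U}} = {t:cell n. pt X n x t:U}"
   if "x:cubes X n" for n x
   using that by (auto simp: top_pre_real pt_def)
  thus ?thesis by auto
 qed
 finally show ?thesis .
qed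

lemma cts_pt:
 assumes "x:cubes X n"
 shows "continuous_map (ct n) (realization X) (pt X n x)"
 unfolding continuous_map_def
proof (intro conjI allI impI)
 show "pt X n x:topspace (ct n) \<rightarrow> topspace (realization X)"
  using pt_in[OF assms] by auto
 fix U assume U: "openin (realization X) U"
 thus "openin (ct n) {t:topspace (ct n). pt X n x t:U}"
  using openin_realization[OF openin_subset[OF U]] assms by simp
qed

lemma cts_from_realization:
 assumes "!!n x. x:cubes X n ==> continuous_map (ct n) T (%t. f (pt X n x t))"
 shows "continuous_map (realization X) T f"
 unfolding continuous_map_def
proof (intro conjI allI impI)
 let ?r = "realization X"
 show "f:topspace ?r \<rightarrow> topspace T"
  using continuous_map_image_subset_topspace[OF assms] by (fastforce simp: topspace_realization)
 fix U assume U: "openin T U"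
 have "openin (ct n) {t:cell n. pt X n x t:{p:topspace ?r. f p:U}}"
  if "x:cubes X n" for n x
 proof -
  have "{t:cell n. pt X n x t:{p:topspace ?r. f p:U}} =
    {t:topspace (ct n). f (pt X n x t):U}"
   using pt_in[OF that] by auto
  thus ?thesis using openin_continuous_map_preimage[OF assms[OF that] U] by simp
 qed
 thus "openin ?r {p:topspace ?r. f p:U}"
  by (subst openin_realization) auto
qed

text \<open>The characteristic map of \<open>x\<close>, regarded as a cube of the singular complex;
  over all cubes it is the unit of the adjunction between realization and singular complex.\<close>

definition ch :: "'a cset => nat => 'a => (nat => real) => 'a real_pt" where
 "ch X n x = (\<lambda>t\<in>cell n. pt X n x t)"

abbreviation SR :: "'a cset => ((nat => real) => 'a real_pt) cset" where
 "SR X == Sing (realization X)"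

lemma ch_in: "x:cubes X n ==> ch X n x:cubes (SR X) n"
 unfolding ch_def by (rule SingI[OF cts_pt])

lemma ch_apply: "t:cell n ==> ch X n x t = pt X n x t"
 by (simp add: ch_def)

lemma ch_act:
 assumes "cubical_set X" "box_hom m n f" "x:cubes X n"
 shows "ch X m (act X m n x f) = act (SR X) m n (ch X n x) f"
 by (rule Sing_eqI[OF ch_in act_in[OF Sing_cset]])
  (use assms in \<open>simp_all add: act_in ch_in ch_apply Sing_act_apply box_top_cell pt_act\<close>)

section \<open>Normal forms of points\<close>

definition icell :: "nat => (nat => real) set" where
 "icell n = {t:cell n. ALL j:{1..n}. 0 < t j & t j < 1}"

lemma icell_cell: "t:icell n ==> t:cell n"
 by (simp add: icell_def)

text \<open>At the level of the least coordinate of \<open>t\<close> every input passes the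
  threshold, at level \<open>1\<close> none does; so the output is positive and less than
  \<open>1\<close>.\<close>

lemma box_top_coord_interior:
 assumes h: "box_hom m n f" and j: "j:{1..n}" and v: "f (vtop m) j" "~ f (vbot m) j" and t: "t:icell m"
 shows "0 < box_top m n f t j & box_top m n f t j < 1"
proof
 have tc: "t:cell m" using t by (rule icell_cell)
 define c where "c = Min (insert 1 (t ` {1..m}))"
 have c: "0 < c" "c <= 1" using t by (auto simp: c_def icell_def)
 have "c <= t i" if "i:{1..m}" for i unfolding c_def using that by (intro Min_le) auto
 hence "threshold m c t = vtop m"
  by (intro vert_eqI[of _ m]) (auto simp: threshold_def vtop_def)
 hence "threshold n c (box_top m n f t) j" using box_top_thr[OF h tc, of c] v c by simp
 thus "0 < box_top m n f t j" using j c by (simp add: threshold_def)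
 have "~ 1 <= t i" if "i:{1..m}" for i using t that by (auto simp: icell_def not_le)
 hence "threshold m 1 t = vbot m"
  by (intro vert_eqI[of _ m]) (auto simp: threshold_def vbot_def)
 hence "~ threshold n 1 (box_top m n f t) j" using box_top_thr[OF h tc, of 1] v by simp
 thus "box_top m n f t j < 1" using j by (simp add: threshold_def)
qed

lemma box_epi_icell: "box_epi m n s ==> t:icell m ==> box_top m n s t:icell n"
 using box_top_coord_interior[OF epi_hom] box_top_cell[OF epi_hom icell_cell]
 by (simp add: icell_def[of n] box_epi_def)

lemma box_top_coord_const:
 assumes h: "box_hom m n f" and j: "j:{1..n}" and c: "!!x. x:vert m ==> f x j = b" and t: "t:cell m"
 shows "box_top m n f t j = of_bool b"
proof -
 let ?b = "box_top m n f t j"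
 have *: "c <= ?b \<longleftrightarrow> b" if "c:{0<..1}" for c
  using fun_cong[OF box_top_thr[OF h t that], of j] j assms(3)[OF threshold_vert] by (simp add: threshold_def)
 have "0 <= ?b & ?b <= 1"
  by (rule cell_bounds[OF box_top_cell[OF h t] j])
 thus ?thesis
 proof (cases b)
  case True
  thus ?thesis using *[of 1] \<open>0 <= _ & _\<close> by simp
 next
  case False
  hence "~ 0 < ?b" using *[of ?b] \<open>0 <= _ & _\<close> by auto
  thus ?thesis using False \<open>0 <= _ & _\<close> by simp
 qed
qed

lemma box_top_boundary_const:
 assumes h: "box_hom m n f" and j: "j:{1..n}" and t: "t:icell m" and e: "box_top m n f t j = of_bool b"
  and x: "x:vert m"
 shows "f x j = b"
proof -
 have "~ (f (vtop m) j & ~ f (vbot m) j)"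
  using box_top_coord_interior[OF h j _ _ t] e by (cases b) auto
 hence c: "!!x. x:vert m ==> f x j = f (vtop m) j"
  using box_const_coord[OF h j] by blast
 from box_top_coord_const[OF h j this icell_cell[OF t]] e have "of_bool (f (vtop m) j) = (of_bool b :: real)" by simp
 hence "f (vtop m) j = b" by (simp only: of_bool_eq_iff)
 thus ?thesis using c[OF x] by simp
qed

lemma degen_face_cell: "i:{1..Suc n} ==> t:cell n ==> degen_fun (Suc n) i (face_fun (Suc n) i (of_bool e) t) = t"
 by (rule cell_eqI[OF degen_fun_cell]) (auto simp: face_fun_cell, auto simp: degen_fun_def face_fun_def)

lemma face_degen_cell:
 assumes "i:{1..Suc n}" "t:cell (Suc n)" "t i = of_bool e"
 shows "face_fun (Suc n) i (of_bool e) (degen_fun (Suc n) i t) = t"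
proof (rule cell_eqI[OF face_fun_cell[OF assms(1) degen_fun_cell[OF assms(1,2)]] assms(2)])
 fix l assume "l:{1..Suc n}"
 moreover then obtain l' where "l = Suc l'" by (cases l) auto
 ultimately show "face_fun (Suc n) i (of_bool e) (degen_fun (Suc n) i t) l = t l"
  using assms by (auto simp: face_fun_def degen_fun_def)
qed

text \<open>Composites of faces, kept inductive so that a retraction can be built together with each
  inclusion.\<close>

inductive facemap :: "nat => nat => box_map => bool" where
 facemap_id: "facemap n n (box_id n)"
| facemap_step: "facemap l n d ==> j:{1..Suc n} ==> facemap l (Suc n) (vcomp l (box_face (Suc n) j e) d)"

lemma facemap_hom: "facemap l n d ==> box_hom l n d"
proof (induction rule: facemap.induct)
 case (facemap_step l n d j e)
 show ?case by (rule box_hom.comp[OF facemap_step.IH face_hom[OF facemap_step.hyps(2) refl]])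
qed (rule box_hom.id)

text \<open>The retraction is a composite of degeneracies. The last clause says that a point whose
  coordinates in the fixed directions are right already lies on the face; it turns squeezing into
  projection in \<open>collapse\<close>.\<close>

lemma facemap_retraction:
 "facemap l n d ==> EX p. box_hom n l p & (ALL t:cell l. box_top n l p (box_top l n d t) = t) &
  (ALL s:cell n. (ALL j:{1..n}. ALL b. (ALL x:vert l. d x j = b) --> s j = of_bool b) -->
    box_top l n d (box_top n l p s) = s)"
proof (induction rule: facemap.induct)
 case (facemap_id n)
 thus ?case by (intro exI[of _ "box_id n"]) (simp add: box_hom.id box_top_id)
next
 case (facemap_step l n d j e)
 then obtain p where p: "box_hom n l p" "!!t. t:cell l ==> box_top n l p (box_top l n d t) = t"
  "!!s. s:cell n ==> (ALL j:{1..n}. ALL b. (ALL x:vert l. d x j = b) --> s j = of_bool b) ==>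
    box_top l n d (box_top n l p s) = s" by blast
 let ?S = "Suc n"
 have h: "box_hom l n d" "box_hom n ?S (box_face ?S j e)" "box_hom ?S n (box_degen ?S j)"
  using facemap_step.hyps by (auto intro: facemap_hom face_hom degen_hom)
 let ?p = "vcomp ?S p (box_degen ?S j)"
 let ?d = "vcomp l (box_face ?S j e) d"
 note j = facemap_step.hyps(2)
 have "box_top ?S l ?p (box_top l ?S ?d t) = t" if t: "t:cell l" for t
  using t p(2)[OF t] box_top_cell[OF h(1) t] j
  by (simp add: box_top_comp[OF h(1,2)] box_top_comp[OF h(3) p(1)] box_top_face box_top_degen
    face_fun_cell degen_face_cell)
 moreover have "box_top l ?S ?d (box_top ?S l ?p s) = s"
  if s: "s:cell ?S" and c: "ALL i:{1..Suc n}. ALL b. (ALL x:vert l. ?d x i = b) --> s i = of_bool b" for s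
 proof -
  let ?s = "degen_fun ?S j s"
  have s': "?s:cell n" by (rule degen_fun_cell[OF j s])
  have fa: "?d x i = (if i < j then d x i else if i = j then e else d x (i - 1))"
   if "x:vert l" "i:{1..Suc n}" for x i
   using that hom_vert[OF h(1) that(1)] by (simp add: box_face_Suc)
  have sj: "s j = of_bool e" using c j fa by simp
  have "?s i = of_bool b" if i: "i:{1..n}" and b: "ALL x:vert l. d x i = b" for i b
  proof (cases "i < j")
   case True
   hence "s i = of_bool b" using c i b fa[of _ i] by simp
   thus ?thesis using True i by (simp add: degen_fun_def)
  next
   case False
   hence "ALL x:vert l. ?d x (Suc i) = b" using i b fa[of _ "Suc i"] by simp
   hence "s (Suc i) = of_bool b" using c i by simp
   thus ?thesis using False i by (simp add: degen_fun_def)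
  qed
  hence "box_top l n d (box_top n l p ?s) = ?s" using p(3)[OF s'] by blast
  thus ?thesis
   using s s' j sj box_top_cell[OF p(1) s']
   by (simp add: box_top_comp[OF h(1,2)] box_top_comp[OF h(3) p(1)] box_top_face box_top_degen face_degen_cell)
 qed
 ultimately show ?case using box_hom.comp[OF h(3) p(1)] by blast
qed

lemma facemap_interior:
 "s:cell n ==> EX l d t. facemap l n d & t:icell l & s = box_top l n d t"
proof (induction n arbitrary: s)
 case 0
 thus ?case using facemap_id[of 0] box_top_id[of s 0] by (intro exI[of _ 0]) (force simp: icell_def)
next
 case (Suc n)
 show ?case
 proof (cases "s:icell (Suc n)")
  case True
  thus ?thesis using facemap_id[of "Suc n"] box_top_id[OF Suc.prems] by metis
 next
  case False
  then obtain j where j: "j:{1..Suc n}" "s j = 0 | s j = 1"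
   using Suc.prems cell_bounds[OF Suc.prems] unfolding icell_def by force
  define c where "c = (s j = 1)"
  have e: "s j = of_bool c" using j by (auto simp: c_def)
  obtain l d t where t: "facemap l n d" "t:icell l" "degen_fun (Suc n) j s = box_top l n d t"
   using Suc.IH[OF degen_fun_cell[OF j(1) Suc.prems]] by blast
  have "s = box_top l (Suc n) (vcomp l (box_face (Suc n) j c) d) t"
   using face_degen_cell[OF j(1) Suc.prems e] t(3) box_top_face[OF j(1)] box_top_cell[OF facemap_hom[OF t(1)] icell_cell[OF t(2)]]
   by (simp add: box_top_comp[OF facemap_hom[OF t(1)] face_hom[OF j(1) refl] icell_cell[OF t(2)]])
  thus ?thesis using facemap_step[OF t(1) j(1)] t(2) by blast
 qed
qed

definition nform :: "'a cset => nat => 'a => (nat => real) => nat => 'a => (nat => real) => bool" where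
 "nform X n x s k y t = (nondeg X k y & (EX l d t' c. box_hom l n d & t':icell l & s = box_top l n d t' &
   box_epi l k c & act X l n x d = act X l k y c & t = box_top l k c t'))"

lemma nformI: "nondeg X k y ==> box_hom l n d ==> t':icell l ==> box_epi l k s ==>
  act X l n x d = act X l k y s ==> nform X n x (box_top l n d t') k y (box_top l k s t')"
 unfolding nform_def by blast

lemma nform_ex:
 assumes X: "cubical_set X" "x:cubes X n" "s:cell n"
 obtains l d t' k c y where "facemap l n d" "t':icell l" "s = box_top l n d t'" "box_epi l k c"
  "nondeg X k y" "act X l n x d = act X l k y c"
proof -
 obtain l d t where t: "facemap l n d" "t:icell l" "s = box_top l n d t"
  using facemap_interior[OF X(3)] by blast
 obtain k y c where y: "nondeg X k y" "box_epi l k c" "act X l n x d = act X l k y c"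
  by (rule EZ_ex[OF X(1) act_in[OF X(1) facemap_hom[OF t(1)] X(2)]])
 show ?thesis by (rule that[OF t y(2,1,3)])
qed

text \<open>As \<open>s\<close> is interior, no output of \<open>d\<close> is constant. Hence
  \<open>d\<close> is epimorphic, and uniqueness of the Eilenberg--Zilber form decides.\<close>

lemma nform_unique_interior:
 assumes X: "cubical_set X" "x:cubes X n" "s:icell n" and z: "nondeg X p z" "box_epi n p u" "x = act X n p z u"
  and n: "nform X n x s k y t"
 shows "k = p & y = z & t = box_top n p u s"
proof -
 obtain l d t' c where a: "nondeg X k y" "box_hom l n d" "t':icell l" "s = box_top l n d t'"
  "box_epi l k c" "act X l n x d = act X l k y c" "t = box_top l k c t'" using n unfolding nform_def by blast
 have d: "box_epi l n d"
 proof (rule ccontr)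
  assume "~ box_epi l n d"
  then obtain j where j: "j:{1..n}" "~ d (vtop l) j | d (vbot l) j"
   using a(2) by (auto simp: box_epi_def)
  have "s j = of_bool (d (vtop l) j)"
   unfolding a(4) by (rule box_top_coord_const[OF a(2) j(1) box_const_coord[OF a(2) j] icell_cell[OF a(3)]])
  moreover have "0 < s j" "s j < 1" using X(3) j(1) by (simp_all add: icell_def)
  ultimately show False by (cases "d (vtop l) j") simp_all
 qed
 have "act X l p z (vcomp l u d) = act X l k y c"
  using act_comp[OF X(1) a(2) epi_hom[OF z(2)] nondeg_cube[OF z(1)]] z(3) a(6) by simp
 from EZ_unique[OF X(1) z(1) a(1) box_epi_comp[OF d z(2)] a(5) this]
 show ?thesis
  using a(4,7) box_top_comp[OF a(2) epi_hom[OF z(2)] icell_cell[OF a(3)]] by auto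
qed

lemma nform_face:
 assumes X: "cubical_set X" "x:cubes X (Suc n)" and j: "j:{1..Suc n}" "s j = of_bool e"
  and n: "nform X (Suc n) x s k y t"
 shows "nform X n (fc X n x j e) (degen_fun (Suc n) j s) k y t"
proof -
 obtain l d t' r where a: "nondeg X k y" "box_hom l (Suc n) d" "t':icell l" "s = box_top l (Suc n) d t'"
  "box_epi l k r" "act X l (Suc n) x d = act X l k y r" "t = box_top l k r t'" using n unfolding nform_def by blast
 have c: "d x j = e" if "x:vert l" for x
  by (rule box_top_boundary_const[OF a(2) j(1) a(3) _ that]) (use j(2) a(4) in simp)
 let ?d = "vcomp l (box_degen (Suc n) j) d"
 have h: "box_hom l n ?d" by (rule box_hom.comp[OF a(2) degen_hom[OF j(1) refl]])
 have "act X l n (fc X n x j e) ?d = act X l k y r"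
  using const_coord_factor[OF a(2) h j(1) c refl X] a(6) by simp
 moreover have "degen_fun (Suc n) j s = box_top l n ?d t'"
  using box_top_comp[OF a(2) degen_hom[OF j(1) refl] icell_cell[OF a(3)]]
   box_top_degen[OF j(1) box_top_cell[OF a(2) icell_cell[OF a(3)]]] a(4) by simp
 ultimately show ?thesis using a h unfolding nform_def by blast
qed

text \<open>Induction on the dimension: a boundary point is moved to a face by
  \<open>nform_face\<close>, an interior one is settled by the Eilenberg--Zilber form.\<close>

lemma nform_unique:
 assumes X: "cubical_set X"
 shows "x:cubes X n ==> s:cell n ==> nform X n x s k y t ==> nform X n x s k' y' t' ==> k = k' & y = y' & t = t'"
proof (induction n arbitrary: x s)
 case (0 x s)
 obtain p z u where z: "nondeg X p z" "box_epi 0 p u" "x = act X 0 p z u" by (rule EZ_ex[OF X 0(1)])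
 have "s:icell 0" using 0 by (simp add: icell_def)
 from nform_unique_interior[OF X 0(1) this z 0(3)] nform_unique_interior[OF X 0(1) this z 0(4)] show ?case by simp
next
 case (Suc n)
 show ?case
 proof (cases "s:icell (Suc n)")
  case True
  obtain p z u where z: "nondeg X p z" "box_epi (Suc n) p u" "x = act X (Suc n) p z u" by (rule EZ_ex[OF X Suc.prems(1)])
  from nform_unique_interior[OF X Suc.prems(1) True z Suc.prems(3)] nform_unique_interior[OF X Suc.prems(1) True z Suc.prems(4)]
  show ?thesis by simp
 next
  case False
  then obtain j where j: "j:{1..Suc n}" "s j = 0 | s j = 1"
   using Suc.prems(2) cell_bounds[OF Suc.prems(2)] unfolding icell_def by force
  define c where "c = (s j = 1)"
  have e: "s j = of_bool c" using j by (auto simp: c_def)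
  have "fc X n x j c:cubes X n" using fc_in[OF X Suc.prems(1)] j by simp
  from Suc.IH[OF this degen_fun_cell[OF j(1) Suc.prems(2)] nform_face[OF X Suc.prems(1) j(1) e Suc.prems(3)]
    nform_face[OF X Suc.prems(1) j(1) e Suc.prems(4)]]
  show ?thesis .
 qed
qed

text \<open>Invariance under the generating identification of the realization. Pushing a normal form
  forward is direct; for the converse a normal form is taken before the operator and compared by
  uniqueness after it.\<close>

lemma nform_act:
 assumes X: "cubical_set X" and f: "box_hom m n f" and x: "x:cubes X n" and t: "t:cell m"
 shows "nform X m (act X m n x f) t k y u \<longleftrightarrow> nform X n x (box_top m n f t) k y u"
proof -
 let ?a = "act X m n x f"
 let ?b = "box_top m n f t"
 have push: "nform X n x ?b k y u" if n: "nform X m ?a t k y u" for k y u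
 proof -
  obtain l d t' s where a: "nondeg X k y" "box_hom l m d" "t':icell l" "t = box_top l m d t'"
   "box_epi l k s" "act X l m ?a d = act X l k y s" "u = box_top l k s t'"
   using n unfolding nform_def by blast
  have "?b = box_top l n (vcomp l f d) t'"
   using box_top_comp[OF a(2) f icell_cell[OF a(3)]] a(4) by simp
  moreover have "act X l n x (vcomp l f d) = act X l k y s"
   using act_comp[OF X a(2) f x] a(6) by simp
  ultimately show ?thesis
   using nformI[OF a(1) box_hom.comp[OF a(2) f] a(3,5)] a(7) by simp
 qed
 show ?thesis
 proof
  assume n: "nform X n x ?b k y u"
  obtain l d t' k' s y' where b: "facemap l m d" "t':icell l" "t = box_top l m d t'" "box_epi l k' s"
   "nondeg X k' y'" "act X l m ?a d = act X l k' y' s"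
   by (rule nform_ex[OF X act_in[OF X f x] t])
  have n': "nform X m ?a t k' y' (box_top l k' s t')"
   using nformI[OF b(5) facemap_hom[OF b(1)] b(2,4,6)] b(3) by simp
  from nform_unique[OF X x box_top_cell[OF f t] push[OF n'] n]
  show "nform X m ?a t k y u" using n' by metis
 qed (rule push)
qed

lemma nform_pt_eq:
 assumes X: "cubical_set X" and e: "pt X n x s = pt X m y t" "x:cubes X n" "s:cell n" "y:cubes X m" "t:cell m"
  and n: "nform X n x s k z u"
 shows "nform X m y t k z u"
proof -
 have "(case ((n, x), s) of ((n, x), s) => nform X n x s k z u) = (case ((m, y), t) of ((n, x), s) => nform X n x s k z u)"
  by (rule pt_invariant[OF e]) (simp add: nform_act[OF X])
 thus ?thesis using n by simp
qed

lemma nform_nondeg: "cubical_set X ==> nondeg X k y ==> t:icell k ==> nform X k y t k y t"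
 using nformI[of X k y k k "box_id k" t "box_id k" y]
 by (simp add: box_hom.id box_epi_id box_top_id icell_cell)

text \<open>An interior point of a non-degenerate cube is its own normal form, so the face and
  epimorphism that reduce \<open>(x, s)\<close> must lead to exactly \<open>(y, u)\<close>.\<close>

lemma nf_interior:
 assumes X: "cubical_set X" and y: "nondeg X k y" "u:icell k" and x: "x:cubes X n" "s:cell n"
  and e: "pt X n x s = pt X k y u"
 obtains l q t d where "facemap l n q" "t:icell l" "s = box_top l n q t" "box_epi l k d"
  "act X l n x q = act X l k y d" "u = box_top l k d t"
proof -
 obtain l q t' k' d y' where b: "facemap l n q" "t':icell l" "s = box_top l n q t'" "box_epi l k' d"
  "nondeg X k' y'" "act X l n x q = act X l k' y' d"
  by (rule nform_ex[OF X x])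
 let ?b = "box_top l k' d t'"
 have "nform X n x s k' y' ?b"
  using nformI[OF b(5) facemap_hom[OF b(1)] b(2,4,6)] b(3) by simp
 from nform_pt_eq[OF X e x nondeg_cube[OF y(1)] icell_cell[OF y(2)] this]
 have "nform X k y u k' y' ?b" .
 from nform_unique[OF X nondeg_cube[OF y(1)] icell_cell[OF y(2)] this nform_nondeg[OF X y]]
 have "k' = k" "y' = y" "?b = u" by auto
 with b that show ?thesis by blast
qed

lemma pt_interior_inj:
 assumes X: "cubical_set X" and y: "nondeg X k y" "u:icell k" and y': "nondeg X k' y'" "u':icell k'"
  and e: "pt X k y u = pt X k' y' u'"
 shows "k = k' & y = y' & u = u'"
 using nform_unique[OF X nondeg_cube[OF y'(1)] icell_cell[OF y'(2)]
   nform_pt_eq[OF X e nondeg_cube[OF y(1)] icell_cell[OF y(2)] nondeg_cube[OF y'(1)] icell_cell[OF y'(2)] nform_nondeg[OF X y]]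
   nform_nondeg[OF X y']] .

text \<open>One interior point reveals the core of a cube. Its epimorphism is then read off from
  points with coordinates \<open>3 / 4\<close> and \<open>1 / 4\<close>, whose threshold at
  \<open>1 / 2\<close> is an arbitrary vertex. Injectivity allows composition in \<open>X\<close> to
  be prescribed inside the singular complex.\<close>

lemma ch_inj:
 assumes X: "cubical_set X" "x:cubes X n" "x':cubes X n" and e: "ch X n x = ch X n x'"
 shows "x = x'"
proof -
 obtain k y s where y: "nondeg X k y" "box_epi n k s" "x = act X n k y s" by (rule EZ_ex[OF X(1,2)])
 obtain k' y' s' where y': "nondeg X k' y'" "box_epi n k' s'" "x' = act X n k' y' s'" by (rule EZ_ex[OF X(1,3)])
 have *: "k = k' & y = y' & box_top n k s t = box_top n k' s' t" if t: "t:icell n" for t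
 proof -
  have "pt X n x t = pt X n x' t" using fun_cong[OF e, of t] icell_cell[OF t] by (simp add: ch_apply)
  hence "pt X k y (box_top n k s t) = pt X k' y' (box_top n k' s' t)"
   using pt_act[OF X(1) epi_hom[OF y(2)] nondeg_cube[OF y(1)] icell_cell[OF t]]
    pt_act[OF X(1) epi_hom[OF y'(2)] nondeg_cube[OF y'(1)] icell_cell[OF t]] y(3) y'(3) by simp
  from pt_interior_inj[OF X(1) y(1) box_epi_icell[OF y(2) t] y'(1) box_epi_icell[OF y'(2) t] this] show ?thesis .
 qed
 have "(\<lambda>j\<in>{1..n}. 1 / 2 :: real):icell n" by (auto simp: icell_def intro: cellI)
 from *[OF this] have k: "k' = k" "y' = y" by auto
 have "s = s'"
 proof (rule PiE_ext[OF hom_PiE[OF epi_hom[OF y(2)]]])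
  show "s':vert n \<rightarrow>\<^sub>E vert k" using hom_PiE[OF epi_hom[OF y'(2)]] k by simp
  fix v assume v: "v:vert n"
  let ?t = "\<lambda>j\<in>{1..n}. if v j then 3 / 4 else 1 / 4 :: real"
  have t: "?t:icell n" by (auto simp: icell_def intro: cellI)
  have "threshold n (1 / 2) ?t = v" using v by (intro vert_eqI[of _ n]) (auto simp: threshold_def)
  thus "s v = s' v"
   using *[OF t] box_top_thr[OF epi_hom[OF y(2)] icell_cell[OF t], of "1 / 2"]
    box_top_thr[OF epi_hom[OF y'(2)] icell_cell[OF t], of "1 / 2"] k by simp
 qed
 thus ?thesis using y y' k by simp
qed

section \<open>Monotone reparametrizations of the realization\<close>

text \<open>A monotone self-map of $[0,1]$ fixing the end points commutes with all operators, so it acts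
 on the realization of every cubical set.\<close>

definition rmap :: "'a cset => (real => real) => 'a real_pt => 'a real_pt" where
 "rmap X w p = (case (SOME a. a:topspace (pre_real X) & real_rel X `` {a} = p) of
   ((n, x), t) => pt X n x (wmap n w t))"

text \<open>By \<open>pt_invariant\<close> the representative selected in \<open>rmap\<close> is
  immaterial, since \<open>wmap\<close> commutes with all operators.\<close>

lemma rmap_pt:
 assumes X: "cubical_set X" and w: "end_mono w" and x: "x:cubes X n" "t:cell n"
 shows "rmap X w (pt X n x t) = pt X n x (wmap n w t)"
proof -
 let ?P = "%a. a:topspace (pre_real X) & real_rel X `` {a} = pt X n x t"
 have "?P ((n, x), t)" using x by (simp add: top_pre_real pt_def)
 from someI[of ?P, OF this] have P: "?P (SOME a. ?P a)" .
 obtain z s where zs: "(SOME a. ?P a) = (z, s)" by (cases "SOME a. ?P a")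
 obtain m y where z: "z = (m, y)" by (cases z)
 note s = zs[unfolded z]
 have y: "y:cubes X m" "s:cell m" "pt X m y s = pt X n x t"
  using P unfolding s by (auto simp: top_pre_real pt_def)
 have "(case ((m, y), s) of ((n, x), t) => pt X n x (wmap n w t)) = (case ((n, x), t) of ((n, x), t) => pt X n x (wmap n w t))"
  by (rule pt_invariant[OF y(3,1,2) x]) (simp add: box_top_wmap[OF w, symmetric] pt_act[OF X] wmap_cell[OF w])
 thus ?thesis unfolding rmap_def s by simp
qed

lemma realization_cases:
 assumes "p:topspace (realization X)"
 obtains n x t where "x:cubes X n" "t:cell n" "p = pt X n x t"
proof -
 from assms have "EX n x t. p = pt X n x t & x:cubes X n & t:cell n"
  unfolding topspace_realization by (rule CollectD)
 thus ?thesis using that by (elim exE conjE) simp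
qed

lemma wmap_wmap: "wmap n w (wmap n w' t) = wmap n (%s. w (w' s)) t"
 by (auto simp: wmap_def)

lemma wmap_cong: "t:cell n ==> (!!s. 0 <= s ==> s <= 1 ==> w s = w' s) ==> wmap n w t = wmap n w' t"
 by (auto simp: wmap_def cell_iff)

lemma wmap_id: "t:cell n ==> wmap n (%s. s) t = t"
 by (rule cell_eqI) (auto simp: wmap_def cell_iff)

lemma cts_wmap:
 assumes "end_mono w" "continuous_on {0..1} w"
 shows "continuous_map (ct n) (ct n) (wmap n w)"
proof (rule cts_cellI)
 fix j assume j: "j:{1..n}"
 have "continuous_map (ct n) (top_of_set {0..1}) (%t. t j)"
  using continuous_map_product_projection[OF j, of "%_. top_of_set {0..1::real}"] .
 from continuous_map_compose[OF this, of euclideanreal w] assms(2)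
 show "cts (ct n) (%t. wmap n w t j)"
  by (simp add: wmap_def o_def)
qed (use assms wmap_cell in simp)

section \<open>Local lifts of maps to the realization\<close>

text \<open>Used only pointwise, being discontinuous for small positive \<open>e\<close>: it moves a
  point near a face onto that face and fixes the coordinates away from the end points.\<close>

definition sq :: "real => real => real" where
 "sq e s = (if s <= e then 0 else if 1 - e <= s then 1 else s)"

text \<open>A continuous map constant near both end points, on \<open>[0, 1/4]\<close> and on
  \<open>[3/4, 1]\<close>; so it absorbs every \<open>sq e\<close> with
  \<open>0 <= e <= 1/4\<close>.\<close>

definition pinch :: "real => real" where
 "pinch s = min 1 (max 0 (2 * s - 1 / 2))"

lemma end_mono_sq: "0 <= e ==> e < 1 / 2 ==> end_mono (sq e)"
 by (auto simp: end_mono_def sq_def mono_on_def)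

lemma end_mono_pinch: "end_mono pinch"
 by (auto simp: end_mono_def pinch_def mono_on_def)

lemma cts_pinch: "continuous_on S pinch"
 unfolding pinch_def by (intro continuous_intros)

lemma pinch_sq: "0 <= e ==> e <= 1 / 4 ==> pinch (sq e s) = pinch s"
 by (auto simp: pinch_def sq_def)

lemma sq_sq: "e <= e' ==> 0 <= e' ==> e' < 1 / 2 ==> sq e' (sq e s) = sq e' s"
 by (auto simp: sq_def)

lemma wmap_fix: "t:cell n ==> (!!j. j:{1..n} ==> w (t j) = t j) ==> wmap n w t = t"
 by (auto simp: wmap_def cell_iff)

lemma sq_fix: "e < s ==> s < 1 - e ==> sq e s = s"
 by (simp add: sq_def)

lemma icell_margin:
 assumes "t:icell n"
 obtains e where "0 < e" "e <= 1 / 4" "!!j. j:{1..n} ==> e <= t j & t j <= 1 - e"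
proof -
 define e where "e = Min (insert (1 / 4) ((%j. min (t j) (1 - t j)) ` {1..n}))"
 have "0 < e" using assms by (auto simp: e_def icell_def)
 moreover have "e <= 1 / 4" unfolding e_def by (rule Min_le) auto
 moreover have "e <= min (t j) (1 - t j)" if "j:{1..n}" for j
  unfolding e_def using that by (intro Min_le) auto
 ultimately show ?thesis by (intro that[of e]) (auto, fastforce+)
qed

lemma openin_coords:
 assumes "finite J" "!!j. j:J ==> cts Z (f j)" "!!j. j:J ==> open (S j)"
 shows "openin Z {v:topspace Z. ALL j:J. f j v:S j}"
 using assms
proof (induction J)
 case (insert a J)
 have "{v:topspace Z. ALL j:insert a J. f j v:S j} =
   {v:topspace Z. f a v:S a} \<inter> {v:topspace Z. ALL j:J. f j v:S j}" by auto
 moreover have "openin Z {v:topspace Z. f a v:S a}"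
  using insert.prems by (intro openin_continuous_map_preimage[of Z euclideanreal]) auto
 ultimately show ?case using insert by auto
qed simp

abbreviation SC :: "nat => cell_map cset" where
 "SC N == Sing (ct N)"

abbreviation "sc N == cubes (SC N)"

text \<open>The equivalence relation on pairs of a cube of \<open>X\<close> and a singular cube of the corresponding
 topological cube that defines the coend of these data; \<open>n\<close> is the dimension of the singular cubes.\<close>

inductive deq :: "'a cset => nat => nat \<times> 'a \<times> cell_map =>
  nat \<times> 'a \<times> cell_map => bool" for X n where
 deq_act: "box_hom m N h ==> x:cubes X N ==> g:sc m n ==>
  deq X n (m, act X m N x h, g) (N, x, compose (cell n) (box_top m N h) g)"
| deq_sym: "deq X n a b ==> deq X n b a"
| deq_trans: "deq X n a b ==> deq X n b c ==> deq X n a c"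

text \<open>Coordinates fixed by the face are squeezed to their end values, and the free ones lie
  where \<open>sq e\<close> is the identity; hence squeezing coincides with projecting to the
  face.\<close>

lemma collapse:
 assumes d: "facemap l n d" and p: "box_hom n l p"
  "!!s. s:cell n ==> (ALL j:{1..n}. ALL b. (ALL x:vert l. d x j = b) --> s j = of_bool b) ==>
    box_top l n d (box_top n l p s) = s"
  and e: "0 <= e" "e < 1 / 2" and s: "s:cell n"
  and c: "!!j b. j:{1..n} ==> (ALL x:vert l. d x j = b) ==> sq e (s j) = of_bool b"
  and i: "!!j. j:{1..l} ==> e < box_top n l p s j & box_top n l p s j < 1 - e"
 shows "wmap n (sq e) s = box_top l n d (box_top n l p s)"
proof -
 let ?b = "box_top n l p (wmap n (sq e) s)"
 have em: "end_mono (sq e)" using e by (rule end_mono_sq)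
 have "box_top l n d ?b = wmap n (sq e) s"
  by (rule p(2)[OF wmap_cell[OF em s]]) (use c in \<open>simp add: wmap_def\<close>)
 moreover have "?b = box_top n l p s"
  unfolding box_top_wmap[OF em p(1) s]
  using i by (intro wmap_fix box_top_cell[OF p(1) s]) (auto intro: sq_fix)
 ultimately show ?thesis by simp
qed

lemma pt_nondeg:
 assumes X: "cubical_set X" "x:cubes X n" "s:cell n"
 obtains k y t where "nondeg X k y" "t:icell k" "pt X n x s = pt X k y t"
proof -
 obtain l d t' k c y where b: "facemap l n d" "t':icell l" "s = box_top l n d t'" "box_epi l k c"
  "nondeg X k y" "act X l n x d = act X l k y c"
  by (rule nform_ex[OF X])
 have "pt X n x s = pt X k y (box_top l k c t')"
  using pt_act[OF X(1) facemap_hom[OF b(1)] X(2) icell_cell[OF b(2)]]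
   pt_act[OF X(1) epi_hom[OF b(4)] nondeg_cube[OF b(5)] icell_cell[OF b(2)]] b(3,6) by simp
 with that b(5) box_epi_icell[OF b(4,2)] show ?thesis by blast
qed

text \<open>By the normal form, \<open>g u\<close> lies on a face \<open>q\<close>, and
  \<open>x\<close> restricted to \<open>q\<close> is the degeneration of \<open>y\<close> along
  \<open>si\<close>. Near \<open>u\<close>, squeezing moves \<open>g v\<close> onto that face, so
  \<open>r\<close> is the projection to the face followed by \<open>si\<close>. Since
  \<open>pinch\<close> absorbs the squeezing, the pinched cubes over \<open>x\<close> and over
  \<open>y\<close> are identified by two generating steps through the restriction of
  \<open>x\<close> to \<open>q\<close>.\<close>

lemma local_chart:
 assumes X: "cubical_set X" and x: "x:cubes X N" and g: "continuous_map Z (ct N) g" and u: "u:topspace Z"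
  and y: "nondeg X k y" "ta:icell k" and e: "pt X N x (g u) = pt X k y ta"
 obtains r e0 where "box_hom N k r" "0 < (e0 :: real)"
  "!!ep. 0 < ep ==> ep < e0 ==> EX W. openin Z W & u:W &
   (ALL v:W. rmap X (sq ep) (pt X N x (g v)) = pt X k y (box_top N k r (g v)) & box_top N k r (g v):icell k) &
   (ALL n c. c:cubes (Sing Z) n --> c ` cell n <= W -->
    deq X n (N, x, \<lambda>t\<in>cell n. wmap N pinch (g (c t))) (k, y, \<lambda>t\<in>cell n. wmap k pinch (box_top N k r (g (c t)))))"
proof -
 let ?t = "topspace Z"
 have gc: "g v:cell N" if "v:?t" for v
  using continuous_map_image_subset_topspace[OF g] that by auto
 obtain l q t si where d: "facemap l N q" "t:icell l" "g u = box_top l N q t" "box_epi l k si"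
  "act X l N x q = act X l k y si" "ta = box_top l k si t"
  by (rule nf_interior[OF X y x gc[OF u] e])
 have hd: "box_hom l N q" "box_hom l k si" using d by (auto intro: facemap_hom epi_hom)
 obtain pp where p: "box_hom N l pp" "ALL t:cell l. box_top N l pp (box_top l N q t) = t"
  "ALL s:cell N. (ALL j:{1..N}. ALL b. (ALL x:vert l. q x j = b) --> s j = of_bool b) -->
    box_top l N q (box_top N l pp s) = s"
  using facemap_retraction[OF d(1)] by (elim exE conjE)
 define w where "w v = box_top N l pp (g v)" for v
 have wc: "w v:cell l" if "v:?t" for v
  unfolding w_def by (rule box_top_cell[OF p(1) gc[OF that]])
 have wu: "w u = t" using p(2) d(2,3) icell_cell by (simp add: w_def)
 have cw: "continuous_map Z (ct l) w"
  using continuous_map_compose[OF g cts_box_top[OF p(1)]] by (simp add: w_def[abs_def] o_def)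
 obtain e0 where e0: "0 < e0" "e0 <= 1 / 4" "!!j. j:{1..l} ==> e0 <= t j & t j <= 1 - e0"
  by (rule icell_margin[OF d(2)]) (rule that)
 let ?r = "vcomp N si pp"
 have hr: "box_hom N k ?r" by (rule box_hom.comp[OF p(1) hd(2)])
 have rw: "box_top N k ?r (g v) = box_top l k si (w v)" if "v:?t" for v
  unfolding w_def by (rule box_top_comp[OF p(1) hd(2) gc[OF that]])
 show ?thesis
 proof (rule that[OF hr e0(1)])
  fix ep assume ep: "0 < ep" "ep < e0"
  let ?s = "sq ep"
  have em: "end_mono ?s" using ep e0 by (intro end_mono_sq) auto
  \<comment> \<open>Only coordinates of \<open>g u\<close> at an end point are controlled here; the
    free coordinates of the face are controlled through \<open>w\<close>.\<close>
  define S where "S j = (if g u j = 0 then {..<ep} else if g u j = 1 then {1 - ep<..} else UNIV)" for j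
  define W where "W = {v:topspace Z. ALL j:{1..N}. g v j:S j} \<inter> {v:topspace Z. ALL j:{1..l}. w v j:{ep<..<1 - ep}}"
  have "openin Z W"
   unfolding W_def
   by (intro openin_Int openin_coords)
    (auto simp: S_def intro: cts_comp_proj[OF g] cts_comp_proj[OF cw])
  moreover have "u:W"
   using u e0 ep wu by (force simp: W_def S_def)
  moreover have W: "v:?t" "wmap N ?s (g v) = box_top l N q (w v)" "w v:icell l" if v: "v:W" for v
  proof -
   show vZ: "v:?t" using v by (simp add: W_def)
   have wv: "ep < w v j & w v j < 1 - ep" if "j:{1..l}" for j using v that by (simp add: W_def)
   show "w v:icell l" using wc[OF vZ] wv ep by (force simp: icell_def)
   show "wmap N ?s (g v) = box_top l N q (w v)"
    unfolding w_def
   proof (rule collapse[OF d(1) p(1) p(3)[rule_format]])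
    show "0 <= ep" "ep < 1 / 2" using ep e0 by auto
    fix j b assume j: "j:{1..N}" and b: "ALL x:vert l. q x j = b"
    have "g u j = of_bool b"
     unfolding d(3) by (rule box_top_coord_const[OF hd(1) j _ icell_cell[OF d(2)]]) (use b in blast)
    moreover have "g v j:S j" using v j by (simp add: W_def)
    ultimately show "sq ep (g v j) = of_bool b"
     using ep e0 by (cases b) (auto simp: S_def sq_def)
   qed (use gc[OF vZ] wv in \<open>auto simp: w_def\<close>)
  qed
  moreover have "rmap X ?s (pt X N x (g v)) = pt X k y (box_top N k ?r (g v)) & box_top N k ?r (g v):icell k"
   if v: "v:W" for v
  proof
   note vW = W[OF v]
   have "rmap X ?s (pt X N x (g v)) = pt X N x (box_top l N q (w v))"
    using rmap_pt[OF X em x gc[OF vW(1)]] vW(2) by simp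
   also have "\<dots> = pt X l (act X l N x q) (w v)" using pt_act[OF X hd(1) x wc[OF vW(1)]] by simp
   also have "\<dots> = pt X k y (box_top l k si (w v))"
    using pt_act[OF X hd(2) nondeg_cube[OF y(1)] wc[OF vW(1)]] d(5) by simp
   finally show "rmap X ?s (pt X N x (g v)) = pt X k y (box_top N k ?r (g v))" using rw[OF vW(1)] by simp
   show "box_top N k ?r (g v):icell k" using rw[OF vW(1)] box_epi_icell[OF d(4) vW(3)] by simp
  qed
  moreover have "deq X n (N, x, \<lambda>t\<in>cell n. wmap N pinch (g (c t))) (k, y, \<lambda>t\<in>cell n. wmap k pinch (box_top N k ?r (g (c t))))"
   if c: "c:cubes (Sing Z) n" "c ` cell n <= W" for n c
  proof -
   have cW: "c t:W" if "t:cell n" for t using c(2) that by blast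
   let ?h = "\<lambda>t\<in>cell n. wmap l pinch (w (c t))"
   have "continuous_map (ct n) (ct l) (%t. wmap l pinch (w (c t)))"
    using continuous_map_compose[OF continuous_map_compose[OF _ cw] cts_wmap[OF end_mono_pinch cts_pinch], of "ct n" c] c(1)
    by (simp add: Sing_cubes o_def)
   hence h: "?h:sc l n" by (rule SingI)
   have "wmap N pinch (g (c t)) = box_top l N q (wmap l pinch (w (c t)))" if "t:cell n" for t
   proof -
    note W' = W[OF cW[OF that]]
    have "wmap N pinch (g (c t)) = wmap N pinch (wmap N ?s (g (c t)))"
     unfolding wmap_wmap using ep e0 pinch_sq by (intro wmap_cong gc[OF W'(1)]) auto
    thus ?thesis using W' box_top_wmap[OF end_mono_pinch hd(1) wc[OF W'(1)]] by simp
   qed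
   hence 1: "(\<lambda>t\<in>cell n. wmap N pinch (g (c t))) = compose (cell n) (box_top l N q) ?h"
    unfolding compose_def by (intro restrict_ext) simp
   have "wmap k pinch (box_top N k ?r (g (c t))) = box_top l k si (wmap l pinch (w (c t)))" if "t:cell n" for t
    using rw[OF W(1)[OF cW[OF that]]] box_top_wmap[OF end_mono_pinch hd(2) wc[OF W(1)[OF cW[OF that]]]] by simp
   hence 2: "(\<lambda>t\<in>cell n. wmap k pinch (box_top N k ?r (g (c t)))) = compose (cell n) (box_top l k si) ?h"
    unfolding compose_def[of "cell n"] by (intro restrict_ext) simp
   show ?thesis
    unfolding 1 2
    by (rule deq_trans[OF deq_sym[OF deq_act[OF hd(1) x h, unfolded d(5)]] deq_act[OF hd(2) nondeg_cube[OF y(1)] h]])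
  qed
  ultimately show "EX W. openin Z W & u:W &
   (ALL v:W. rmap X ?s (pt X N x (g v)) = pt X k y (box_top N k ?r (g v)) & box_top N k ?r (g v):icell k) &
   (ALL n c. c:cubes (Sing Z) n --> c ` cell n <= W -->
    deq X n (N, x, \<lambda>t\<in>cell n. wmap N pinch (g (c t))) (k, y, \<lambda>t\<in>cell n. wmap k pinch (box_top N k ?r (g (c t)))))"
   by (intro exI[of _ W] conjI ballI allI impI) simp_all
 qed
qed

text \<open>Both representations have the same normal form at \<open>u\<close>, so each is
  identified with a chart over the same \<open>y\<close>. After squeezing they name the same
  interior point of \<open>y\<close>, which makes the two charts coincide.\<close>

lemma deq_local:
 assumes X: "cubical_set X" and x: "x:cubes X N" "x':cubes X N'"
  and g: "continuous_map Z (ct N) g" "continuous_map Z (ct N') g'"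
  and e: "!!v. v:topspace Z ==> pt X N x (g v) = pt X N' x' (g' v)" and u: "u:topspace Z"
 obtains W where "openin Z W" "u:W"
  "!!n c. c:cubes (Sing Z) n ==> c ` cell n <= W ==>
   deq X n (N, x, \<lambda>t\<in>cell n. wmap N pinch (g (c t))) (N', x', \<lambda>t\<in>cell n. wmap N' pinch (g' (c t)))"
proof -
 let ?S = "Sing Z"
 have gu: "g u:cell N" using continuous_map_image_subset_topspace[OF g(1)] u by auto
 obtain k y ta where y: "nondeg X k y" "ta:icell k" "pt X N x (g u) = pt X k y ta"
  by (rule pt_nondeg[OF X x(1) gu])
 obtain w e0 where r: "box_hom N k w" "0 < (e0 :: real)"
  "!!d. 0 < d ==> d < e0 ==> EX W. openin Z W & u:W &
   (ALL v:W. rmap X (sq d) (pt X N x (g v)) = pt X k y (box_top N k w (g v)) & box_top N k w (g v):icell k) &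
   (ALL n c. c:cubes ?S n --> c ` cell n <= W -->
    deq X n (N, x, \<lambda>t\<in>cell n. wmap N pinch (g (c t))) (k, y, \<lambda>t\<in>cell n. wmap k pinch (box_top N k w (g (c t)))))"
  by (rule local_chart[OF X x(1) g(1) u y]) (rule that)
 have e': "pt X N' x' (g' u) = pt X k y ta" using e[OF u] y(3) by simp
 obtain w' e0' where r': "box_hom N' k w'" "0 < (e0' :: real)"
  "!!d. 0 < d ==> d < e0' ==> EX W. openin Z W & u:W &
   (ALL v:W. rmap X (sq d) (pt X N' x' (g' v)) = pt X k y (box_top N' k w' (g' v)) & box_top N' k w' (g' v):icell k) &
   (ALL n c. c:cubes ?S n --> c ` cell n <= W -->
    deq X n (N', x', \<lambda>t\<in>cell n. wmap N' pinch (g' (c t))) (k, y, \<lambda>t\<in>cell n. wmap k pinch (box_top N' k w' (g' (c t)))))"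
  by (rule local_chart[OF X x(2) g(2) u y(1,2) e']) (rule that)
 define d where "d = min e0 e0' / 2"
 have d: "0 < d" "d < e0" "d < e0'" using r(2) r'(2) by (auto simp: d_def)
 obtain W where W: "openin Z W" "u:W"
  "ALL v:W. rmap X (sq d) (pt X N x (g v)) = pt X k y (box_top N k w (g v)) & box_top N k w (g v):icell k"
  "ALL n c. c:cubes ?S n --> c ` cell n <= W -->
    deq X n (N, x, \<lambda>t\<in>cell n. wmap N pinch (g (c t))) (k, y, \<lambda>t\<in>cell n. wmap k pinch (box_top N k w (g (c t))))"
  using r(3)[OF d(1,2)] by (elim exE conjE)
 obtain W' where W': "openin Z W'" "u:W'"
  "ALL v:W'. rmap X (sq d) (pt X N' x' (g' v)) = pt X k y (box_top N' k w' (g' v)) & box_top N' k w' (g' v):icell k"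
  "ALL n c. c:cubes ?S n --> c ` cell n <= W' -->
    deq X n (N', x', \<lambda>t\<in>cell n. wmap N' pinch (g' (c t))) (k, y, \<lambda>t\<in>cell n. wmap k pinch (box_top N' k w' (g' (c t))))"
  using r'(3)[OF d(1,3)] by (elim exE conjE)
 let ?W = "W \<inter> W'"
 have same: "box_top N k w (g v) = box_top N' k w' (g' v)" if "v:?W" for v
 proof -
  have "v:topspace Z" using openin_subset[OF W(1)] that by auto
  hence "pt X k y (box_top N k w (g v)) = pt X k y (box_top N' k w' (g' v))"
   using W(3) W'(3) e that by (metis IntD1 IntD2)
  thus ?thesis using pt_interior_inj[OF X y(1) _ y(1)] W(3) W'(3) that by blast
 qed
 show ?thesis
 proof (rule that[of ?W])
  show "openin Z ?W" "u:?W" using W W' by auto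
  fix n c assume c: "c:cubes ?S n" "c ` cell n <= ?W"
  have "(\<lambda>t\<in>cell n. wmap k pinch (box_top N k w (g (c t)))) = (\<lambda>t\<in>cell n. wmap k pinch (box_top N' k w' (g' (c t))))"
   using c(2) same by (intro restrict_ext) (simp add: image_subset_iff)
  thus "deq X n (N, x, \<lambda>t\<in>cell n. wmap N pinch (g (c t))) (N', x', \<lambda>t\<in>cell n. wmap N' pinch (g' (c t)))"
   using W(4)[rule_format, OF c(1)] W'(4)[rule_format, OF c(1), THEN deq_sym] c(2) by (auto intro: deq_trans)
 qed
qed

text \<open>The sets \<open>U S\<close> below use the discontinuous squeezing maps \<open>sq\<close>; letting the squeezing
 parameter vary makes them open.\<close>

lemma local_lift:
 assumes X: "cubical_set X" and p: "p:topspace (realization X)"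
 obtains U k y g where "openin (realization X) U" "p:U" "y:cubes X k"
  "continuous_map (subtopology (realization X) U) (ct k) g"
  "!!q. q:U ==> rmap X pinch q = pt X k y (wmap k pinch (g q))"
proof -
 let ?r = "realization X"
 obtain n x s where x: "x:cubes X n" "s:cell n" "p = pt X n x s" by (rule realization_cases[OF p])
 obtain k y u0 where y: "nondeg X k y" "u0:icell k" "p = pt X k y u0"
  using pt_nondeg[OF X x(1,2)] x(3) by metis
 let ?c = "ct k"
 obtain e where e: "0 < e" "e <= 1 / 4" "!!j. j:{1..k} ==> e <= u0 j & u0 j <= 1 - e"
  by (rule icell_margin[OF y(2)]) (rule that)
 \<comment> \<open>Half the margin, so that \<open>u0\<close> satisfies the strict inequalities
   defining \<open>B\<close>.\<close>
 define e0 where "e0 = e / 2"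
 have e0: "0 < e0" "e0 <= 1 / 4" "e0 < 1 / 2" and u0: "!!j. j:{1..k} ==> e0 < u0 j & u0 j < 1 - e0"
  using e by (auto simp: e0_def) (smt (verit) e(3) field_sum_of_halves atLeastAtMost_iff)+
 have em: "end_mono (sq c)" if "0 < c" "c < e0" for c using that e0 by (intro end_mono_sq) auto
 define B where "B = {u:cell k. ALL j:{1..k}. e0 < u j & u j < 1 - e0}"
 have Bi: "u:icell k" if "u:B" for u using that e0 by (force simp: B_def icell_def)
 define U where "U S = {q:topspace ?r. EX c u. 0 < c & c < e0 & u:S & rmap X (sq c) q = pt X k y u}" for S
 \<comment> \<open>The parameter of the given point is enlarged from \<open>c\<close> to
   \<open>c'\<close>: the condition \<open>s j <= c\<close> is thereby relaxed to the open condition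
   \<open>s j < c'\<close>, and likewise at the other end, while \<open>c'\<close> stays so small
   that the free coordinates remain unsqueezed.\<close>
 have U_open: "openin ?r (U S)" if S: "S <= B" "openin ?c S" for S
 proof -
  have "openin (ct n) {s:cell n. pt X n x s:U S}" if x: "x:cubes X n" for n x
  proof (subst openin_subopen, intro ballI)
   fix s0 assume "s0:{s:cell n. pt X n x s:U S}"
   then obtain c u where s0: "s0:cell n" and c: "0 < c" "c < e0" "u:S" "rmap X (sq c) (pt X n x s0) = pt X k y u"
    by (auto simp: U_def)
   have u: "u:icell k" using Bi S(1) c(3) by blast
   have eq: "pt X n x (wmap n (sq c) s0) = pt X k y u" using rmap_pt[OF X em[OF c(1,2)] x s0] c(4) by simp
   obtain l de t r where d: "facemap l n de" "t:icell l" "wmap n (sq c) s0 = box_top l n de t" "box_epi l k r"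
    "act X l n x de = act X l k y r" "u = box_top l k r t"
    by (rule nf_interior[OF X y(1) u x wmap_cell[OF em[OF c(1,2)] s0] eq])
   have hd: "box_hom l n de" "box_hom l k r" using d by (auto intro: facemap_hom epi_hom)
   obtain v where p: "box_hom n l v" "ALL t:cell l. box_top n l v (box_top l n de t) = t"
    "ALL s:cell n. (ALL j:{1..n}. ALL b. (ALL x:vert l. de x j = b) --> s j = of_bool b) -->
      box_top l n de (box_top n l v s) = s"
    using facemap_retraction[OF d(1)] by (elim exE conjE)
   define w0 where "w0 = box_top n l v s0"
   have w0c: "w0:cell l" unfolding w0_def by (rule box_top_cell[OF p(1) s0])
   have w0t: "wmap l (sq c) w0 = t"
    using box_top_wmap[OF em[OF c(1,2)] p(1) s0] p(2) d(2,3) icell_cell by (simp add: w0_def)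
   have w0j: "c < w0 j & w0 j < 1 - c" "w0 j = t j" if "j:{1..l}" for j
   proof -
    have "sq c (w0 j) = t j" using fun_cong[OF w0t, of j] that by (simp add: wmap_def)
    moreover have "0 < t j & t j < 1" using d(2) that by (simp add: icell_def)
    ultimately show "c < w0 j & w0 j < 1 - c" "w0 j = t j" by (auto simp: sq_def split: if_splits)
   qed
   have "w0 = t" by (rule cell_eqI[OF w0c icell_cell[OF d(2)] w0j(2)])
   define e1 where "e1 = Min (insert e0 ((%j. min (w0 j) (1 - w0 j)) ` {1..l}))"
   have "c < e1" using c w0j by (auto simp: e1_def) (smt (verit) atLeastAtMost_iff w0j(1))+
   then obtain c' where c': "c < c'" "c' < e1" using dense by blast
   have e1: "e1 <= e0" unfolding e1_def by (rule Min_le) auto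
   have "e1 <= min (w0 j) (1 - w0 j)" if "j:{1..l}" for j
    unfolding e1_def using that by (intro Min_le) auto
   hence w0': "c' < w0 j & w0 j < 1 - c'" if "j:{1..l}" for j using c'(2) that by fastforce
   have c'0: "0 < c'" "c' < e0" using c' c e1 by auto
   define O1 where "O1 j = (if s0 j <= c then {..<c'} else if 1 - c <= s0 j then {1 - c'<..} else UNIV)" for j
   define W where "W = {s:topspace (ct n). ALL j:{1..n}. s j:O1 j} \<inter>
    {s:topspace (ct n). ALL j:{1..l}. box_top n l v s j:{c'<..<1 - c'}} \<inter>
    {s:topspace (ct n). box_top l k r (box_top n l v s):S}"
   note cp = cts_box_top[OF p(1)]
   have "continuous_map (ct n) ?c (%s. box_top l k r (box_top n l v s))"
    using continuous_map_compose[OF cp cts_box_top[OF hd(2)]] by (simp add: o_def)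
   hence "openin (ct n) W"
    unfolding W_def
    by (intro openin_Int openin_coords openin_continuous_map_preimage[OF _ S(2)])
     (auto simp: O1_def intro: cts_proj cts_comp_proj[OF cp])
   moreover have "s0:W"
    using s0 c' c w0' d(6) \<open>w0 = t\<close> unfolding W_def by (auto simp: O1_def w0_def)
   moreover have "W <= {s:cell n. pt X n x s:U S}"
   proof
    fix s assume s: "s:W"
    hence sc: "s:cell n" by (simp add: W_def)
    have wc: "box_top n l v s:cell l" by (rule box_top_cell[OF p(1) sc])
    have "wmap n (sq c') s = box_top l n de (box_top n l v s)"
    proof (rule collapse[OF d(1) p(1) p(3)[rule_format]])
     show "0 <= c'" "c' < 1 / 2" using c'0 e0 by auto
     fix j b assume j: "j:{1..n}" and b: "ALL x:vert l. de x j = b"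
     have "wmap n (sq c) s0 j = of_bool b"
      unfolding d(3) by (rule box_top_coord_const[OF hd(1) j _ icell_cell[OF d(2)]]) (use b in blast)
     hence "sq c (s0 j) = of_bool b" using j by (simp add: wmap_def)
     moreover have "s j:O1 j" using s j by (simp add: W_def)
     ultimately show "sq c' (s j) = of_bool b"
      using c'0 e0 c by (cases b) (auto simp: O1_def sq_def split: if_splits)
    qed (use sc s in \<open>auto simp: W_def\<close>)
    hence "rmap X (sq c') (pt X n x s) = pt X n x (box_top l n de (box_top n l v s))"
     using rmap_pt[OF X em[OF c'0] x sc] by simp
    also have "\<dots> = pt X k y (box_top l k r (box_top n l v s))"
     using pt_act[OF X hd(1) x wc] pt_act[OF X hd(2) nondeg_cube[OF y(1)] wc] d(5) by simp
    finally show "s:{s:cell n. pt X n x s:U S}"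
     using s sc c'0 pt_in[OF x sc] unfolding U_def W_def by blast
   qed
   ultimately show "EX T. openin (ct n) T & s0:T & T <= {s:cell n. pt X n x s:U S}" by blast
  qed
  thus ?thesis by (subst openin_realization) (auto simp: U_def)
 qed
 let ?s = "subtopology ?r (U B)"
 \<comment> \<open>The stronger squeezing absorbs the weaker one and fixes the points of
   \<open>B\<close>, so the value found does not depend on the parameter.\<close>
 have uniq: "u = u'" if "c <= c'" "0 < c" "c' < e0" "u:B" "u':B" "q:topspace ?r"
  "rmap X (sq c) q = pt X k y u" "rmap X (sq c') q = pt X k y u'" for c c' u u' q
 proof -
  note qr = that(6)
  obtain n x s where x: "x:cubes X n" "s:cell n" "q = pt X n x s" by (rule realization_cases[OF qr])
  have c: "end_mono (sq c)" "end_mono (sq c')" using that em by auto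
  have "rmap X (sq c') (rmap X (sq c) q) = rmap X (sq c') q"
  proof -
   have "c <= c'" "0 <= c'" "c' < 1 / 2" using that(1-3) e0 by auto
   thus ?thesis unfolding x(3) using x(1,2) by (simp add: rmap_pt[OF X] c wmap_cell wmap_wmap sq_sq)
  qed
  moreover have "rmap X (sq c') (pt X k y u) = pt X k y u"
  proof -
   have "wmap k (sq c') u = u" using that(3,4) by (intro wmap_fix) (force simp: B_def intro!: sq_fix)+
   thus ?thesis using rmap_pt[OF X c(2) nondeg_cube[OF y(1)], of u] that(4) by (simp add: B_def)
  qed
  ultimately have "pt X k y u = pt X k y u'" using that by simp
  thus ?thesis using pt_interior_inj[OF X y(1) Bi[OF that(4)] y(1) Bi[OF that(5)]] by blast
 qed
 define g where "g q = (SOME u. u:B & (EX c. 0 < c & c < e0 & rmap X (sq c) q = pt X k y u))" for q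
 have g_eq: "g q = u" if "q:topspace ?r" "u:B" "0 < c" "c < e0" "rmap X (sq c) q = pt X k y u" for q u c
 proof -
  have "g q:B & (EX c. 0 < c & c < e0 & rmap X (sq c) q = pt X k y (g q))"
   unfolding g_def by (rule someI[of _ u]) (use that in blast)
  then obtain c' where "g q:B" "0 < c'" "c' < e0" "rmap X (sq c') q = pt X k y (g q)" by blast
  with uniq[of c c' u "g q" q] uniq[of c' c "g q" u q] that show ?thesis by (cases "c <= c'") auto
 qed
 have Bo: "openin ?c B"
 proof -
  have "B = {u:topspace ?c. ALL j:{1..k}. u j:{e0<..<1 - e0}}" by (auto simp: B_def)
  thus ?thesis using openin_coords[of "{1..k}" ?c "%j u. u j" "%_. {e0<..<1 - e0}"]
   cts_proj by simp
 qed
 show ?thesis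
 proof (rule that[of "U B" y k g])
  show "openin ?r (U B)" by (rule U_open[OF _ Bo]) simp
  show "p:U B"
  proof -
   have "wmap k (sq (e0 / 2)) u0 = u0"
    using u0 e0 icell_cell[OF y(2)] by (intro wmap_fix) (force intro!: sq_fix)+
   hence "rmap X (sq (e0 / 2)) p = pt X k y u0"
    using rmap_pt[OF X em nondeg_cube[OF y(1)] icell_cell[OF y(2)], of "e0 / 2"] e0 y(3) by simp
   moreover have "u0:B" using u0 icell_cell[OF y(2)] by (simp add: B_def)
   ultimately show ?thesis using p e0(1) unfolding U_def by (intro CollectI conjI exI[of _ "e0 / 2"] exI[of _ u0]) auto
  qed
  show "y:cubes X k" by (rule nondeg_cube[OF y(1)])
  show "continuous_map ?s ?c g"
   unfolding continuous_map_def
  proof (intro conjI allI impI)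
   show "g:topspace ?s \<rightarrow> topspace ?c"
    using g_eq by (force simp: U_def B_def)
   fix S assume S: "openin ?c S"
   have "{q:topspace ?s. g q:S} = U (S \<inter> B) \<inter> U B"
    using g_eq unfolding U_def by fastforce
   moreover have "openin ?r (U (S \<inter> B))" using S Bo by (intro U_open) auto
   ultimately show "openin ?s {q:topspace ?s. g q:S}"
    unfolding openin_subtopology by blast
  qed
  fix q assume "q:U B"
  then obtain c u where q: "q:topspace ?r" "0 < c" "c < e0" "u:B" "rmap X (sq c) q = pt X k y u"
   by (auto simp: U_def)
  obtain n x s where x: "x:cubes X n" "s:cell n" "q = pt X n x s" by (rule realization_cases[OF q(1)])
  have "rmap X pinch q = rmap X pinch (rmap X (sq c) q)"
   using x q(2,3) e0 by (simp add: rmap_pt[OF X] em end_mono_pinch wmap_cell wmap_wmap pinch_sq)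
  also have "\<dots> = pt X k y (wmap k pinch u)"
   using rmap_pt[OF X end_mono_pinch nondeg_cube[OF y(1)], of u] q(4,5) by (simp add: B_def)
  finally show "rmap X pinch q = pt X k y (wmap k pinch (g q))"
   using g_eq[OF q(1,4,2,3,5)] by simp
 qed
qed

section \<open>Subdivision of topological cubes\<close>

lemma cell_box_nbhd:
 assumes "openin (ct M) W" "u:W"
 obtains r where "0 < (r :: real)" "!!s. s:cell M ==> (!!j. j:{1..M} ==> \<bar>s j - u j\<bar> < r) ==> s:W"
proof -
 obtain U where U: "!!i. i:{1..M} ==> openin (top_of_set {0..1::real}) (U i)" "u:Pi\<^sub>E {1..M} U" "Pi\<^sub>E {1..M} U <= W"
 proof -
  have "EX U. finite {i:{1..M}. U i ~= topspace (top_of_set {0..1::real})} &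
    (ALL i:{1..M}. openin (top_of_set {0..1}) (U i)) & u:Pi\<^sub>E {1..M} U & Pi\<^sub>E {1..M} U <= W"
   using assms by (simp add: openin_product_topology_alt)
  thus ?thesis by (elim exE conjE) (rule that, simp_all)
 qed
 have "EX e>0. ALL x':{0..1}. dist x' (u i) < e --> x':U i" if "i:{1..M}" for i
  using U(1)[OF that] PiE_mem[OF U(2) that] unfolding openin_euclidean_subtopology_iff by blast
 then obtain r where r: "!!i. i:{1..M} ==> 0 < r i" "!!i x. i:{1..M} ==> x:{0..1} ==> dist x (u i) < r i ==> x:U i"
  by metis
 define R where "R = Min (insert 1 (r ` {1..M}))"
 have "0 < R" using r(1) by (auto simp: R_def)
 moreover have "R <= r i" if "i:{1..M}" for i unfolding R_def using that by (intro Min_le) auto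
 ultimately show ?thesis
 proof (intro that[of R])
  fix s assume R: "!!i. i:{1..M} ==> R <= r i" and s: "s:cell M" "!!j. j:{1..M} ==> \<bar>s j - u j\<bar> < R"
  have "s i:U i" if i: "i:{1..M}" for i
   using r(2)[OF i, of "s i"] s(2)[OF i] R[OF i] cell_bounds[OF s(1) i] by (auto simp: dist_real_def)
  hence "s:Pi\<^sub>E {1..M} U" using s(1) by (auto simp: extensional_def cell_iff)
  thus "s:W" using U(3) by blast
 qed
qed

lemma cell_lebesgue:
 assumes W: "!!u. u:cell M ==> openin (ct M) (W u) & u:W u"
 obtains e where "0 < (e :: real)"
  "!!v. v:cell M ==> EX u:cell M. ALL s:cell M. (ALL j:{1..M}. \<bar>s j - v j\<bar> < e) --> s:W u"
proof -
 let ?c = "cell M"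
 have "EX r>0. ALL s:cell M. (ALL j:{1..M}. \<bar>s j - u j\<bar> < r) --> s:W u" if "u:?c" for u
  using cell_box_nbhd[of M "W u" u] W[OF that] by metis
 then obtain r where r: "!!u. u:cell M ==> 0 < r u"
  "!!u s. u:cell M ==> s:cell M ==> (ALL j:{1..M}. \<bar>s j - u j\<bar> < r u) ==> s:W u" by metis
 define B where "B u = {s:topspace (ct M). ALL j:{1..M}. s j:{u j - r u / 2<..<u j + r u / 2}}" for u
 have Bo: "openin (ct M) (B u)" for u
  unfolding B_def by (intro openin_coords cts_proj) auto
 have uB: "u:B u" if "u:?c" for u using r(1)[OF that] that by (simp add: B_def)
 have "compact_space (ct M)"
  by (simp add: compact_space_product_topology compact_space_subtopology)
 hence "compactin (ct M) ?c" by (simp add: compact_space_def)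
 from compactinD[OF this, of "B ` cell M"] obtain F where F: "finite F" "F <= B ` cell M" "?c <= \<Union>F"
  using Bo uB by blast
 obtain D where D: "D <= ?c" "finite D" "F = B ` D" using finite_subset_image[OF F(1,2)] by blast
 define e where "e = Min (insert 1 ((%u. r u / 2) ` D))"
 have e: "0 < e" using D r(1) by (auto simp: e_def)
 have ele: "e <= r u / 2" if "u:D" for u unfolding e_def using D(2) that by (intro Min_le) auto
 show ?thesis
 proof (rule that[OF e])
  fix v assume "v:?c"
  then obtain u where u: "u:D" "v:B u" using F(3) D(3) by blast
  have "s:W u" if s: "s:?c" "ALL j:{1..M}. \<bar>s j - v j\<bar> < e" for s
  proof (rule r(2)[OF _ s(1)])
   show "u:?c" using u D by blast
   show "ALL j:{1..M}. \<bar>s j - u j\<bar> < r u"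
   proof
    fix j assume j: "j:{1..M}"
    have "\<bar>s j - v j\<bar> < r u / 2" using s(2) j ele[OF u(1)] by force
    moreover have "\<bar>v j - u j\<bar> < r u / 2" 
    proof -
     have "v j:{u j - r u / 2<..<u j + r u / 2}" using u(2) j unfolding B_def by blast
     thus ?thesis unfolding abs_less_iff greaterThanLessThan_iff by linarith
    qed
    ultimately show "\<bar>s j - u j\<bar> < r u" by linarith
   qed
  qed
  thus "EX u:cell M. ALL s:cell M. (ALL j:{1..M}. \<bar>s j - v j\<bar> < e) --> s:W u"
   using u D by blast
 qed
qed

section \<open>Regular grids in the topological cube and lifts over their cells\<close>

definition vidx :: "nat => nat => (nat => nat) => bool" where
 "vidx M k a = ((ALL j:{1..M}. a j < k))"

definition cm :: "nat => nat => (nat => nat) => (nat => real) => nat => real" where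
 "cm M k a t = (\<lambda>j\<in>{1..M}. (real (a j) + t j) / real k)"

definition idel :: "nat => (nat => nat) => nat => nat" where
 "idel i a j = (if j < i then a j else a (Suc j))"

lemma cm_cell:
 assumes "vidx M k a" "t:cell M"
 shows "cm M k a t:cell M"
 unfolding cm_def
proof (rule cellI)
 fix j assume j: "j:{1..M}"
 have "a j < k" using assms(1) j by (simp add: vidx_def)
 hence "real (a j) + 1 <= real k" by linarith
 thus "0 <= (real (a j) + t j) / real k & (real (a j) + t j) / real k <= 1"
  using cell_bounds[OF assms(2) j] by auto
qed

lemma continuous_map_cm: "vidx M k a ==> 0 < k ==> continuous_map (ct M) (ct M) (cm M k a)"
proof (rule cts_cellI)
 fix j assume "vidx M k a" "0 < k" "j:{1..M}"
 hence "cts (ct M) (%t. (real (a j) + t j) / real k)"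
  by (intro continuous_intros cts_proj) auto
 thus "cts (ct M) (%t. cm M k a t j)"
  by (simp add: cm_def)
qed (simp add: cm_cell)

lemma Sing_subtopology: "c:cubes (Sing (subtopology T C)) n \<longleftrightarrow> c:cubes (Sing T) n & c ` cell n <= C"
 by (auto simp: Sing_cubes continuous_map_in_subtopology)

abbreviation "chart_cube N x g n c l == (N l, x l, \<lambda>t\<in>cell n. wmap (N l) pinch (g l (c t)))"
abbreviation "face_cube N x g M i u l == (N l, x l, fc (SC (N l)) M (g l) i u)"

text \<open>Near a common point of two charts this is \<open>deq_local\<close>; elsewhere the
  complement of the closed overlap is a neighbourhood on which the claim is vacuous, because cells
  are nonempty. A Lebesgue number makes this uniform, for all pairs of the finitely many charts at
  once.\<close>

lemma charts_deq:
 assumes X: "cubical_set X" and I: "finite I"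
  and C: "!!l. l:I ==> closedin (ct M) (C l)" and x: "!!l. l:I ==> x l:cubes X (N l)"
  and g: "!!l. l:I ==> continuous_map (subtopology (ct M) (C l)) (ct (N l)) (g l)"
  and f: "!!l v. l:I ==> v:C l ==> pt X (N l) (x l) (g l v) = f v"
 obtains e where "0 < (e :: real)"
  "!!l m n c. l:I ==> m:I ==> c:sc M n ==> c ` cell n <= C l \<inter> C m ==>
   (ALL t:cell n. ALL t':cell n. ALL j:{1..M}. \<bar>c t j - c t' j\<bar> < e) ==>
   deq X n (chart_cube N x g n c l) (chart_cube N x g n c m)"
proof -
 let ?c = "ct M"
 define P where "P l m W \<longleftrightarrow> (ALL n c. c:sc M n --> c ` cell n <= C l \<inter> C m \<inter> W -->
  deq X n (chart_cube N x g n c l) (chart_cube N x g n c m))"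
  for l m W
 have "(\<lambda>j\<in>{1..n}. 0):cell n" for n by (rule cellI) simp
 hence ne: "cell n ~= {}" for n by blast
 have "EX W. openin ?c W & u:W & P l m W" if l: "l:I" "m:I" and u: "u:cell M" for l m u
 proof (cases "u:C l \<inter> C m")
  case True
  let ?Z = "subtopology ?c (C l \<inter> C m)"
  let ?C = "C l \<inter> C m"
  have Zt: "topspace ?Z = ?C" using closedin_subset[OF C[OF l(1)]] by auto
  have gl: "continuous_map ?Z (ct (N l)) (g l)"
   using continuous_map_from_subtopology_mono[OF g[OF l(1)], of ?C] by simp
  have gm: "continuous_map ?Z (ct (N m)) (g m)"
   using continuous_map_from_subtopology_mono[OF g[OF l(2)], of ?C] by simp
  obtain W where W: "openin ?Z W" "u:W"
   "!!n c. c:cubes (Sing ?Z) n ==> c ` cell n <= W ==>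
    deq X n (chart_cube N x g n c l) (chart_cube N x g n c m)"
   by (rule deq_local[OF X x[OF l(1)] x[OF l(2)] gl gm, of u]) (use f l Zt True in \<open>auto intro: that\<close>)
  obtain W' where W': "openin ?c W'" "W = W' \<inter> ?C"
   using W(1) unfolding openin_subtopology by blast
  have "P l m W'"
   unfolding P_def
  proof (intro allI impI)
   fix n c assume c: "c:sc M n" "c ` cell n <= C l \<inter> C m \<inter> W'"
   show "deq X n (chart_cube N x g n c l) (chart_cube N x g n c m)"
    by (rule W(3)) (use c W'(2) in \<open>auto simp: Sing_subtopology\<close>)
  qed
  thus ?thesis using W' W(2) by blast
 next
  case False
  let ?W = "topspace ?c - C l \<inter> C m"
  have "openin ?c ?W" by (rule openin_diff[OF openin_topspace closedin_Int[OF C[OF l(1)] C[OF l(2)]]])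
  moreover have "P l m ?W"
   using ne unfolding P_def by blast
  ultimately show ?thesis using False u by (intro exI[of _ ?W]) simp
 qed
 then obtain W where W: "!!l m u. l:I ==> m:I ==> u:cell M ==> openin ?c (W l m u) & u:W l m u & P l m (W l m u)"
  by metis
 define V where "V u = (\<Inter>p\<in>I \<times> I. W (fst p) (snd p) u) \<inter> topspace ?c" for u
 have V: "openin ?c (V u) & u:V u" if "u:cell M" for u
 proof
  show "openin ?c (V u)"
   unfolding V_def by (rule openin_INT) (use I W that in auto)
  show "u:V u" using W that by (auto simp: V_def)
 qed
 obtain e where e: "0 < (e :: real)"
  "!!v. v:cell M ==> EX u:cell M. ALL s:cell M. (ALL j:{1..M}. \<bar>s j - v j\<bar> < e) --> s:V u"
  by (rule cell_lebesgue[of M V, OF V]) (assumption, rule that)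
 show ?thesis
 proof (rule that[OF e(1)])
  fix l m n c assume l: "l:I" "m:I" and c: "c:sc M n" "c ` cell n <= C l \<inter> C m"
   and d: "ALL t:cell n. ALL t':cell n. ALL j:{1..M}. \<bar>c t j - c t' j\<bar> < e"
  obtain t0 where t0: "t0:cell n" using ne by blast
  have cc: "c t:cell M" if "t:cell n" for t using Sing_topspace[OF c(1) that] by simp
  obtain u where u: "u:cell M" "ALL s:cell M. (ALL j:{1..M}. \<bar>s j - c t0 j\<bar> < e) --> s:V u"
   using e(2)[OF cc[OF t0]] by blast
  have "c ` cell n <= V u" using u(2) cc d t0 by blast
  hence "c ` cell n <= W l m u" using l by (force simp: V_def)
  thus "deq X n (chart_cube N x g n c l) (chart_cube N x g n c m)"
   using W[OF l u(1)] c unfolding P_def by blast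
 qed
qed

definition subcell :: "nat => nat => (nat => nat) => (nat => real) set" where
 "subcell M k a = {v:cell M. ALL j:{1..M}. real (a j) / real k <= v j & v j <= (real (a j) + 1) / real k}"

text \<open>A Lebesgue number for the open sets of \<open>local_lift\<close> puts every cell of a
  fine enough grid inside one of them. The price is one pinch.\<close>

lemma coarse_charts:
 assumes X: "cubical_set X" and f: "f:cubes (SR X) M"
 obtains k N x g where "0 < k"
  "!!a. vidx M k a ==> x a:cubes X (N a)"
  "!!a. vidx M k a ==> continuous_map (subtopology (ct M) (subcell M k a)) (ct (N a)) (g a)"
  "!!a v. vidx M k a ==> v:subcell M k a ==> pt X (N a) (x a) (g a v) = rmap X pinch (f v)"
proof -
 let ?l = "\<lambda>j\<in>{1..M}. 0"
 let ?r = "realization X"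
 let ?c = "ct M"
 have cf: "continuous_map ?c ?r f" using f by (simp add: Sing_cubes)
 define ok where "ok C N x g \<longleftrightarrow> x:cubes X N & continuous_map (subtopology ?c C) (ct N) g &
  (ALL v:C. pt X N x (g v) = rmap X pinch (f v))" for C N x g
 have "EX W. openin ?c W & u:W & (EX N x g. ok W N x g)" if u: "u:cell M" for u
 proof -
  obtain U k y g where U: "openin ?r U" "f u:U" "y:cubes X k"
   "continuous_map (subtopology ?r U) (ct k) g"
   "!!q. q:U ==> rmap X pinch q = pt X k y (wmap k pinch (g q))"
   by (rule local_lift[OF X Sing_topspace[OF f u]]) (rule that)
  let ?W = "{v:topspace ?c. f v:U}"
  let ?v = "%v. wmap k pinch (g (f v))"
  have "openin ?c ?W" by (rule openin_continuous_map_preimage[OF cf U(1)])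
  moreover have "continuous_map (subtopology ?c ?W) (subtopology ?r U) f"
   using cf by (auto simp: continuous_map_in_subtopology intro: continuous_map_from_subtopology)
  from continuous_map_compose[OF continuous_map_compose[OF this U(4)] cts_wmap[OF end_mono_pinch cts_pinch]]
  have "continuous_map (subtopology ?c ?W) (ct k) ?v"
   by (simp add: o_def)
  hence "ok ?W k y ?v" using U(3,5) by (simp add: ok_def)
  ultimately show ?thesis using u U(2) by (intro exI[of _ ?W]) auto
 qed
 then obtain W where W: "!!u. u:cell M ==> openin ?c (W u) & u:W u & (EX N x g. ok (W u) N x g)"
  by metis
 have W': "openin ?c (W u) & u:W u" if "u:cell M" for u using W[OF that] by blast
 obtain e where e: "0 < (e :: real)"
  "!!v. v:cell M ==> EX u:cell M. ALL s:cell M. (ALL j:{1..M}. \<bar>s j - v j\<bar> < e) --> s:W u"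
  by (rule cell_lebesgue[of M W, OF W']) (assumption, rule that)
 obtain k where k: "0 < k" "1 / real k < e"
  using reals_Archimedean[OF e(1)] by (metis inverse_eq_divide zero_less_Suc)
 have "EX N x g. ok (subcell M k a) N x g" if a: "vidx M k a" for a
 proof -
  have "?l:cell M" by (rule cellI) simp
  from cm_cell[OF a this] have c: "cm M k a ?l:cell M" .
  obtain u where u: "u:cell M" "ALL s:cell M. (ALL j:{1..M}. \<bar>s j - cm M k a ?l j\<bar> < e) --> s:W u"
   using e(2)[OF c] by blast
  have sub: "subcell M k a <= W u"
  proof
   fix s assume s: "s:subcell M k a"
   have "\<bar>s j - cm M k a ?l j\<bar> < e" if j: "j:{1..M}" for j
   proof -
    have "real (a j) / real k <= s j" "s j <= real (a j) / real k + 1 / real k"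
     using s j by (auto simp: subcell_def add_divide_distrib)
    moreover have "cm M k a ?l j = real (a j) / real k" using j by (simp add: cm_def)
    ultimately show ?thesis using k(2) by linarith
   qed
   thus "s:W u" using u(2) s by (simp add: subcell_def)
  qed
  obtain N x g where "ok (W u) N x g" using W[OF u(1)] by blast
  hence "ok (subcell M k a) N x g"
   using sub continuous_map_from_subtopology_mono unfolding ok_def by blast
  thus ?thesis by blast
 qed
 then obtain N x g where "!!a. vidx M k a ==> ok (subcell M k a) (N a) (x a) (g a)" by metis
 thus ?thesis using that[OF k(1), of x N g] unfolding ok_def by blast
qed

lemma closedin_subcell: "closedin (ct M) (subcell M k a)"
proof -
 let ?c = "ct M"
 have "subcell M k a = topspace ?c - (\<Union>j\<in>{1..M}.
   {v:topspace ?c. v j:- {real (a j) / real k..(real (a j) + 1) / real k}})"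
  by (auto simp: subcell_def)
 moreover have "openin ?c (\<Union>j\<in>{1..M}.
   {v:topspace ?c. v j:- {real (a j) / real k..(real (a j) + 1) / real k}})"
 proof (rule openin_Union)
  fix T assume "T:(%j. {v:topspace ?c. v j:- {real (a j) / real k..(real (a j) + 1) / real k}}) ` {1..M}"
  then obtain j where j: "j:{1..M}"
   and T: "T = {v:topspace ?c. v j:- {real (a j) / real k..(real (a j) + 1) / real k}}"
   by (rule imageE)
  show "openin ?c T"
   unfolding T by (rule openin_continuous_map_preimage[OF cts_proj[OF j]])
    (simp add: open_Compl)
 qed
 ultimately show ?thesis by (simp only: closedin_diff[OF closedin_topspace])
qed

lemma cm_subcell:
 assumes a: "vidx M (k * k2) a" and k: "0 < k" "0 < k2" and t: "t:cell M"
 shows "cm M (k * k2) a t:subcell M k (\<lambda>j\<in>{1..M}. a j div k2)"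
proof -
 let ?k = "k * k2"
 have "real (a j div k2) / real k <= cm M ?k a t j & cm M ?k a t j <= (real (a j div k2) + 1) / real k"
  if j: "j:{1..M}" for j
 proof -
  let ?a = "a j div k2"
  let ?j = "real (a j) + t j"
  have b: "0 <= t j" "t j <= 1" using cell_bounds[OF t j] by auto
  have "a j div k2 * k2 <= a j" by simp
  hence 1: "(real ?a * real k2) <= real (a j)" by (metis of_nat_le_iff of_nat_mult)
  have "a j < (a j div k2 + 1) * k2" using k(2) by (metis add.commute dividend_less_times_div mult.commute mult_Suc plus_1_eq_Suc)
  hence "a j + 1 <= (a j div k2 + 1) * k2" by linarith
  hence 2: "real (a j) + 1 <= ((real ?a + 1) * real k2)" by (metis of_nat_1 of_nat_add of_nat_le_iff of_nat_mult)
  have "real ?a / real k = (real ?a * real k2) / real ?k"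
   "(real ?a + 1) / real k = ((real ?a + 1) * real k2) / real ?k"
   using k by auto
  moreover have "(real ?a * real k2) <= ?j" "?j <= ((real ?a + 1) * real k2)"
   using 1 2 b by linarith+
  moreover have "cm M ?k a t j = ?j / real ?k" using j by (simp add: cm_def)
  ultimately show ?thesis by (simp only:) (intro conjI divide_right_mono of_nat_0_le_iff)
 qed
 thus ?thesis using cm_cell[OF a t] by (simp add: subcell_def)
qed

type_synonym chart = "(nat => nat) + nat \<times> bool"

abbreviation up :: "nat => (nat => nat) => nat => nat" where "up i a == a(i := Suc (a i))"

text \<open>The first pinch gives charts on a coarse grid with \<open>k1\<close> steps, the second
  makes overlapping charts equivalent on the finer grid with \<open>k1 * k2\<close> steps. The
  prescribed cubes \<open>s i u\<close> are treated as further charts, on the closed faces of the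
  cube; the same overlap argument then identifies the outer faces of the grid with the prescribed
  data.\<close>

lemma grid:
 assumes X: "cubical_set X" and f: "f:cubes (SR X) (Suc M)"
  and s: "!!i u. i:{1..Suc M} ==> s i u:cubes X M"
  and fs: "!!i u. i:{1..Suc M} ==> fc (SR X) M f i u = ch X M (s i u)"
 obtains k N x g where "0 < k"
  "!!a. vidx (Suc M) k a ==> x a:cubes X (N a) & g a:sc (N a) (Suc M)"
  "!!a t. vidx (Suc M) k a ==> t:cell (Suc M) ==>
   pt X (N a) (x a) (g a t) = rmap X pinch (rmap X pinch (f (cm (Suc M) k a t)))"
  "!!a i. vidx (Suc M) k a ==> vidx (Suc M) k (up i a) ==> i:{1..Suc M} ==>
   deq X M (face_cube N x g M i True a)
    (face_cube N x g M i False (up i a))"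
  "!!a i u. vidx (Suc M) k a ==> i:{1..Suc M} ==> a i = (if u then k - 1 else 0) ==>
   deq X M (face_cube N x g M i u a)
    (M, s i u, \<lambda>t\<in>cell M. wmap M pinch (wmap M pinch (cm M k (idel i a) t)))"
proof -
 let ?M = "Suc M"
 obtain k1 N1 x1 g1 where k1: "0 < k1" and c1:
  "!!a. vidx ?M k1 a ==> x1 a:cubes X (N1 a)"
  "!!a. vidx ?M k1 a ==> continuous_map (subtopology (ct ?M) (subcell ?M k1 a)) (ct (N1 a)) (g1 a)"
  "!!a v. vidx ?M k1 a ==> v:subcell ?M k1 a ==> pt X (N1 a) (x1 a) (g1 a v) = rmap X pinch (f v)"
  by (rule coarse_charts[OF X f]) (rule that)
 define I :: "chart set" where
  "I = Inl ` (PiE {1..?M} (%_. {..<k1})) \<union> Inr ` ({1..?M} \<times> UNIV)"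
 define C where "C l = (case l of Inl a => subcell ?M k1 a | Inr (i, u) => {v:cell ?M. v i = of_bool u})"
  for l :: chart
 define N where "N l = (case l of Inl a => N1 a | Inr (i, u) => M)" for l :: chart
 define x where "x l = (case l of Inl a => x1 a | Inr (i, u) => s i u)" for l :: chart
 \<comment> \<open>The boundary charts are pinched once, since all charts have to represent
   \<open>rmap X pinch (f v)\<close>.\<close>
 define g where "g l = (case l of Inl a => g1 a | Inr (i, u) => %v. wmap M pinch (degen_fun ?M i v))"
  for l :: chart
 let ?c = "cell M"
 let ?C = "ct ?M"
 have Icases: "(EX a. l = Inl a & vidx ?M k1 a) | (EX i u. l = Inr (i, u) & i:{1..?M})" if "l:I" for l
  using that by (auto simp: I_def vidx_def)
 have "finite I" unfolding I_def by (intro finite_UnI finite_imageI finite_PiE finite_cartesian_product) auto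
 have cdeg: "continuous_map ?C (ct M) (degen_fun ?M i)" if i: "i:{1..?M}" for i
  by (rule continuous_map_eq[OF cts_box_top[OF degen_hom[OF i refl]]]) (simp add: box_top_degen[OF i])
 have clo: "closedin ?C (C l)" if "l:I" for l
  using Icases[OF that]
 proof (elim disjE exE conjE)
  fix i u assume l: "l = Inr (i, u)" "i:{1..?M}"
  from closedin_continuous_map_preimage[OF cts_proj[OF l(2)], of "{of_bool u}"]
  show ?thesis by (simp add: C_def l)
 qed (simp add: C_def closedin_subcell)
 have xin: "x l:cubes X (N l)" if "l:I" for l
  using Icases[OF that] c1(1) s by (elim disjE exE conjE) (simp_all add: x_def N_def)
 have cg: "continuous_map (subtopology ?C (C l)) (ct (N l)) (g l)" if "l:I" for l
  using Icases[OF that]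
 proof (elim disjE exE conjE)
  fix i u assume l: "l = Inr (i, u)" "i:{1..?M}"
  from continuous_map_compose[OF cdeg[OF l(2)] cts_wmap[OF end_mono_pinch cts_pinch]]
  show ?thesis unfolding l(1) by (simp add: N_def g_def o_def continuous_map_from_subtopology)
 qed (simp add: C_def N_def g_def c1(2))
 have fp: "pt X (N l) (x l) (g l v) = rmap X pinch (f v)" if "l:I" "v:C l" for l v
  using Icases[OF that(1)]
 proof (elim disjE exE conjE)
  fix i u assume l: "l = Inr (i, u)" "i:{1..?M}"
  have v: "v:cell ?M" "v i = of_bool u" using that(2) by (simp_all add: C_def l)
  note d = degen_fun_cell[OF l(2) v(1)]
  have "f v = fc (SR X) M f i u (degen_fun ?M i v)"
   using l(2) by (simp add: Sing_fc[OF f _ _ d] face_degen_cell[OF l(2) v])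
  also have "\<dots> = pt X M (s i u) (degen_fun ?M i v)" using fs[OF l(2)] by (simp add: ch_apply[OF d])
  finally show ?thesis using rmap_pt[OF X end_mono_pinch s[OF l(2)] d] by (simp add: l(1) N_def x_def g_def)
 qed (use c1(3) that(2) in \<open>simp add: C_def N_def x_def g_def\<close>)
 obtain e where e: "0 < (e :: real)"
  "!!l m n c. l:I ==> m:I ==> c:sc ?M n ==> c ` cell n <= C l \<inter> C m ==>
   (ALL t:cell n. ALL t':cell n. ALL j:{1..?M}. \<bar>c t j - c t' j\<bar> < e) ==>
   deq X n (chart_cube N x g n c l) (chart_cube N x g n c m)"
  by (rule charts_deq[OF X \<open>finite I\<close> clo xin cg fp]) (assumption+, rule that)
 obtain k2 where k2: "0 < k2" "1 / real k2 < e"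
  using reals_Archimedean[OF e(1)] by (metis inverse_eq_divide zero_less_Suc)
 define k where "k = k1 * k2"
 have k0: "0 < k" using k1 k2 by (simp add: k_def)
 have ke: "1 / real k < e"
 proof -
  have "k2 <= k" using k1 by (simp add: k_def)
  hence "1 / real k <= 1 / real k2" using k2 by (intro divide_left_mono) auto
  thus ?thesis using k2 by linarith
 qed
 define p where "p a = (\<lambda>j\<in>{1..?M}. a j div k2)" for a :: "nat => nat"
 let ?Q = "%a. Inl (p a)"
 have pI: "Inl (p a):I" "vidx ?M k1 (p a)" if "vidx ?M k a" for a
 proof -
  show "vidx ?M k1 (p a)" using that by (auto simp: vidx_def p_def k_def less_mult_imp_div_less)
  thus "Inl (p a):I" by (auto simp: I_def vidx_def p_def)
 qed
 have sub: "cm ?M k a t:C (?Q a)" if "vidx ?M k a" "t:cell ?M" for a t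
  using cm_subcell[of ?M k1 k2 a t] that k1 k2 by (simp add: C_def p_def k_def)
 define h where "h a = (\<lambda>t\<in>cell ?M. wmap (N (?Q a)) pinch (g (?Q a) (cm ?M k a t)))" for a
 have h_in: "h a:sc (N (?Q a)) ?M" if a: "vidx ?M k a" for a
 proof -
  have "continuous_map ?C (subtopology ?C (C (?Q a))) (cm ?M k a)"
   using continuous_map_cm[OF a k0] sub[OF a] by (auto simp: continuous_map_in_subtopology)
  from continuous_map_compose[OF continuous_map_compose[OF this cg[OF pI(1)[OF a]]] cts_wmap[OF end_mono_pinch cts_pinch]]
  show ?thesis unfolding h_def by (intro SingI) (simp add: o_def)
 qed
 have face_h: "fc (SC (N (?Q a))) M (h a) i u =
   (\<lambda>t\<in>cell M. wmap (N (?Q a)) pinch (g (?Q a) (cm ?M k a (face_fun ?M i (of_bool u) t))))"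
  if a: "vidx ?M k a" and i: "i:{1..?M}" for a i u
 proof (rule extensionalityI[of _ ?c])
  let ?a = "Inl (p a)"
  have i': "1 <= i" "i <= Suc M" using i by auto
  show "fc (SC (N ?a)) M (h a) i u:extensional ?c"
   using fc_in[OF Sing_cset h_in[OF a] i'] by (simp add: Sing_cubes)
  fix t assume t: "t:?c"
  thus "fc (SC (N ?a)) M (h a) i u t =
   (\<lambda>t\<in>cell M. wmap (N ?a) pinch (g ?a (cm ?M k a (face_fun ?M i (of_bool u) t)))) t"
   using Sing_fc[OF h_in[OF a] i' t] face_fun_cell[OF i t] by (simp add: h_def)
 qed simp
 define c where "c a i u = (\<lambda>t\<in>cell M. cm ?M k a (face_fun ?M i (of_bool u) t))" for a i u
 have c_in: "c a i u:sc ?M M" if a: "vidx ?M k a" and i: "i:{1..?M}" for a i u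
 proof -
  have "continuous_map (ct M) ?C (face_fun ?M i (of_bool u))"
   by (rule continuous_map_eq[OF cts_box_top[OF face_hom[OF i refl]]]) (simp add: box_top_face[OF i])
  from continuous_map_compose[OF this continuous_map_cm[OF a k0]] show ?thesis
   unfolding c_def by (intro SingI) (simp add: o_def)
 qed
 have c_small: "\<bar>c a i u t j - c a i u t' j\<bar> < e"
  if a: "vidx ?M k a" and i: "i:{1..?M}" and t: "t:?c" "t':?c" and j: "j:{1..?M}" for a i u t t' j
 proof -
  let ?o = "of_bool u"
  have b: "\<bar>face_fun ?M i ?o t j - face_fun ?M i ?o t' j\<bar> <= 1"
   using cell_bounds[OF face_fun_cell[OF i t(1), of u] j] cell_bounds[OF face_fun_cell[OF i t(2), of u] j] by linarith
  have "c a i u t j - c a i u t' j = (face_fun ?M i ?o t j - face_fun ?M i ?o t' j) / real k"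
   using t j by (simp add: c_def cm_def diff_divide_distrib add_divide_distrib)
  hence "\<bar>c a i u t j - c a i u t' j\<bar> <= 1 / real k"
   using b k0 by (simp add: divide_right_mono)
  thus ?thesis using ke by linarith
 qed
 have c_sub: "c a i u ` cell M <= C (?Q a)" if a: "vidx ?M k a" and i: "i:{1..?M}" for a i u
 proof
  fix y assume "y:c a i u ` cell M"
  then obtain t where t: "t:?c" "y = c a i u t" by blast
  show "y:C (?Q a)"
   using sub[OF a face_fun_cell[OF i t(1)], of u] t unfolding c_def by (simp only: restrict_apply' t(1))
 qed
 have face_h': "fc (SC (N (?Q a))) M (h a) i u = (\<lambda>t\<in>cell M. wmap (N (?Q a)) pinch (g (?Q a) (c a i u t)))"
  if a: "vidx ?M k a" and i: "i:{1..?M}" for a i u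
  unfolding face_h[OF that] by (intro restrict_ext) (simp add: c_def)
 show ?thesis
 proof (rule that[OF k0, of "%a. x (?Q a)" "%a. N (?Q a)" h])
  fix a assume a: "vidx ?M k a"
  show "x (?Q a):cubes X (N (?Q a)) & h a:sc (N (?Q a)) ?M"
   using xin[OF pI(1)[OF a]] h_in[OF a] by simp
  fix t assume t: "t:cell ?M"
  let ?v = "cm ?M k a t"
  note l = pI(1)[OF a] and v = sub[OF a t]
  let ?P = "Inl (p a)"
  have gv: "g ?P ?v:cell (N ?P)"
   using continuous_map_image_subset_topspace[OF cg[OF l]] v cm_cell[OF a t] by auto
  show "pt X (N ?P) (x ?P) (h a t) = rmap X pinch (rmap X pinch (f ?v))"
   using rmap_pt[OF X end_mono_pinch xin[OF l] gv] fp[OF l v] t by (simp add: h_def)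
 next
  fix a i assume a: "vidx ?M k a" and b: "vidx ?M k (up i a)" and i: "i:{1..?M}"
  let ?b = "up i a"
  let ?A = "Inl (p a)"
  have cc: "c a i True = c ?b i False"
   unfolding c_def
  proof (rule restrict_ext)
   fix t assume "t:?c"
   show "cm ?M k a (face_fun ?M i (of_bool True) t) = cm ?M k ?b (face_fun ?M i (of_bool False) t)"
    using i by (auto simp: cm_def face_fun_def)
  qed
  show "deq X M (N ?A, x ?A, fc (SC (N ?A)) M (h a) i True)
    (N (?Q ?b), x (?Q ?b), fc (SC (N (?Q ?b))) M (h ?b) i False)"
   unfolding face_h'[OF a i] face_h'[OF b i] cc[symmetric]
  proof (rule e(2)[OF pI(1)[OF a] pI(1)[OF b] c_in[OF a i]])
   show "c a i True ` cell M <= C ?A \<inter> C (?Q ?b)"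
    using c_sub[OF a i, of True] c_sub[OF b i, of False] unfolding cc by (rule Int_greatest)
   show "ALL t:cell M. ALL t':cell M. ALL j:{1..?M}. \<bar>c a i True t j - c a i True t' j\<bar> < e"
    by (intro ballI c_small[OF a i])
  qed
 next
  fix a i u assume a: "vidx ?M k a" and i: "i:{1..?M}" and ai: "a i = (if u then k - 1 else 0)"
  let ?l = "Inr (i, u) :: chart"
  let ?I = "Inl (p a)"
  have lI: "?l:I" using i by (auto simp: I_def)
  have ci: "c a i u t i = of_bool u" if "t:?c" for t
   using that i ai k0 by (cases u) (auto simp: c_def cm_def face_fun_def)
  have "c a i u ` cell M <= C ?I \<inter> C ?l"
   using c_sub[OF a i, of u] ci Sing_topspace[OF c_in[OF a i, of u]] by (auto simp: C_def)
  hence d: "deq X M (N ?I, x ?I, \<lambda>t\<in>cell M. wmap (N ?I) pinch (g ?I (c a i u t)))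
    (N ?l, x ?l, \<lambda>t\<in>cell M. wmap (N ?l) pinch (g ?l (c a i u t)))"
   by (rule e(2)[OF pI(1)[OF a] lI c_in[OF a i]]) (intro ballI c_small[OF a i])
  have "degen_fun ?M i (c a i u t) = cm M k (idel i a) t" if "t:?c" for t
   using that i by (auto simp: c_def degen_fun_def cm_def face_fun_def idel_def)
  hence "(\<lambda>t\<in>cell M. wmap (N ?l) pinch (g ?l (c a i u t))) = (\<lambda>t\<in>cell M. wmap M pinch (wmap M pinch (cm M k (idel i a) t)))"
   by (intro restrict_ext) (simp add: N_def g_def)
  thus "deq X M (N ?I, x ?I, fc (SC (N ?I)) M (h a) i u)
    (M, s i u, \<lambda>t\<in>cell M. wmap M pinch (wmap M pinch (cm M k (idel i a) t)))"
   using d unfolding face_h'[OF a i] by (simp add: N_def x_def)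
 qed
qed

section \<open>Extending operators to all cubes of a topological cube\<close>

definition oper :: "nat => nat => cell_map => bool" where
 "oper N n g = ((EX f. box_hom n N f & g = box_top n N f))"

definition infc :: "nat => cell_map => nat => bool => bool" where
 "infc n g j e = ((ALL t:cell n. g t j = of_bool e))"

text \<open>The singular cubes over which a value is already forced: on operators by normalization,
  on cubes in the boundary by the values over the faces.\<close>

definition subA :: "nat => nat => cell_map set" where
 "subA N n = {g:sc N n. oper N n g | (EX j:{1..N}. EX e. infc n g j e)}"

text \<open>A natural prescription of all \<open>2 k\<close> faces in the first \<open>k\<close>
  directions. General \<open>k\<close> is needed because the induction on \<open>N\<close> trades
  one coordinate of the topological cube for one more such direction.\<close>

definition shell :: "'e cset => 'y cset => nat => (nat => bool => nat => 'y => 'e) => bool" where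
 "shell E Y k b =
   ((ALL m i c n y. k = Suc m --> 1 <= i --> i <= k --> y:cubes Y n --> b i c n y:cubes E (m + n)) &
   (ALL m i c a n y f. k = Suc m --> 1 <= i --> i <= k --> box_hom a n f --> y:cubes Y n -->
    b i c a (act Y a n y f) = tn E m a n (b i c n y) f) &
   (ALL m i j c d n y. k = Suc (Suc m) --> 1 <= i --> i < j --> j <= k --> y:cubes Y n -->
    fc E (m + n) (b j d n y) i c = fc E (m + n) (b i c n y) (j - 1) d))"

definition nat_fam :: "'e cset => 'y cset => nat => (nat => 'y set) => (nat => 'y => 'e) => bool" where
 "nat_fam E Y k A L = ((ALL n y. y:A n --> L n y:cubes E (k + n)) &
   (ALL a n f y. box_hom a n f --> y:A n --> L a (act Y a n y f) = tn E k a n (L n y) f))"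

definition has_shell :: "'e cset => nat => (nat => bool => nat => 'y => 'e) => (nat => 'y set) => (nat => 'y => 'e) => bool" where
 "has_shell E k b A L = ((ALL m i c n y. k = Suc m --> 1 <= i --> i <= k --> y:A n -->
   fc E (m + n) (L n y) i c = b i c n y))"

lemma shell_in: "shell E Y (Suc m) b ==> 1 <= i ==> i <= Suc m ==> y:cubes Y n ==> b i e n y:cubes E (m + n)"
 by (simp add: shell_def)

lemma shell_nat: "shell E Y (Suc m) b ==> 1 <= i ==> i <= Suc m ==> box_hom a n f ==> y:cubes Y n ==>
  b i e a (act Y a n y f) = tn E m a n (b i e n y) f"
 by (simp add: shell_def)

lemma shell_comp: "shell E Y (Suc (Suc m)) b ==> 1 <= i ==> i < j ==> j <= Suc (Suc m) ==> y:cubes Y n ==>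
  fc E (m + n) (b j d n y) i e = fc E (m + n) (b i e n y) (j - 1) d"
 by (simp add: shell_def)

lemma nat_fam_in: "nat_fam E Y k A L ==> y:A n ==> L n y:cubes E (k + n)"
 by (simp add: nat_fam_def)

lemma nat_fam_act: "nat_fam E Y k A L ==> box_hom a n f ==> y:A n ==>
  L a (act Y a n y f) = tn E k a n (L n y) f"
 by (simp add: nat_fam_def)

lemma has_shellD: "has_shell E (Suc m) b A L ==> 1 <= i ==> i <= Suc m ==> y:A n ==>
  fc E (m + n) (L n y) i e = b i e n y"
 by (simp add: has_shell_def)

declare plus_1_eq_Suc [simp]

text \<open>A parameter coordinate of the singular cube may equally be counted as direction
  \<open>k + 1\<close> of its value; operators on the remaining coordinates do not notice the
  difference.\<close>

lemma tens_Suc: "tens k (Suc a) (Suc n) (tens 1 a n f) = tens (Suc k) a n f"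
 using tens_tens[of k 1 a n f] by simp

lemma tens1_hom: "box_hom a n f ==> box_hom (Suc a) (Suc n) (tens 1 a n f)"
 using tens_hom[of a n f 1] by simp

lemma cell_nonempty: "EX t. t:cell n"
proof
 show "(\<lambda>j\<in>{1..n}. 0):cell n" by (rule cellI) simp
qed

lemma box_top_SC: "box_hom n N f ==> box_top n N f:sc N n"
 using box_top_PiE[of n N f] cts_box_top[of n N f] by (simp add: Sing_cubes PiE_def)

lemma SC_cell: "g:sc N n ==> t:cell n ==> g t:cell N"
 using Sing_topspace[of g "ct N" n t] by simp

lemma SC_eqI:
 assumes "g:sc N n" "h:sc N n" "!!t j. t:cell n ==> j:{1..N} ==> g t j = h t j"
 shows "g = h"
 by (rule Sing_eqI[OF assms(1,2)], rule cell_eqI[OF SC_cell[OF assms(1)] SC_cell[OF assms(2)]]) (use assms(3) in auto)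

lemma SC_I:
 assumes "!!t j. t:cell n ==> j:{1..N} ==> 0 <= f t j & f t j <= 1"
  and "!!j. j:{1..N} ==> cts (ct n) (%t. f t j)"
 shows "(\<lambda>t\<in>cell n. \<lambda>j\<in>{1..N}. f t j):sc N n"
proof (rule SingI, rule cts_cellI)
 show "(\<lambda>j\<in>{1..N}. f t j):cell N" if "t:topspace (ct n)" for t
  using assms(1) that by (intro cellI) auto
 show "cts (ct n) (%t. (\<lambda>j\<in>{1..N}. f t j) j)" if "j:{1..N}" for j
  using assms(2)[OF that] by simp
qed

lemma SC_continuous: "g:sc N n ==> j:{1..N} ==> cts (ct n) (%t. g t j)"
 by (rule cts_comp_proj[of _ N]) (simp_all add: Sing_cubes)

lemma cts_drp: "continuous_map (ct (m + n)) (ct n) (drp m n)"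
proof (rule cts_cellI)
 show "cts (ct (m + n)) (%t. drp m n t j)" if "j:{1..n}" for j
  using cts_proj[of "m + j" "m + n"] that by (simp add: drp_apply)
qed (simp add: drp_cell)

lemma cts_drp1: "continuous_map (ct (Suc n)) (ct n) (drp 1 n)"
 using cts_drp[of 1 n] by simp

lemma drp1_cell: "t:cell (Suc n) ==> drp 1 n t:cell n"
 using drp_cell[of t 1 n] by simp

lemma SC_continuous_drp: "g:sc N n ==> j:{1..N} ==>
  cts (ct (Suc n)) (%t. g (drp 1 n t) j)"
 using continuous_map_compose[OF cts_drp1 SC_continuous, of g N n j] by (simp add: o_def)

lemma SC_bounds: "g:sc N n ==> t:cell n ==> j:{1..N} ==> 0 <= g t j & g t j <= 1"
 by (rule cell_bounds[OF SC_cell])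

lemma box_top_tens1:
 assumes "box_hom a n f" "t:cell (Suc a)"
 shows "box_top (Suc a) (Suc n) (tens 1 a n f) t 1 = t 1"
  "drp 1 n (box_top (Suc a) (Suc n) (tens 1 a n f) t) = box_top a n f (drp 1 a t)"
proof -
 let ?d = "drp 1 n (box_top (Suc a) (Suc n) (tens 1 a n f) t)"
 have *: "box_top (Suc a) (Suc n) (tens 1 a n f) t =
   (\<lambda>j\<in>{1..Suc n}. if j <= 1 then t j else box_top a n f (drp 1 a t) (j - 1))"
  using box_top_tens[OF assms(1), of t 1] assms(2) by simp
 show "box_top (Suc a) (Suc n) (tens 1 a n f) t 1 = t 1" unfolding * by simp
 show "?d = box_top a n f (drp 1 a t)"
 proof (rule cell_eqI)
  show "?d:cell n"
   by (rule drp1_cell[OF box_top_cell[OF tens1_hom[OF assms(1)] assms(2)]])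
  show "box_top a n f (drp 1 a t):cell n" by (rule box_top_cell[OF assms(1) drp1_cell[OF assms(2)]])
 qed (simp add: drp_apply *)
qed

section \<open>Cones, cylinders and their ends for singular cubes\<close>

lemma face_fun_1: "t:cell n ==> face_fun (Suc n) 1 e t 1 = e & drp 1 n (face_fun (Suc n) 1 e t) = t"
 by (auto simp: face_fun_def drp_def cell_iff)

text \<open>Contracts the first coordinate of \<open>g\<close> to \<open>0\<close>, with the cone
  parameter as a new first variable. The minimum makes it a connection applied to the product with
  an interval, so operators go to operators.\<close>

definition dcone :: "nat => nat => cell_map => (nat => real) => nat => real" where
 "dcone N n g = (\<lambda>t\<in>cell (Suc n). \<lambda>j\<in>{1..Suc N}. if j = 1 then min (t 1) (g (drp 1 n t) 1) else g (drp 1 n t) j)"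

text \<open>The product with an interval, which is what the cone becomes over a cube whose first
  coordinate is constantly \<open>1\<close> (\<open>dcone_cylm\<close>).\<close>

definition cylm :: "nat => nat => cell_map => (nat => real) => nat => real" where
 "cylm N n h = (\<lambda>t\<in>cell (Suc n). \<lambda>j\<in>{1..Suc N}. if j = 1 then t 1 else h (drp 1 n t) (j - 1))"

definition capm :: "nat => bool => nat => cell_map => (nat => real) => nat => real" where
 "capm N e n h = (\<lambda>t\<in>cell n. \<lambda>j\<in>{1..Suc N}. if j = 1 then of_bool e else h t (j - 1))"

definition tailm :: "nat => nat => cell_map => (nat => real) => nat => real" where
 "tailm N n g = (\<lambda>t\<in>cell n. \<lambda>j\<in>{1..N}. g t (Suc j))"

lemma pred_mem: "j:{1..Suc N} ==> j ~= 1 ==> j - 1:{1..N}"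
 by (simp; arith)

lemma SC_consI:
 assumes "!!t. t:cell n ==> 0 <= a t & a t <= 1" "cts (ct n) a"
  and "!!t j. t:cell n ==> j:{1..Suc N} ==> j ~= 1 ==> 0 <= b t j & b t j <= 1"
  and "!!j. j:{1..Suc N} ==> j ~= 1 ==> cts (ct n) (%t. b t j)"
 shows "(\<lambda>t\<in>cell n. \<lambda>j\<in>{1..Suc N}. if j = 1 then a t else b t j):sc (Suc N) n"
proof (rule SC_I)
 show "cts (ct n) (%t. if j = 1 then a t else b t j)" if "j:{1..Suc N}" for j
  using assms(2) assms(4)[OF that] by (cases "j = 1") auto
qed (use assms(1,3) in auto)

lemma dcone_in: "g:sc (Suc N) n ==> dcone N n g:sc (Suc N) (Suc n)"
 unfolding dcone_def
 by (rule SC_consI) (use SC_bounds[of g "Suc N" n] drp1_cell cell_bounds[of _ "Suc n" 1] SC_continuous_drp[of g "Suc N" n]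
   cts_proj[of 1 "Suc n"] in \<open>auto intro!: continuous_map_real_min simp: min_le_iff_disj\<close>)

lemma cylm_in: "h:sc N n ==> cylm N n h:sc (Suc N) (Suc n)"
 unfolding cylm_def
 by (rule SC_consI) (use SC_bounds[OF _ drp1_cell pred_mem, of h N n] cell_bounds[of _ "Suc n" 1]
   SC_continuous_drp[OF _ pred_mem, of h N n] cts_proj[of 1 "Suc n"] in auto)

lemma capm_in: "h:sc N n ==> capm N e n h:sc (Suc N) n"
 unfolding capm_def
 by (rule SC_consI) (use SC_bounds[OF _ _ pred_mem, of h N n] SC_continuous[OF _ pred_mem, of h N n] in auto)

lemma tailm_in: "g:sc (Suc N) n ==> tailm N n g:sc N n"
 unfolding tailm_def by (rule SC_I) (use SC_bounds[of g "Suc N" n] SC_continuous[of g "Suc N" n] in auto)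

lemmas SC_act_in = act_in[OF Sing_cset]

lemma dcone_act:
 assumes f: "box_hom a n f" and g: "g:sc (Suc N) n"
 shows "dcone N a (act (SC (Suc N)) a n g f) = act (SC (Suc N)) (Suc a) (Suc n) (dcone N n g) (tens 1 a n f)"
 by (rule SC_eqI[OF dcone_in[OF SC_act_in[OF f g]] SC_act_in[OF tens1_hom[OF f] dcone_in[OF g]]])
  (use box_top_cell[OF tens1_hom[OF f]] drp1_cell in
   \<open>simp_all add: Sing_act_apply dcone_def box_top_tens1[OF f]\<close>)

lemma cylm_act:
 assumes f: "box_hom a n f" and g: "h:sc N n"
 shows "cylm N a (act (SC N) a n h f) = act (SC (Suc N)) (Suc a) (Suc n) (cylm N n h) (tens 1 a n f)"
 by (rule SC_eqI[OF cylm_in[OF SC_act_in[OF f g]] SC_act_in[OF tens1_hom[OF f] cylm_in[OF g]]])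
  (use box_top_cell[OF tens1_hom[OF f]] drp1_cell in
   \<open>simp_all add: Sing_act_apply cylm_def box_top_tens1[OF f]\<close>)

lemma capm_act:
 assumes f: "box_hom a n f" and g: "h:sc N n"
 shows "capm N e a (act (SC N) a n h f) = act (SC (Suc N)) a n (capm N e n h) f"
 by (rule SC_eqI[OF capm_in[OF SC_act_in[OF f g]] SC_act_in[OF f capm_in[OF g]]])
  (use box_top_cell[OF f] in \<open>simp_all add: Sing_act_apply capm_def\<close>)

lemma tailm_act:
 assumes f: "box_hom a n f" and g: "g:sc (Suc N) n"
 shows "tailm N a (act (SC (Suc N)) a n g f) = act (SC N) a n (tailm N n g) f"
 by (rule SC_eqI[OF tailm_in[OF SC_act_in[OF f g]] SC_act_in[OF f tailm_in[OF g]]])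
  (use box_top_cell[OF f] in \<open>simp_all add: Sing_act_apply tailm_def\<close>)

lemma fc_dcone:
 assumes g: "g:sc (Suc N) n"
 shows "fc (SC (Suc N)) n (dcone N n g) 1 True = g" "fc (SC (Suc N)) n (dcone N n g) 1 False = capm N False n (tailm N n g)"
proof -
 let ?d = "dcone N n g"
 let ?S = "SC (Suc N)"
 have f: "fc ?S n ?d 1 e:sc (Suc N) n" for e
  by (rule fc_in[OF Sing_cset dcone_in[OF g]]) auto
 have a: "fc ?S n ?d 1 e t j = (if j = 1 then min (of_bool e) (g t 1) else g t j)"
  if "t:cell n" "j:{1..Suc N}" for e t j
  using that face_fun_cell[of 1 n t e] face_fun_1[OF that(1), of "of_bool e"]
  unfolding Sing_fc[OF dcone_in[OF g] order_refl le_add1[of 1 n, unfolded plus_1_eq_Suc] that(1)] by (simp add: dcone_def)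
 show "fc ?S n ?d 1 True = g"
  by (rule SC_eqI[OF f g]) (use SC_bounds[OF g, of _ 1] in \<open>simp add: a\<close>)
 show "fc ?S n ?d 1 False = capm N False n (tailm N n g)"
  by (rule SC_eqI[OF f capm_in[OF tailm_in[OF g]]])
   (use SC_bounds[OF g, of _ 1] in \<open>auto simp: a capm_def tailm_def\<close>)
qed

lemma fc_cylm:
 assumes h: "h:sc N n"
 shows "fc (SC (Suc N)) n (cylm N n h) 1 e = capm N e n h"
proof (rule SC_eqI)
 show "fc (SC (Suc N)) n (cylm N n h) 1 e:sc (Suc N) n"
  by (rule fc_in[OF Sing_cset cylm_in[OF h]]) auto
 show "capm N e n h:sc (Suc N) n" by (rule capm_in[OF h])
 fix t j assume t: "t:cell n" and j: "j:{1..Suc N}"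
 show "fc (SC (Suc N)) n (cylm N n h) 1 e t j = capm N e n h t j"
  unfolding Sing_fc[OF cylm_in[OF h] order_refl le_add1[of 1 n, unfolded plus_1_eq_Suc] t]
  using face_fun_cell[of 1 n t e] face_fun_1[OF t, of "of_bool e"] t
  by (simp add: cylm_def capm_def)
qed

lemma capm_tailm: "g:sc (Suc N) n ==> infc n g 1 e ==> capm N e n (tailm N n g) = g"
 by (rule SC_eqI[OF capm_in[OF tailm_in]]) (auto simp: capm_def tailm_def infc_def)

lemma dcone_cylm:
 assumes g: "g:sc (Suc N) n" "infc n g 1 True"
 shows "dcone N n g = cylm N n (tailm N n g)"
proof (rule SC_eqI[OF dcone_in[OF g(1)] cylm_in[OF tailm_in[OF g(1)]]])
 fix t j assume "t:cell (Suc n)" "j:{1..Suc N}"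
 thus "dcone N n g t j = cylm N n (tailm N n g) t j"
  using g(2) drp1_cell[of t n] cell_bounds[of t "Suc n" 1]
  by (auto simp: dcone_def cylm_def tailm_def infc_def)
qed

lemma oper_act: "box_hom a n f ==> oper N n g ==> oper N a (act (SC N) a n g f)"
 unfolding oper_def Sing_act using box_hom.comp box_top_compose by metis

lemma infc_act: "box_hom a n f ==> infc n g j e ==> infc a (act (SC N) a n g f) j e"
 by (simp add: infc_def Sing_act_apply box_top_cell)

lemma subA_act: "box_hom a n f ==> g:subA N n ==> act (SC N) a n g f:subA N a"
 unfolding subA_def using oper_act infc_act SC_act_in by blast

lemma subA_in: "g:subA N n ==> g:sc N n"
 by (simp add: subA_def)

lemma subA_infc: "g:sc N n ==> j:{1..N} ==> infc n g j e ==> g:subA N n"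
 by (auto simp: subA_def)

lemma capm_subA: "h:sc N n ==> capm N e n h:subA (Suc N) n"
 by (rule subA_infc[OF capm_in, of _ _ _ 1]) (auto simp: infc_def capm_def)

lemma oper_cylm: "oper N n h ==> oper (Suc N) (Suc n) (cylm N n h)"
proof -
 assume "oper N n h"
 then obtain f where f: "box_hom n N f" "h = box_top n N f" unfolding oper_def by (elim exE conjE)
 have "cylm N n h = box_top (Suc n) (Suc N) (tens 1 n N f)"
 proof (rule SC_eqI[OF cylm_in box_top_SC[OF tens1_hom[OF f(1)]]])
  fix t j assume t: "t:cell (Suc n)" and j: "j:{1..Suc N}"
  show "cylm N n h t j = box_top (Suc n) (Suc N) (tens 1 n N f) t j"
   using box_top_tens[OF f(1), of t 1] t by (auto simp: cylm_def f(2))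
 qed (simp add: f box_top_SC)
 thus ?thesis using tens1_hom[OF f(1)] unfolding oper_def by metis
qed

lemma cylm_subA: "h:subA N n ==> cylm N n h:subA (Suc N) (Suc n)"
proof -
 assume h: "h:subA N n"
 then consider "oper N n h" | j e where "j:{1..N}" "infc n h j e" by (auto simp: subA_def)
 thus ?thesis
 proof cases
  case 1
  thus ?thesis using oper_cylm cylm_in[OF subA_in[OF h]] by (simp add: subA_def)
 next
  case 2
  show ?thesis
   by (rule subA_infc[OF cylm_in[OF subA_in[OF h]], of "Suc j" e])
    (use 2 drp1_cell in \<open>auto simp: infc_def cylm_def\<close>)
 qed
qed

lemma oper_tailm: "oper (Suc N) n g ==> oper N n (tailm N n g)"
proof -
 let ?b = "box_degen (Suc N) 1"
 assume "oper (Suc N) n g"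
 then obtain f where f: "box_hom n (Suc N) f" "g = box_top n (Suc N) f" unfolding oper_def by (elim exE conjE)
 have d: "box_hom (Suc N) N ?b" by (rule degen_hom) auto
 have "tailm N n g = box_top n N (vcomp n ?b f)"
 proof (rule SC_eqI[OF tailm_in box_top_SC[OF box_hom.comp[OF f(1) d]]])
  fix t j assume t: "t:cell n" and j: "j:{1..N}"
  show "tailm N n g t j = box_top n N (vcomp n ?b f) t j"
   using t by (simp add: tailm_def box_top_comp[OF f(1) d] box_top_degen box_top_cell[OF f(1)] degen_fun_def f(2))
 qed (simp add: f box_top_SC)
 thus ?thesis using box_hom.comp[OF f(1) d] unfolding oper_def by metis
qed

text \<open>Deleting the first coordinate can only destroy the property of lying in a face of that
  coordinate; an operator stays an operator.\<close>

lemma tailm_subA: "g:subA (Suc N) n ==> infc n g 1 True | infc n g 1 False | tailm N n g:subA N n"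
proof -
 assume g: "g:subA (Suc N) n"
 then consider "oper (Suc N) n g" | j e where "j:{1..Suc N}" "infc n g j e" by (auto simp: subA_def)
 thus ?thesis
 proof cases
  case 1
  thus ?thesis using oper_tailm tailm_in[OF subA_in[OF g]] by (simp add: subA_def)
 next
  case 2
  show ?thesis
  proof (cases "j = 1")
   case True
   thus ?thesis using 2(2) by (cases e) simp_all
  next
   case False
   hence "tailm N n g:subA N n"
    by (intro subA_infc[OF tailm_in[OF subA_in[OF g]] pred_mem[OF 2(1)], of e])
     (use 2 pred_mem[OF 2(1)] in \<open>auto simp: infc_def tailm_def\<close>)
   thus ?thesis by simp
  qed
 qed
qed

lemma oper_dcone: "oper (Suc N) n g ==> oper (Suc N) (Suc n) (dcone N n g)"
proof -
 let ?S = "Suc N"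
 let ?b = "box_conn (Suc ?S) 1 True"
 let ?n = "Suc n"
 assume "oper ?S n g"
 then obtain f where f: "box_hom n ?S f" "g = box_top n ?S f" unfolding oper_def by (elim exE conjE)
 have c: "box_hom (Suc ?S) ?S ?b" by (rule conn_hom) auto
 note h = box_hom.comp[OF tens1_hom[OF f(1)] c]
 have "dcone N n g = box_top ?n ?S (vcomp ?n ?b (tens 1 n ?S f))"
 proof (rule SC_eqI[OF dcone_in box_top_SC[OF h]])
  fix t j assume t: "t:cell ?n" and j: "j:{1..Suc N}"
  note b = box_top_cell[OF tens1_hom[OF f(1)] t]
  have e: "box_top ?n (Suc ?S) (tens 1 n ?S f) t =
   (\<lambda>j\<in>{1..Suc ?S}. if j <= 1 then t j else box_top n ?S f (drp 1 n t) (j - 1))"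
   using box_top_tens[OF f(1), of t 1] t by simp
  show "dcone N n g t j = box_top ?n ?S (vcomp ?n ?b (tens 1 n ?S f)) t j"
   unfolding box_top_comp[OF tens1_hom[OF f(1)] c t] e
   using t j by (auto simp: dcone_def box_top_conn[OF _ b[unfolded e]] conn_fun_def f(2) simp flip: One_nat_def)
 qed (simp add: f box_top_SC)
 thus ?thesis using h unfolding oper_def by metis
qed

text \<open>The critical case is a first coordinate constantly \<open>1\<close>: the cone is then a
  cylinder over the tail, and lies in \<open>subA\<close> by the hypothesis on that tail. In the
  other cases the cone is an operator or stays in the same face.\<close>

lemma dcone_subA:
 assumes g: "g:subA (Suc N) n" and a: "infc n g 1 True ==> tailm N n g:subA N n"
 shows "dcone N n g:subA (Suc N) (Suc n)"
proof -
 note g' = subA_in[OF g]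
 consider "oper (Suc N) n g" | "infc n g 1 True" | "infc n g 1 False"
  | j e where "j:{1..Suc N}" "j ~= 1" "infc n g j e"
  using g by (auto simp: subA_def) (metis (full_types))
 thus ?thesis
 proof cases
  case 1
  thus ?thesis using oper_dcone dcone_in[OF g'] by (simp add: subA_def)
 next
  case 2
  thus ?thesis using cylm_subA[OF a] dcone_cylm[OF g'] by simp
 next
  case 3
  show ?thesis
   by (rule subA_infc[OF dcone_in[OF g'], of 1 False])
    (use 3 drp1_cell cell_bounds[of _ "Suc n" 1] in \<open>auto simp: infc_def dcone_def\<close>)
 next
  case 4
  show ?thesis
   by (rule subA_infc[OF dcone_in[OF g'], of j e])
    (use 4 drp1_cell in \<open>auto simp: infc_def dcone_def\<close>)
 qed
qed

lemma bang_hom: "box_hom n 0 (box_bang n)"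
proof -
 have h: "EX f. box_hom n 0 f"
 proof (induction n)
  case 0
  thus ?case using box_hom.id by blast
 next
  case (Suc n)
  have "box_hom (Suc n) n (box_degen (Suc n) 1)" by (rule degen_hom) auto
  thus ?case using Suc box_hom.comp by blast
 qed
 then obtain f where f: "box_hom n 0 f" ..
 have "box_bang n:vert n \<rightarrow>\<^sub>E vert 0" unfolding box_bang_def restrict_PiE_iff by (simp add: vert_iff)
 hence "box_bang n = f" by (rule box_eqI[OF _ hom_PiE[OF f]]) simp
 thus ?thesis using f by simp
qed

lemma SC_0: "g:sc 0 n ==> g = box_top n 0 (box_bang n)"
 by (rule SC_eqI[OF _ box_top_SC[OF bang_hom]]) auto

lemma subA_0: "g:sc 0 n ==> g:subA 0 n"
 unfolding subA_def oper_def using SC_0 bang_hom by blast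

text \<open>Shell for values with \<open>k + 1\<close> directions: in the first \<open>k\<close> the
  given shell on a cone or cylinder \<open>y\<close>, in the last one the known family on its end
  \<open>z\<close>.\<close>

definition glue :: "nat => (nat => bool => nat => 'y => 'e) => (nat => 'y => 'e) => nat => bool => nat => 'y => 'y => 'e" where
 "glue k b LA i c n y z = (if i <= k then b i c (Suc n) y else LA n z)"

lemma face1_hom: "box_hom n (Suc n) (box_face (Suc n) 1 c)"
 by (rule face_hom) auto

lemma glue_in:
 assumes "shell E (SC N) k b" "nat_fam E (SC N) k A LA" "1 <= i" "y:sc N (Suc n)" "z:A n"
 shows "glue k b LA i c n y z:cubes E (k + n)"
 using assms shell_in[of E "SC N" "k - 1" b i y "Suc n" c] nat_fam_in[of E "SC N" k A LA z n] by (cases k) (auto simp: glue_def)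

lemma glue_nat:
 assumes "shell E (SC N) k b" "nat_fam E (SC N) k A LA" "1 <= i" "box_hom a n p" "y:sc N (Suc n)" "z:A n"
 shows "glue k b LA i c a (act (SC N) (Suc a) (Suc n) y (tens 1 a n p)) (act (SC N) a n z p) = tn E k a n (glue k b LA i c n y z) p"
 using assms shell_nat[of E "SC N" "k - 1" b i "Suc a" "Suc n" "tens 1 a n p" y c] nat_fam_act[of E "SC N" k A LA a n p z]
  tens1_hom[of a n p] by (cases k) (auto simp: glue_def tens_Suc)

lemma shell_face1: "shell E (SC N) (Suc m) b ==> 1 <= i ==> i <= Suc m ==> y:sc N (Suc n) ==>
  fc E (m + n) (b i c (Suc n) y) (Suc m) u = b i c n (fc (SC N) n y 1 u)"
 using shell_nat[of E "SC N" m b i n "Suc n" _ y c, OF _ _ _ face1_hom] tn_face[of 1 n E m _ u] by simp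

lemma glue_comp:
 assumes b: "shell E (SC N) k b" and LA: "has_shell E k b A LA" and k: "k = Suc m" and ij: "1 <= i" "i < j" "j <= Suc k"
  and y: "y:sc N (Suc n)" and z: "z:A n" and yz: "j = Suc k ==> fc (SC N) n y 1 u = z"
 shows "fc E (m + n) (glue k b LA j u n y z) i c = fc E (m + n) (glue k b LA i c n y z') (j - 1) u"
proof (cases "j <= k")
 case True
 then obtain m' where m': "m = Suc m'" using ij k by (cases m) auto
 show ?thesis using shell_comp[OF b[unfolded k m'] ij(1,2) _ y, of u c] True ij k m' by (simp add: glue_def)
next
 case False
 hence i: "j = Suc k" "i <= Suc m" using ij k by auto
 have "fc E (m + n) (b i c (Suc n) y) (Suc m) u = b i c n (fc (SC N) n y 1 u)"
  by (rule shell_face1[OF b[unfolded k] ij(1) i(2) y])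
 thus ?thesis using has_shellD[OF LA[unfolded k] ij(1) i(2) z] yz i k by (simp add: glue_def)
qed

text \<open>Contracting the first coordinate reduces the extension to filling open boxes with one
  more direction. Cones over \<open>subA\<close> stay in \<open>subA\<close>, except that a first
  coordinate constantly \<open>1\<close> gives a cylinder over an arbitrary singular cube of one
  dimension less. Cylinders are therefore handled beforehand, by the induction hypothesis with
  \<open>k + 1\<close> directions (the family \<open>K\<close>). After compatible filling, the
  missing face is the desired extension.\<close>

lemma extend_step:
 fixes E :: "'e cset"
 assumes E: "kanE E" and IH: "!!b LA. shell E (SC N) (Suc k) b ==> nat_fam E (SC N) (Suc k) (subA N) LA ==>
   has_shell E (Suc k) b (subA N) LA ==>
   EX L. nat_fam E (SC N) (Suc k) (cubes (SC N)) L & has_shell E (Suc k) b (cubes (SC N)) L &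
    (ALL n g. g:subA N n --> L n g = LA n g)"
  and b: "shell E (SC (Suc N)) k b" and LA: "nat_fam E (SC (Suc N)) k (subA (Suc N)) LA"
  and LA_b: "has_shell E k b (subA (Suc N)) LA"
 shows "EX L. nat_fam E (SC (Suc N)) k (cubes (SC (Suc N))) L & has_shell E k b (cubes (SC (Suc N))) L &
    (ALL n g. g:subA (Suc N) n --> L n g = LA n g)"
proof -
 let ?S = "SC (Suc N)"
 let ?k = "Suc k"
 let ?N = "Suc N"
 let ?b = "SC N"
 let ?n = "%n h. LA (Suc n) (cylm N n h)"
 let ?c = "cubes ?b"
 note Ec = kanE_cset[OF E]
 have cap: "capm N c n h:subA ?N n" if "h:sc N n" for c n h
  using that by (rule capm_subA)
 have tf: "tn E m n (Suc n) x (box_face (Suc n) 1 c) = fc E (m + n) x (Suc m) c" for m n x c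
  using tn_face[of 1 n E m x c] by simp
 have LA_face: "fc E (k + n) (LA (Suc n) y) ?k c = LA n (fc ?S n y 1 c)"
  if "y:subA ?N (Suc n)" for n y c
  using nat_fam_act[OF LA face1_hom that] tf by simp
 \<comment> \<open>The ends of a cylinder lie on the boundary, so \<open>LA\<close> already supplies
   the faces in direction \<open>k + 1\<close>.\<close>
 define b1 where "b1 i c n h = glue k b LA i c n (cylm N n h) (capm N c n h)" for i c n h
 have b1_shell: "shell E ?b ?k b1"
  unfolding shell_def
 proof (intro conjI allI impI)
  fix m i c n h assume "?k = Suc m" "1 <= i" "i <= ?k" "h:sc N n"
  thus "b1 i c n h:cubes E (m + n)" unfolding b1_def using glue_in[OF b LA _ cylm_in cap] by simp
 next
  fix m i c a n h p assume "?k = Suc m" "1 <= i" "i <= ?k" "box_hom a n p" "h:sc N n"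
  thus "b1 i c a (act ?b a n h p) = tn E m a n (b1 i c n h) p"
   unfolding b1_def using glue_nat[OF b LA _ _ cylm_in cap] by (simp add: cylm_act capm_act)
 next
  fix m i j c u n h assume m: "?k = Suc (Suc m)" "1 <= i" "i < j" "j <= ?k" and h: "h:sc N n"
  show "fc E (m + n) (b1 j u n h) i c = fc E (m + n) (b1 i c n h) (j - 1) u"
   unfolding b1_def by (rule glue_comp[OF b LA_b _ _ _ _ cylm_in[OF h] cap[OF h]]) (use m fc_cylm[OF h] in auto)
 qed
 have "nat_fam E ?b ?k (subA N) ?n"
  unfolding nat_fam_def
 proof (intro conjI allI impI)
  fix n h assume h: "h:subA N n"
  show "LA (Suc n) (cylm N n h):cubes E (Suc k + n)"
   using nat_fam_in[OF LA cylm_subA[OF h]] by simp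
 next
  fix a n p h assume p: "box_hom a n p" and h: "h:subA N n"
  show "LA (Suc a) (cylm N a (act ?b a n h p)) = tn E ?k a n (LA (Suc n) (cylm N n h)) p"
   using nat_fam_act[OF LA tens1_hom[OF p] cylm_subA[OF h]] by (simp add: cylm_act[OF p subA_in[OF h]] tens_Suc)
 qed
 moreover have "has_shell E ?k b1 (subA N) ?n"
  unfolding has_shell_def
 proof (intro allI impI)
  fix m i c n h assume m: "?k = Suc m" and i: "1 <= i" "i <= ?k" and h: "h:subA N n"
  show "fc E (m + n) (LA (Suc n) (cylm N n h)) i c = b1 i c n h"
  proof (cases "i <= k")
   case True
   then obtain k' where k': "k = Suc k'" using i by (cases k) auto
   thus ?thesis using has_shellD[OF LA_b[unfolded k'] i(1) _ cylm_subA[OF h], of c] True m by (auto simp: b1_def glue_def)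
  next
   case False
   hence "i = ?k" using i by simp
   thus ?thesis using LA_face[OF cylm_subA[OF h]] m fc_cylm[OF subA_in[OF h]] by (simp add: b1_def glue_def)
  qed
 qed
 ultimately have "EX L. nat_fam E ?b ?k ?c L & has_shell E ?k b1 ?c L &
    (ALL n g. g:subA N n --> L n g = LA (Suc n) (cylm N n g))"
  using IH[OF b1_shell] by simp
 then obtain K where K: "nat_fam E ?b ?k ?c K" "has_shell E ?k b1 ?c K"
  "ALL n g. g:subA N n --> K n g = LA (Suc n) (cylm N n g)" by (elim exE conjE)

 define b2 where "b2 i c n g = glue k b LA i c n (dcone N n g) (capm N False n (tailm N n g))" for i c n g
 \<comment> \<open>On \<open>subA\<close> the filler is prescribed as the value on the cone, or by
   \<open>K\<close> when the cone is a cylinder. The next fact says that both agree where both make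
   sense.\<close>
 define LB where "LB n g = (if infc n g 1 True then K n (tailm N n g) else LA (Suc n) (dcone N n g))" for n g
 have LB: "LB n g = LA (Suc n) (dcone N n g) & dcone N n g:subA ?N (Suc n)"
  if g: "g:subA ?N n" "infc n g 1 True ==> tailm N n g:subA N n" for n g
  using K(3) that dcone_cylm[OF subA_in[OF g(1)]] dcone_subA[OF g] by (simp add: LB_def)
 have "EX L. (ALL n y. y:cubes ?S n --> L n y:cubes E (Suc k + n)) &
  (ALL a n p y. box_hom a n p --> y:cubes ?S n --> L a (act ?S a n y p) = tn E ?k a n (L n y) p) &
  (ALL i c n y. 1 <= i --> i <= Suc k --> (i, c) ~= (Suc k, True) --> y:cubes ?S n --> fc E (k + n) (L n y) i c = b2 i c n y) &
  (ALL n y. y:subA ?N n --> L n y = LB n y)" (is "EX L. ?P L")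
 proof (rule natural_filling[OF E Sing_cset])
  show "?k:{1..Suc k}" by simp
 next
  fix i c n g assume "1 <= i" "i <= ?k" "(i, c) ~= (?k, True)" and g: "g:cubes ?S n"
  thus "b2 i c n g:cubes E (k + n)" unfolding b2_def using glue_in[OF b LA _ dcone_in[OF g] cap[OF tailm_in[OF g]]] by simp
 next
  fix i c a n g p assume "1 <= i" "i <= ?k" "(i, c) ~= (?k, True)" and p: "box_hom a n p" and g: "g:cubes ?S n"
  thus "b2 i c a (act ?S a n g p) = tn E k a n (b2 i c n g) p"
   unfolding b2_def using glue_nat[OF b LA _ p dcone_in[OF g] cap[OF tailm_in[OF g]]]
   by (simp add: dcone_act tailm_act capm_act tailm_in)
 next
  fix m i j c u n g assume k: "k = Suc m" "1 <= i" "i < j" "j <= ?k" "(j, u) ~= (?k, True)" and g: "g:cubes ?S n"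
  show "fc E (m + n) (b2 j u n g) i c = fc E (m + n) (b2 i c n g) (j - 1) u"
   unfolding b2_def
   by (rule glue_comp[OF b LA_b k(1-4) dcone_in[OF g] cap[OF tailm_in[OF g]]]) (use k fc_dcone(2)[OF g] in auto)
 next
  show "g:subA ?N n ==> g:cubes ?S n" for n g by (rule subA_in)
  show "box_hom a n p ==> g:subA ?N n ==> act ?S a n g p:subA ?N a" for a n p g by (rule subA_act)
 next
  fix n g assume g: "g:subA ?N n"
  show "LB n g:cubes E (Suc k + n)"
  proof (cases "infc n g 1 True")
   case True
   thus ?thesis using nat_fam_in[OF K(1) tailm_in[OF subA_in[OF g]]] by (simp add: LB_def)
  next
   case False
   thus ?thesis using nat_fam_in[OF LA conjunct2[OF LB[OF g]]] by (simp add: LB_def)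
  qed
 next
  fix a n p g assume p: "box_hom a n p" and g: "g:subA ?N n"
  note g' = subA_in[OF g] and ga = subA_act[OF p g]
  let ?a = "act ?S a n g p"
  show "LB a ?a = tn E ?k a n (LB n g) p"
  proof (cases "infc n g 1 True")
   case True
   thus ?thesis
    using infc_act[OF p True] nat_fam_act[OF K(1) p tailm_in[OF g']] by (simp add: LB_def tailm_act[OF p g'])
  next
   \<comment> \<open>Restriction may make the first coordinate constantly \<open>1\<close>. The tail
     of \<open>g\<close> then lies in \<open>subA\<close>, so the two branches of \<open>LB\<close>
     agree on the restricted cube.\<close>
   case False
   have "tailm N a ?a:subA N a" if t: "infc a ?a 1 True"
   proof -
    have "~ infc n g 1 False"
    proof
     assume "infc n g 1 False"
     from infc_act[OF p this, of ?N] t cell_nonempty[of a] show False by (auto simp: infc_def)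
    qed
    hence "tailm N n g:subA N n" using tailm_subA[OF g] False by simp
    thus ?thesis using subA_act[OF p] tailm_act[OF p g'] by simp
   qed
   hence "LB a ?a = LA (Suc a) (dcone N a ?a)" using LB[OF ga] by simp
   also have "\<dots> = tn E ?k a n (LA (Suc n) (dcone N n g)) p"
    using nat_fam_act[OF LA tens1_hom[OF p] conjunct2[OF LB[OF g]]] False
    by (simp add: dcone_act[OF p g'] tens_Suc)
   finally show ?thesis using False by (simp add: LB_def)
  qed
 next
  fix i c n g assume i: "1 <= i" "i <= ?k" "(i, c) ~= (Suc k, True)" and g: "g:subA ?N n"
  note g' = subA_in[OF g]
  show "fc E (k + n) (LB n g) i c = b2 i c n g"
  proof (cases "infc n g 1 True")
   case True
   thus ?thesis
    using has_shellD[OF K(2) i(1,2) tailm_in[OF g'], of c] i dcone_cylm[OF g' True]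
    by (auto simp: LB_def b1_def b2_def glue_def)
  next
   case False
   note d = conjunct2[OF LB[OF g]]
   show ?thesis
   proof (cases "i <= k")
    case True
    then obtain k' where k': "k = Suc k'" using i by (cases k) auto
    thus ?thesis using has_shellD[OF LA_b[unfolded k'] i(1) _ d, of c] True False by (simp add: b2_def glue_def LB_def)
   next
    case f: False
    hence "i = ?k" "c = False" using i by auto
    thus ?thesis using LA_face[OF d, of False] False fc_dcone(2)[OF g'] by (simp add: b2_def glue_def LB_def)
   qed
  qed
 qed
 then obtain w where w: "?P w" ..
 note w = w[THEN conjunct1] w[THEN conjunct2, THEN conjunct1] w[THEN conjunct2, THEN conjunct2, THEN conjunct1]
  w[THEN conjunct2, THEN conjunct2, THEN conjunct2]
 \<comment> \<open>The face missing from the open box, above the end at which the cone of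
   \<open>g\<close> is \<open>g\<close> itself.\<close>
 define L where "L n g = fc E (k + n) (w n g) ?k True" for n g
 have w_in: "w n g:cubes E (Suc k + n)" if "g:cubes ?S n" for n g using w(1) that by simp
 have "nat_fam E ?S k (cubes ?S) L"
  unfolding nat_fam_def
 proof (intro conjI allI impI)
  fix n g assume g: "g:cubes ?S n"
  show "L n g:cubes E (k + n)" unfolding L_def by (rule fc_in[OF Ec]) (use w_in[OF g] in auto)
 next
  fix a n p g assume p: "box_hom a n p" and g: "g:cubes ?S n"
  have "w a (act ?S a n g p) = tn E ?k a n (w n g) p" using w(2) p g by simp
  thus "L a (act ?S a n g p) = tn E k a n (L n g) p"
   using fc_tn[OF Ec w_in[OF g] p, of ?k True] by (simp add: L_def)
 qed
 moreover have "has_shell E k b (cubes ?S) L"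
  unfolding has_shell_def
 proof (intro allI impI)
  fix m i c n g assume k: "k = Suc m" and i: "1 <= i" "i <= k" and g: "g:cubes ?S n"
  let ?m = "m + n"
  let ?i = "b i c (Suc n) (dcone N n g)"
  have wi: "w n g:cubes E (Suc (Suc ?m))" using w_in[OF g] k by simp
  have "fc E ?m (L n g) i c = fc E ?m (fc E (Suc ?m) (w n g) i c) (Suc m) True"
   using fc_fc[OF Ec wi i(1), of ?k True c] i k by (simp add: L_def)
  also have "fc E (Suc ?m) (w n g) i c = ?i"
   using w(3)[rule_format, of i c g n] i g k by (simp add: b2_def glue_def)
  also have "fc E ?m ?i (Suc m) True = b i c n g"
   using shell_face1[OF b[unfolded k] i(1) i(2)[unfolded k] dcone_in[OF g], of c True] fc_dcone(1)[OF g] by simp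
  finally show "fc E ?m (L n g) i c = b i c n g" .
 qed
 moreover have "L n g = LA n g" if g: "g:subA ?N n" for n g
 proof (cases "infc n g 1 True")
  case True
  note h = tailm_in[OF subA_in[OF g]]
  have "L n g = fc E (k + n) (K n (tailm N n g)) ?k True" using w(4) g True by (simp add: L_def LB_def)
  also have "\<dots> = LA n (capm N True n (tailm N n g))"
   using has_shellD[OF K(2) _ _ h, of ?k True] by (simp add: b1_def glue_def)
  also have "\<dots> = LA n g" using capm_tailm[OF subA_in[OF g] True] by simp
  finally show ?thesis .
 next
  case False
  thus ?thesis
   using w(4) g LA_face[OF conjunct2[OF LB[OF g]], of True] fc_dcone(1)[OF subA_in[OF g]] by (simp add: L_def LB_def)
 qed
 ultimately show ?thesis by (intro exI[of _ L]) simp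
qed

text \<open>Induction on \<open>N\<close> for all \<open>k\<close> at once; over the point every
  singular cube is an operator, so nothing has to be extended.\<close>

lemma extend_operators:
 fixes E :: "'e cset"
 assumes E: "kanE E"
 shows "shell E (SC N) k b ==> nat_fam E (SC N) k (subA N) LA ==> has_shell E k b (subA N) LA ==>
  EX L. nat_fam E (SC N) k (cubes (SC N)) L & has_shell E k b (cubes (SC N)) L &
    (ALL n g. g:subA N n --> L n g = LA n g)"
proof (induction N arbitrary: k b LA)
 case 0
 have "cubes (SC 0) = subA 0" using subA_0 subA_in by (intro ext) blast
 thus ?case using 0 by (intro exI[of _ LA]) simp
next
 case (Suc N)
 show ?case by (rule extend_step[OF E Suc.IH Suc.prems])
qed

section \<open>Lifting cubes of topological cubes to a cubical set\<close>

definition push :: "nat => nat => box_map => nat => cell_map => (nat => real) => nat => real" where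
 "push M N h n g = compose (cell n) (box_top M N h) g"

lemma push_apply: "t:cell n ==> push M N h n g t = box_top M N h (g t)"
 by (simp add: push_def compose_eq)

lemma push_in: "box_hom M N h ==> g:sc M n ==> push M N h n g:sc N n"
 unfolding push_def compose_def
 by (rule SingI)
  (use continuous_map_compose[of "ct n" "ct M" g "ct N" "box_top M N h"]
    cts_box_top[of M N h] in \<open>simp add: Sing_cubes o_def\<close>)

lemma push_push:
 assumes "box_hom L M h" "box_hom M N h'" "g:sc L n"
 shows "push M N h' n (push L M h n g) = push L N (vcomp L h' h) n g"
 by (rule Sing_eqI[OF push_in[OF assms(2) push_in[OF assms(1,3)]] push_in[OF box_hom.comp[OF assms(1,2)] assms(3)]])
  (simp add: push_apply box_top_comp[OF assms(1,2) SC_cell[OF assms(3)]])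

lemma push_id: "g:sc N n ==> push N N (box_id N) n g = g"
 by (rule Sing_eqI[OF push_in[OF box_hom.id]]) (simp_all add: push_apply box_top_id SC_cell)

lemma push_act:
 assumes "box_hom M N h" "g:sc M n" "box_hom a n f"
 shows "push M N h a (act (SC M) a n g f) = act (SC N) a n (push M N h n g) f"
 by (rule Sing_eqI[OF push_in[OF assms(1) SC_act_in[OF assms(3,2)]] SC_act_in[OF assms(3) push_in[OF assms(1,2)]]])
  (simp add: push_apply Sing_act_apply box_top_cell[OF assms(3)])

lemma push_box_top:
 assumes "box_hom M N h" "box_hom n M f"
 shows "push M N h n (box_top n M f) = box_top n N (vcomp n h f)"
 by (simp add: push_def box_top_compose[OF assms(2,1)])

lemma box_top_vert:
 assumes "box_hom m n f" "x:vert m"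
 shows "f x = threshold n 1 (box_top m n f (\<lambda>i\<in>{1..m}. of_bool (x i))) & (\<lambda>i\<in>{1..m}. of_bool (x i)):cell m"
proof -
 let ?t = "\<lambda>i\<in>{1..m}. of_bool (x i) :: real"
 have t: "?t:cell m" by (rule cellI) simp
 have "threshold m 1 ?t = x" using assms(2) by (intro vert_eqI[of _ m]) (auto simp: threshold_def)
 thus ?thesis using box_top_thr[OF assms(1) t, of 1] t by simp
qed

lemma box_top_inj:
 assumes "box_hom m n f" "box_hom m n g" "box_top m n f = box_top m n g"
 shows "f = g"
 by (rule hom_eqI[OF assms(1,2)]) (simp only: box_top_vert[OF assms(1)] box_top_vert[OF assms(2)] assms(3))

lemma box_top_infc:
 assumes f: "box_hom m n f" and j: "j:{1..n}" and c: "infc m (box_top m n f) j e" and x: "x:vert m"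
 shows "f x j = e"
 using box_top_vert[OF f x] c j by (simp add: threshold_def infc_def)

lemma push_face_degen:
 assumes "g:sc (Suc N) n" "j:{1..Suc N}" "infc n g j e"
 shows "push N (Suc N) (box_face (Suc N) j e) n (push (Suc N) N (box_degen (Suc N) j) n g) = g"
proof (rule Sing_eqI[OF push_in[OF face_hom[OF assms(2) refl] push_in[OF degen_hom[OF assms(2) refl] assms(1)]] assms(1)])
 fix t assume t: "t:cell n"
 note c = SC_cell[OF assms(1) t]
 show "push N (Suc N) (box_face (Suc N) j e) n (push (Suc N) N (box_degen (Suc N) j) n g) t = g t"
  using assms(3) t face_degen_cell[OF assms(2) c, of e]
  by (simp add: push_apply box_top_degen[OF assms(2) c] box_top_face[OF assms(2) degen_fun_cell[OF assms(2) c]] infc_def)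
qed

lemma push_degen_face:
 assumes "g:sc N n" "j:{1..Suc N}"
 shows "push (Suc N) N (box_degen (Suc N) j) n (push N (Suc N) (box_face (Suc N) j e) n g) = g"
 using push_push[OF face_hom[OF assms(2) refl] degen_hom[OF assms(2) refl] assms(1)] degen_face[OF assms(2)]
  push_id[OF assms(1)] by simp

lemma infc_push_face: "g:sc N n ==> j:{1..Suc N} ==> infc n (push N (Suc N) (box_face (Suc N) j e) n g) j e"
 by (simp add: infc_def push_apply box_top_face SC_cell) (simp add: face_fun_def)

section \<open>The cubical set of value assignments, and its sections over a cubical set\<close>

definition valsp :: "nat => (nat => cell_map => 'e) set" where
 "valsp N = {v. ALL n g. g ~: sc N n --> v n g = undefined}"

text \<open>An \<open>N\<close>-cube assigns a value to every singular cube of the topological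
  \<open>N\<close>-cube. A map from \<open>X\<close> to \<open>vals\<close> is thus a value for each
  pair of a cube and a singular cube, compatible with the coend identifications. The fixed value
  outside the domain gives equality of cubes its intended meaning.\<close>

definition vals :: "(nat => cell_map => 'e) cset" where
 "vals = \<lparr>cubes = valsp,
   act = (%M N v h n g. if g:sc M n then v n (push M N h n g) else undefined)\<rparr>"

lemma vals_cubes: "v:cubes vals N \<longleftrightarrow> (ALL n g. g ~: sc N n --> v n g = undefined)"
 by (simp add: vals_def valsp_def)

lemma vals_act: "act vals M N v h n g = (if g:sc M n then v n (push M N h n g) else undefined)"
 by (simp add: vals_def)

lemma cubical_set_vals: "cubical_set vals"
 unfolding cubical_set_def
proof (intro conjI allI impI ballI)
 show "act vals M N v h:cubes vals M" for M N v h by (simp add: vals_cubes vals_act)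
 show "act vals N N v (box_id N) = v" if "v:cubes vals N" for N and v :: "nat => cell_map => 'e"
  using that by (auto simp: vals_cubes vals_act fun_eq_iff push_id)
 show "act vals l n v (vcomp l g f) = act vals l m (act vals m n v g) f"
  if "box_hom l m f" "box_hom m n g" for l m n f g and v :: "nat => cell_map => 'e"
  using that by (simp add: vals_act fun_eq_iff push_in push_push)
qed

definition fill_at :: "'e cset => nat => (nat => bool => nat => cell_map => 'e) => 'e =>
  nat => (nat => cell_map => 'e) => bool" where
 "fill_at E k b e N v = (nat_fam E (SC N) k (cubes (SC N)) v & has_shell E k b (cubes (SC N)) v &
   (ALL n f. box_hom n N f --> v n (box_top n N f) = tn E k n N e f))"

lemma fill_at_cong:
 assumes "fill_at E k b e N v" "!!n g. g:sc N n ==> v' n g = v n g"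
 shows "fill_at E k b e N v'"
 using assms(1) unfolding fill_at_def nat_fam_def has_shell_def by (simp add: assms(2) SC_act_in box_top_SC)

text \<open>The common source of both liftings: \<open>k = 0\<close> yields the cubes
  \<open>r\<close>, and \<open>k = 1\<close> the homotopies \<open>h\<close>, whose shell
  \<open>be\<close> consists of the two ends.\<close>

locale cube_lifting =
 fixes E :: "'e cset" and X :: "'x cset" and k :: nat and std :: "nat => 'x => 'e"
  and be :: "nat => 'x => nat => bool => nat => cell_map => 'e"
 assumes E: "kanE E" and X: "cubical_set X"
  and std_in: "x:cubes X N ==> std N x:cubes E (k + N)"
  and std_nat: "box_hom M N h ==> x:cubes X N ==> std M (act X M N x h) = tn E k M N (std N x) h"
  and be_shell: "x:cubes X N ==> shell E (SC N) k (be N x)"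
  and be_nat: "box_hom M N h ==> x:cubes X N ==> g:sc M n ==>
   be M (act X M N x h) i c n g = be N x i c n (push M N h n g)"
  and be_std: "k = Suc m ==> 1 <= i ==> i <= k ==> box_hom n N f ==> x:cubes X N ==>
   fc E (m + n) (tn E k n N (std N x) f) i c = be N x i c n (box_top n N f)"
begin

lemma fill_at_act:
 assumes h: "box_hom M N h" and x: "x:cubes X N" and v: "fill_at E k (be N x) (std N x) N v"
 shows "fill_at E k (be M (act X M N x h)) (std M (act X M N x h)) M (act vals M N v h)"
 unfolding fill_at_def
proof (intro conjI allI impI)
 let ?a = "act X M N x h"
 have vn: "nat_fam E (SC N) k (cubes (SC N)) v" and vs: "has_shell E k (be N x) (cubes (SC N)) v"
  and vo: "!!n f. box_hom n N f ==> v n (box_top n N f) = tn E k n N (std N x) f"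
  using v by (simp_all add: fill_at_def)
 show "nat_fam E (SC M) k (cubes (SC M)) (act vals M N v h)"
  unfolding nat_fam_def
  using nat_fam_in[OF vn push_in[OF h]] nat_fam_act[OF vn _ push_in[OF h]]
  by (simp add: vals_act SC_act_in push_act[OF h])
 show "has_shell E k (be M ?a) (cubes (SC M)) (act vals M N v h)"
  unfolding has_shell_def
 proof (intro allI impI)
  fix m i e n g assume k: "k = Suc m" and i: "1 <= i" "i <= k" and g: "g:sc M n"
  show "fc E (m + n) (act vals M N v h n g) i e = be M ?a i e n g"
   using has_shellD[OF vs[unfolded k] i(1) i(2)[unfolded k] push_in[OF h g]] g be_nat[OF h x g]
   by (simp add: vals_act)
 qed
 show "act vals M N v h n (box_top n M f) = tn E k n M (std M ?a) f" if f: "box_hom n M f" for n f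
  using vo[OF box_hom.comp[OF f h]] tn_comp[OF kanE_cset[OF E] std_in[OF x] f h] std_nat[OF h x] box_top_SC[OF f]
  by (simp add: vals_act push_box_top[OF h f])
qed

text \<open>Once values over the faces of \<open>x\<close> are given, those on \<open>subA\<close>
  are forced: \<open>std\<close> on operators, the value over a face on cubes lying in it. It
  remains to see that these prescriptions agree; \<open>extend_operators\<close> does the
  rest.\<close>

lemma fill_extend:
 fixes v :: "nat => bool => nat => cell_map => 'e"
 assumes x: "x:cubes X N"
  and v: "!!N' i b. N = Suc N' ==> 1 <= i ==> i <= N ==> v i b:cubes vals N' &
   fill_at E k (be N' (fc X N' x i b)) (std N' (fc X N' x i b)) N' (v i b)"
  and vc: "!!N' i j b u. N = Suc (Suc N') ==> 1 <= i ==> i < j ==> j <= N ==>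
    fc vals N' (v j u) i b = fc vals N' (v i b) (j - 1) u"
 shows "EX w:cubes vals N. fill_at E k (be N x) (std N x) N w &
  (ALL N' i b. N = Suc N' --> 1 <= i --> i <= N --> fc vals N' w i b = v i b)"
proof -
 note Ec = kanE_cset[OF E]
 define dg where "dg j n g = push N (N - 1) (box_degen N j) n g" for j n g
 define LA where "LA n g =
  (if oper N n g then tn E k n N (std N x) (SOME q. box_hom n N q & g = box_top n N q)
   else (case (SOME p. fst p:{1..N} & infc n g (fst p) (snd p)) of (j, b) => v j b n (dg j n g)))" for n g
 have LA_oper: "LA n (box_top n N q) = tn E k n N (std N x) q" if "box_hom n N q" for n q
 proof -
  have "(SOME q'. box_hom n N q' & box_top n N q = box_top n N q') = q"
   by (rule some_equality) (use that box_top_inj in auto)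
  thus ?thesis using that by (auto simp: LA_def oper_def)
 qed
 \<comment> \<open>An operator landing in a face factors through it, and the family over that face
   is standard on operators.\<close>
 have oper_face: "tn E k n N (std N x) q = v j b n (dg j n (box_top n N q))"
  if q: "box_hom n N q" and j: "j:{1..N}" and c: "infc n (box_top n N q) j b" for n q j b
 proof -
  obtain N' where N: "N = Suc N'" using j by (cases N) auto
  have j': "j:{1..Suc N'}" "1 <= j" "j <= N" using j N by auto
  note q' = q[unfolded N] and d = degen_hom[OF j'(1) refl] and f = face_hom[OF j'(1) refl]
  let ?r = "vcomp n (box_degen (Suc N') j) q"
  note h = box_hom.comp[OF q' d]
  have "q = vcomp n (box_face (Suc N') j b) ?r"
   by (rule box_face_factor[OF q' j'(1) box_top_infc[OF q j c]])
  hence "tn E k n N (std N x) q = tn E k n N' (tn E k N' N (std N x) (box_face (Suc N') j b)) ?r"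
   using tn_comp[OF Ec std_in[OF x, unfolded N] h f] N by simp
  also have "\<dots> = tn E k n N' (std N' (fc X N' x j b)) ?r" using std_nat[OF f x[unfolded N]] N by simp
  also have "\<dots> = v j b n (box_top n N' ?r)" using v[OF N j'(2,3)] h by (simp add: fill_at_def)
  also have "box_top n N' ?r = dg j n (box_top n N q)" using push_box_top[OF d q'] N by (simp add: dg_def)
  finally show ?thesis .
 qed
 \<comment> \<open>A singular cube in two faces lies in their intersection; compatibility of
   \<open>v\<close> is applied to its projection \<open>h\<close> there.\<close>
 have face_face': "v l u n (dg l n g) = v j b n (dg j n g)"
  if jl: "1 <= j" "j < l" "l <= N" and c: "infc n g j b" "infc n g l u" and g: "g:sc N n" for j l b u n g
 proof -
  obtain N' where N: "N = Suc (Suc N')" using jl by (cases N; cases "N - 1") auto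
  let ?S = "Suc N'"
  have J: "j:{1..Suc N'}" "j:{1..Suc ?S}" "l:{1..Suc ?S}" "l - 1:{1..Suc N'}"
   using jl N by (auto; arith)+
  note g' = g[unfolded N]
  have dl: "dg l n g:sc ?S n" "dg j n g:sc ?S n"
   using push_in[OF degen_hom[OF J(3) refl] g'] push_in[OF degen_hom[OF J(2) refl] g'] N by (simp_all add: dg_def)
  have c': "infc n (dg l n g) j b" "infc n (dg j n g) (l - 1) u"
   using c J jl SC_cell[OF g'] N
   by (auto simp: infc_def dg_def push_apply box_top_degen) (auto simp: degen_fun_def)
  define h where "h = push ?S N' (box_degen ?S j) n (dg l n g)"
  have h: "h:sc N' n" unfolding h_def by (rule push_in[OF degen_hom[OF J(1) refl] dl(1)])
  have h': "h = push ?S N' (box_degen ?S (l - 1)) n (dg j n g)"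
   using push_push[OF degen_hom[OF J(3) refl] degen_hom[OF J(1) refl] g']
    push_push[OF degen_hom[OF J(2) refl] degen_hom[OF J(4) refl] g'] degen_degen[of j l N'] jl N
   by (simp add: h_def dg_def)
  have "v l u n (dg l n g) = fc vals N' (v l u) j b n h"
   using push_face_degen[OF dl(1) J(1) c'(1)] h by (simp add: vals_act h_def)
  also have "\<dots> = fc vals N' (v j b) (l - 1) u n h" using vc[OF N jl(1,2)] jl(3) by simp
  also have "\<dots> = v j b n (dg j n g)"
   using push_face_degen[OF dl(2) J(4) c'(2)] h by (simp add: vals_act h')
  finally show ?thesis .
 qed
 let ?c = "cubes (SC N)"
 let ?b = "be N x"
 have LA_face: "LA n g = v j b n (dg j n g)"
  if g: "g:sc N n" and j: "j:{1..N}" and c: "infc n g j b" for n g j b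
 proof (cases "oper N n g")
  case True
  then obtain q where "box_hom n N q" "g = box_top n N q" unfolding oper_def by (elim exE conjE)
  thus ?thesis using LA_oper oper_face j c by simp
 next
  case False
  define p where "p = (SOME p. fst p:{1..N} & infc n g (fst p) (snd p))"
  let ?v = "v (fst p) (snd p) n (dg (fst p) n g)"
  have p: "fst p:{1..N} & infc n g (fst p) (snd p)"
   unfolding p_def by (rule someI[of _ "(j, b)"]) (use j c in simp)
  have LAp: "LA n g = ?v"
   using False unfolding LA_def p_def[symmetric] by (simp only: if_False case_prod_unfold)
  consider "fst p = j" | "fst p < j" | "j < fst p" by linarith
  thus ?thesis
  proof cases
   case 1
   hence "snd p = b" using p c cell_nonempty[of n] by (auto simp: infc_def)
   thus ?thesis using 1 LAp by simp
  next
   case 2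
   have "v j b n (dg j n g) = ?v"
    by (rule face_face'[OF _ 2 _ _ c g]) (use p j in auto)
   thus ?thesis using LAp by simp
  next
   case 3
   have "?v = v j b n (dg j n g)"
    by (rule face_face'[OF _ 3 _ c _ g]) (use p j in auto)
   thus ?thesis using LAp by simp
  qed
 qed
 have fac: "(EX N'. N = Suc N' & dg j n g = push (Suc N') N' (box_degen (Suc N') j) n g & 1 <= j & j <= N & j:{1..Suc N'} &
   dg j n g:sc N' n)"
  if jN: "j:{1..N}" and g: "g:sc N n" for j n g
 proof -
  obtain N' where N: "N = Suc N'" using jN by (cases N) auto
  have j: "j:{1..Suc N'}" using jN N by simp
  show ?thesis using push_in[OF degen_hom[OF j refl] g[unfolded N]] jN N by (intro exI[of _ N']) (simp add: dg_def)
 qed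
 have subA_cases: "P" if "g:subA N n" "!!q. box_hom n N q ==> g = box_top n N q ==> P"
  "!!j b. j:{1..N} ==> infc n g j b ==> P" for g n P
 proof -
  from that(1) have "(EX q. box_hom n N q & g = box_top n N q) | (EX j:{1..N}. EX b. infc n g j b)"
   by (simp add: subA_def oper_def)
  thus P by (elim disjE exE conjE bexE) ((rule that(2); assumption), (rule that(3); assumption))
 qed
 have "nat_fam E (SC N) k (subA N) LA"
  unfolding nat_fam_def
 proof (intro conjI allI impI)
  fix n g assume g: "g:subA N n"
  show "LA n g:cubes E (k + n)"
  proof (rule subA_cases[OF g])
   fix q assume q: "box_hom n N q" "g = box_top n N q"
   show ?thesis unfolding q(2) LA_oper[OF q(1)] by (rule tn_in[OF Ec std_in[OF x] q(1)])
  next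
   fix j b assume j: "j:{1..N}" "infc n g j b"
   obtain N' where N: "N = Suc N'" "1 <= j" "j <= N" "dg j n g:sc N' n" using fac[OF j(1) subA_in[OF g]] by blast
   have "nat_fam E (SC N') k (cubes (SC N')) (v j b)" using v[OF N(1-3)] by (simp add: fill_at_def)
   from nat_fam_in[OF this N(4)] show ?thesis unfolding LA_face[OF subA_in[OF g] j] .
  qed
 next
  fix a n q g assume q: "box_hom a n q" and g: "g:subA N n"
  note ga = subA_in[OF subA_act[OF q g]]
  show "LA a (act (SC N) a n g q) = tn E k a n (LA n g) q"
  proof (rule subA_cases[OF g])
   fix r assume r: "box_hom n N r" "g = box_top n N r"
   have "act (SC N) a n g q = box_top a N (vcomp a r q)"
    using box_top_compose[OF q r(1)] r(2) by (simp add: Sing_act)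
   thus ?thesis using LA_oper[OF box_hom.comp[OF q r(1)]] LA_oper[OF r(1)] tn_comp[OF Ec std_in[OF x] q r(1)] r(2) by simp
  next
   fix j b assume j: "j:{1..N}" "infc n g j b"
   obtain N' where N: "N = Suc N'" "1 <= j" "j <= N" "dg j n g:sc N' n" "j:{1..Suc N'}"
    using fac[OF j(1) subA_in[OF g]] by blast
   have "nat_fam E (SC N') k (cubes (SC N')) (v j b)" using v[OF N(1-3)] by (simp add: fill_at_def)
   from nat_fam_act[OF this q N(4)]
   show ?thesis
    unfolding LA_face[OF subA_in[OF g] j] LA_face[OF ga j(1) infc_act[OF q j(2)]]
    using push_act[OF degen_hom[OF N(5) refl] _ q, of g] subA_in[OF g] N(1) by (simp add: dg_def)
  qed
 qed
 moreover have "has_shell E k ?b (subA N) LA"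
  unfolding has_shell_def
 proof (intro allI impI)
  fix m i b n g assume k: "k = Suc m" and i: "1 <= i" "i <= k" and g: "g:subA N n"
  show "fc E (m + n) (LA n g) i b = be N x i b n g"
  proof (rule subA_cases[OF g])
   fix q assume q: "box_hom n N q" "g = box_top n N q"
   show ?thesis unfolding q(2) LA_oper[OF q(1)] by (rule be_std[OF k i q(1) x])
  next
   fix j u assume j: "j:{1..N}" "infc n g j u"
   obtain N' where N: "N = Suc N'" "1 <= j" "j <= N" "dg j n g:sc N' n" "j:{1..Suc N'}"
    "dg j n g = push (Suc N') N' (box_degen (Suc N') j) n g"
    using fac[OF j(1) subA_in[OF g]] by blast
   have "has_shell E (Suc m) (be N' (fc X N' x j u)) (cubes (SC N')) (v j u)" using v[OF N(1-3), of u] k by (simp add: fill_at_def)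
   from has_shellD[OF this i(1) i(2)[unfolded k] N(4)]
   show ?thesis unfolding LA_face[OF subA_in[OF g] j]
    using be_nat[OF face_hom[OF N(5) refl] _ N(4)] x N(1)
     push_face_degen[OF _ N(5) j(2)] subA_in[OF g] by (simp add: N(6))
  qed
 qed
 ultimately have "EX L. nat_fam E (SC N) k ?c L & has_shell E k ?b ?c L &
    (ALL n g. g:subA N n --> L n g = LA n g)"
  by (rule extend_operators[OF E be_shell[OF x]])
 then obtain L where L: "nat_fam E (SC N) k ?c L" "has_shell E k ?b ?c L"
    "ALL n g. g:subA N n --> L n g = LA n g" by (elim exE conjE)
 define w where "w n g = (if g:sc N n then L n g else undefined)" for n g
 have "fill_at E k ?b (std N x) N L"
  unfolding fill_at_def
 proof (intro conjI allI impI L(1,2))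
  fix n q assume q: "box_hom n N q"
  hence "box_top n N q:subA N n" using box_top_SC[OF q] by (auto simp: subA_def oper_def)
  thus "L n (box_top n N q) = tn E k n N (std N x) q" using L(3) LA_oper[OF q] by simp
 qed
 hence "fill_at E k ?b (std N x) N w" by (rule fill_at_cong) (simp add: w_def)
 moreover have "w:cubes vals N" by (simp add: vals_cubes w_def)
 moreover have "fc vals N' w i b = v i b" if N: "N = Suc N'" "1 <= i" "i <= N" for N' i b
 proof (rule ext, rule ext)
  fix n g
  have i: "i:{1..Suc N'}" "i:{1..N}" using N by auto
  show "fc vals N' w i b n g = v i b n g"
  proof (cases "g:sc N' n")
   case True
   let ?h = "push N' (Suc N') (box_face (Suc N') i b) n g"
   have h: "?h:sc N n" using push_in[OF face_hom[OF i(1) refl] True] N by simp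
   note c = infc_push_face[OF True i(1), of b]
   have "fc vals N' w i b n g = LA n ?h" using True h L(3) subA_infc[OF h i(2) c] by (simp add: vals_act w_def)
   also have "\<dots> = v i b n g" using LA_face[OF h i(2) c] push_degen_face[OF True i(1)] N by (simp add: dg_def)
   finally show ?thesis .
  next
   case False
   thus ?thesis using v[OF N, of b] by (simp add: vals_act vals_cubes)
  qed
 qed
 ultimately show ?thesis by blast
qed

text \<open>Sections of \<open>vals\<close> over \<open>X\<close> with nothing prescribed in
  advance, hence the empty \<open>A\<close>; the extension property required of each cube is
  \<open>fill_extend\<close>.\<close>

lemma lifting_exists:
 "EX L. ALL N x. x:cubes X N --> fill_at E k (be N x) (std N x) N (L N x) &
  (ALL M h n g. box_hom M N h --> g:sc M n --> L M (act X M N x h) n g = L N x n (push M N h n g))"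
proof -
 interpret natural_section X vals "%_. {}" "%_ _. undefined" "%N x v. fill_at E k (be N x) (std N x) N v"
 proof
  fix x n and v :: "nat => bool => nat => cell_map => 'e"
  assume "x:cubes X n"
   "!!n' i c. n = Suc n' ==> 1 <= i ==> i <= n ==> v i c:cubes vals n' &
    fill_at E k (be n' (fc X n' x i c)) (std n' (fc X n' x i c)) n' (v i c)"
   "!!n' i j c d. n = Suc (Suc n') ==> 1 <= i ==> i < j ==> j <= n ==>
    fc vals n' (v j d) i c = fc vals n' (v i c) (j - 1) d"
  thus "EX w:cubes vals n. fill_at E k (be n x) (std n x) n w &
    (ALL n' i c. n = Suc n' --> 1 <= i --> i <= n --> fc vals n' w i c = v i c)"
   by (rule fill_extend)
 qed (simp_all add: X cubical_set_vals fill_at_act)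
 from section_exists obtain s where
  s: "ALL n x. x:cubes X n --> s n x:cubes vals n & fill_at E k (be n x) (std n x) n (s n x)"
   "ALL m n f x. box_hom m n f --> x:cubes X n --> s m (act X m n x f) = act vals m n (s n x) f" by (elim exE conjE)
 show ?thesis by (rule exI[of _ s]) (use s in \<open>simp add: vals_act\<close>)
qed

end

section \<open>Lifts of singular cubes into a Kan complex and the homotopies to their
  realizations\<close>

lemma tens_0: "box_hom a b f ==> tens 0 a b f = f"
proof (rule box_eqI[of _ a b])
 let ?v = "vert a \<rightarrow>\<^sub>E vert b"
 assume h: "box_hom a b f"
 show "tens 0 a b f:?v" using tens_PiE[of 0 a b f] by simp
 show "f:?v" by (rule hom_PiE[OF h])
 fix x j assume x: "x:vert a" and j: "j:{1..b}"
 have "drp 0 a x = x" using x by (intro vert_eqI[of _ a]) (auto simp: drp_apply)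
 thus "tens 0 a b f x j = f x j" using x j by (simp add: tens_apply)
qed

lemma degen_tens1:
 assumes f: "box_hom a b f"
 shows "vcomp (Suc a) (box_degen (Suc b) 1) (tens 1 a b f) = vcomp (Suc a) f (box_degen (Suc a) 1)"
proof -
 let ?S = "Suc a"
 have d: "box_hom ?S a (box_degen ?S 1)" "box_hom (Suc b) b (box_degen (Suc b) 1)"
  by (auto intro: degen_hom)
 show ?thesis
 proof (rule hom_eqI[OF box_hom.comp[OF tens1_hom[OF f] d(2)] box_hom.comp[OF d(1) f]])
  fix x j assume x: "x:vert ?S" and j: "j:{1..b}"
  have "drp 1 a x = box_degen ?S 1 x"
   using x hom_vert[OF d(1) x] by (intro vert_eqI[of _ a]) (auto simp: drp_apply box_degen_Suc)
  thus "vcomp ?S (box_degen (Suc b) 1) (tens 1 a b f) x j =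
    vcomp ?S f (box_degen ?S 1) x j"
   using x j hom_vert[OF tens1_hom[OF f] x] by (simp add: box_degen_Suc tens_apply)
 qed
qed

definition ptm :: "'a cset => nat => 'a => nat => cell_map => (nat => real) => 'a real_pt" where
 "ptm X N x n g = (\<lambda>t\<in>cell n. pt X N x (g t))"

lemma ptm_in: "x:cubes X N ==> g:sc N n ==> ptm X N x n g:cubes (SR X) n"
 unfolding ptm_def
 by (rule SingI) (use continuous_map_compose[of "ct n" "ct N" g "realization X" "pt X N x"] cts_pt[of x X N] in \<open>simp add: Sing_cubes o_def\<close>)

lemma ptm_act: "x:cubes X N ==> g:sc N n ==> box_hom a n f ==>
  ptm X N x a (act (SC N) a n g f) = act (SR X) a n (ptm X N x n g) f"
 by (rule Sing_eqI[OF ptm_in[OF _ SC_act_in] act_in[OF Sing_cset _ ptm_in]])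
  (simp_all add: ptm_def Sing_act_apply box_top_cell)

lemma ptm_push: "cubical_set X ==> box_hom M N h ==> x:cubes X N ==> g:sc M n ==>
  ptm X M (act X M N x h) n g = ptm X N x n (push M N h n g)"
 unfolding ptm_def by (rule restrict_ext) (simp add: pt_act push_apply SC_cell)

lemma ptm_box_top: "cubical_set X ==> box_hom n N f ==> x:cubes X N ==> ptm X N x n (box_top n N f) = ch X n (act X n N x f)"
 unfolding ptm_def ch_def by (rule restrict_ext) (simp add: pt_act)

text \<open>The first coordinate of \<open>h\<close> is the homotopy parameter, from the singular
  representative at \<open>False\<close> to the realized lift at \<open>True\<close>. The clauses
  \<open>r_push\<close> and \<open>h_push\<close> make both constructions invariant under
  \<open>deq\<close>.\<close>

locale lifting =
 fixes X :: "'a cset" and r :: "nat => 'a => nat => cell_map => 'a"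
  and h :: "nat => 'a => nat => cell_map => (nat => real) => 'a real_pt"
 assumes X: "kanE X"
  and r_in: "x:cubes X N ==> g:sc N n ==> r N x n g:cubes X n"
  and r_act: "x:cubes X N ==> g:sc N n ==> box_hom a n f ==>
   r N x a (act (SC N) a n g f) = act X a n (r N x n g) f"
  and r_oper: "x:cubes X N ==> box_hom n N f ==> r N x n (box_top n N f) = act X n N x f"
  and r_push: "x:cubes X N ==> box_hom M N q ==> g:sc M n ==>
   r M (act X M N x q) n g = r N x n (push M N q n g)"
  and h_in: "x:cubes X N ==> g:sc N n ==> h N x n g:cubes (SR X) (Suc n)"
  and h_act: "x:cubes X N ==> g:sc N n ==> box_hom a n f ==>
   h N x a (act (SC N) a n g f) = tn (SR X) 1 a n (h N x n g) f"
  and h_face: "x:cubes X N ==> g:sc N n ==>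
   fc (SR X) n (h N x n g) 1 e = (if e then ch X n (r N x n g) else ptm X N x n g)"
  and h_oper: "x:cubes X N ==> box_hom n N f ==>
   h N x n (box_top n N f) = act (SR X) (Suc n) n (ch X n (act X n N x f)) (box_degen (Suc n) 1)"
  and h_push: "x:cubes X N ==> box_hom M N q ==> g:sc M n ==>
   h M (act X M N x q) n g = h N x n (push M N q n g)"

text \<open>\<open>cube_lifting\<close> is applied twice: into \<open>X\<close> with no directions,
  then into the singular complex with one direction, whose ends are dictated by the first lifting
  and which is degenerate on operators.\<close>

lemma lifting_ex:
 fixes X :: "'a cset"
 assumes K: "kanE X"
 obtains r h where "lifting X r h"
proof -
 have X: "cubical_set X" by (rule kanE_cset[OF K])
 let ?S = "SR X"
 have S: "cubical_set ?S" by (rule Sing_cset)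
 interpret A: cube_lifting X X 0 "%N x. x" "%_ _ _ _ _ _. undefined"
  by standard (simp_all add: K X tens_0 shell_def)
 obtain r where "ALL N x. x:cubes X N --> fill_at X 0 (%_ _ _ _. undefined) x N (r N x) &
  (ALL M q n g. box_hom M N q --> g:sc M n --> r M (act X M N x q) n g = r N x n (push M N q n g))"
  using A.lifting_exists by (rule exE)
 hence r: "!!N x. x:cubes X N ==> fill_at X 0 (%_ _ _ _. undefined) x N (r N x)"
  "!!N x M q n g. x:cubes X N ==> box_hom M N q ==> g:sc M n ==> r M (act X M N x q) n g = r N x n (push M N q n g)"
  by simp_all
 have r_in: "r N x n g:cubes X n" if "x:cubes X N" "g:sc N n" for N x n g
  using r(1)[OF that(1)] that(2) unfolding fill_at_def nat_fam_def by simp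
 have r_act: "r N x a (act (SC N) a n g f) = act X a n (r N x n g) f"
  if "x:cubes X N" "g:sc N n" "box_hom a n f" for N x n g a f
  using r(1)[OF that(1)] that(2,3) unfolding fill_at_def nat_fam_def by (simp add: tens_0)
 have r_oper: "r N x n (box_top n N f) = act X n N x f" if "x:cubes X N" "box_hom n N f" for N x n f
  using r(1)[OF that(1)] that(2) unfolding fill_at_def by (simp add: tens_0)
 have d: "box_hom (Suc n) n (box_degen (Suc n) 1)" for n by (rule degen_hom) auto
 define std where "std N x = act ?S (Suc N) N (ch X N x) (box_degen (Suc N) 1)" for N x
 define be where "be N x (i :: nat) e n g = (if e then ch X n (r N x n g) else ptm X N x n g)" for N x i e n g
 have std_tn: "tn ?S 1 n N (std N x) f = std n (act X n N x f)" if "x:cubes X N" "box_hom n N f" for n N x f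
  using act_comp[OF S tens1_hom[OF that(2)] d ch_in[OF that(1)]] act_comp[OF S d that(2) ch_in[OF that(1)]]
   degen_tens1[OF that(2)] ch_act[OF X that(2,1)] by (simp add: std_def)
 have std_face: "fc ?S n (std n x) 1 e = ch X n x" if "x:cubes X n" for n x e
  using act_comp[OF S face_hom[of 1 "Suc n" n e] d ch_in[OF that]] degen_face[of 1 n e] act_id[OF S ch_in[OF that]]
  by (simp add: std_def)
 interpret B: cube_lifting ?S X 1 std be
 proof
  show "kanE ?S" by (rule kanE_Sing)
  show "std N x:cubes ?S (1 + N)" if "x:cubes X N" for N x
   unfolding std_def using act_in[OF S d ch_in[OF that]] by simp
  show "std M (act X M N x q) = tn ?S 1 M N (std N x) q" if "box_hom M N q" "x:cubes X N" for M N x q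
   using std_tn[OF that(2,1)] by simp
  show "shell ?S (SC N) 1 (be N x)" if "x:cubes X N" for N x
   unfolding shell_def
   using r_in[OF that] r_act[OF that] ptm_in[OF that] ptm_act[OF that] ch_act[OF X]
   by (simp add: be_def tens_0 ch_in)
  show "be M (act X M N x q) i e n g = be N x i e n (push M N q n g)"
   if "box_hom M N q" "x:cubes X N" "g:sc M n" for M N x q i e n g
   using that r(2) ptm_push[OF X] by (simp add: be_def)
  show "fc ?S (m + n) (tn ?S 1 n N (std N x) f) i e = be N x i e n (box_top n N f)"
   if "1 = Suc m" "1 <= i" "i <= 1" "box_hom n N f" "x:cubes X N" for m i n N f x e
  proof -
   have "m = 0" "i = 1" using that by auto
   thus ?thesis
    using std_tn[OF that(5,4)] std_face[OF act_in[OF X that(4,5)]] r_oper[OF that(5,4)] ptm_box_top[OF X that(4,5)]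
    by (simp add: be_def)
  qed
 qed (rule X)
 obtain h where "ALL N x. x:cubes X N --> fill_at ?S 1 (be N x) (std N x) N (h N x) &
  (ALL M q n g. box_hom M N q --> g:sc M n --> h M (act X M N x q) n g = h N x n (push M N q n g))"
  using B.lifting_exists by (rule exE)
 hence h: "!!N x. x:cubes X N ==> fill_at ?S 1 (be N x) (std N x) N (h N x)"
  "!!N x M q n g. x:cubes X N ==> box_hom M N q ==> g:sc M n ==> h M (act X M N x q) n g = h N x n (push M N q n g)"
  by simp_all
 have "lifting X r h"
 proof
  fix x :: 'a and N n g assume x: "x:cubes X N" and g: "g:sc N n"
  have a: "nat_fam ?S (SC N) 1 (cubes (SC N)) (h N x)" "has_shell ?S (Suc 0) (be N x) (cubes (SC N)) (h N x)"
   using h(1)[OF x] by (simp_all add: fill_at_def One_nat_def)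
  show "h N x n g:cubes ?S (Suc n)" using nat_fam_in[OF a(1) g] by simp
  show "h N x a (act (SC N) a n g f) = tn ?S 1 a n (h N x n g) f" if "box_hom a n f" for a f
   by (rule nat_fam_act[OF a(1) that g])
  show "fc ?S n (h N x n g) 1 e = (if e then ch X n (r N x n g) else ptm X N x n g)" for e
   using has_shellD[OF a(2) _ _ g, of 1 e] by (simp add: be_def)
 next
  fix x :: 'a and N n f assume x: "x:cubes X N" and f: "box_hom n N f"
  show "h N x n (box_top n N f) = act ?S (Suc n) n (ch X n (act X n N x f)) (box_degen (Suc n) 1)"
   using h(1)[OF x] f std_tn[OF x f] unfolding fill_at_def by (simp add: std_def)
 qed (use K r_in r_act r_oper r(2) h(2) in simp_all)
 thus ?thesis by (rule that)
qed

context lifting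
begin

lemma deq_r: "deq X n a b ==> (case a of (N, x, g) => r N x n g) = (case b of (N, x, g) => r N x n g)"
proof (induction rule: deq.induct)
 case (deq_act m N h x g)
 thus ?case using r_push[of x N m h g n] by (simp add: push_def)
qed simp_all

lemma deq_h: "deq X n a b ==> (case a of (N, x, g) => h N x n g) = (case b of (N, x, g) => h N x n g)"
proof (induction rule: deq.induct)
 case (deq_act m N q x g)
 thus ?case using h_push[of x N m q g n] by (simp add: push_def)
qed simp_all

end

section \<open>Loop objects\<close>

definition konst :: "'e cset => 'e => nat => 'e" where
 "konst E e m = act E m 0 e (box_bang m)"

lemma box_hom_0_unique: "box_hom n 0 f ==> box_hom n 0 g ==> f = g"
 by (rule hom_eqI[of n 0]) auto

lemma konst_in: "cubical_set E ==> e:cubes E 0 ==> konst E e m:cubes E m"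
 unfolding konst_def by (rule act_in[OF _ bang_hom])

lemma konst_act: "cubical_set E ==> e:cubes E 0 ==> box_hom a b f ==> act E a b (konst E e b) f = konst E e a"
 unfolding konst_def
 using act_comp[OF _ _ bang_hom] box_hom_0_unique[OF box_hom.comp[OF _ bang_hom] bang_hom] by metis

lemma konst_0: "cubical_set E ==> e:cubes E 0 ==> konst E e 0 = e"
 unfolding konst_def using box_hom_0_unique[OF bang_hom box_hom.id] act_id by metis

lemma konst_map: "cset_map E E' c ==> e:cubes E 0 ==> c m (konst E e m) = konst E' (c 0 e) m"
 unfolding konst_def cset_map_def using bang_hom by simp

lemma loop_cubes: "s:cubes (loop_cset E e) n \<longleftrightarrow> s:cubes E (Suc n) & (ALL c. fc E n s 1 c = konst E e n)"
 by (simp add: loop_cset_def path_cset_def konst_def)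

lemma loop_act: "act (loop_cset E e) a b s f = tn E 1 a b s f"
 by (simp add: loop_cset_def path_cset_def tens_def)

lemma loop_fc: "1 <= i ==> i <= Suc n ==> fc (loop_cset E e) n s i c = fc E (Suc n) s (Suc i) c"
 using tn_face[of i n E 1 s c] by (simp add: loop_act)

lemma fc_konst: "cubical_set E ==> e:cubes E 0 ==> 1 <= i ==> i <= Suc n ==> fc E n (konst E e (Suc n)) i c = konst E e n"
 by (rule konst_act) (auto intro: face_hom)

lemma tn_konst: "cubical_set E ==> e:cubes E 0 ==> box_hom a b f ==> tn E m a b (konst E e (m + b)) f = konst E e (m + a)"
 by (rule konst_act) (auto intro: tens_hom)

lemma fc_tn1: "cubical_set E ==> x:cubes E (Suc b) ==> box_hom a b f ==>
  fc E a (tn E 1 a b x f) 1 e = act E a b (fc E b x 1 e) f"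
 using fc_tn[of E x 0 b a f 1 e] by (simp add: tens_0 One_nat_def)

lemma loop_cset_cubical:
 assumes E: "cubical_set E" and e: "e:cubes E 0"
 shows "cubical_set (loop_cset E e)"
 unfolding cubical_set_def
proof (intro conjI allI impI ballI)
 let ?l = "loop_cset E e"
 show "act ?l m n x f:cubes ?l m"
  if "box_hom m n f" "x:cubes ?l n" for m n f x
  using that tn_in[OF E, of x 1 n m f] fc_tn1[OF E _ that(1)] konst_act[OF E e that(1)] by (simp add: loop_cubes loop_act)
 show "act ?l n n x (box_id n) = x" if "x:cubes ?l n" for n x
  using that tn_id[OF E, of x 1 n] by (simp add: loop_cubes loop_act)
 show "act ?l l n x (vcomp l g f) = act ?l l m (act ?l m n x g) f"
  if "box_hom l m f" "box_hom m n g" "x:cubes ?l n" for l m n f g x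
  using that tn_comp[OF E, of x 1 n l m f g] by (simp add: loop_cubes loop_act)
qed

text \<open>A box in the loop object is a box of one dimension more in \<open>E\<close> whose two
  faces in the first direction are constant; the missing face stays missing.\<close>

lemma kanE_loop:
 assumes K: "kanE E" and e: "e:cubes E 0"
 shows "kanE (loop_cset E e)"
 unfolding kanE_def
proof (intro conjI allI impI)
 note E = kanE_cset[OF K]
 let ?l = "loop_cset E e"
 show "cubical_set ?l" by (rule loop_cset_cubical[OF E e])
 fix n i c v
 let ?S = "Suc n"
 assume i: "i:{1..Suc n}"
  and v: "ALL j:{1..Suc n}. ALL d. (j, d) ~= (i, c) --> v j d:cubes ?l n"
  and vc: "ALL n' j l d h. n = Suc n' --> 1 <= j --> j < l --> l <= Suc n --> (j, d) ~= (i, c) --> (l, h) ~= (i, c) -->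
    fc ?l n' (v l h) j d = fc ?l n' (v j d) (l - 1) h"
 define u where "u j d = (if j = 1 then konst E e ?S else v (j - 1) d)" for j d
 have i': "Suc i:{1..Suc ?S}" using i by simp
 obtain f where f: "f:cubes E (Suc ?S)"
  "!!j d. j:{1..Suc ?S} ==> (j, d) ~= (Suc i, c) ==> fc E ?S f j d = u j d"
 proof (rule kanE_fill[OF K i', of c u])
  fix j d assume j: "j:{1..Suc ?S}" "(j, d) ~= (Suc i, c)"
  show "u j d:cubes E ?S"
  proof (cases "j = 1")
   case False
   hence "j - 1:{1..Suc n}" "(j - 1, d) ~= (i, c)" using j by (simp_all; arith)+
   hence "v (j - 1) d:cubes ?l n" using v by blast
   thus ?thesis using False by (simp add: u_def loop_cubes)
  qed (simp add: u_def konst_in[OF E e])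
 next
  fix n' j l d h assume n': "?S = Suc n'" and jl: "1 <= j" "j < l" "l <= Suc ?S"
   and ne: "(j, d) ~= (Suc i, c)" "(l, h) ~= (Suc i, c)"
  obtain l' where l': "l = Suc l'" using jl by (cases l) auto
  have ll: "1 <= l'" "l' <= ?S" "l':{1..Suc n}" "(l', h) ~= (i, c)" using jl l' ne by auto
  have vl: "v l' h:cubes ?l n" using v ll by blast
  show "fc E n' (u l h) j d = fc E n' (u j d) (l - 1) h"
  proof (cases "j = 1")
   case True
   thus ?thesis using vl n' ll l' fc_konst[OF E e, of l' n h] by (simp add: u_def loop_cubes)
  next
   case False
   then obtain j' where j': "j = Suc j'" "1 <= j'" using jl by (cases j) auto
   have "n ~= 0" using jl j' by auto
   then obtain n2 where n2: "n = Suc n2" by (cases n) auto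
   obtain l2 where l2: "l' = Suc l2" using ll by (cases l') auto
   have "(j', d) ~= (i, c)" "j' < l'" using ne jl j' l' by auto
   hence "fc ?l n2 (v l' h) j' d = fc ?l n2 (v j' d) (l' - 1) h"
    using vc n2 j' ll by blast
   thus ?thesis using n' n2 l' j' ll jl by (simp add: u_def loop_fc)
  qed
 qed (rule that)
 have "f:cubes ?l ?S" using f(1) f(2)[of 1] i by (simp add: loop_cubes u_def)
 moreover have "fc ?l n f j d = v j d" if "j:{1..Suc n}" "(j, d) ~= (i, c)" for j d
  using f(2)[of "Suc j" d] that by (simp add: loop_fc u_def)
 ultimately show "EX f:cubes ?l ?S. ALL j:{1..Suc n}. ALL d. (j, d) ~= (i, c) --> fc ?l n f j d = v j d"
  by blast
qed

abbreviation "lbase E e == act E 1 0 e (box_degen 1 1)"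

lemma lbase_konst: "lbase E e = konst E e 1"
 unfolding konst_def using box_hom_0_unique[OF bang_hom[of 1] degen_hom[of 1 1 0]] by simp

lemma lbase_in: "cubical_set E ==> e:cubes E 0 ==> lbase E e:cubes (loop_cset E e) 0"
 using konst_in[of E e 1] fc_konst[of E e 1 0] by (simp add: lbase_konst loop_cubes flip: One_nat_def)

lemma konst_loop:
 assumes E: "cubical_set E" and e: "e:cubes E 0"
 shows "konst (loop_cset E e) (lbase E e) m = konst E e (Suc m)"
proof -
 have "konst (loop_cset E e) (lbase E e) m = tn E 1 m 0 (konst E e 1) (box_bang m)"
  by (simp only: konst_def[of "loop_cset E e"] loop_act lbase_konst)
 also have "\<dots> = konst E e (Suc m)" using tn_konst[OF E e bang_hom[of m], of 1] by (simp flip: One_nat_def)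
 finally show ?thesis .
qed

definition embed :: "'e cset => 'f cset => (nat => 'e => 'f) => bool" where
 "embed E F c = (cset_map E F c & (ALL n. inj_on (c n) (cubes E n)))"

lemma cset_map_in: "cset_map E F c ==> x:cubes E n ==> c n x:cubes F n"
 by (auto simp: cset_map_def)

lemma cset_map_act: "cset_map E F c ==> box_hom m n f ==> x:cubes E n ==> c m (act E m n x f) = act F m n (c n x) f"
 by (simp add: cset_map_def)

lemma cset_map_fc: "cset_map E F c ==> x:cubes E (Suc n) ==> 1 <= i ==> i <= Suc n ==> c n (fc E n x i e) = fc F n (c (Suc n) x) i e"
 by (rule cset_map_act) (auto intro: face_hom)

lemma cset_map_loop:
 assumes c: "cset_map E F c" and e: "e:cubes E 0"
 shows "cset_map (loop_cset E e) (loop_cset F (c 0 e)) (loop_map c)"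
 unfolding cset_map_def[of "loop_cset E e"]
proof (intro conjI allI impI ballI)
 let ?l = "loop_cset E e"
 let ?F = "loop_cset F (c 0 e)"
 show "loop_map c n:cubes ?l n \<rightarrow> cubes ?F n" for n
 proof
  fix s assume "s:cubes ?l n"
  thus "loop_map c n s:cubes ?F n"
   using cset_map_in[OF c, of s "Suc n"] cset_map_fc[OF c, of s n 1, symmetric] konst_map[OF c e, of n]
   by (simp add: loop_map_def loop_cubes)
 qed
 show "loop_map c m (act ?l m n x f) = act ?F m n (loop_map c n x) f"
  if "box_hom m n f" "x:cubes ?l n" for m n f x
  using cset_map_act[OF c tens1_hom[OF that(1)]] that(2) by (simp add: loop_map_def loop_cubes loop_act)
qed

lemma embed_loop:
 assumes "embed E F c" "e:cubes E 0"
 shows "embed (loop_cset E e) (loop_cset F (c 0 e)) (loop_map c)"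
proof -
 have "inj_on (loop_map c n) (cubes (loop_cset E e) n)" for n
  unfolding loop_map_def by (rule inj_on_subset[of _ "cubes E (Suc n)"]) (use assms(1) in \<open>auto simp: embed_def loop_cubes\<close>)
 thus ?thesis using cset_map_loop[of E F c e] assms by (simp add: embed_def)
qed

section \<open>Natural composition\<close>

text \<open>Composable pairs of paths with \<open>n\<close> parameters. As they form a cubical set,
  a natural composition is an instance of \<open>natural_filling\<close>.\<close>

definition pairs :: "'e cset => ('e \<times> 'e) cset" where
 "pairs E = \<lparr>cubes = (%n. {(x, y). x:cubes E (Suc n) & y:cubes E (Suc n) & fc E n x 1 True = fc E n y 1 False}),
   act = (%a n (x, y) f. (tn E 1 a n x f, tn E 1 a n y f))\<rparr>"

lemma pairs_cubes: "(x, y):cubes (pairs E) n \<longleftrightarrow> x:cubes E (Suc n) & y:cubes E (Suc n) & fc E n x 1 True = fc E n y 1 False"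
 by (simp add: pairs_def)

lemma pairs_act: "act (pairs E) a n (x, y) f = (tn E 1 a n x f, tn E 1 a n y f)"
 by (simp add: pairs_def)

lemma cubical_set_pairs:
 assumes E: "cubical_set E"
 shows "cubical_set (pairs E)"
 unfolding cubical_set_def
proof (intro conjI allI impI ballI)
 fix m n f p assume "box_hom m n f" "p:cubes (pairs E) n"
 thus "act (pairs E) m n p f:cubes (pairs E) m"
  using fc_tn1[OF E _ \<open>box_hom m n f\<close>] tn_in[OF E, of _ 1 n m f] by (cases p) (simp add: pairs_cubes pairs_act)
next
 fix n p assume "p:cubes (pairs E) n"
 thus "act (pairs E) n n p (box_id n) = p"
  using tn_id[OF E, of _ 1 n] by (cases p) (simp add: pairs_cubes pairs_act)
next
 fix l m n f g p assume "box_hom l m f" "box_hom m n g" "p:cubes (pairs E) n"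
 thus "act (pairs E) l n p (vcomp l g f) = act (pairs E) l m (act (pairs E) m n p g) f"
  using tn_comp[OF E, of _ 1 n l m f g] by (cases p) (simp add: pairs_cubes pairs_act)
qed

abbreviation "dg1 E n x == act E (Suc n) n x (box_degen (Suc n) 1)"
abbreviation "cn1 E n x == act E (Suc (Suc n)) (Suc n) x (box_conn (Suc (Suc n)) 1 False)"

lemma dg1_hom: "box_hom (Suc n) n (box_degen (Suc n) 1)"
 by (rule degen_hom) auto

lemma cn1_hom: "box_hom (Suc (Suc n)) (Suc n) (box_conn (Suc (Suc n)) 1 e)"
 by (rule conn_hom) auto

lemma fc_dg1: "cubical_set E ==> x:cubes E n ==> fc E n (dg1 E n x) 1 e = x"
 using act_comp[of E n "Suc n" "box_face (Suc n) 1 e" n "box_degen (Suc n) 1" x] dg1_hom[of n]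
  face_hom[of 1 "Suc n" n e] degen_face[of 1 n e] by (simp add: act_id)

lemma tn_dg1: "cubical_set E ==> x:cubes E n ==> box_hom a n f ==> tn E 1 a n (dg1 E n x) f = dg1 E a (act E a n x f)"
 using act_comp[of E _ _ "tens 1 a n f" n "box_degen (Suc n) 1" x] dg1_hom tens1_hom[of a n f]
  act_comp[of E "Suc a" a "box_degen (Suc a) 1" n f x] degen_tens1[of a n f] by simp

lemma fc_cn1_False:
 assumes E: "cubical_set E" and x: "x:cubes E (Suc n)" and i: "i:{1, 2}"
 shows "fc E (Suc n) (cn1 E n x) i False = x"
proof -
 let ?S = "Suc (Suc n)"
 have f: "box_hom (Suc n) ?S (box_face ?S i False)" using i by (intro face_hom) auto
 have "vcomp (Suc n) (box_conn ?S 1 False) (box_face ?S i False) = box_id (Suc n)"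
  by (rule hom_eqI[OF box_hom.comp[OF f cn1_hom] box_hom.id])
   (use i hom_vert[OF f] in \<open>auto simp: box_conn_Suc box_face_Suc simp flip: One_nat_def\<close>)
 thus ?thesis using act_comp[OF E f cn1_hom x] act_id[OF E x] by simp
qed

lemma fc_cn1_True:
 assumes E: "cubical_set E" and x: "x:cubes E (Suc n)" and i: "i:{1, 2}"
 shows "fc E (Suc n) (cn1 E n x) i True = dg1 E n (fc E n x 1 True)"
proof -
 let ?S = "Suc n"
 let ?b = "box_face (Suc ?S) i True"
 have f: "box_hom ?S (Suc ?S) ?b" using i by (intro face_hom) auto
 have f1: "box_hom n ?S (box_face ?S 1 True)" by (rule face_hom) auto
 have "vcomp ?S (box_conn (Suc ?S) 1 False) ?b =
   vcomp ?S (box_face ?S 1 True) (box_degen ?S 1)"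
  by (rule hom_eqI[OF box_hom.comp[OF f cn1_hom] box_hom.comp[OF dg1_hom f1]])
   (use i hom_vert[OF f] hom_vert[OF dg1_hom] in \<open>auto simp: box_conn_Suc box_face_Suc box_degen_Suc\<close>)
 thus ?thesis using act_comp[OF E f cn1_hom x] act_comp[OF E dg1_hom f1 x] by simp
qed

lemma box_hom_tens2: "box_hom a n f ==> box_hom (Suc (Suc a)) (Suc (Suc n)) (tens 2 a n f)"
 using tens_hom[of a n f 2] by simp

lemma tn_cn1:
 assumes E: "cubical_set E" and x: "x:cubes E (Suc n)" and f: "box_hom a n f"
 shows "tn E 2 a n (cn1 E n x) f = cn1 E a (tn E 1 a n x f)"
proof -
 let ?S = "Suc (Suc a)"
 let ?b = "box_conn (Suc (Suc n)) 1 False"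
 note t1 = tens1_hom[OF f] and t2 = box_hom_tens2[OF f]
 have "vcomp ?S ?b (tens 2 a n f) =
   vcomp ?S (tens 1 a n f) (box_conn ?S 1 False)"
 proof (rule hom_eqI[OF box_hom.comp[OF t2 cn1_hom] box_hom.comp[OF cn1_hom t1]])
  fix v j assume v: "v:vert ?S" and j: "j:{1..Suc n}"
  have d: "drp 1 a (box_conn ?S 1 False v) = drp 2 a v"
   using v by (intro vert_eqI[of _ a]) (auto simp: drp_apply box_conn_Suc)
  show "vcomp ?S ?b (tens 2 a n f) v j =
    vcomp ?S (tens 1 a n f) (box_conn ?S 1 False) v j"
   using v j hom_vert[OF t2 v] hom_vert[OF cn1_hom v] d
   by (auto simp: box_conn_Suc tens_apply)
 qed
 thus ?thesis using act_comp[OF E t2 cn1_hom x] act_comp[OF E cn1_hom t1 x] by simp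
qed

text \<open>A natural choice of squares of the shape used in \<open>cs_pi1_group\<close>, with the
  face \<open>(2, False)\<close> as composite. Taking the connection when \<open>y\<close> is
  degenerate makes composition with a constant path strictly unital.\<close>

definition sfill :: "'e cset => (nat => 'e \<times> 'e => 'e) => bool" where
 "sfill E w = ((ALL n x y. (x, y):cubes (pairs E) n --> w n (x, y):cubes E (Suc (Suc n)) &
   (ALL a f. box_hom a n f --> w a (tn E 1 a n x f, tn E 1 a n y f) = tn E 2 a n (w n (x, y)) f) &
   fc E (Suc n) (w n (x, y)) 1 False = x & fc E (Suc n) (w n (x, y)) 2 True = y &
   fc E (Suc n) (w n (x, y)) 1 True = dg1 E n (fc E n y 1 True) &
   (y = dg1 E n (fc E n x 1 True) --> w n (x, y) = cn1 E n x)))"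

text \<open>Two prescriptions precede the filling: connections on pairs with degenerate second entry
  (\<open>U\<close>) and images of the squares chosen in \<open>E\<close> (\<open>I\<close>). On
  common pairs they agree, since \<open>c\<close> is injective and \<open>w\<close> satisfies the
  unit clause.\<close>

lemma sfill_extend:
 fixes F :: "'f cset" and E :: "'e cset"
 assumes K: "kanE F" and E: "cubical_set E" and c: "embed E F c" and w: "sfill E w"
 obtains w' where "sfill F w'"
  "!!n x y. (x, y):cubes (pairs E) n ==> w' n (c (Suc n) x, c (Suc n) y) = c (Suc (Suc n)) (w n (x, y))"
proof -
 let ?E = "pairs E"
 note F = kanE_cset[OF K]
 let ?p = "pairs F"
 have cm: "cset_map E F c" and ci: "!!n. inj_on (c n) (cubes E n)" using c by (simp_all add: embed_def)
 note cin = cset_map_in[OF cm] and cact = cset_map_act[OF cm]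
 have cfc: "c n (fc E n x 1 d) = fc F n (c (Suc n) x) 1 d" if "x:cubes E (Suc n)" for n x d
  using cset_map_fc[OF cm that, of 1] by simp
 define U where "U n = {p:cubes ?p n. snd p = dg1 F n (fc F n (fst p) 1 True)}" for n
 define I where "I n = (%(x, y). (c (Suc n) x, c (Suc n) y)) ` cubes ?E n" for n
 define LA where "LA n p = (if p:U n then cn1 F n (fst p)
   else c (Suc (Suc n)) (w n (inv_into (cubes E (Suc n)) (c (Suc n)) (fst p), inv_into (cubes E (Suc n)) (c (Suc n)) (snd p))))" for n p
 have LA_I: "LA n (c (Suc n) x, c (Suc n) y) = c (Suc (Suc n)) (w n (x, y))" if p: "(x, y):cubes ?E n" for n x y
 proof (cases "(c (Suc n) x, c (Suc n) y):U n")
  case True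
  let ?n = "fc E n x 1 True"
  have x: "x:cubes E (Suc n)" and y: "y:cubes E (Suc n)" using p by (simp_all add: pairs_cubes)
  have f: "?n:cubes E n" by (rule fc_in[OF E x]) auto
  have "c (Suc n) y = c (Suc n) (dg1 E n ?n)"
   using True cfc[OF x] cact[OF dg1_hom f] by (simp add: U_def)
  hence "y = dg1 E n ?n" using ci act_in[OF E dg1_hom f] y by (meson inj_onD)
  hence "w n (x, y) = cn1 E n x" using w p unfolding sfill_def by blast
  thus ?thesis using True cact[OF cn1_hom x] by (simp add: LA_def)
 next
  case False
  thus ?thesis using p ci by (simp add: LA_def pairs_cubes)
 qed
 have I_in: "(c (Suc n) x, c (Suc n) y):cubes ?p n" if "(x, y):cubes ?E n" for n x y
  using that cin cfc by (metis pairs_cubes)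
 define b where "b i d n p = (if i = 2 then snd p else if d then dg1 F n (fc F n (snd p) 1 True) else fst p)"
  for i :: nat and d n and p :: "'f \<times> 'f"
 have fF: "fc F n z 1 d:cubes F n" if "z:cubes F (Suc n)" for n z d by (rule fc_in[OF F that]) auto
 have U_act: "act ?p a n p q:U a" if "box_hom a n q" "p:U n" for a n q p
 proof -
  obtain x y where p: "p = (x, y)" by (cases p)
  note x' = that(2)[unfolded U_def p mem_Collect_eq fst_conv snd_conv]
  note x = conjunct1[OF conjunct1[OF x', unfolded pairs_cubes]] conjunct2[OF x'] conjunct1[OF x']
  have "act ?p a n p q:cubes ?p a" using act_in[OF cubical_set_pairs[OF F] that(1)] x(3) p by simp
  thus ?thesis using tn_dg1[OF F fF[OF x(1)] that(1)] fc_tn1[OF F x(1) that(1)] x(2) by (simp add: U_def p pairs_act)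
 qed
 have w_nat: "w a (tn E 1 a n x q, tn E 1 a n y q) = tn E 2 a n (w n (x, y)) q" and w_in: "w n (x, y):cubes E (Suc (Suc n))"
  if "box_hom a n q" "(x, y):cubes ?E n" for a n x y q
  using w that unfolding sfill_def by blast+
 have I_act: "act ?p a n (c (Suc n) x, c (Suc n) y) q = (c (Suc a) (tn E 1 a n x q), c (Suc a) (tn E 1 a n y q))
   & (tn E 1 a n x q, tn E 1 a n y q):cubes ?E a"
  if "box_hom a n q" "(x, y):cubes ?E n" for a n x y q
  using cact[OF tens1_hom[OF that(1)]] that(2) act_in[OF cubical_set_pairs[OF E] that] by (simp add: pairs_act pairs_cubes)
 have Ud: "x:cubes F (Suc n) & y = dg1 F n (fc F n x 1 True)" if p: "p:U n" "p = (x, y)" for p n x y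
 proof -
  note x' = p(1)[unfolded U_def p(2) mem_Collect_eq fst_conv snd_conv]
  show ?thesis by (rule conjI[OF conjunct1[OF conjunct1[OF x', unfolded pairs_cubes]] conjunct2[OF x']])
 qed
 have AI: "(p:U n & (EX x y. p = (x, y))) | (EX x y. (x, y):cubes ?E n & p = (c (Suc n) x, c (Suc n) y))" if "p:U n \<union> I n" for p n
  using that by (auto simp: I_def)
 have "EX L. (ALL n p. p:cubes ?p n --> L n p:cubes F (Suc 1 + n)) &
  (ALL a n q p. box_hom a n q --> p:cubes ?p n --> L a (act ?p a n p q) = tn F (Suc 1) a n (L n p) q) &
  (ALL i d n p. 1 <= i --> i <= Suc 1 --> (i, d) ~= (2, False) --> p:cubes ?p n --> fc F (1 + n) (L n p) i d = b i d n p) &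
  (ALL n p. p:U n \<union> I n --> L n p = LA n p)"
 proof (rule natural_filling[OF K cubical_set_pairs[OF F]])
  show "2:{1..Suc 1}" by simp
 next
  fix i d n and p :: "'f \<times> 'f" assume "p:cubes ?p n"
  thus "b i d n p:cubes F (1 + n)"
   using act_in[OF F dg1_hom fF] by (cases p) (simp add: b_def pairs_cubes)
 next
  fix i d a n q and p :: "'f \<times> 'f" assume q: "box_hom a n q" and "p:cubes ?p n"
  thus "b i d a (act ?p a n p q) = tn F 1 a n (b i d n p) q"
   using fc_tn1[OF F _ q] tn_dg1[OF F fF q] by (cases p) (simp add: b_def pairs_cubes pairs_act)
 next
  fix m i j d u n and p :: "'f \<times> 'f"
  assume m: "1 = Suc m" and ij: "1 <= i" "i < j" "j <= Suc 1" and ne: "(j, u) ~= (2, False)" and p: "p:cubes ?p n"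
  have "m = 0" "i = 1" "j = 2" "u = True" using m ij ne by auto
  thus "fc F (m + n) (b j u n p) i d = fc F (m + n) (b i d n p) (j - 1) u"
   using p fc_dg1[OF F fF] by (cases p) (simp add: b_def pairs_cubes One_nat_def)
 next
  fix n and p :: "'f \<times> 'f" assume "p:U n \<union> I n"
  thus "p:cubes ?p n" using I_in by (auto simp: U_def I_def)
 next
  fix a n q and p :: "'f \<times> 'f" assume q: "box_hom a n q" and p: "p:U n \<union> I n"
  show "act ?p a n p q:U a \<union> I a"
   using AI[OF p]
  proof (elim disjE exE conjE)
   fix x y assume "(x, y):cubes ?E n" "p = (c (Suc n) x, c (Suc n) y)"
   thus ?thesis using I_act[OF q, of x y] by (auto simp: I_def)
  qed (simp add: U_act[OF q])
 next
  fix n and p :: "'f \<times> 'f" assume p: "p:U n \<union> I n"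
  show "LA n p:cubes F (Suc 1 + n)"
   using AI[OF p]
  proof (elim disjE exE conjE)
   fix x y assume "(x, y):cubes ?E n" "p = (c (Suc n) x, c (Suc n) y)"
   thus ?thesis using cin[OF w_in[OF box_hom.id]] by (simp add: LA_I)
  next
   fix x y assume xy: "p:U n" "p = (x, y)"
   have "LA n p = cn1 F n x" using xy(1) unfolding LA_def xy(2) by (simp only: if_True fst_conv)
   thus ?thesis using act_in[OF F cn1_hom conjunct1[OF Ud[OF xy]]] by simp
  qed
 next
  fix a n q and p :: "'f \<times> 'f" assume q: "box_hom a n q" and p: "p:U n \<union> I n"
  show "LA a (act ?p a n p q) = tn F (Suc 1) a n (LA n p) q"
   using AI[OF p]
  proof (elim disjE exE conjE)
   fix x y assume xy: "(x, y):cubes ?E n" "p = (c (Suc n) x, c (Suc n) y)"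
   thus ?thesis
    using I_act[OF q xy(1)] LA_I[OF xy(1)] LA_I[of "tn E 1 a n x q" "tn E 1 a n y q" a] w_nat[OF q xy(1)]
     cact[OF box_hom_tens2[OF q] w_in[OF q xy(1)]] by simp
  next
   fix x y assume xy: "p:U n" "p = (x, y)"
   have "LA n p = cn1 F n x" using xy(1) unfolding LA_def xy(2) by (simp only: if_True fst_conv)
   moreover have "LA a (act ?p a n p q) = cn1 F a (tn F 1 a n x q)"
    using U_act[OF q xy(1)] unfolding LA_def xy(2) pairs_act by (simp only: if_True fst_conv)
   ultimately show ?thesis using tn_cn1[OF F conjunct1[OF Ud[OF xy]] q] by simp
  qed
 next
  fix i d n and p :: "'f \<times> 'f" assume i: "1 <= i" "i <= Suc 1" "(i, d) ~= (2, False)" and p: "p:U n \<union> I n"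
  let ?S = "Suc n"
  have i': "i = 1 | i = 2 & d" using i by auto
  show "fc F (1 + n) (LA n p) i d = b i d n p"
   using AI[OF p]
  proof (elim disjE exE conjE)
   fix x y assume xy: "(x, y):cubes ?E n" "p = (c ?S x, c ?S y)"
   have y: "y:cubes E ?S" "fc E n y 1 True:cubes E n" using xy(1) fc_in[OF E, of y n 1] by (simp_all add: pairs_cubes)
   have "fc E ?S (w n (x, y)) 1 False = x" "fc E ?S (w n (x, y)) 2 True = y"
    "fc E ?S (w n (x, y)) 1 True = dg1 E n (fc E n y 1 True)" using w xy(1) unfolding sfill_def by blast+
   thus ?thesis
    using i' cset_map_fc[OF cm w_in[OF box_hom.id xy(1)], of 1, symmetric]
     cset_map_fc[OF cm w_in[OF box_hom.id xy(1)], of 2, symmetric]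
     cact[OF dg1_hom y(2)] cfc[OF y(1)] LA_I[OF xy(1)] by (cases d) (auto simp: xy(2) b_def)
  next
   fix x y assume xy: "p:U n" "p = (x, y)"
   note x = conjunct1[OF Ud[OF xy]] conjunct2[OF Ud[OF xy]]
   have l: "LA n p = cn1 F n x" using xy(1) unfolding LA_def xy(2) by (simp only: if_True fst_conv)
   show ?thesis using i' fc_cn1_True[OF F x(1), of i] fc_cn1_False[OF F x(1), of 1] fc_dg1[OF F fF[OF x(1)]]
    unfolding l unfolding xy(2) b_def snd_conv fst_conv x(2) by (cases d) auto
  qed
 qed
 then obtain L where L: "ALL n p. p:cubes ?p n --> L n p:cubes F (Suc 1 + n)"
  "ALL a n q p. box_hom a n q --> p:cubes ?p n --> L a (act ?p a n p q) = tn F (Suc 1) a n (L n p) q"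
  "ALL i d n p. 1 <= i --> i <= Suc 1 --> (i, d) ~= (2, False) --> p:cubes ?p n --> fc F (1 + n) (L n p) i d = b i d n p"
  "ALL n p. p:U n \<union> I n --> L n p = LA n p" by (elim exE conjE)
 have "sfill F L"
  unfolding sfill_def
 proof (intro allI impI conjI)
  fix n x y assume p: "(x, y):cubes ?p n"
  show "L n (x, y):cubes F (Suc (Suc n))" using L(1) p by simp
  show "L a (tn F 1 a n x q, tn F 1 a n y q) = tn F 2 a n (L n (x, y)) q" if "box_hom a n q" for a q
   using L(2)[rule_format, OF that p] by (simp add: pairs_act)
  show "fc F (Suc n) (L n (x, y)) 1 False = x" using L(3)[rule_format, of 1 False "(x, y)" n] p by (simp add: b_def)
  show "fc F (Suc n) (L n (x, y)) 2 True = y" using L(3)[rule_format, of 2 True "(x, y)" n] p by (simp add: b_def)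
  show "fc F (Suc n) (L n (x, y)) 1 True = dg1 F n (fc F n y 1 True)"
   using L(3)[rule_format, of 1 True "(x, y)" n] p by (simp add: b_def)
  show "L n (x, y) = cn1 F n x" if "y = dg1 F n (fc F n x 1 True)"
   using L(4)[rule_format, of "(x, y)" n] p that by (simp add: LA_def U_def)
 qed
 moreover have "L n (c (Suc n) x, c (Suc n) y) = c (Suc (Suc n)) (w n (x, y))" if "(x, y):cubes ?E n" for n x y
 proof -
  have m: "(c (Suc n) x, c (Suc n) y):U n \<union> I n" using that by (force simp: I_def)
  show ?thesis using L(4)[rule_format, OF m] LA_I[OF that] by simp
 qed
 ultimately show ?thesis by (rule that)
qed

section \<open>Merging grids of cubes\<close>

definition star :: "'e cset => (nat => 'e \<times> 'e => 'e) => nat => 'e => 'e => 'e" where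
 "star E w n x y = fc E (Suc n) (w n (x, y)) 2 False"

primrec chain :: "'e cset => (nat => 'e \<times> 'e => 'e) => nat => (nat => 'e) => nat => 'e" where
 "chain E w n f 0 = f 0"
| "chain E w n f (Suc k) = star E w n (chain E w n f k) (f (Suc k))"

locale composition =
 fixes E :: "'e cset" and w
 assumes E: "cubical_set E" and w: "sfill E w"
begin

lemma w_in: "(x, y):cubes (pairs E) n ==> w n (x, y):cubes E (Suc (Suc n))"
 and w_act: "(x, y):cubes (pairs E) n ==> box_hom a n f ==> w a (tn E 1 a n x f, tn E 1 a n y f) = tn E 2 a n (w n (x, y)) f"
 and w_10: "(x, y):cubes (pairs E) n ==> fc E (Suc n) (w n (x, y)) 1 False = x"
 and w_11: "(x, y):cubes (pairs E) n ==> fc E (Suc n) (w n (x, y)) 1 True = dg1 E n (fc E n y 1 True)"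
 and w_unit: "(x, y):cubes (pairs E) n ==> y = dg1 E n (fc E n x 1 True) ==> w n (x, y) = cn1 E n x"
 using w unfolding sfill_def by blast+

lemma star_in: "(x, y):cubes (pairs E) n ==> star E w n x y:cubes E (Suc n)"
 unfolding star_def by (rule fc_in[OF E w_in]) auto

lemma star_fc:
 assumes p: "(x, y):cubes (pairs E) n"
 shows "fc E n (star E w n x y) 1 e = (if e then fc E n y 1 True else fc E n x 1 False)"
proof -
 have y: "fc E n y 1 True:cubes E n" using p fc_in[OF E, of y n 1] by (simp add: pairs_cubes)
 have "fc E n (star E w n x y) 1 e = fc E n (fc E (Suc n) (w n (x, y)) 1 e) 1 False"
  using fc_fc[OF E w_in[OF p], of 1 2 False e] unfolding star_def by (simp flip: One_nat_def)
 thus ?thesis using w_10[OF p] w_11[OF p] fc_dg1[OF E y] by (cases e) auto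
qed

lemma star_act:
 assumes p: "(x, y):cubes (pairs E) n" and f: "box_hom a n f"
 shows "star E w a (tn E 1 a n x f) (tn E 1 a n y f) = tn E 1 a n (star E w n x y) f"
 unfolding star_def w_act[OF p f] using fc_tn[OF E _ f, of _ 1 2 False] w_in[OF p] by simp

lemma star_unit:
 assumes p: "(x, y):cubes (pairs E) n" and y: "y = dg1 E n (fc E n x 1 True)"
 shows "star E w n x y = x"
 unfolding star_def w_unit[OF assms] by (rule fc_cn1_False[OF E]) (use p in \<open>simp_all add: pairs_cubes\<close>)

lemma chain_props:
 assumes "!!i. i <= k ==> f i:cubes E (Suc n)" "!!i. i < k ==> fc E n (f i) 1 True = fc E n (f (Suc i)) 1 False"
 shows "chain E w n f k:cubes E (Suc n) &
  (ALL e. fc E n (chain E w n f k) 1 e = (if e then fc E n (f k) 1 True else fc E n (f 0) 1 False)) &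
  (ALL a q. box_hom a n q --> chain E w a (%i. tn E 1 a n (f i) q) k = tn E 1 a n (chain E w n f k) q)"
 using assms
proof (induction k)
 case 0
 thus ?case by simp
next
 case (Suc k)
 let ?c = "chain E w n f k"
 have IH: "?c:cubes E (Suc n)"
  "fc E n ?c 1 e = (if e then fc E n (f k) 1 True else fc E n (f 0) 1 False)"
  "box_hom a n q ==> chain E w a (%i. tn E 1 a n (f i) q) k = tn E 1 a n ?c q" for e a q
  using Suc by simp_all
 have p: "(chain E w n f k, f (Suc k)):cubes (pairs E) n"
  using IH(1,2) Suc.prems(1)[of "Suc k"] Suc.prems(2)[of k] by (simp add: pairs_cubes)
 show ?case using star_in[OF p] star_fc[OF p] star_act[OF p] IH by simp
qed

lemma chain_cong: "(!!i. i <= k ==> f i = g i) ==> chain E w n f k = chain E w n g k"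
 by (induction k) simp_all

lemma chain_unit:
 assumes "f 0:cubes E (Suc n)" "!!i. 0 < i ==> i <= k ==> f i = dg1 E n (fc E n (f 0) 1 True)"
 shows "chain E w n f k = f 0"
 using assms(2)
proof (induction k)
 case 0
 thus ?case by simp
next
 case (Suc k)
 have z: "fc E n (f 0) 1 True:cubes E n" by (rule fc_in[OF E assms(1)]) auto
 have e: "f (Suc k) = dg1 E n (fc E n (f 0) 1 True)" using Suc.prems by simp
 have "(f 0, f (Suc k)):cubes (pairs E) n"
  unfolding e using assms(1) act_in[OF E dg1_hom z] fc_dg1[OF E z] by (simp add: pairs_cubes)
 from star_unit[OF this e] show ?case using Suc by simp
qed

end

definition LP :: "nat => 'e cset => 'e => 'e cset" where
 "LP N E e = fst (iter_loop N (E, e))"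

lemma iter_loop_Suc: "iter_loop (Suc N) (E, e) = iter_loop N (loop_cset E e, lbase E e)"
 unfolding iter_loop_def funpow_Suc_right by (simp add: loop_pointed_def)

lemma LP_0: "LP 0 E e = E" and LP_Suc: "LP (Suc N) E e = LP N (loop_cset E e) (lbase E e)"
 by (simp add: LP_def iter_loop_def) (simp add: LP_def iter_loop_Suc)

text \<open>Indices run through \<open>0..k\<close>, so there are \<open>k + 1\<close> steps in each
  of the \<open>N\<close> grid directions; the \<open>n\<close> coordinates behind these are
  parameters. Constant outer faces make merged cubes loops.\<close>

definition valid :: "'e cset => 'e => nat => nat => nat => ((nat => nat) => 'e) => bool" where
 "valid E e N k n c = ((ALL a. vidx N (Suc k) a --> c a:cubes E (N + n)) &
   (ALL a i N'. N = Suc N' --> i:{1..N} --> vidx N (Suc k) a --> vidx N (Suc k) (up i a) -->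
    fc E (N' + n) (c a) i True = fc E (N' + n) (c (up i a)) i False) &
   (ALL a i d N'. N = Suc N' --> i:{1..N} --> vidx N (Suc k) a --> a i = (if d then k else 0) -->
    fc E (N' + n) (c a) i d = konst E e (N' + n)))"

lemma valid_in: "valid E e N k n c ==> vidx N (Suc k) a ==> c a:cubes E (N + n)"
 by (simp add: valid_def)

lemma valid_match: "valid E e (Suc N) k n c ==> i:{1..Suc N} ==> vidx (Suc N) (Suc k) a ==>
  vidx (Suc N) (Suc k) (up i a) ==> fc E (N + n) (c a) i True = fc E (N + n) (c (up i a)) i False"
 by (simp add: valid_def)

lemma valid_bdry: "valid E e (Suc N) k n c ==> i:{1..Suc N} ==> vidx (Suc N) (Suc k) a ==>
  a i = (if d then k else 0) ==> fc E (N + n) (c a) i d = konst E e (N + n)"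
 by (simp add: valid_def)

definition icons :: "nat => (nat => nat) => nat => nat" where
 "icons b a j = (if j = 0 then 0 else if j = 1 then b else a (j - 1))"

lemma icons_simps [simp]: "icons b a 1 = b" "1 <= j ==> icons b a (Suc j) = a j" "(icons b a)(1 := b') = icons b' a"
 by (auto simp: icons_def)

lemma icons_upd: "1 <= i ==> icons b (a(i := x)) = (icons b a)(Suc i := x)"
 by (auto simp: icons_def fun_eq_iff)

lemma vidx_icons: "vidx (Suc N) K (icons b a) \<longleftrightarrow> b < K & vidx N K a"
proof
 assume h: "vidx (Suc N) K (icons b a)"
 have "icons b a 1 < K" using h unfolding vidx_def by (rule bspec) simp
 moreover have "a j < K" if "j:{1..N}" for j
 proof -
  have "icons b a (Suc j) < K" using h unfolding vidx_def by (rule bspec) (use that in simp)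
  thus ?thesis using that by simp
 qed
 ultimately show "b < K & vidx N K a" by (simp add: vidx_def)
next
 assume h: "b < K & vidx N K a"
 show "vidx (Suc N) K (icons b a)"
  unfolding vidx_def
 proof
  fix j assume "j:{1..Suc N}"
  thus "icons b a j < K" using h pred_mem[of j N] by (auto simp: icons_def vidx_def)
 qed
qed

text \<open>Merging as an abstract operation. Naturality lets a homotopy of grids be merged to a
  homotopy of the results, and the unit clause evaluates a grid with a single nontrivial cell
  exactly.\<close>

definition merging :: "'e cset => 'e => nat => nat => (nat => ((nat => nat) => 'e) => 'e) => bool" where
 "merging E e N k m =
   ((ALL n c. valid E e N k n c --> m n c:cubes (LP N E e) n &
    (ALL a f. box_hom a n f --> m a (%l. tn E N a n (c l) f) = act (LP N E e) a n (m n c) f)) &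
   (ALL n s. s:cubes (LP N E e) n --> m n (%a. if ALL j:{1..N}. a j = 0 then s else konst E e (N + n)) = s) &
   (ALL n c c'. (ALL a. vidx N (Suc k) a --> c a = c' a) --> m n c = m n c'))"

lemma LP_cubes:
 assumes "cubical_set E" "e:cubes E 0"
 shows "s:cubes (LP N E e) n \<longleftrightarrow> s:cubes E (N + n) &
  (ALL N' i c. N = Suc N' --> i:{1..N} --> fc E (N' + n) s i c = konst E e (N' + n))"
 using assms
proof (induction N arbitrary: E e)
 case 0
 thus ?case by (simp add: LP_0)
next
 case (Suc N)
 let ?L = "loop_cset E e"
 let ?N = "N + n"
 note IH = Suc.IH[OF loop_cset_cubical[OF Suc.prems] lbase_in[OF Suc.prems]]
 have f: "fc ?L (N' + n) s i c = fc E ?N s (Suc i) c" if "N = Suc N'" "i:{1..N}" for N' i c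
  using that by (simp add: loop_fc)
 have "(ALL N' i c. N = Suc N' --> i:{1..N} --> fc ?L (N' + n) s i c = konst ?L (lbase E e) (N' + n)) \<longleftrightarrow>
   (ALL i:{1..N}. ALL c. fc E ?N s (Suc i) c = konst E e ?N)"
 proof (cases N)
  case (Suc N')
  thus ?thesis using f konst_loop[OF Suc.prems] by auto
 qed simp
 moreover have "(ALL i:{1..Suc N}. ALL c. fc E ?N s i c = konst E e ?N) \<longleftrightarrow>
   (ALL c. fc E ?N s 1 c = konst E e ?N) & (ALL i:{1..N}. ALL c. fc E ?N s (Suc i) c = konst E e ?N)"
  (is "?l \<longleftrightarrow> ?r1 & ?r2")
 proof
  assume r: "?r1 & ?r2"
  show ?l
  proof (intro ballI allI)
   fix i c assume i: "i:{1..Suc N}"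
   show "fc E ?N s i c = konst E e ?N"
   proof (cases "i = 1")
    case False
    have "Suc (i - 1) = i" using i by simp
    thus ?thesis using r pred_mem[OF i False] by metis
   qed (use r in simp)
  qed
 qed auto
 ultimately show ?case unfolding LP_Suc IH by (auto simp: loop_cubes)
qed

lemma LP_act: "cubical_set E ==> e:cubes E 0 ==> s:cubes (LP N E e) n ==> box_hom a n f ==>
  act (LP N E e) a n s f = tn E N a n s f"
proof (induction N arbitrary: E e)
 case 0
 thus ?case by (simp add: LP_0 tens_0)
next
 case (Suc N)
 have "act (LP (Suc N) E e) a n s f = tn (loop_cset E e) N a n s f"
  using Suc.IH[OF loop_cset_cubical[OF Suc.prems(1,2)] lbase_in[OF Suc.prems(1,2)]] Suc.prems(3,4) by (simp add: LP_Suc)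
 thus ?case using tens_tens[of 1 N a n f] by (simp add: loop_act)
qed

text \<open>Rows in the first direction are composed by \<open>chain\<close>. Their outer faces are
  constant, so the results are loops, and they form a valid grid with one direction less in the loop
  object.\<close>

lemma merging_step:
 fixes E :: "'e cset"
 assumes E: "cubical_set E" and e: "e:cubes E 0" and w: "sfill E w"
  and u: "merging (loop_cset E e) (lbase E e) N k u"
 defines "C == %n c a. chain E w (N + n) (%i. c (icons i a)) k"
 shows "merging E e (Suc N) k (%n c. u n (C n c))"
  and "!!n c. valid E e (Suc N) k n c ==> valid (loop_cset E e) (lbase E e) N k n (C n c)"
proof -
 let ?S = "Suc N"
 let ?k = "Suc k"
 interpret composition E w by standard (fact E w)+
 let ?L = "loop_cset E e" and ?l = "lbase E e"
 note L = loop_cset_cubical[OF E e] and l = lbase_in[OF E e]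
 have cin: "c (icons i a):cubes E (Suc (N + n))"
  and cm: "i < k ==> fc E (N + n) (c (icons i a)) 1 True = fc E (N + n) (c (icons (Suc i) a)) 1 False"
  and cb: "i = (if d then k else 0) ==> fc E (N + n) (c (icons i a)) 1 d = konst E e (N + n)"
  if "valid E e ?S k n c" "vidx N ?k a" "i <= k" for n c a i d
 proof -
  let ?I = "icons i a"
  have v: "vidx ?S ?k ?I" using that by (simp add: vidx_icons)
  show "c ?I:cubes E (Suc (N + n))" using valid_in[OF that(1) v] by simp
  show "fc E (N + n) (c ?I) 1 d = konst E e (N + n)" if "i = (if d then k else 0)"
   using valid_bdry[OF \<open>valid E e (Suc N) k n c\<close> _ v, of 1 d] that by simp
  show "fc E (N + n) (c ?I) 1 True = fc E (N + n) (c (icons (Suc i) a)) 1 False" if "i < k"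
   using valid_match[OF \<open>valid E e (Suc N) k n c\<close> _ v, of 1] that \<open>vidx N (Suc k) a\<close> by (simp add: vidx_icons)
 qed
 have ch: "C n c a:cubes ?L (N + n)"
  and ca: "!!b q. box_hom b (N + n) q ==> chain E w b (%i. tn E 1 b (N + n) (c (icons i a)) q) k = tn E 1 b (N + n) (C n c a) q"
  if "valid E e ?S k n c" "vidx N ?k a" for n c a
 proof -
  let ?N = "N + n"
  have p: "C n c a:cubes E (Suc ?N) &
   (ALL d. fc E ?N (C n c a) 1 d = (if d then fc E ?N (c (icons k a)) 1 True else fc E ?N (c (icons 0 a)) 1 False)) &
   (ALL b q. box_hom b ?N q --> chain E w b (%i. tn E 1 b ?N (c (icons i a)) q) k = tn E 1 b ?N (C n c a) q)"
   unfolding C_def by (rule chain_props) (use cin[OF that] cm[OF that] in simp_all)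
  show "C n c a:cubes ?L ?N" using p cb[OF that, of k True] cb[OF that, of 0 False] by (simp add: loop_cubes)
  show "!!b q. box_hom b ?N q ==> chain E w b (%i. tn E 1 b ?N (c (icons i a)) q) k = tn E 1 b ?N (C n c a) q"
   using p by simp
 qed
 have face: "fc ?L m (C n c a) i d = chain E w m (%b. fc E (Suc m) (c (icons b a)) (Suc i) d) k"
  if "valid E e ?S k n c" "vidx N ?k a" "1 <= i" "i <= N" "N + n = Suc m" for n c a i d m
 proof -
  have i: "i <= Suc m" using that(4,5) by linarith
  hence h: "box_hom m (N + n) (box_face (Suc m) i d)" using face_hom[of i "Suc m" m d] that(3,5) by simp
  have "fc E (Suc m) x (Suc i) d = tn E 1 m (N + n) x (box_face (Suc m) i d)" for x
   using tn_face[OF that(3) i, of E 1 x d] that(5) by simp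
  thus ?thesis using ca[OF that(1,2) h] loop_fc[OF that(3) i, of E e "C n c a" d] by simp
 qed
 have un: "chain E w m (%i. konst E e (Suc m)) k = konst E e (Suc m)" for m
 proof (rule chain_unit)
  let ?E = "konst E e (Suc m)"
  show "?E:cubes E (Suc m)" by (rule konst_in[OF E e])
  show "?E = dg1 E m (fc E m ?E 1 True)"
   using fc_konst[OF E e, of 1 m True] konst_act[OF E e dg1_hom] by simp
 qed
 show V: "valid ?L ?l N k n (C n c)" if v: "valid E e ?S k n c" for n c
  unfolding valid_def
 proof (intro conjI allI impI)
  show "C n c a:cubes ?L (N + n)" if "vidx N ?k a" for a by (rule ch[OF v that])
 next
  fix a i N' assume N: "N = Suc N'" and i: "i:{1..N}" and a: "vidx N ?k a" and a': "vidx N ?k (up i a)"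
  let ?i = "up i a"
  have i': "1 <= i" "i <= N" using i by auto
  have m: "N + n = Suc (N' + n)" using N by simp
  show "fc ?L (N' + n) (C n c a) i True = fc ?L (N' + n) (C n c ?i) i False"
   unfolding face[OF v a i' m] face[OF v a' i' m]
  proof (rule chain_cong)
   fix b assume b: "b <= k"
   have e: "(icons b a)(Suc i := Suc (icons b a (Suc i))) = icons b ?i"
    using i'(1) by (simp add: icons_upd)
   show "fc E (Suc (N' + n)) (c (icons b a)) (Suc i) True = fc E (Suc (N' + n)) (c (icons b ?i)) (Suc i) False"
    using valid_match[OF v, of "Suc i" "icons b a"] i b a a' N unfolding e by (simp add: vidx_icons)
  qed
 next
  fix a i d N' assume N: "N = Suc N'" and i: "i:{1..N}" and a: "vidx N ?k a" and ai: "a i = (if d then k else 0)"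
  let ?n = "N' + n"
  have i': "1 <= i" "i <= N" using i by auto
  have m: "N + n = Suc ?n" using N by simp
  have "fc ?L ?n (C n c a) i d = chain E w ?n (%_. konst E e (Suc ?n)) k"
   unfolding face[OF v a i' m]
  proof (rule chain_cong)
   fix b assume b: "b <= k"
   show "fc E (Suc ?n) (c (icons b a)) (Suc i) d = konst E e (Suc ?n)"
    using valid_bdry[OF v, of "Suc i" "icons b a" d] i b a ai N by (simp add: vidx_icons)
  qed
  thus "fc ?L ?n (C n c a) i d = konst ?L ?l ?n" by (simp add: un konst_loop[OF E e])
 qed
 have u_in: "u n c:cubes (LP N ?L ?l) n"
  and u_act: "box_hom a n q ==> u a (%l. tn ?L N a n (c l) q) = act (LP N ?L ?l) a n (u n c) q"
  if "valid ?L ?l N k n c" for n c a q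
  using u that unfolding merging_def by simp_all
 have u_unit: "u n (%a. if ALL j:{1..N}. a j = 0 then s else konst ?L ?l (N + n)) = s" if "s:cubes (LP N ?L ?l) n" for n s
  using u that unfolding merging_def by simp
 have u_cong: "u n c = u n c'" if "!!a. vidx N ?k a ==> c a = c' a" for n c c'
  using u that unfolding merging_def by simp
 show "merging E e ?S k (%n c. u n (C n c))"
  unfolding merging_def
 proof (intro conjI allI impI)
  fix n c assume v: "valid E e ?S k n c"
  show "u n (C n c):cubes (LP ?S E e) n" using u_in[OF V[OF v]] by (simp add: LP_Suc)
  fix a q assume q: "box_hom a n q"
  let ?t = "%l. tn E ?S a n (c l) q"
  have "u a (C a ?t) = u a (%l. tn ?L N a n (C n c l) q)"
  proof (rule u_cong)
   fix l assume l: "vidx N ?k l"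
   have t: "tens 1 (N + a) (N + n) (tens N a n q) = tens ?S a n q" using tens_tens[of 1 N a n q] by simp
   show "C a ?t l = tn ?L N a n (C n c l) q"
    using ca[OF v l tens_hom[OF q, of N]] unfolding t loop_act by (simp add: C_def)
  qed
  thus "u a (C a ?t) = act (LP ?S E e) a n (u n (C n c)) q"
   using u_act[OF V[OF v] q] by (simp add: LP_Suc)
 next
  fix n s assume s: "s:cubes (LP ?S E e) n"
  let ?c = "%a. if ALL j:{1..Suc N}. a j = 0 then s else konst E e (Suc N + n)"
  let ?a = "N + n"
  have s1: "s:cubes E (Suc ?a)" "fc E ?a s 1 True = konst E e ?a"
   using s LP_cubes[OF E e, of s ?S n] by auto
  have z: "(ALL j:{1..Suc N}. icons i a j = 0) \<longleftrightarrow> i = 0 & (ALL j:{1..N}. a j = 0)" for i a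
   using vidx_icons[of N 1 i a] by (simp add: vidx_def)
  have "u n (C n ?c) = u n (%a. if ALL j:{1..N}. a j = 0 then s else konst ?L ?l ?a)"
  proof (rule u_cong)
   fix a assume "vidx N ?k a"
   show "C n ?c a = (if ALL j:{1..N}. a j = 0 then s else konst ?L ?l ?a)"
   proof (cases "ALL j:{1..N}. a j = 0")
    case True
    have "chain E w ?a (%i. if i = 0 then s else konst E e (Suc ?a)) k = (if (0::nat) = 0 then s else konst E e (Suc ?a))"
     by (rule chain_unit) (use s1 konst_act[OF E e dg1_hom] in simp_all)
    thus ?thesis using True unfolding C_def z add_Suc by simp
   next
    case False
    hence f: "(ALL j:{1..N}. a j = 0) = False" by simp
     show ?thesis unfolding C_def z add_Suc f simp_thms if_False un konst_loop[OF E e] by simp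
   qed
  qed
  also have "\<dots> = s" by (rule u_unit) (use s in \<open>simp add: LP_Suc\<close>)
  finally show "u n (C n ?c) = s" .
 next
  fix n and c c' :: "(nat => nat) => 'e" assume cc: "ALL a. vidx ?S ?k a --> c a = c' a"
  show "u n (C n c) = u n (C n c')"
   by (rule u_cong) (use cc in \<open>auto simp: C_def vidx_icons intro!: chain_cong\<close>)
 qed
qed

text \<open>Composition on \<open>E\<close> is obtained by extending from the empty cubical set,
  then extended to \<open>F\<close> along \<open>h\<close>.\<close>

lemma sfill_pair:
 fixes E :: "'e cset" and F :: "'f cset"
 assumes KE: "kanE E" and KF: "kanE F" and h: "embed E F h"
 obtains w w' where "sfill E w" "sfill F w'"
  "!!n x y. (x, y):cubes (pairs E) n ==> w' n (h (Suc n) x, h (Suc n) y) = h (Suc (Suc n)) (w n (x, y))"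
proof -
 let ?Z = "\<lparr>cubes = %_. {}, act = %_ _ x _. x\<rparr> :: 'e cset"
 have "cubical_set ?Z" "embed ?Z E (%_ x. x)" "sfill ?Z (%_ p. fst p)"
  by (simp_all add: cubical_set_def embed_def cset_map_def sfill_def pairs_cubes)
 then obtain w where w: "sfill E w" by (rule sfill_extend[OF KE])
 show ?thesis by (rule sfill_extend[OF KF kanE_cset[OF KE] h w]) (rule that[OF w])
qed

text \<open>The two mergings are built together, because agreement under \<open>h\<close> has to be
  arranged anew at each stage of the iterated loop objects.\<close>

lemma merge_ex:
 fixes E :: "'e cset" and F :: "'f cset"
 assumes "kanE E" "kanE F" "embed E F h" "e:cubes E 0"
 shows "EX u u'. merging E e N k u & merging F (h 0 e) N k u' &
  (ALL n c. valid E e N k n c --> u' n (%a. h (N + n) (c a)) = h (N + n) (u n c))"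
 using assms
proof (induction N arbitrary: E F h e)
 case 0
 have m0: "merging E e 0 k (%n c. c (%_. 0))" if "cubical_set E" "e:cubes E 0" for E :: "'x cset" and e
  unfolding merging_def by (simp add: valid_def LP_0 tens_0 vidx_def)
 have "h 0 e:cubes F 0" by (rule cset_map_in[OF conjunct1[OF 0(3)[unfolded embed_def]] 0(4)])
 with m0[OF kanE_cset[OF 0(1)] 0(4)] m0[OF kanE_cset[OF 0(2)]]
 show ?case by (intro exI[of _ "%n c. c (%_. 0)"]) simp
next
 case (Suc N)
 note KE = Suc.prems(1) and KF = Suc.prems(2) and h = Suc.prems(3) and e = Suc.prems(4)
 have hm: "cset_map E F h" using h by (simp add: embed_def)
 have he: "h 0 e:cubes F 0" by (rule cset_map_in[OF hm e])
 note E = kanE_cset[OF KE] and F = kanE_cset[OF KF]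
 obtain w w' where w: "sfill E w" "sfill F w'"
  "!!n x y. (x, y):cubes (pairs E) n ==> w' n (h (Suc n) x, h (Suc n) y) = h (Suc (Suc n)) (w n (x, y))"
  by (rule sfill_pair[OF KE KF h]) (rule that)
 have "loop_map h 0 (lbase E e) = lbase F (h 0 e)"
  using konst_map[OF hm e, of 1] by (simp add: loop_map_def lbase_konst flip: One_nat_def)
 with Suc.IH[OF kanE_loop[OF KE e] kanE_loop[OF KF he] embed_loop[OF h e] lbase_in[OF E e]]
 obtain u u' where u: "merging (loop_cset E e) (lbase E e) N k u" "merging (loop_cset F (h 0 e)) (lbase F (h 0 e)) N k u'"
  "ALL n c. valid (loop_cset E e) (lbase E e) N k n c --> u' n (%a. loop_map h (N + n) (c a)) = loop_map h (N + n) (u n c)"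
  by (elim exE conjE) simp
 note mE = merging_step[OF E e w(1) u(1)] and mF = merging_step[OF F he w(2) u(2)]
 interpret A: composition E w by standard (fact E w)+
 interpret B: composition F w' by standard (fact F w)+
 have chain_h: "h (Suc m) (chain E w m f j) = chain F w' m (%i. h (Suc m) (f i)) j"
  if "!!i. i <= j ==> f i:cubes E (Suc m)" "!!i. i < j ==> fc E m (f i) 1 True = fc E m (f (Suc i)) 1 False" for m f j
  using that
 proof (induction j)
  case 0
  show ?case by simp
 next
  case (Suc j)
  let ?c = "chain E w m f j"
  have c: "chain E w m f j:cubes E (Suc m) &
   (ALL d. fc E m ?c 1 d = (if d then fc E m (f j) 1 True else fc E m (f 0) 1 False)) &
   (ALL a q. box_hom a m q --> chain E w a (%i. tn E 1 a m (f i) q) j = tn E 1 a m ?c q)"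
   by (rule A.chain_props) (use Suc.prems in simp_all)
  have p: "(chain E w m f j, f (Suc j)):cubes (pairs E) m"
   using c Suc.prems(1)[of "Suc j"] Suc.prems(2)[of j] by (simp add: pairs_cubes)
  have "h (Suc m) (star E w m ?c (f (Suc j))) = star F w' m (h (Suc m) ?c) (h (Suc m) (f (Suc j)))"
   unfolding star_def w(3)[OF p] by (rule cset_map_fc[OF hm A.w_in[OF p]]) auto
  thus ?case using Suc by simp
 qed
 show ?case
 proof (intro exI conjI allI impI)
  show "merging E e (Suc N) k (%n c. u n (%a. chain E w (N + n) (%i. c (icons i a)) k))" by (rule mE(1))
  show "merging F (h 0 e) (Suc N) k (%n c. u' n (%a. chain F w' (N + n) (%i. c (icons i a)) k))" by (rule mF(1))
  fix n c assume v: "valid E e (Suc N) k n c"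
  let ?N = "N + n"
  let ?a = "%a. chain F w' ?N (%i. h (Suc N + n) (c (icons i a))) k"
  let ?u = "u n (%a. chain E w ?N (%i. c (icons i a)) k)"
  have "u' n ?a =
    u' n (%a. loop_map h ?N (chain E w ?N (%i. c (icons i a)) k))"
  proof -
   have "chain F w' ?N (%i. h (Suc N + n) (c (icons i a))) k = loop_map h ?N (chain E w ?N (%i. c (icons i a)) k)"
    if a: "vidx N (Suc k) a" for a
   proof -
    have "h (Suc ?N) (chain E w ?N (%i. c (icons i a)) k) = chain F w' ?N (%i. h (Suc ?N) (c (icons i a))) k"
    proof (rule chain_h)
     fix i assume "i <= k"
     thus "c (icons i a):cubes E (Suc ?N)" using valid_in[OF v, of "icons i a"] a by (simp add: vidx_icons)
    next
     fix i assume "i < k"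
     thus "fc E ?N (c (icons i a)) 1 True = fc E ?N (c (icons (Suc i) a)) 1 False"
      using valid_match[OF v, of 1 "icons i a"] a by (simp add: vidx_icons)
    qed
    thus ?thesis by (simp add: loop_map_def)
   qed
   thus ?thesis using u(2) unfolding merging_def by simp
  qed
  also have "\<dots> = loop_map h ?N ?u"
   using u(3) mE(2)[OF v] by simp
  finally show "u' n ?a =
    h (Suc N + n) ?u"
   by (simp add: loop_map_def)
 qed
qed

section \<open>Comparing merged grids\<close>

declare One_nat_def [symmetric, simp]

definition lnk :: "'e cset => 'e => 'e => bool" where
 "lnk Z s s' = ((EX H:cubes Z 1. fc Z 0 H 1 False = s & fc Z 0 H 1 True = s'))"

lemma lnkI: "H:cubes Z 1 ==> fc Z 0 H 1 False = s ==> fc Z 0 H 1 True = s' ==> lnk Z s s'"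
 by (auto simp: lnk_def)

lemma merging_in: "merging E e N k m ==> valid E e N k n c ==> m n c:cubes (LP N E e) n"
 and merging_act: "merging E e N k m ==> valid E e N k n c ==> box_hom a n f ==>
  m a (%l. tn E N a n (c l) f) = act (LP N E e) a n (m n c) f"
 and merging_unit: "merging E e N k m ==> s:cubes (LP N E e) n ==>
  m n (%a. if ALL j:{1..N}. a j = 0 then s else konst E e (N + n)) = s"
 and merging_cong: "merging E e N k m ==> (!!a. vidx N (Suc k) a ==> c a = c' a) ==> m n c = m n c'"
 unfolding merging_def by simp_all

text \<open>Naturality of merging, applied to the two vertices of the parameter interval.\<close>

lemma merging_ends:
 assumes m: "merging E e N k m" and c: "valid E e N k 1 c"
  and d: "!!a. vidx N (Suc k) a ==> d a = fc E N (c a) (Suc N) b"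
 shows "fc (LP N E e) 0 (m 1 c) 1 b = m 0 d"
proof -
 have f: "box_hom 0 1 (box_face 1 1 b)" by (rule face_hom) auto
 have "fc (LP N E e) 0 (m 1 c) 1 b = m 0 (%l. tn E N 0 1 (c l) (box_face 1 1 b))"
  using merging_act[OF m c f] by simp
 also have "\<dots> = m 0 d"
  by (rule merging_cong[OF m]) (use d tn_face[of 1 0 E N _ b] in simp)
 finally show ?thesis .
qed

text \<open>The straight line from the part of the reparametrized cube in cell \<open>a\<close> to
  the map with coordinates \<open>min 1 (a j + t j)\<close>. The latter is the identity on the
  corner cell, lies in a face at \<open>1\<close> on every other cell, and still matches along the
  grid.\<close>

definition straight :: "nat => nat => (real => real) => (nat => nat) => (nat => real) => nat => real" where
 "straight N k w a = (\<lambda>t\<in>cell (Suc N). \<lambda>j\<in>{1..N}.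
   (1 - t (Suc N)) * w ((real (a j) + t j) / real (Suc k)) + t (Suc N) * min 1 (real (a j) + t j))"

lemma end_mono_bounds: "end_mono w ==> 0 <= s ==> s <= 1 ==> 0 <= w s & w s <= 1"
 by (auto simp: end_mono_def)

lemma straight_in:
 assumes u: "end_mono u" "continuous_on {0..1} u" and a: "vidx N (Suc k) a"
 shows "straight N k u a:sc N (Suc N)"
 unfolding straight_def
proof (rule SC_I)
 fix t j assume t: "t:cell (Suc N)" and j: "j:{1..N}"
 let ?r = "(real (a j) + t j) / real (Suc k)"
 let ?a = "real (a j) + t j"
 let ?S = "Suc N"
 let ?T = "1 - t ?S"
 have aj: "a j < Suc k" using a j by (simp add: vidx_def)
 hence "real (a j) + 1 <= real (Suc k)" by linarith
 moreover have tj: "0 <= t j" "t j <= 1" "0 <= t ?S" "t ?S <= 1"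
  using cell_bounds[OF t, of j] cell_bounds[OF t, of ?S] j by auto
 ultimately have "0 <= ?r" "?r <= 1"
  by auto
 hence w: "0 <= u ?r" "u ?r <= 1"
  using end_mono_bounds[OF u(1)] by blast+
 have m: "0 <= min 1 ?a" "min 1 ?a <= 1" using tj by auto
 show "0 <= ?T * u ?r + t ?S * min 1 ?a &
  ?T * u ?r + t ?S * min 1 ?a <= 1"
 proof
  show "0 <= ?T * u ?r + t ?S * min 1 ?a"
   using w tj by simp
  have "?T * u ?r <= ?T"
   by (rule mult_left_le) (use w tj in auto)
  moreover have "t ?S * min 1 ?a <= t ?S" by (rule mult_left_le) (use m tj in auto)
  ultimately show "?T * u ?r + t ?S * min 1 ?a <= 1"
   by linarith
 qed
next
 fix j assume j: "j:{1..N}"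
 let ?t = "%t. (real (a j) + t j) / real (Suc k)"
 let ?c = "ct (Suc N)"
 have aj: "a j < Suc k" using a j by (simp add: vidx_def)
 hence aj': "real (a j) + 1 <= real (Suc k)" by linarith
 have p: "cts ?c (%t. t j)"
  "cts ?c (%t. t (Suc N))"
  using j by (auto intro: cts_proj)
 have "continuous_map ?c (top_of_set {0..1}) ?t"
  unfolding continuous_map_in_subtopology
 proof
  show "continuous_map ?c euclidean ?t"
   using p by (intro continuous_intros) auto
  show "?t:topspace ?c \<rightarrow> {0..1}"
   using j aj' cell_bounds[of _ "Suc N" j] by (force)
 qed
 hence "cts ?c (%t. u ((real (a j) + t j) / real (Suc k)))"
  using continuous_map_compose[of _ "top_of_set {0..1}" _ euclideanreal u] u(2) by (simp add: o_def)
 thus "cts ?c (%t. (1 - t (Suc N)) * u ((real (a j) + t j) / real (Suc k)) + t (Suc N) * min 1 (real (a j) + t j))"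
  using p by (intro continuous_map_add continuous_map_real_mult continuous_map_diff continuous_map_real_min) auto
qed

lemma SC_fc: "g:sc N (Suc n) ==> 1 <= i ==> i <= Suc n ==> fc (SC N) n g i e:sc N n"
 by (rule fc_in[OF Sing_cset])

text \<open>At the far end of the straight-line homotopy only the corner cell is nontrivial, so the
  unit clause of merging returns the value of \<open>r\<close> on the identity exactly. Abstracting
  \<open>r\<close> allows it to be composition with a singular cube or a lifting over a cube of
  \<open>X\<close>.\<close>

lemma cell_link:
 assumes E: "cubical_set E" and e: "e:cubes E 0" and m: "merging E e N k m"
  and om: "end_mono om" "continuous_on {0..1} om"
  and r_in: "!!n g. g:sc N n ==> r n g:cubes E n"
  and r_act: "!!a n g p. box_hom a n p ==> g:sc N n ==> r a (act (SC N) a n g p) = act E a n (r n g) p"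
  and r_bdry: "!!n g j c. g:sc N n ==> j:{1..N} ==> infc n g j c ==> r n g = konst E e n"
 shows "lnk (LP N E e) (m 0 (%a. r N (\<lambda>t\<in>cell N. wmap N om (cm N (Suc k) a t)))) (r N (\<lambda>t\<in>cell N. t))"
proof (rule lnkI)
 let ?D = "%a i c. fc (SC N) N (straight N k om a) i c"
 note sin = straight_in[OF om]
 let ?S = "Suc k"
 define C where "C a = r (Suc N) (straight N k om a)" for a
 have w01: "om 0 = 0" "om 1 = 1" using om(1) by (simp_all add: end_mono_def)
 have fcC: "fc E n (C a) i c = r n (fc (SC N) n (straight N k om a) i c)"
  if "vidx N ?S a" "1 <= i" "i <= Suc n" "n = N" for n a i c
  using r_act[OF face_hom[of i "Suc N" N c] sin[OF that(1)]] that by (simp add: C_def)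
 have st: "?D a i c t j =
   (1 - u) * om ((real (a j) + v) / real ?S) + u * min 1 (real (a j) + v)"
  if "vidx N ?S a" "1 <= i" "i <= Suc N" "t:cell N" "j:{1..N}"
   "v = face_fun (Suc N) i (of_bool c) t j" "u = face_fun (Suc N) i (of_bool c) t (Suc N)" for a i c t j u v
  unfolding Sing_fc[OF sin[OF that(1)] that(2-4)] that(6,7)
  using that(2-5) face_fun_cell[of i N t c] by (simp add: straight_def)
 have V: "valid E e N k 1 C"
  unfolding valid_def
 proof (intro conjI allI impI)
  show "C a:cubes E (N + 1)" if "vidx N ?S a" for a
   using r_in[OF sin[OF that]] by (simp add: C_def)
 next
  fix a i N' assume N: "N = Suc N'" and i: "i:{1..N}" and a: "vidx N ?S a" "vidx N ?S (up i a)"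
  have i': "1 <= i" "i <= Suc N" using i by auto
  have "?D a i True = ?D (up i a) i False"
  proof (rule SC_eqI[OF SC_fc[OF sin[OF a(1)] i'] SC_fc[OF sin[OF a(2)] i']])
   fix t j assume t: "t:cell N" and j: "j:{1..N}"
   have u: "face_fun (Suc N) i (of_bool c) t (Suc N) = t N" for c using i by (simp add: face_fun_def)
   show "?D a i True t j = ?D (up i a) i False t j"
    unfolding st[OF a(1) i' t j refl refl] st[OF a(2) i' t j refl refl] u
    using j by (auto simp: face_fun_def add_ac)
  qed
  thus "fc E (N' + 1) (C a) i True = fc E (N' + 1) (C (up i a)) i False"
   using fcC[OF a(1), of i "N' + 1"] fcC[OF a(2), of i "N' + 1"] i' N by simp
 next
  fix a i c N' assume N: "N = Suc N'" and i: "i:{1..N}" and a: "vidx N ?S a" "a i = (if c then k else 0)"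
  have i': "1 <= i" "i <= Suc N" using i by auto
  have "infc N (?D a i c) i c"
   unfolding infc_def
  proof
   fix t assume t: "t:cell N"
   have "face_fun (Suc N) i (of_bool c) t i = of_bool c" using i by (simp add: face_fun_def)
   thus "?D a i c t i = of_bool c"
    unfolding st[OF a(1) i' t i refl refl] using a(2) w01 by (cases c) (simp_all add: algebra_simps)
  qed
  thus "fc E (N' + 1) (C a) i c = konst E e (N' + 1)"
   using fcC[OF a(1), of i "N' + 1"] r_bdry[OF SC_fc[OF sin[OF a(1)] i'] i] i' N by simp
 qed
 show "m 1 C:cubes (LP N E e) 1" by (rule merging_in[OF m V])
 have last: "face_fun (Suc N) (Suc N) x t j = t j" "face_fun (Suc N) (Suc N) x t (Suc N) = x" if "j:{1..N}" for j x and t :: "nat => real"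
  using that by (auto simp: face_fun_def)
 have last': "face_fun (Suc N) (Suc N) x t (Suc N) = x" for x and t :: "nat => real"
  by (auto simp: face_fun_def)
 have cmw: "(\<lambda>t\<in>cell N. wmap N om (cm N ?S a t)) = ?D a (Suc N) False"
  if a: "vidx N ?S a" for a
 proof (rule extensionalityI[of _ "cell N"])
  show "?D a (Suc N) False:extensional (cell N)"
   using SC_fc[OF sin[OF a], of "Suc N"] by (simp add: Sing_cubes)
  fix t assume t: "t:cell N"
  have "?D a (Suc N) False t:cell N"
   by (rule SC_cell[OF SC_fc[OF sin[OF a]] t]) auto
  moreover have "wmap N om (cm N ?S a t):cell N" by (rule wmap_cell[OF om(1) cm_cell[OF a t]])
  ultimately show "(\<lambda>t\<in>cell N. wmap N om (cm N ?S a t)) t = ?D a (Suc N) False t"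
   using t st[OF a _ _ t _ refl refl, of "Suc N" _ False] last last'
   by (simp, intro cell_eqI) (auto simp: wmap_def cm_def)
 qed simp
 show "fc (LP N E e) 0 (m 1 C) 1 False = m 0 (%a. r N (\<lambda>t\<in>cell N. wmap N om (cm N ?S a t)))"
  by (rule merging_ends[OF m V]) (simp add: fcC cmw)
 define s where "s = r N (\<lambda>t\<in>cell N. t)"
 have idc: "(\<lambda>t\<in>cell N. t):sc N N"
  by (rule SingI) (use continuous_map_id in \<open>simp\<close>)
 have s: "s:cubes (LP N E e) 0"
  unfolding LP_cubes[OF E e]
 proof (intro conjI allI impI)
  show "s:cubes E (N + 0)" using r_in[OF idc] by (simp add: s_def)
  fix N' i c assume N: "N = Suc N'" and i: "i:{1..N}"
  have i': "1 <= i" "i <= Suc N'" "i:{1..Suc N'}" using i N by auto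
  note f = idc[unfolded N]
  have "infc N' (fc (SC (Suc N')) N' (\<lambda>t\<in>cell (Suc N'). t) i c) i c"
   using face_fun_cell[OF i'(3)] i' by (simp add: infc_def Sing_fc[OF f i'(1,2)]) (simp add: face_fun_def)
  hence "r N' (fc (SC N) N' (\<lambda>t\<in>cell N. t) i c) = konst E e N'"
   using r_bdry[OF _ i] SC_fc[OF f i'(1,2)] N by simp
  thus "fc E (N' + 0) s i c = konst E e (N' + 0)"
   using r_act[OF face_hom[OF i'(3) refl], of "\<lambda>t\<in>cell N. t" c] idc N by (simp add: s_def)
 qed
 let ?l = "\<lambda>t\<in>cell N. t"
 have "fc (LP N E e) 0 (m 1 C) 1 True = m 0 (%a. if ALL j:{1..N}. a j = 0 then s else konst E e (N + 0))"
 proof (rule merging_ends[OF m V])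
  fix a assume a: "vidx N ?S a"
  let ?g = "?D a (Suc N) True"
  let ?i = "if ALL j:{1..N}. a j = 0 then s else konst E e (N + 0)"
  have g: "?g:sc N N" by (rule SC_fc[OF sin[OF a]]) auto
  have gj: "?g t j = min 1 (real (a j) + t j)" if "t:cell N" "j:{1..N}" for t j
   using st[OF a _ _ that refl refl, of "Suc N" True] last that by simp
  have "r N ?g = ?i"
  proof (cases "ALL j:{1..N}. a j = 0")
   case True
   have "?g = ?l"
   proof (rule SC_eqI[OF g idc])
    fix t j assume t: "t:cell N" and j: "j:{1..N}"
    show "?g t j = ?l t j" using True gj[OF t j] cell_bounds[OF t j] t j by simp
   qed
   thus ?thesis using True by (simp add: s_def)
  next
   case False
   then obtain j where j: "j:{1..N}" "a j ~= 0" by blast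
   hence "1 <= a j" by linarith
   hence "infc N ?g j True" using gj j cell_bounds by (fastforce simp: infc_def)
   thus ?thesis using False r_bdry[OF g j(1)] by auto
  qed
  thus "?i = fc E N (C a) (Suc N) True"
   using fcC[OF a, of "Suc N" N True] by simp
 qed
 thus "fc (LP N E e) 0 (m 1 C) 1 True = r N ?l"
  using merging_unit[OF m s] by (simp add: s_def)
qed

section \<open>Comparing a cubical set with its singular cubes\<close>

lemma cell_0: "cell 0 = {%_. undefined}"
 by (auto simp: cell_iff)

lemma ch_0: "ch X 0 x = (\<lambda>t\<in>cell 0. real_vertex X x)"
 unfolding ch_def by (rule restrict_ext) (simp add: cell_0 real_vertex_def pt_def)

lemma konst_Sing: "konst (Sing T) (\<lambda>t\<in>cell 0. p) n = (\<lambda>t\<in>cell n. p)"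
 using box_top_cell[OF bang_hom] by (auto simp: konst_def Sing_act compose_def fun_eq_iff)

lemma const_Sing: "p:topspace T ==> (\<lambda>t\<in>cell n. p):cubes (Sing T) n"
 by (rule SingI) simp

lemma LP_Sing_iff:
 assumes p: "p:topspace T"
 shows "f:cubes (LP N (Sing T) (\<lambda>t\<in>cell 0. p)) n \<longleftrightarrow> f:cubes (Sing T) (N + n) &
  (ALL t:cell (N + n). (EX i:{1..N}. t i = 0 | t i = 1) --> f t = p)"
proof (cases N)
 case 0
 thus ?thesis by (simp add: LP_0)
next
 case (Suc M)
 let ?l = "\<lambda>t\<in>cell (M + n). p"
 let ?M = "M + n"
 let ?S = "Sing T"
 let ?a = "Suc ?M"
 let ?A = "ALL i:{1..N}. ALL c. fc ?S ?M f i c = ?l"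
 let ?N = "N + n"
 have "?A \<longleftrightarrow>
   (ALL t:cell ?N. (EX i:{1..N}. t i = 0 | t i = 1) --> f t = p)" if f: "f:cubes ?S ?N"
 proof
  assume l: "ALL i:{1..N}. ALL c. fc ?S ?M f i c = ?l"
  show "ALL t:cell ?N. (EX i:{1..N}. t i = 0 | t i = 1) --> f t = p"
  proof (intro ballI impI, elim bexE)
   fix t i assume t: "t:cell ?N" and i: "i:{1..N}" "t i = 0 | t i = 1"
   then obtain c where e: "t i = of_bool c" by (metis of_bool_eq(1) of_bool_eq(2))
   have i': "i:{1..Suc ?M}" "1 <= i" "i <= ?a" using i(1) Suc by auto
   have t': "t:cell ?a" using t Suc by simp
   have d: "degen_fun ?a i t:cell ?M" by (rule degen_fun_cell[OF i'(1) t'])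
   have "f t = fc ?S ?M f i c (degen_fun ?a i t)"
    using Sing_fc[of f T ?M i, OF _ i'(2,3) d] f Suc face_degen_cell[OF i'(1) t' e] by simp
   thus "f t = p" using l i(1) d by simp
  qed
 next
  assume r: "ALL t:cell ?N. (EX i:{1..N}. t i = 0 | t i = 1) --> f t = p"
  show "ALL i:{1..N}. ALL c. fc ?S ?M f i c = ?l"
  proof (intro ballI allI)
   fix i c assume i: "i:{1..N}"
   let ?o = "of_bool c"
   have i': "i:{1..Suc ?M}" "1 <= i" "i <= ?a" using i Suc by auto
   have f': "f:cubes ?S ?a" using f Suc by simp
   show "fc ?S ?M f i c = ?l"
   proof (rule Sing_eqI[OF fc_in[OF Sing_cset f' i'(2,3)] const_Sing[OF p]])
    fix t assume t: "t:cell ?M"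
    have "face_fun ?a i ?o t i = ?o" using i' by (simp add: face_fun_def)
    hence "EX i':{1..N}. face_fun ?a i ?o t i' = 0 | face_fun ?a i ?o t i' = 1"
     using i by (intro bexI[of _ i]) auto
    thus "fc ?S ?M f i c t = ?l t"
     using r[rule_format, of "face_fun ?a i ?o t"] face_fun_cell[OF i'(1) t, of c] i Suc t
     unfolding Sing_fc[OF f' i'(2,3) t] by simp
   qed
  qed
 qed
 moreover have "f:cubes (LP N ?S (\<lambda>t\<in>cell 0. p)) n \<longleftrightarrow> f:cubes ?S ?N &
   ?A"
  unfolding LP_cubes[OF Sing_cset const_Sing[OF p]] konst_Sing using Suc by auto
 ultimately show ?thesis by blast
qed

text \<open>The homotopies \<open>h\<close> carry their parameter in the first coordinate, merging
  expects it behind the grid directions; precomposition with \<open>rot\<close> moves it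
  there.\<close>

definition rot :: "nat => (nat => real) => nat => real" where
 "rot N t = (\<lambda>j\<in>{1..Suc N}. if j = 1 then t (Suc N) else t (j - 1))"

lemma rot_cell: "t:cell (Suc N) ==> rot N t:cell (Suc N)"
 unfolding rot_def
proof (rule cellI)
 fix j assume t: "t:cell (Suc N)" and j: "j:{1..Suc N}"
 let ?i = "if j = 1 then t (Suc N) else t (j - 1)"
 show "0 <= ?i & ?i <= 1"
  using cell_bounds[OF t, of "Suc N"] cell_bounds[OF t, of "j - 1"] pred_mem[OF j] by auto
qed

lemma cts_rot: "continuous_map (ct (Suc N)) (ct (Suc N)) (rot N)"
proof (rule cts_cellI)
 fix j assume j: "j:{1..Suc N}"
 show "cts (ct (Suc N)) (%t. rot N t j)"
  using cts_proj[of "Suc N" "Suc N"] cts_proj[of "j - 1" "Suc N"] pred_mem[OF j] j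
  by (cases "j = 1") (auto simp: rot_def)
qed (simp add: rot_cell)

lemma rot_face:
 assumes i: "i:{1..Suc M}"
 shows "rot (Suc M) (face_fun (Suc (Suc M)) i e t) = face_fun (Suc (Suc M)) (Suc i) e (rot M t)"
proof
 fix j
 consider "j = 0" | "j = 1" | l where "j = Suc (Suc l)" by (cases j; cases "j - 1") auto
 thus "rot (Suc M) (face_fun (Suc (Suc M)) i e t) j = face_fun (Suc (Suc M)) (Suc i) e (rot M t) j"
  using i by cases (auto simp: rot_def face_fun_def)
qed

lemma rot_last: "t:cell N ==> rot N (face_fun (Suc N) (Suc N) e t) = face_fun (Suc N) 1 e t"
proof
 fix j assume t: "t:cell N"
 consider "j = 0" | "j = 1" | l where "j = Suc (Suc l)" by (cases j; cases "j - 1") auto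
 thus "rot N (face_fun (Suc N) (Suc N) e t) j = face_fun (Suc N) 1 e t j"
  by cases (auto simp: rot_def face_fun_def)
qed

lemma embed_ch: "cubical_set X ==> embed X (SR X) (ch X)"
 unfolding embed_def cset_map_def by (auto simp: ch_in ch_act inj_on_def intro: ch_inj)

lemma cts_rmap:
 assumes X: "cubical_set X" and w: "end_mono w" "continuous_on {0..1} w"
 shows "continuous_map (realization X) (realization X) (rmap X w)"
proof (rule cts_from_realization)
 fix n x assume x: "x:cubes X n"
 show "continuous_map (ct n) (realization X) (%t. rmap X w (pt X n x t))"
  by (rule continuous_map_eq[OF continuous_map_compose[OF cts_wmap[OF w] cts_pt[OF x]]])
   (simp add: rmap_pt[OF X w(1) x])
qed

lemma rmap_vertex: "cubical_set X ==> end_mono w ==> x:cubes X 0 ==> rmap X w (real_vertex X x) = real_vertex X x"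
 using rmap_pt[of X w x 0 "%_. undefined"] wmap_cell[of w "%_. undefined" 0]
 by (simp add: real_vertex_def pt_def cell_0)

lemma real_vertex_in: "x:cubes X 0 ==> real_vertex X x:topspace (realization X)"
 using pt_in[of x X 0 "%_. undefined"] by (simp add: real_vertex_def pt_def cell_0)

lemma vidx_idel: "vidx (Suc M) K a ==> vidx M K (idel i a)"
 by (auto simp: vidx_def idel_def)

section \<open>Surjectivity and injectivity for iterated loops, by merging lifted grids\<close>

context lifting
begin

lemma Xc: "cubical_set X"
 by (rule kanE_cset[OF X])

lemma r_konst: "x:cubes X 0 ==> g:sc M n ==> r M (konst X x M) n g = konst X x n"
 using r_push[of x 0 M "box_bang M" g n] SC_0[OF push_in[OF bang_hom]] r_oper[OF _ bang_hom, of x n] bang_hom[of M]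
 by (simp add: konst_def)

lemma h_konst:
 assumes x: "x:cubes X 0" and g: "g:sc M n"
 shows "h M (konst X x M) n g = konst (SR X) (ch X 0 x) (Suc n)"
proof -
 have "h M (konst X x M) n g = h 0 x n (box_top n 0 (box_bang n))"
  using h_push[OF x bang_hom g] SC_0[OF push_in[OF bang_hom g]] by (simp add: konst_def)
 also have "\<dots> = dg1 (SR X) n (ch X n (konst X x n))" using h_oper[OF x bang_hom] by (simp add: konst_def)
 also have "ch X n (konst X x n) = konst (SR X) (ch X 0 x) n"
  using konst_map[of X "SR X" "ch X"] embed_ch[OF Xc] x by (simp add: embed_def)
 also have "dg1 (SR X) n (konst (SR X) (ch X 0 x) n) = konst (SR X) (ch X 0 x) (Suc n)"
  by (rule konst_act[OF Sing_cset ch_in[OF x] dg1_hom])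
 finally show ?thesis .
qed

lemma r_fc: "x:cubes X N ==> g:sc N (Suc n) ==> 1 <= i ==> i <= Suc n ==>
  fc X n (r N x (Suc n) g) i e = r N x n (fc (SC N) n g i e)"
 using r_act[of x N g "Suc n" n "box_face (Suc n) i e"] face_hom[of i "Suc n" n e] by simp

lemma h_fc: "x:cubes X N ==> g:sc N (Suc n) ==> 1 <= i ==> i <= Suc n ==>
  fc (SR X) (Suc n) (h N x (Suc n) g) (Suc i) e = h N x n (fc (SC N) n g i e)"
 using h_act[of x N g "Suc n" n "box_face (Suc n) i e"] face_hom[of i "Suc n" n e]
  tn_face[of i n "SR X" 1 "h N x (Suc n) g" e] by simp

text \<open>The grid for \<open>F\<close> has pieces \<open>A\<close>, lifts \<open>B\<close> and
  homotopies \<open>D\<close> between them; adjacent ones match because \<open>r\<close> and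
  \<open>h\<close> respect \<open>deq\<close>. Merging \<open>D\<close> links the merged pieces to
  the image of the merged lifts, as the two mergings are compatible under \<open>ch\<close>; and
  \<open>cell_link\<close> links the merged pieces to \<open>F\<close>.\<close>

lemma surj_link:
 assumes x: "x:cubes X 0" and f: "f:cubes (LP (Suc M) (SR X) (ch X 0 x)) 0"
 defines "F == \<lambda>t\<in>cell (Suc M). rmap X pinch (rmap X pinch (f t))"
 shows "EX s:cubes (LP (Suc M) X x) 0. EX f'. lnk (LP (Suc M) (SR X) (ch X 0 x)) f' F &
  lnk (LP (Suc M) (SR X) (ch X 0 x)) f' (ch X (Suc M) s)"
proof -
 let ?S = "SR X" and ?e = "ch X 0 x" and ?N = "Suc M" and ?p = "real_vertex X x"
 have S: "cubical_set ?S" by (rule Sing_cset)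
 have e: "?e:cubes ?S 0" by (rule ch_in[OF x])
 have hm: "cset_map X ?S (ch X)" using embed_ch[OF Xc] by (simp add: embed_def)
 note chk = konst_map[OF hm x, symmetric]
 have f1: "f:cubes ?S ?N" and f2: "!!i u. i:{1..?N} ==> fc ?S M f i u = ch X M (konst X x M)"
  using f unfolding LP_cubes[OF S e] by (simp_all add: chk)
 obtain K N y g where K: "0 < K"
  and yg: "!!a. vidx ?N K a ==> y a:cubes X (N a) & g a:sc (N a) ?N"
  and pt: "!!a t. vidx ?N K a ==> t:cell ?N ==> pt X (N a) (y a) (g a t) = rmap X pinch (rmap X pinch (f (cm ?N K a t)))"
  and dm: "!!a i. vidx ?N K a ==> vidx ?N K (up i a) ==> i:{1..?N} ==>
   deq X M (face_cube N y g M i True a)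
    (face_cube N y g M i False (up i a))"
  and db: "!!a i u. vidx ?N K a ==> i:{1..?N} ==> a i = (if u then K - 1 else 0) ==>
   deq X M (face_cube N y g M i u a)
    (M, konst X x M, \<lambda>t\<in>cell M. wmap M pinch (wmap M pinch (cm M K (idel i a) t)))"
  by (rule grid[OF Xc f1, of "%_ _. konst X x M", OF konst_in[OF Xc x] f2]) (assumption, rule that)
 let ?L = "LP ?N ?S ?e"
 let ?a = "Suc ?N"
 let ?k = "konst ?S ?e ?N"
 let ?c = "cell ?N"
 obtain k where k: "K = Suc k" using K by (cases K) auto
 let ?r = "%a i u. r (N a) (y a) M (fc (SC (N a)) M (g a) i u)"
 let ?h = "%a i u. h (N a) (y a) M (fc (SC (N a)) M (g a) i u)"
 note yg = yg[unfolded k] and pt = pt[unfolded k] and dm = dm[unfolded k]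
 have bc: "(\<lambda>t\<in>cell M. wmap M pinch (wmap M pinch (cm M K (idel i a) t))):sc M M" if "vidx ?N K a" for i a
 proof -
  have "vidx M K (idel i a)" by (rule vidx_idel[OF that])
  from continuous_map_compose[OF continuous_map_compose[OF continuous_map_cm[OF this K]
     cts_wmap[OF end_mono_pinch cts_pinch]] cts_wmap[OF end_mono_pinch cts_pinch]]
  show ?thesis by (intro SingI) (simp add: o_def)
 qed
 have pin: "?p:topspace (realization X)" by (rule real_vertex_in[OF x])
 have Fc: "F:cubes ?S ?N"
  unfolding F_def
  using continuous_map_compose[OF continuous_map_compose[OF conjunct2[OF f1[unfolded Sing_cubes]]
     cts_rmap[OF Xc end_mono_pinch cts_pinch]] cts_rmap[OF Xc end_mono_pinch cts_pinch]]
  by (intro SingI) (simp add: o_def)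
 have fb: "f t = ?p" if "t:?c" "i:{1..?N}" "t i = of_bool u" for t i u
 proof -
  have "EX i:{1..?N}. t i = 0 | t i = 1" using that by (cases u) auto
  thus ?thesis using f that(1) LP_Sing_iff[OF pin, of f ?N 0] by (simp add: ch_0)
 qed
 have Fb: "F t = ?p" if "t:?c" "i:{1..?N}" "t i = of_bool u" for t i u
  using fb[OF that] that(1) rmap_vertex[OF Xc end_mono_pinch x] by (simp add: F_def)
 define A where "A a = ptm X (N a) (y a) ?N (g a)" for a
 define B where "B a = r (N a) (y a) ?N (g a)" for a
 define C where "C a = h (N a) (y a) ?N (g a)" for a
 define D where "D a = compose (cell ?a) (C a) (rot ?N)" for a
 have B_in: "B a:cubes X ?N" if "vidx ?N (Suc k) a" for a using yg[OF that] r_in by (simp add: B_def)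
 have C_in: "C a:cubes ?S ?a" if "vidx ?N (Suc k) a" for a using yg[OF that] h_in by (simp add: C_def)
 have D_in: "D a:cubes ?S ?a" if "vidx ?N (Suc k) a" for a
  unfolding D_def by (rule Sing_composeI[OF C_in[OF that] cts_rot])
 have ygf: "y a:cubes X (N a)" "g a:sc (N a) ?N" "1 <= i" "i <= Suc M" if "vidx ?N (Suc k) a" "i:{1..?N}" for a i
  using yg[OF that(1)] that(2) by auto
 have B_fc: "fc X M (B a) i u = ?r a i u" if "vidx ?N (Suc k) a" "i:{1..?N}" for a i u
  unfolding B_def by (rule r_fc[OF ygf[OF that]])
 have D_fc: "fc ?S ?N (D a) i u = compose ?c (?h a i u) (rot M)"
  if "vidx ?N (Suc k) a" "i:{1..?N}" for a i u
 proof -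
  note y = ygf[OF that]
  have i: "i:{1..Suc ?N}" "1 <= i" "i <= ?a" "1 <= Suc i" "Suc i <= ?a" using y by auto
  have hc: "fc ?S ?N (C a) (Suc i) u = ?h a i u" unfolding C_def by (rule h_fc[OF y])
  show ?thesis
   unfolding hc[symmetric]
  proof (rule Sing_eqI[OF fc_in[OF S D_in[OF that(1)] i(2,3)] Sing_composeI[OF fc_in[OF S C_in[OF that(1)] i(4,5)] cts_rot]])
   fix t assume t: "t:?c"
   show "fc ?S ?N (D a) i u t = compose ?c (fc ?S ?N (C a) (Suc i) u) (rot M) t"
    unfolding Sing_fc[OF D_in[OF that(1)] i(2,3) t] compose_eq[OF t] Sing_fc[OF C_in[OF that(1)] i(4,5) rot_cell[OF t]]
    using face_fun_cell[OF i(1) t, of u] rot_face[OF that(2), of "of_bool u" t] by (simp add: D_def compose_eq)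
  qed
 qed
 have D_last: "fc ?S ?N (D a) ?a u = (if u then ch X ?N (B a) else A a)" if a: "vidx ?N (Suc k) a" for a u
 proof -
  have "fc ?S ?N (D a) ?a u = fc ?S ?N (C a) 1 u"
  proof (rule Sing_eqI[OF fc_in[OF S D_in[OF a]] fc_in[OF S C_in[OF a]]])
   fix t assume t: "t:?c"
   have i: "1 <= ?a" "?a <= ?a" "?a:{1..Suc ?N}" "(1::nat) <= 1" by auto
   show "fc ?S ?N (D a) ?a u t = fc ?S ?N (C a) 1 u t"
    unfolding Sing_fc[OF D_in[OF a] i(1,2) t] Sing_fc[OF C_in[OF a] i(4) i(1) t]
    using face_fun_cell[OF i(3) t, of u] rot_last[OF t, of "of_bool u"] by (simp add: D_def compose_eq)
  qed auto
  thus ?thesis using h_face[of "y a" "N a" "g a" ?N u] yg[OF a] by (simp add: C_def B_def A_def)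
 qed
 have rm: "?r a i True = ?r (up i a) i False"
  and hmm: "?h a i True = ?h (up i a) i False"
  if "vidx ?N (Suc k) a" "vidx ?N (Suc k) (up i a)" "i:{1..?N}" for a i
  using deq_r[OF dm[OF that]] deq_h[OF dm[OF that]] by simp_all
 have rb: "?r a i u = konst X x M"
  and hb: "?h a i u = ?k"
  if a: "vidx ?N (Suc k) a" and i: "i:{1..?N}" and ai: "a i = (if u then k else 0)" for a i u
 proof -
  have ai': "a i = (if u then K - 1 else 0)" using ai k by simp
  note d = db[OF a[folded k] i ai']
  note b = bc[OF a[folded k], of i]
  let ?f = "fc (SC (N a)) M (g a) i u"
  show "r (N a) (y a) M ?f = konst X x M" using deq_r[OF d] r_konst[OF x b] by simp
  show "h (N a) (y a) M ?f = ?k" using deq_h[OF d] h_konst[OF x b] by simp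
 qed
 have VB: "valid X x ?N k 0 B"
  unfolding valid_def using B_in B_fc rm rb by simp
 have kr: "compose ?c ?k (rot M) = ?k"
  unfolding ch_0 konst_Sing compose_def by (rule restrict_ext) (simp add: rot_cell)
 have VD: "valid ?S ?e ?N k 1 D"
  unfolding valid_def using D_in D_fc hmm hb kr by simp
 obtain m m' where m: "merging X x ?N k m" "merging ?S ?e ?N k m'"
  "ALL n c. valid X x ?N k n c --> m' n (%a. ch X (?N + n) (c a)) = ch X (?N + n) (m n c)"
  using merge_ex[OF X kanE_Sing embed_ch[OF Xc] x, of ?N k] by (elim exE conjE)
 have "lnk ?L (m' 0 A) (ch X ?N (m 0 B))"
 proof (rule lnkI)
  show "m' 1 D:cubes ?L 1" by (rule merging_in[OF m(2) VD])
  show "fc ?L 0 (m' 1 D) 1 False = m' 0 A" by (rule merging_ends[OF m(2) VD]) (simp add: D_last)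
  have "fc ?L 0 (m' 1 D) 1 True = m' 0 (%a. ch X (?N + 0) (B a))"
   by (rule merging_ends[OF m(2) VD]) (simp add: D_last)
  thus "fc ?L 0 (m' 1 D) 1 True = ch X ?N (m 0 B)" using m(3)[rule_format, OF VB] by simp
 qed
 moreover have "lnk ?L (m' 0 A) F"
 proof -
  \<comment> \<open>\<open>cell_link\<close> is applied to composition with \<open>F\<close>, the
    identity being the reparametrization, since both pinches are already contained in
    \<open>F\<close>.\<close>
  define v where "v n g = (\<lambda>t\<in>cell n. F (g t))" for n and g :: "(nat => real) => nat => real"
  let ?m = "m' 0 (%a. v ?N (\<lambda>t\<in>cell ?N. wmap ?N (%s. s) (cm ?N (Suc k) a t)))"
  let ?v = "v ?N (\<lambda>t\<in>cell ?N. t)"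
  have "lnk ?L ?m ?v"
  proof (rule cell_link[OF S e m(2)])
   show "end_mono (%s. s)" "continuous_on {0..1::real} (%s. s)" by (simp_all add: end_mono_def mono_on_def)
   show v_in: "v n g:cubes ?S n" if "g:sc ?N n" for n g
    unfolding v_def using continuous_map_compose[of "ct n" "ct ?N" g "realization X" F] Fc that
    by (intro SingI) (simp add: Sing_cubes o_def)
   show "v a (act (SC ?N) a n g q) = act ?S a n (v n g) q" if "box_hom a n q" "g:sc ?N n" for a n g q
    by (rule Sing_eqI[OF v_in[OF SC_act_in[OF that]] act_in[OF S that(1) v_in[OF that(2)]]])
     (simp add: v_def Sing_act_apply box_top_cell[OF that(1)])
   show "v n g = konst ?S ?e n" if "g:sc ?N n" "j:{1..?N}" "infc n g j u" for n g j u
    unfolding v_def ch_0 konst_Sing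
   proof (rule restrict_ext)
    fix t assume t: "t:cell n"
    thus "F (g t) = ?p" using Fb[OF SC_cell[OF that(1) t] that(2), of u] that(3) by (simp add: infc_def)
   qed
  qed
  moreover have "?v = F"
   using Fc by (auto simp: v_def Sing_cubes extensional_def fun_eq_iff)
  moreover have "?m = m' 0 A"
  proof (rule merging_cong[OF m(2)])
   fix a assume a: "vidx ?N (Suc k) a"
   show "v ?N (\<lambda>t\<in>cell ?N. wmap ?N (%s. s) (cm ?N (Suc k) a t)) = A a"
    unfolding v_def A_def ptm_def
    by (rule restrict_ext) (simp add: wmap_id[OF cm_cell[OF a]] pt[OF a] F_def cm_cell[OF a])
  qed
  ultimately show ?thesis by simp
 qed
 moreover have "m 0 B:cubes (LP ?N X x) 0" by (rule merging_in[OF m(1) VB])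
 ultimately show ?thesis by blast
qed

text \<open>The homotopy is lifted over a grid in \<open>N + 1\<close> directions, of which only the
  first \<open>N\<close> are merged. Each slab in the last direction becomes a link between loops of
  \<open>X\<close>, and consecutive slabs share an end. At both extremes the merged lift of the
  doubly pinched \<open>s w\<close> is linked to \<open>s w\<close> by \<open>cell_link\<close>. No
  composition of slabs is needed, as the generated equivalence suffices.\<close>

lemma inj_link:
 assumes x: "x:cubes X 0" and s: "!!w. s w:cubes (LP N X x) 0" and H: "H:cubes (LP N (SR X) (ch X 0 x)) 1"
  and Hs: "!!w. fc (SR X) N H (Suc N) w = ch X N (s w)"
 shows "equivclp (lnk (LP N X x)) (s False) (s True)"
proof -
 let ?S = "SR X" and ?e = "ch X 0 x"
 let ?s = "%s. pinch (pinch s)"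
 have S: "cubical_set ?S" by (rule Sing_cset)
 have e: "?e:cubes ?S 0" by (rule ch_in[OF x])
 have hm: "cset_map X ?S (ch X)" using embed_ch[OF Xc] by (simp add: embed_def)
 note chk = konst_map[OF hm x, symmetric]
 have H1: "H:cubes ?S (Suc N)" and H2: "!!i w. i:{1..N} ==> fc ?S N H i w = ch X N (konst X x N)"
  using H unfolding LP_cubes[OF S e] by (cases N; simp add: chk)+
 have s1: "s w:cubes X N" and s2: "!!M i et. N = Suc M ==> i:{1..N} ==> fc X M (s w) i et = konst X x M" for w
  using s[of w] unfolding LP_cubes[OF Xc x] by simp_all
 define q where "q i w = (if i = Suc N then s w else konst X x N)" for i w
 have q_in: "q i w:cubes X N" for i w using s1 konst_in[OF Xc x] by (simp add: q_def)
 have q_fc: "fc ?S N H i w = ch X N (q i w)" if "i:{1..Suc N}" for i w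
  using H2 Hs that by (auto simp: q_def)
 obtain K M y g where K: "0 < K"
  and yg: "!!a. vidx (Suc N) K a ==> y a:cubes X (M a) & g a:sc (M a) (Suc N)"
  and dm: "!!a i. vidx (Suc N) K a ==> vidx (Suc N) K (up i a) ==> i:{1..Suc N} ==>
   deq X N (face_cube M y g N i True a)
    (face_cube M y g N i False (up i a))"
  and db: "!!a i w. vidx (Suc N) K a ==> i:{1..Suc N} ==> a i = (if w then K - 1 else 0) ==>
   deq X N (face_cube M y g N i w a)
    (N, q i w, \<lambda>t\<in>cell N. wmap N pinch (wmap N pinch (cm N K (idel i a) t)))"
  by (rule grid[OF Xc H1, of q, OF q_in q_fc]) (assumption, rule that)
 obtain k where k: "K = Suc k" using K by (cases K) auto
 note yg = yg[unfolded k] and dm = dm[unfolded k]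
 define B where "B a = r (M a) (y a) (Suc N) (g a)" for a
 have B_in: "B a:cubes X (Suc N)" if "vidx (Suc N) (Suc k) a" for a using yg[OF that] r_in by (simp add: B_def)
 have B_fc: "fc X N (B a) i w = r (M a) (y a) N (fc (SC (M a)) N (g a) i w)" if "vidx (Suc N) (Suc k) a" "i:{1..Suc N}" for a i w
  unfolding B_def by (rule r_fc) (use yg[OF that(1)] that(2) in auto)
 have B_match: "fc X N (B a) i True = fc X N (B (up i a)) i False"
  if "vidx (Suc N) (Suc k) a" "vidx (Suc N) (Suc k) (up i a)" "i:{1..Suc N}" for a i
  using deq_r[OF dm[OF that]] B_fc[OF that(1,3)] B_fc[OF that(2,3)] by simp
 have B_bdry: "fc X N (B a) i w = r N (q i w) N (\<lambda>t\<in>cell N. wmap N pinch (wmap N pinch (cm N K (idel i a) t)))"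
  if "vidx (Suc N) (Suc k) a" "i:{1..Suc N}" "a i = (if w then k else 0)" for a i w
 proof -
  have "a i = (if w then K - 1 else 0)" using that(3) k by simp
  from deq_r[OF db[OF that(1)[folded k] that(2) this]] B_fc[OF that(1,2)] show ?thesis by simp
 qed
 have pp: "(\<lambda>t\<in>cell N. wmap N pinch (wmap N pinch (cm N K a t))) = (\<lambda>t\<in>cell N. wmap N ?s (cm N K a t))" for a
  by (rule restrict_ext) (simp add: wmap_wmap)
 have mp: "end_mono ?s"
 proof -
  have p: "0 <= pinch s" "pinch s <= 1" "s <= t ==> pinch s <= pinch t" for s t by (auto simp: pinch_def)
  have "pinch 0 = 0" "pinch 1 = 1" by (simp_all add: pinch_def)
  thus ?thesis using p by (simp add: end_mono_def mono_on_def)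
 qed
 have cp: "continuous_on {0..1} ?s"
  unfolding pinch_def by (intro continuous_intros)
 have bc: "(\<lambda>t\<in>cell N. wmap N pinch (wmap N pinch (cm N K a t))):sc N N" if "vidx N K a" for a
  using continuous_map_compose[OF continuous_map_cm[OF that K] cts_wmap[OF mp cp]]
  unfolding pp by (intro SingI) (simp add: o_def)
 have vu: "vidx (Suc N) (Suc k) (a(Suc N := b))" if "vidx N (Suc k) a" "b <= k" for a b
  using that by (auto simp: vidx_def)
 \<comment> \<open>The slab at height \<open>b\<close>, whose last coordinate is left as a
   parameter.\<close>
 define C where "C b a = B (a(Suc N := b))" for b a
 have V: "valid X x N k 1 (C b)" if b: "b <= k" for b
  unfolding valid_def
 proof (intro conjI allI impI)
  show "C b a:cubes X (N + 1)" if "vidx N (Suc k) a" for a using B_in[OF vu[OF that b]] by (simp add: C_def)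
 next
  fix a i N' assume N: "N = Suc N'" and i: "i:{1..N}" and a: "vidx N (Suc k) a" "vidx N (Suc k) (up i a)"
  have ne: "i ~= Suc N" "i:{1..Suc N}" using i by auto
  have tw: "(up i a)(Suc N := b) = (a(Suc N := b))(i := Suc ((a(Suc N := b)) i))" using ne by auto
  show "fc X (N' + 1) (C b a) i True = fc X (N' + 1) (C b (up i a)) i False"
   using B_match[OF vu[OF a(1) b] vu[OF a(2) b, unfolded tw] ne(2)] N unfolding C_def tw by simp
 next
  fix a i w N' assume N: "N = Suc N'" and i: "i:{1..N}" and a: "vidx N (Suc k) a" "a i = (if w then k else 0)"
  have ne: "i ~= Suc N" "i:{1..Suc N}" using i by auto
  have v: "vidx N K (idel i (a(Suc N := b)))" using vidx_idel[OF vu[OF a(1) b]] k by simp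
  have "fc X N (C b a) i w = r N (q i w) N (\<lambda>t\<in>cell N. wmap N pinch (wmap N pinch (cm N K (idel i (a(Suc N := b))) t)))"
   unfolding C_def by (rule B_bdry[OF vu[OF a(1) b] ne(2)]) (use a(2) ne in simp)
  also have "\<dots> = konst X x N" using r_konst[OF x bc[OF v]] ne by (simp add: q_def)
  finally show "fc X (N' + 1) (C b a) i w = konst X x (N' + 1)" using N by simp
 qed
 obtain m where m: "merging X x N k m"
  using merge_ex[OF X kanE_Sing embed_ch[OF Xc] x, of N k] by (elim exE conjE)
 let ?L = "LP N X x"
 define E where "E b w = fc ?L 0 (m 1 (C b)) 1 w" for b w
 let ?E = "E 0 False"
 have lE: "lnk ?L (E b False) (E b True)" if "b <= k" for b
  by (rule lnkI[OF merging_in[OF m V[OF that]]]) (simp_all add: E_def)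
 have EE: "E b True = E (Suc b) False" if "Suc b <= k" for b
 proof -
  let ?m = "m 0 (%a. fc X N (C b a) (Suc N) True)"
  have b: "b <= k" using that by simp
  have "E b True = ?m" unfolding E_def by (rule merging_ends[OF m V[OF b]]) simp
  moreover have "E (Suc b) False = ?m"
   unfolding E_def
  proof (rule merging_ends[OF m V[OF that]])
   fix a assume a: "vidx N (Suc k) a"
   have u: "(a(Suc N := b))(Suc N := Suc ((a(Suc N := b)) (Suc N))) = a(Suc N := Suc b)" by simp
   show "fc X N (C b a) (Suc N) True = fc X N (C (Suc b) a) (Suc N) False"
    using B_match[OF vu[OF a b], of "Suc N", unfolded u, OF vu[OF a that]] by (simp add: C_def)
  qed
  ultimately show ?thesis by simp
 qed
 have path: "equivclp (lnk ?L) ?E (E b True)" if "b <= k" for b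
  using that
 proof (induction b)
  case 0
  thus ?case using lE[of 0] by (intro r_into_equivclp) simp
 next
  case (Suc b)
  have "equivclp (lnk ?L) ?E (E (Suc b) False)" using Suc EE[OF Suc.prems] by simp
  thus ?case using lE[OF Suc.prems] by (meson equivclp_trans r_into_equivclp)
 qed
 have ends: "lnk ?L (E (if w then k else 0) w) (s w)" for w
 proof -
  let ?b = "if w then k else 0"
  let ?w = "s w"
  have b: "?b <= k" by simp
  have "lnk ?L (m 0 (%a. r N ?w N (\<lambda>t\<in>cell N. wmap N ?s (cm N (Suc k) a t)))) (r N ?w N (\<lambda>t\<in>cell N. t))"
  proof (rule cell_link[OF Xc x m mp cp, of "%n g. r N ?w n g"])
   show "r N ?w n g:cubes X n" if "g:sc N n" for n g by (rule r_in[OF s1 that])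
   show "r N ?w a (act (SC N) a n g f) = act X a n (r N ?w n g) f" if "box_hom a n f" "g:sc N n" for a n g f
    by (rule r_act[OF s1 that(2,1)])
   show "r N ?w n g = konst X x n" if g: "g:sc N n" and j: "j:{1..N}" and c: "infc n g j et" for n g j et
   proof -
    obtain N' where N: "N = Suc N'" using j by (cases N) auto
    have j': "j:{1..Suc N'}" using j N by simp
    note g' = g[unfolded N]
    let ?p = "push (Suc N') N' (box_degen (Suc N') j) n g"
    have d: "?p:sc N' n" by (rule push_in[OF degen_hom[OF j' refl] g'])
    have "r N ?w n g = r N' (fc X N' ?w j et) n ?p"
     using r_push[OF s1[of w, unfolded N] face_hom[OF j' refl] d] push_face_degen[OF g' j' c] N by simp
    also have "\<dots> = konst X x n" using s2[OF N j] r_konst[OF x d] by simp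
    finally show ?thesis .
   qed
  qed
  moreover have "r N ?w N (\<lambda>t\<in>cell N. t) = ?w"
  proof -
   have "(\<lambda>t\<in>cell N. t) = box_top N N (box_id N)" using box_top_eqI[OF box_top_graph.id] by simp
   thus ?thesis using r_oper[OF s1 box_hom.id] act_id[OF Xc s1] by simp
  qed
  moreover have "E ?b w = m 0 (%a. r N ?w N (\<lambda>t\<in>cell N. wmap N ?s (cm N (Suc k) a t)))"
   unfolding E_def
  proof (rule merging_ends[OF m V[OF b]])
   fix a assume a: "vidx N (Suc k) a"
   have "cm N K (idel (Suc N) (a(Suc N := ?b))) t = cm N (Suc k) a t" for t
    unfolding cm_def k by (rule restrict_ext) (simp add: idel_def)
   thus "r N ?w N (\<lambda>t\<in>cell N. wmap N ?s (cm N (Suc k) a t)) = fc X N (C ?b a) (Suc N) w"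
    using B_bdry[OF vu[OF a b], of "Suc N" w] unfolding C_def pp by (simp add: q_def)
  qed
  ultimately show ?thesis by simp
 qed
 have "equivclp (lnk ?L) (s False) ?E" using ends[of False] by (simp add: equivclp_sym r_into_equivclp)
 also have "equivclp (lnk ?L) ?E (E k True)" by (rule path) simp
 also have "equivclp (lnk ?L) (E k True) (s True)" using ends[of True] by (simp add: r_into_equivclp)
 finally (equivclp_trans) show ?thesis .
qed

end

section \<open>Homotopies of spheroids\<close>

definition snoc :: "nat => (nat => real) => real => nat => real" where
 "snoc N t u = (\<lambda>j\<in>{1..Suc N}. if j = Suc N then u else t j)"

lemma snoc_cell: "t:cell N ==> 0 <= u ==> u <= 1 ==> snoc N t u:cell (Suc N)"
 unfolding snoc_def by (rule cellI) (auto simp: cell_iff)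

lemma snoc_face: "face_fun (Suc N) (Suc N) u t = snoc N t u"
 by (auto simp: face_fun_def snoc_def)

lemma restrict_cell: "t:cell (Suc N) ==> restrict t {1..N}:cell N"
 by (auto simp: cell_iff)

lemma cell_bdry_iff: "t:cell_bdry N \<longleftrightarrow> t:cell N & (EX i:{1..N}. t i = 0 | t i = 1)"
 by (simp add: cell_bdry_def)

lemma spheroids_LP: "p:topspace T ==> f:spheroids N T p \<longleftrightarrow> f:cubes (LP N (Sing T) (\<lambda>t\<in>cell 0. p)) 0"
 by (auto simp: LP_Sing_iff spheroids_def Sing_cubes cell_bdry_iff)

lemma top_pi_rel_iff:
 "(f, g):top_pi_rel N T p \<longleftrightarrow> f:extensional (cell N) & g:extensional (cell N) &
   homotopic_with (%h. ALL t:cell_bdry N. h t = p) (ct N) T f g"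
 using homotopic_with_imp_continuous_maps[of "%h. ALL t:cell_bdry N. h t = p" "ct N" T f g]
  homotopic_with_imp_property[of "%h. ALL t:cell_bdry N. h t = p" "ct N" T f g]
 by (auto simp: top_pi_rel_def spheroids_def)

lemma top_pi_equiv: "equiv (spheroids N T p) (top_pi_rel N T p)"
proof (rule equivI)
 let ?t = "top_pi_rel N T p"
 show "?t <= spheroids N T p \<times> spheroids N T p" by (auto simp: top_pi_rel_def)
 show "refl_on (spheroids N T p) ?t"
  by (rule refl_onI) (auto simp: top_pi_rel_def spheroids_def)
 show "sym ?t"
  by (rule symI) (simp add: top_pi_rel_iff homotopic_with_sym)
 show "trans ?t"
  by (rule transI) (auto simp: top_pi_rel_iff intro: homotopic_with_trans)
qed

text \<open>Homotopies are handled as cubes with the parameter as last coordinate; this passes to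
  the library form, where the parameter is a separate first factor.\<close>

lemma htpyI:
 assumes H: "continuous_map (ct (Suc N)) T H"
  and b: "!!t i. t:cell (Suc N) ==> i:{1..N} ==> t i = 0 | t i = 1 ==> H t = p"
  and f: "f:extensional (cell N)" "!!t. t:cell N ==> f t = H (snoc N t 0)"
  and g: "g:extensional (cell N)" "!!t. t:cell N ==> g t = H (snoc N t 1)"
 shows "(f, g):top_pi_rel N T p"
proof -
 let ?I = "top_of_set {0..1::real}"
 let ?p = "prod_topology ?I (ct N)"
 have c: "continuous_map ?p (ct (Suc N)) (%q. snoc N (snd q) (fst q))"
 proof (rule cts_cellI)
  show "snoc N (snd q) (fst q):cell (Suc N)" if "q:topspace ?p" for q
   using that by (auto intro: snoc_cell)
  fix j assume j: "j:{1..Suc N}"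
  show "cts ?p (%q. snoc N (snd q) (fst q) j)"
  proof (cases "j = Suc N")
   case True
   have "cts ?p (%q. fst q)"
    using continuous_map_fst[of ?I "ct N"] by (simp add: continuous_map_in_subtopology)
   thus ?thesis using True by (simp add: snoc_def)
  next
   case False
   hence j': "j:{1..N}" using j by auto
   have "cts ?p ((%t. t j) \<circ> snd)"
    by (rule continuous_map_compose[OF continuous_map_snd cts_proj[OF j']])
   thus ?thesis using False by (simp add: snoc_def o_def)
  qed
 qed
 have "homotopic_with (%h. ALL t:cell_bdry N. h t = p) (ct N) T f g"
 proof (subst homotopic_with)
  show "(ALL t:cell_bdry N. h t = p) = (ALL t:cell_bdry N. k t = p)" if "!!t. t:topspace (ct N) ==> h t = k t" for h k
   using that by (auto simp: cell_bdry_iff)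
  have "ALL t:cell_bdry N. H (snoc N t u) = p" if "u:{0..1}" for u
   using b[OF snoc_cell] that by (auto simp: cell_bdry_iff snoc_def)
  thus "EX h. continuous_map ?p T h &
    (ALL t:topspace (ct N). h (0, t) = f t) & (ALL t:topspace (ct N). h (1, t) = g t) &
    (ALL u:{0..1}. ALL t:cell_bdry N. h (u, t) = p)"
   using continuous_map_compose[OF c H] f(2) g(2)
   by (intro exI[of _ "%q. H (snoc N (snd q) (fst q))"]) (simp add: o_def)
 qed
 thus ?thesis using f(1) g(1) by (simp add: top_pi_rel_iff)
qed

lemma htpyD:
 assumes p: "p:topspace T" and fg: "(f, g):top_pi_rel N T p"
 obtains H where "H:cubes (LP N (Sing T) (\<lambda>t\<in>cell 0. p)) 1"
  "!!c. fc (Sing T) N H (Suc N) c = (if c then g else f)"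
proof -
 let ?I = "top_of_set {0..1::real}"
 let ?S = "Suc N"
 let ?e = "extensional (cell N)"
 let ?T = "Sing T"
 have e: "f:?e" "g:?e"
  and "homotopic_with (%h. ALL t:cell_bdry N. h t = p) (ct N) T f g" using fg by (simp_all add: top_pi_rel_iff)
 then obtain h where h: "continuous_map (prod_topology ?I (ct N)) T h" "ALL x. h (0, x) = f x" "ALL x. h (1, x) = g x"
  "ALL u:{0..1}. ALL t:cell_bdry N. h (u, t) = p" unfolding homotopic_with_def by (elim exE conjE)
 define H where "H = (\<lambda>t\<in>cell ?S. h (t ?S, restrict t {1..N}))"
 have "continuous_map (ct ?S) (ct N) (%t. restrict t {1..N})"
 proof (rule cts_cellI)
  show "cts (ct ?S) (%t. restrict t {1..N} j)" if "j:{1..N}" for j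
   using cts_proj[of j ?S] by simp
 qed (simp add: restrict_cell)
 moreover have "continuous_map (ct ?S) ?I (%t. t ?S)"
  unfolding continuous_map_in_subtopology using cts_proj[of ?S ?S] cell_bounds[of _ ?S ?S] by force
 ultimately have "continuous_map (ct ?S) (prod_topology ?I (ct N)) (%t. (t ?S, restrict t {1..N}))"
  by (simp add: continuous_map_pairwise o_def)
 from continuous_map_compose[OF this h(1)] have Hc: "H:cubes ?T ?S"
  unfolding H_def by (intro SingI) (simp add: o_def)
 have u01: "t ?S:{0..1}" if "t:cell ?S" for t using cell_bounds[OF that, of ?S] by simp
 have "H t = p" if "t:cell ?S" "i:{1..N}" "t i = 0 | t i = 1" for t i
 proof -
  have "restrict t {1..N}:cell_bdry N" using that restrict_cell[OF that(1)] by (auto simp: cell_bdry_iff)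
  thus ?thesis using h(4) u01[OF that(1)] that(1) by (simp add: H_def)
 qed
 hence H1: "H:cubes (LP N ?T (\<lambda>t\<in>cell 0. p)) 1" using Hc by (auto simp: LP_Sing_iff[OF p])
 have "fc ?T N H ?S c = (if c then g else f)" for c
 proof (rule extensionalityI[of _ "cell N"])
  have i: "1 <= ?S" "?S <= ?S" "?S:{1..Suc N}" by auto
  show "fc ?T N H ?S c:?e"
   using fc_in[OF Sing_cset Hc i(1,2)] by (simp add: Sing_cubes)
  show "(if c then g else f):?e" using e by simp
  fix t assume t: "t:cell N"
  have r: "restrict (snoc N t (of_bool c)) {1..N} = t" using t by (auto simp: snoc_def cell_iff)
  have l: "snoc N t (of_bool c) ?S = of_bool c" by (simp add: snoc_def)
  have "fc ?T N H ?S c t = h (of_bool c, t)"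
   unfolding Sing_fc[OF Hc i(1,2) t] snoc_face unfolding H_def using snoc_cell[OF t, of "of_bool c"] r l by simp
  thus "fc ?T N H ?S c t = (if c then g else f) t" using h(2,3) by simp
 qed
 with H1 show ?thesis by (rule that)
qed

lemma LP_fc_last:
 assumes "cubical_set E" "e:cubes E 0" "H:cubes (LP N E e) 1"
 shows "fc (LP N E e) 0 H 1 c = fc E N H (Suc N) c"
 using LP_act[OF assms, of 0 "box_face 1 1 c"] face_hom[of 1 1 0 c] tn_face[of 1 0 E N H c] by simp

lemma lnk_top:
 assumes p: "p:topspace T" and l: "lnk (LP N (Sing T) (\<lambda>t\<in>cell 0. p)) f g"
 shows "(f, g):top_pi_rel N T p"
proof -
 let ?S = "Suc N"
 let ?e = "extensional (cell N)"
 let ?T = "Sing T"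
 obtain H where H: "H:cubes (LP N ?T (\<lambda>t\<in>cell 0. p)) 1"
  "fc ?T N H ?S False = f" "fc ?T N H ?S True = g"
  using l LP_fc_last[OF Sing_cset const_Sing[OF p]] unfolding lnk_def by metis
 have H1: "H:cubes ?T ?S" and H2: "!!t i. t:cell ?S ==> i:{1..N} ==> t i = 0 | t i = 1 ==> H t = p"
  using H(1) unfolding LP_Sing_iff[OF p] by auto
 have i: "1 <= ?S" "?S <= ?S" by auto
 have x: "fc ?T N H ?S e:?e" for e
  using fc_in[OF Sing_cset H1 i] by (simp add: Sing_cubes)
 show ?thesis
 proof (rule htpyI[OF _ H2])
  show "continuous_map (ct ?S) T H" using H1 by (simp add: Sing_cubes)
  show "f:?e" "g:?e" using x[of False] x[of True] H(2,3) by simp_all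
  show "f t = H (snoc N t 0)" if "t:cell N" for t
   using Sing_fc[OF H1 i that, of False] H(2) by (simp add: snoc_face)
  show "g t = H (snoc N t 1)" if "t:cell N" for t
   using Sing_fc[OF H1 i that, of True] H(3) by (simp add: snoc_face)
 qed
qed

section \<open>Deformations of the realization\<close>

definition defm :: "real => real => real" where
 "defm u s = (1 - u) * s + u * pinch s"

lemma pinch_bounds: "0 <= pinch s" "pinch s <= 1"
 by (auto simp: pinch_def)

lemma convex_01:
 fixes a b u :: real
 assumes "0 <= u" "u <= 1" "0 <= a" "a <= 1" "0 <= b" "b <= 1"
 shows "0 <= (1 - u) * a + u * b & (1 - u) * a + u * b <= 1"
proof
 show "0 <= (1 - u) * a + u * b" using assms by simp
 have "(1 - u) * a <= 1 - u" by (rule mult_left_le) (use assms in auto)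
 moreover have "u * b <= u" by (rule mult_left_le) (use assms in auto)
 ultimately show "(1 - u) * a + u * b <= 1" by linarith
qed

lemma end_mono_defm:
 assumes "0 <= u" "u <= 1"
 shows "end_mono (defm u)"
proof -
 have p: "s <= t ==> pinch s <= pinch t" "pinch 0 = 0" "pinch 1 = 1" for s t by (auto simp: pinch_def)
 have "defm u s <= defm u t" if "s <= t" for s t
  unfolding defm_def by (intro add_mono mult_left_mono) (use that p assms in auto)
 thus ?thesis
  using convex_01[OF assms _ _ pinch_bounds] p by (auto simp: end_mono_def mono_on_def defm_def)
qed

text \<open>The interval is compact Hausdorff, so its product with the quotient map onto the
  realization is again a quotient map, and continuity can be checked on cells.\<close>

lemma continuous_map_defm:
 assumes X: "cubical_set X"
 shows "continuous_map (prod_topology (top_of_set {0..1}) (realization X)) (realization X) (%(u, q). rmap X (defm u) q)"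
proof -
 let ?I = "top_of_set {0..1::real}" and ?q = "%a. real_rel X `` {a}"
 let ?p = "prod_topology ?I (pre_real X)"
 let ?r = "realization X"
 have Q: "quotient_map ?p (prod_topology ?I ?r) (%(u, a). (u, ?q a))"
 proof (rule quotient_map_prod_right)
  show "locally_compact_space ?I"
   by (intro compact_imp_locally_compact_space) (simp_all add: compact_space_subtopology)
  show "Hausdorff_space ?I | regular_space ?I" by (simp add: Hausdorff_space_subtopology)
  show "quotient_map (pre_real X) ?r ?q" unfolding realization_def by (rule quotient_map_coinduced)
 qed
 have c: "continuous_map (prod_topology ?I (ct n)) ?r (%z. pt X n x (wmap n (defm (fst z)) (snd z)))"
  if x: "x:cubes X n" for n x
 proof -
  let ?c = "prod_topology ?I (ct n)"
  have "continuous_map ?c (ct n) (%z. wmap n (defm (fst z)) (snd z))"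
  proof (rule cts_cellI)
   show "wmap n (defm (fst z)) (snd z):cell n" if "z:topspace ?c" for z
    using that by (auto intro!: wmap_cell end_mono_defm)
   fix j assume j: "j:{1..n}"
   have a: "cts ?c (%z. fst z)"
    using continuous_map_fst[of ?I "ct n"] by (simp add: continuous_map_in_subtopology)
   have b: "cts ?c (%z. snd z j)"
    using continuous_map_compose[OF continuous_map_snd cts_proj[OF j], of ?I] by (simp add: o_def)
   have d: "cts ?c (%z. pinch (snd z j))"
    using continuous_map_compose[OF b, of euclideanreal pinch] cts_pinch by (simp add: o_def)
   show "cts ?c (%z. wmap n (defm (fst z)) (snd z) j)"
    using j a b d by (simp add: wmap_def defm_def) (intro continuous_map_add continuous_map_real_mult continuous_map_diff; simp)
  qed
  from continuous_map_compose[OF this cts_pt[OF x]] show ?thesis by (simp add: o_def)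
 qed
 define G where "G = (%(u, q). rmap X (defm u) q)"
 have Gpt: "G (u, ?q ((n, x), t)) = pt X n x (wmap n (defm u) t)" if "u:{0..1}" "x:cubes X n" "t:cell n" for u n x t
  using rmap_pt[OF X end_mono_defm that(2,3), of u] that(1) by (simp add: G_def pt_def)
 have "continuous_map ?p ?r (G \<circ> (%(u, a). (u, ?q a)))"
  unfolding continuous_map_def
 proof (intro conjI allI impI)
  show "G \<circ> (%(u, a). (u, ?q a)):topspace ?p \<rightarrow> topspace ?r"
   by (auto simp: top_pre_real Gpt intro!: pt_in wmap_cell end_mono_defm)
  fix U assume U: "openin ?r U"
  let ?W = "{z:topspace ?p. (G \<circ> (%(u, a). (u, ?q a))) z:U}"
  show "openin ?p ?W"
   unfolding openin_prod_topology_alt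
  proof (intro allI impI)
   fix u a assume ua: "(u, a):?W"
   obtain n x t where a: "a = ((n, x), t)" by (metis prod.exhaust)
   have u: "u:{0..1}" and x: "x:cubes X n" and t: "t:cell n" using ua a by (auto simp: top_pre_real)
   let ?V = "{z:topspace (prod_topology ?I (ct n)). pt X n x (wmap n (defm (fst z)) (snd z)):U}"
   have "openin (prod_topology ?I (ct n)) ?V" by (rule openin_continuous_map_preimage[OF c[OF x] U])
   moreover have "(u, t):?V" using ua t Gpt[OF u x t] a by simp
   ultimately obtain A B where AB: "openin ?I A" "openin (ct n) B" "u:A" "t:B" "A \<times> B <= ?V"
    unfolding openin_prod_topology_alt by meson
   have "openin (pre_real X) (Pair (n, x) ` B)"
    unfolding pre_real_def
    using open_map_component_injection[of "(n, x)" "SIGMA n:UNIV. cubes X n" "%(n, x). ct n"] x AB(2)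
    by (simp add: open_map_def)
   moreover have "A \<times> Pair (n, x) ` B <= ?W"
   proof
    fix z assume "z:A \<times> Pair (n, x) ` B"
    then obtain u' t' where z: "z = (u', ((n, x), t'))" "u':A" "t':B" by blast
    hence m: "(u', t'):?V" using AB(5) by blast
    hence u': "u':{0..1}" and t': "t':cell n" by simp_all
    show "z:?W" using m Gpt[OF u' x t'] u' x by (simp add: z(1) top_pre_real)
   qed
   ultimately show "EX U' V'. openin ?I U' & openin (pre_real X) V' & u:U' & a:V' & U' \<times> V' <= ?W"
    using AB a by (intro exI[of _ A] exI[of _ "Pair (n, x) ` B"]) simp
  qed
 qed
 from continuous_compose_quotient_map[OF Q this] show ?thesis by (simp add: G_def)
qed

lemma pinch_top_pi_rel:
 assumes X: "cubical_set X" and x: "x:cubes X 0" and f: "f:spheroids N (realization X) (real_vertex X x)"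
 shows "(f, \<lambda>t\<in>cell N. rmap X pinch (f t)):top_pi_rel N (realization X) (real_vertex X x)"
proof -
 let ?I = "top_of_set {0..1::real}" and ?p = "real_vertex X x"
 let ?r = "realization X"
 let ?l = "\<lambda>t\<in>cell N. rmap X pinch (f t)"
 let ?c = "ct N"
 have fc: "continuous_map ?c ?r f" "f:extensional (cell N)" "ALL t:cell_bdry N. f t = ?p"
  using f by (simp_all add: spheroids_def)
 have ft: "f t:topspace ?r" if "t:cell N" for t
  using continuous_map_image_subset_topspace[OF fc(1)] that by auto
 have id: "rmap X (defm 0) q = q" "rmap X (defm 1) q = rmap X pinch q" if q: "q:topspace ?r" for q
 proof -
  obtain n y t where y: "y:cubes X n" "t:cell n" "q = pt X n y t" by (rule realization_cases[OF q])
  have d: "defm 0 = (%s. s)" "defm 1 = pinch" by (simp_all add: defm_def fun_eq_iff)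
  show "rmap X (defm 0) q = q" "rmap X (defm 1) q = rmap X pinch q"
   using rmap_pt[OF X end_mono_defm y(1,2), of 0] rmap_pt[OF X end_mono_pinch y(1,2)]
    wmap_id[OF y(2)] d by (simp_all add: y(3))
 qed
 have c: "continuous_map (prod_topology ?I ?c) (prod_topology ?I ?r) (%z. (fst z, f (snd z)))"
  using continuous_map_fst[of ?I ?c] continuous_map_compose[OF continuous_map_snd fc(1), of ?I]
  by (simp add: continuous_map_pairwise o_def)
 have "homotopic_with (%h. ALL t:cell_bdry N. h t = ?p) ?c ?r f ?l"
 proof (subst homotopic_with)
  show "(ALL t:cell_bdry N. h t = ?p) = (ALL t:cell_bdry N. k t = ?p)" if "!!t. t:topspace ?c ==> h t = k t" for h k
   using that by (auto simp: cell_bdry_iff)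
  show "EX h. continuous_map (prod_topology ?I ?c) ?r h &
    (ALL t:topspace ?c. h (0, t) = f t) &
    (ALL t:topspace ?c. h (1, t) = ?l t) &
    (ALL u:{0..1}. ALL t:cell_bdry N. h (u, t) = ?p)"
   using continuous_map_compose[OF c continuous_map_defm[OF X]] id ft fc(3) rmap_vertex[OF X end_mono_defm x]
   by (intro exI[of _ "%z. rmap X (defm (fst z)) (f (snd z))"]) (simp add: o_def)
 qed
 thus ?thesis using fc(2) by (simp add: top_pi_rel_iff)
qed

section \<open>The homotopy groups of a space\<close>

lemma cell_upd: "t:cell (Suc m) ==> 0 <= s ==> s <= 1 ==> t(1 := s):cell (Suc m)"
 by (auto simp: cell_iff)

text \<open>The source may have one coordinate more than the target, which then serves as a homotopy
  parameter.\<close>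

lemma continuous_map_upd:
 assumes c: "cts (ct n) h" "!!t. t:cell n ==> 0 <= h t & h t <= 1"
  and n: "n = Suc m | n = Suc (Suc m)"
 shows "continuous_map (ct n) (ct (Suc m)) (%t. \<lambda>j\<in>{1..Suc m}. if j = 1 then h t else t j)"
proof (rule cts_cellI)
 show "(\<lambda>j\<in>{1..Suc m}. if j = 1 then h t else t j):cell (Suc m)" if "t:topspace (ct n)" for t
 proof -
  have t: "t:cell n" using that by simp
  show ?thesis by (rule cellI) (use c(2)[OF t] cell_bounds[OF t] n in auto)
 qed
 show "cts (ct n) (%t. (\<lambda>j\<in>{1..Suc m}. if j = 1 then h t else t j) j)" if "j:{1..Suc m}" for j
  using c(1) cts_proj[of j n] that n by (cases "j = 1") auto
qed

lemma upd_restrict: "t:cell (Suc m) ==> (\<lambda>j\<in>{1..Suc m}. if j = 1 then s else t j) = t(1 := s)"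
 by (auto simp: cell_iff)

text \<open>Linear interpolation between the two reparametrizations of the first coordinate; common
  end values in \<open>{0, 1}\<close> keep the boundary at the base point.\<close>

lemma repar:
 assumes f: "f:spheroids (Suc M) T p"
  and h: "continuous_on {0..1} h" "!!s. 0 <= s ==> s <= 1 ==> 0 <= h s & h s <= 1"
  and h': "continuous_on {0..1} h'" "!!s. 0 <= s ==> s <= 1 ==> 0 <= h' s & h' s <= 1"
  and ends: "h' 0 = h 0" "h' 1 = h 1" "h 0 = 0 | h 0 = 1" "h 1 = 0 | h 1 = (1 :: real)"
 shows "(\<lambda>t\<in>cell (Suc M). f (t(1 := h (t 1))), \<lambda>t\<in>cell (Suc M). f (t(1 := h' (t 1)))):top_pi_rel (Suc M) T p"
proof -
 let ?N = "Suc M"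
 let ?S = "Suc ?N"
 define c where "c t = (1 - t ?S) * h (t 1) + t ?S * h' (t 1)" for t :: "nat => real"
 have cont: "cts (ct ?S) (%t. b (t 1))" if "continuous_on {0..1} b" for b :: "real => real"
 proof -
  have "continuous_map (ct ?S) (top_of_set {0..1}) (%t. t 1)"
   unfolding continuous_map_in_subtopology using cts_proj[of 1 ?S] cell_bounds[of _ ?S 1] by force
  from continuous_map_compose[OF this, of euclideanreal b] that show ?thesis by (simp add: o_def)
 qed
 have cc: "cts (ct ?S) c"
  unfolding c_def using cont[OF h(1)] cont[OF h'(1)] cts_proj[of ?S ?S]
  by (intro continuous_map_add continuous_map_real_mult continuous_map_diff) auto
 have cb: "0 <= c t & c t <= 1" if t: "t:cell ?S" for t
 proof -
  have 1: "0 <= t 1" "t 1 <= 1" "0 <= t ?S" "t ?S <= 1"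
   using cell_bounds[OF t, of 1] cell_bounds[OF t, of ?S] by auto
  show ?thesis unfolding c_def by (rule convex_01) (use 1 h(2)[of "t 1"] h'(2)[of "t 1"] in auto)
 qed
 let ?d = "%t. \<lambda>j\<in>{1..?N}. if j = 1 then c t else t j"
 have d: "continuous_map (ct ?S) (ct ?N) ?d" by (rule continuous_map_upd[OF cc cb]) simp_all
 have fc: "continuous_map (ct ?N) T f" and fb: "!!t. t:cell_bdry ?N ==> f t = p" using f by (simp_all add: spheroids_def)
 show ?thesis
 proof (rule htpyI)
  show "continuous_map (ct ?S) T (%t. f (?d t))" using continuous_map_compose[OF d fc] by (simp add: o_def)
  show "f (?d t) = p" if t: "t:cell ?S" and i: "i:{1..?N}" "t i = 0 | t i = 1" for t i
  proof (rule fb)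
   have dc: "?d t:cell ?N" using continuous_map_image_subset_topspace[OF d] t by fastforce
   have "c t = h 0" if "t 1 = 0" using that ends(1) by (simp add: c_def algebra_simps)
   moreover have "c t = h 1" if "t 1 = 1" using that ends(2) by (simp add: c_def algebra_simps)
   ultimately have "?d t i = 0 | ?d t i = 1" using i ends(3,4) by (cases "i = 1") auto
   thus "?d t:cell_bdry ?N" using dc i(1) unfolding cell_bdry_iff by blast
  qed
  show "(\<lambda>t\<in>cell ?N. f (t(1 := h (t 1)))) t = f (?d (snoc ?N t 0))" if t: "t:cell ?N" for t
  proof -
   have "?d (snoc ?N t 0) = t(1 := h (t 1))"
    unfolding upd_restrict[OF t, symmetric] by (rule restrict_ext) (simp add: snoc_def c_def)
   thus ?thesis using t by simp
  qed
  show "(\<lambda>t\<in>cell ?N. f (t(1 := h' (t 1)))) t = f (?d (snoc ?N t 1))" if t: "t:cell ?N" for t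
  proof -
   have "?d (snoc ?N t 1) = t(1 := h' (t 1))"
    unfolding upd_restrict[OF t, symmetric] by (rule restrict_ext) (simp add: snoc_def c_def)
   thus ?thesis using t by simp
  qed
 qed auto
qed

lemma concat_apply: "t:cell m ==> spheroid_concat m f g t = (if t 1 <= 1 / 2 then f (t(1 := 2 * t 1)) else g (t(1 := 2 * t 1 - 1)))"
 by (simp add: spheroid_concat_def)

lemma concat_upd: "t:cell (Suc m) ==> 0 <= s ==> s <= 1 ==> spheroid_concat (Suc m) f g (t(1 := s)) =
  (if s <= 1 / 2 then f (t(1 := 2 * s)) else g (t(1 := 2 * s - 1)))"
 unfolding concat_apply[OF cell_upd] by simp

lemma concat_Sing:
 assumes f: "f:cubes (Sing T) (Suc m)" and g: "g:cubes (Sing T) (Suc m)"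
  and fp: "!!t. t:cell (Suc m) ==> t 1 = 1 ==> f t = p" and gp: "!!t. t:cell (Suc m) ==> t 1 = 0 ==> g t = p"
 shows "spheroid_concat (Suc m) f g:cubes (Sing T) (Suc m)"
 unfolding spheroid_concat_def
proof (rule SingI)
 let ?C = "ct (Suc m)"
 let ?s = "subtopology ?C {t:topspace ?C. t 1 <= 1 / 2}"
 let ?t = "subtopology ?C {t:topspace ?C. 1 / 2 <= t 1}"
 let ?c = "cell (Suc m)"
 have p1: "cts ?C (%t. t 1)" by (rule cts_proj) simp
 have b1: "0 <= t 1" "t 1 <= 1" if "t:?c" for t using cell_bounds[OF that, of 1] by auto
 have c1: "continuous_map ?C T (%t. f (\<lambda>j\<in>{1..Suc m}. if j = 1 then min 1 (2 * t 1) else t j))"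
 proof -
  have "continuous_map ?C ?C (%t. \<lambda>j\<in>{1..Suc m}. if j = 1 then min 1 (2 * t 1) else t j)"
   by (rule continuous_map_upd) (use p1 b1 in \<open>auto intro!: continuous_map_real_min continuous_map_real_mult\<close>)
  from continuous_map_compose[OF this conjunct2[OF f[unfolded Sing_cubes]]] show ?thesis by (simp add: o_def)
 qed
 have c2: "continuous_map ?C T (%t. g (\<lambda>j\<in>{1..Suc m}. if j = 1 then max 0 (2 * t 1 - 1) else t j))"
 proof -
  have "continuous_map ?C ?C (%t. \<lambda>j\<in>{1..Suc m}. if j = 1 then max 0 (2 * t 1 - 1) else t j)"
   by (rule continuous_map_upd) (use p1 b1 in \<open>auto intro!: continuous_map_real_max continuous_map_real_mult continuous_map_diff\<close>)
  from continuous_map_compose[OF this conjunct2[OF g[unfolded Sing_cubes]]] show ?thesis by (simp add: o_def)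
 qed
 show "continuous_map ?C T (%t. if t 1 <= 1 / 2 then f (t(1 := 2 * t 1)) else g (t(1 := 2 * t 1 - 1)))"
 proof (rule continuous_map_cases_le[OF p1])
  show "cts ?C (%t. 1 / 2)" by simp
  show "continuous_map ?s T (%t. f (t(1 := 2 * t 1)))"
  proof (rule continuous_map_eq[OF continuous_map_from_subtopology[OF c1]])
   fix t assume "t:topspace ?s"
   hence t: "t:?c" "t 1 <= 1 / 2" by auto
   hence "min 1 (2 * t 1) = 2 * t 1" by simp
   thus "f (\<lambda>j\<in>{1..Suc m}. if j = 1 then min 1 (2 * t 1) else t j) = f (t(1 := 2 * t 1))"
    by (simp only: upd_restrict[OF t(1)])
  qed
  show "continuous_map ?t T (%t. g (t(1 := 2 * t 1 - 1)))"
  proof (rule continuous_map_eq[OF continuous_map_from_subtopology[OF c2]])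
   fix t assume "t:topspace ?t"
   hence t: "t:?c" "1 / 2 <= t 1" by auto
   hence "max 0 (2 * t 1 - 1) = 2 * t 1 - 1" by simp
   thus "g (\<lambda>j\<in>{1..Suc m}. if j = 1 then max 0 (2 * t 1 - 1) else t j) = g (t(1 := 2 * t 1 - 1))"
    by (simp only: upd_restrict[OF t(1)])
  qed
  fix t assume "t:topspace ?C" "t 1 = 1 / 2"
  hence t: "t:?c" and e: "2 * t 1 = 1" by simp_all
  show "f (t(1 := 2 * t 1)) = g (t(1 := 2 * t 1 - 1))"
   unfolding e using fp[of "t(1 := 1)"] gp[of "t(1 := 0)"] cell_upd[OF t, of 1] cell_upd[OF t, of 0] by simp
 qed
qed

text \<open>The index set \<open>I\<close> is left general so that both spheroids and homotopies are
  covered, the latter with the homotopy direction omitted from \<open>I\<close>.\<close>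

lemma concat_bdry:
 assumes f: "!!t i. t:cell (Suc m) ==> i:I ==> t i = 0 | t i = 1 ==> f t = p"
  and g: "!!t i. t:cell (Suc m) ==> i:I ==> t i = 0 | t i = 1 ==> g t = p"
  and t: "t:cell (Suc m)" "i:I" "t i = 0 | t i = 1"
 shows "spheroid_concat (Suc m) f g t = p"
proof -
 have b: "0 <= t 1" "t 1 <= 1" using cell_bounds[OF t(1), of 1] by auto
 show ?thesis
 proof (cases "t 1 <= 1 / 2")
  case True
  hence "(t(1 := 2 * t 1)) i = 0 | (t(1 := 2 * t 1)) i = 1" using t(3) by auto
  thus ?thesis using f[OF cell_upd[OF t(1)] t(2), of "2 * t 1"] True b by (simp add: concat_apply[OF t(1)])
 next
  case False
  hence "(t(1 := 2 * t 1 - 1)) i = 0 | (t(1 := 2 * t 1 - 1)) i = 1" using t(3) by auto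
  thus ?thesis using g[OF cell_upd[OF t(1)] t(2), of "2 * t 1 - 1"] False b by (simp add: concat_apply[OF t(1)])
 qed
qed

lemma spheroids_iff: "f:spheroids N T p \<longleftrightarrow> f:cubes (Sing T) N & (ALL t:cell N. ALL i:{1..N}. t i = 0 | t i = 1 --> f t = p)"
 by (auto simp: spheroids_def Sing_cubes cell_bdry_iff)

lemma concat_spheroid:
 assumes "f:spheroids (Suc M) T p" "g:spheroids (Suc M) T p"
 shows "spheroid_concat (Suc M) f g:spheroids (Suc M) T p"
proof -
 let ?c = "cubes (Sing T) (Suc M)"
 have f: "f:?c" "!!t i. t:cell (Suc M) ==> i:{1..Suc M} ==> t i = 0 | t i = 1 ==> f t = p"
  and g: "g:?c" "!!t i. t:cell (Suc M) ==> i:{1..Suc M} ==> t i = 0 | t i = 1 ==> g t = p"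
  using assms unfolding spheroids_iff by blast+
 have "spheroid_concat (Suc M) f g:?c"
  by (rule concat_Sing[OF f(1) g(1)]) (use f(2)[of _ 1] g(2)[of _ 1] in auto)
 moreover have "spheroid_concat (Suc M) f g t = p" if "t:cell (Suc M)" "i:{1..Suc M}" "t i = 0 | t i = 1" for t i
  by (rule concat_bdry[of M "{1..Suc M}" f p g, OF f(2) g(2) that])
 ultimately show ?thesis unfolding spheroids_iff by blast
qed

text \<open>The two homotopies are concatenated like spheroids: their parameter is the last
  coordinate and does not interfere with the first.\<close>

lemma concat_rel:
 assumes p: "p:topspace T" and f: "(f, f'):top_pi_rel (Suc M) T p" and g: "(g, g'):top_pi_rel (Suc M) T p"
 shows "(spheroid_concat (Suc M) f g, spheroid_concat (Suc M) f' g'):top_pi_rel (Suc M) T p"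
proof -
 let ?N = "Suc M"
 let ?S = "Suc ?N"
 let ?c = "cubes (LP ?N (Sing T) (\<lambda>t\<in>cell 0. p)) 1"
 let ?T = "cubes (Sing T) ?S"
 obtain H where H: "H:?c" "!!e. fc (Sing T) ?N H ?S e = (if e then f' else f)"
  by (rule htpyD[OF p f]) (rule that)
 obtain K where K: "K:?c" "!!e. fc (Sing T) ?N K ?S e = (if e then g' else g)"
  by (rule htpyD[OF p g]) (rule that)
 have H': "H:?T" "!!t i. t:cell ?S ==> i:{1..?N} ==> t i = 0 | t i = 1 ==> H t = p"
  and K': "K:?T" "!!t i. t:cell ?S ==> i:{1..?N} ==> t i = 0 | t i = 1 ==> K t = p"
  using H(1) K(1) unfolding LP_Sing_iff[OF p] by auto
 let ?C = "spheroid_concat ?S H K"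
 have C: "?C:?T"
  by (rule concat_Sing[OF H'(1) K'(1)]) (use H'(2)[of _ 1] K'(2)[of _ 1] in auto)
 have i: "1 <= ?S" "?S <= ?S" by auto
 have ends: "spheroid_concat ?N (if e then f' else f) (if e then g' else g) t = ?C (snoc ?N t (of_bool e))" if t: "t:cell ?N" for t e
 proof -
  let ?o = "of_bool e"
  have s: "snoc ?N t ?o:cell ?S" by (rule snoc_cell[OF t]) simp_all
  have s1: "snoc ?N t ?o 1 = t 1" by (simp add: snoc_def)
  have su: "(snoc ?N t ?o)(1 := v) = snoc ?N (t(1 := v)) ?o" for v by (auto simp: snoc_def)
  have h: "(if e then f' else f) t' = H (snoc ?N t' ?o)" "(if e then g' else g) t' = K (snoc ?N t' ?o)" if "t':cell ?N" for t'
   using Sing_fc[OF H'(1) i that, of e] Sing_fc[OF K'(1) i that, of e] H(2)[of e] K(2)[of e] by (simp_all only: snoc_face)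
  have b: "0 <= t 1" "t 1 <= 1" using cell_bounds[OF t, of 1] by auto
  show ?thesis
   unfolding concat_apply[OF t] concat_apply[OF s] s1 su
   using h[OF cell_upd[OF t, of "2 * t 1"]] h[OF cell_upd[OF t, of "2 * t 1 - 1"]] b by auto
 qed
 show ?thesis
 proof (rule htpyI)
  show "continuous_map (ct ?S) T ?C" using C by (simp add: Sing_cubes)
  show "?C t = p" if "t:cell ?S" "i:{1..?N}" "t i = 0 | t i = 1" for t i
   by (rule concat_bdry[of ?N "{1..?N}" H p K, OF H'(2) K'(2) that])
  show "spheroid_concat ?N f g t = ?C (snoc ?N t 0)" if "t:cell ?N" for t using ends[OF that, of False] by simp
  show "spheroid_concat ?N f' g' t = ?C (snoc ?N t 1)" if "t:cell ?N" for t using ends[OF that, of True] by simp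
 qed (simp_all add: spheroid_concat_def)
qed

section \<open>Group axioms for classes of spheroids\<close>

lemma top_pi_class: "A:top_pi N T p ==> EX f. f:spheroids N T p & A = top_pi_rel N T p `` {f}"
 by (auto simp: top_pi_def quotient_def)

lemma top_pi_classI: "f:spheroids N T p ==> top_pi_rel N T p `` {f}:top_pi N T p"
 by (auto simp: top_pi_def quotient_def)

lemma top_pi_class_eq: "(f, g):top_pi_rel N T p ==> top_pi_rel N T p `` {f} = top_pi_rel N T p `` {g}"
 by (rule equiv_class_eq[OF top_pi_equiv])

lemma top_pi_relD: "(f, g):top_pi_rel N T p ==> f:spheroids N T p & g:spheroids N T p"
 by (auto simp: top_pi_rel_def)

lemma top_pi_refl: "f:spheroids N T p ==> (f, f):top_pi_rel N T p"
 using top_pi_equiv[of N T p] by (auto simp: equiv_def refl_on_def)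

lemma top_mult:
 assumes p: "p:topspace T" and f: "f:spheroids (Suc M) T p" and g: "g:spheroids (Suc M) T p"
 shows "top_pi_rel (Suc M) T p `` {f} \<otimes>\<^bsub>top_pi_group (Suc M) T p\<^esub> top_pi_rel (Suc M) T p `` {g} =
  top_pi_rel (Suc M) T p `` {spheroid_concat (Suc M) f g}"
proof -
 let ?R = "top_pi_rel (Suc M) T p"
 let ?S = "{spheroid_concat (Suc M) f' g' | f' g'. f':?R `` {f} & g':?R `` {g}}"
 let ?s = "?R `` {spheroid_concat (Suc M) f g}"
 have "?R `` ?S = ?s"
 proof (rule saturation_eq[OF top_pi_equiv concat_spheroid[OF f g]])
  show "?S <= ?s" using concat_rel[OF p] by blast
  show "?S ~= {}" using top_pi_refl[OF f] top_pi_refl[OF g] by blast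
 qed
 thus ?thesis by (simp add: top_pi_group_def)
qed

lemma const_spheroid: "p:topspace T ==> (\<lambda>t\<in>cell N. p):spheroids N T p"
 by (simp add: spheroids_iff const_Sing)

lemma repar_id: "f:spheroids (Suc M) T p ==> (\<lambda>t\<in>cell (Suc M). f (t(1 := t 1))) = f"
 by (auto simp: spheroids_def extensional_def)

lemma concat_assoc:
 assumes f: "f:spheroids (Suc M) T p" and g: "g:spheroids (Suc M) T p" and h: "h:spheroids (Suc M) T p"
 shows "(spheroid_concat (Suc M) (spheroid_concat (Suc M) f g) h, spheroid_concat (Suc M) f (spheroid_concat (Suc M) g h))
 :top_pi_rel (Suc M) T p"
proof -
 let ?N = "Suc M" and ?F = "spheroid_concat (Suc M) f (spheroid_concat (Suc M) g h)"
 \<comment> \<open>The piecewise linear map taking the breakpoints \<open>1 / 4\<close>,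
   \<open>1 / 2\<close> of the left bracketing to the breakpoints \<open>1 / 2\<close>,
   \<open>3 / 4\<close> of the right one.\<close>
 define q :: "real => real" where "q s = min (2 * s) (min (s + 1 / 4) ((s + 1) / 2))" for s
 let ?l = "\<lambda>t\<in>cell ?N. ?F (t(1 := q (t 1)))"
 have "spheroid_concat ?N (spheroid_concat ?N f g) h = ?l"
 proof (rule extensionalityI[of _ "cell ?N"])
  fix t assume t: "t:cell ?N"
  let ?t = "t 1"
  let ?T = "2 * t 1"
  have b: "0 <= ?t" "?t <= 1" using cell_bounds[OF t, of 1] by auto
  have F: "?F (t(1 := s)) = (if s <= 1 / 2 then f (t(1 := 2 * s)) else if s <= 3 / 4 then g (t(1 := 4 * s - 2)) else h (t(1 := 4 * s - 3)))"
   if s: "0 <= s" "s <= 1" for s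
  proof (cases "s <= 1 / 2")
   case True
   thus ?thesis using concat_upd[OF t s] by simp
  next
   case False
   hence s': "0 <= 2 * s - 1" "2 * s - 1 <= 1" using s by auto
   have e: "(2 * s - 1 <= 1 / 2) = (s <= 3 / 4)" "2 * (2 * s - 1) - 1 = 4 * s - 3" "2 * (2 * s - 1) = 4 * s - 2" by auto
   show ?thesis unfolding concat_upd[OF t s] concat_upd[OF t s', of g h] e by simp
  qed
  have tb: "0 <= q ?t" "q ?t <= 1" using b by (auto simp: q_def min_def)
  consider "?t <= 1 / 4" | "1 / 4 < ?t" "?t <= 1 / 2" | "1 / 2 < ?t" by linarith
  thus "spheroid_concat ?N (spheroid_concat ?N f g) h t = ?l t"
  proof cases
   case 1
   hence "q ?t = ?T" "?T <= 1 / 2" "?T <= 1" "?t <= 1 / 2" by (auto simp: q_def)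
   thus ?thesis unfolding concat_apply[OF t] using F[OF tb] t concat_upd[OF t, of ?T f g] b by simp
  next
   case 2
   hence *: "q ?t = t 1 + 1 / 4" "~ 2 * t 1 <= 1 / 2" "?T <= 1" by (auto simp: q_def)
   have "~ q ?t <= 1 / 2" "q ?t <= 3 / 4" "4 * q ?t - 2 = 2 * ?T - 1" using * 2 by auto
   thus ?thesis unfolding concat_apply[OF t] using F[OF tb] t concat_upd[OF t, of ?T f g] b * by simp
  next
   case 3
   hence *: "q ?t = (t 1 + 1) / 2" using b by (auto simp: q_def)
   hence "~ q ?t <= 1 / 2" "~ q ?t <= 3 / 4" "4 * q ?t - 3 = 2 * t 1 - 1" using 3 by auto
   thus ?thesis unfolding concat_apply[OF t] using F[OF tb] t by simp
  qed
 qed (simp_all add: spheroid_concat_def)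
 moreover have "(\<lambda>t\<in>cell ?N. ?F (t(1 := q (t 1))), \<lambda>t\<in>cell ?N. ?F (t(1 := t 1))):top_pi_rel ?N T p"
 proof (rule repar[OF concat_spheroid[OF f concat_spheroid[OF g h]]])
  show "continuous_on {0..1} q" unfolding q_def by (intro continuous_intros) auto
 qed (auto simp: q_def min_def)
 ultimately show ?thesis using repar_id[OF concat_spheroid[OF f concat_spheroid[OF g h]]] by simp
qed

text \<open>The common form of the unit and inverse laws: a concatenation ending in \<open>f\<close>
  is \<open>f\<close> run along \<open>w\<close>, and \<open>w\<close> may be exchanged for any
  \<open>u\<close> with the same ends.\<close>

lemma concat_repar:
 assumes f: "f:spheroids (Suc M) T p" and w: "continuous_on {0..1} w" "!!s. 0 <= s ==> s <= 1 ==> 0 <= w s & w s <= 1"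
   "!!s. 1 / 2 < s ==> w s = 2 * s - 1"
  and u: "continuous_on {0..1} u" "!!s. 0 <= s ==> s <= 1 ==> 0 <= u s & u s <= 1" "u 0 = w 0" "u 1 = 1" "w 0 = 0 | w 0 = 1"
  and l: "!!t. t:cell (Suc M) ==> t 1 <= 1 / 2 ==> l (t(1 := 2 * t 1)) = f (t(1 := w (t 1)))"
 shows "(spheroid_concat (Suc M) l f, \<lambda>t\<in>cell (Suc M). f (t(1 := u (t 1)))):top_pi_rel (Suc M) T p"
proof -
 have "spheroid_concat (Suc M) l f = (\<lambda>t\<in>cell (Suc M). f (t(1 := w (t 1))))"
  unfolding spheroid_concat_def by (rule restrict_ext) (use l w(3) in auto)
 thus ?thesis using repar[OF f w(1,2) u(1,2)] u w(3)[of 1] by simp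
qed

lemma spheroid_end:
 assumes "f:spheroids (Suc M) T p" "t:cell (Suc M)" "s = 0 | s = 1"
 shows "f (t(1 := s)) = p"
 using assms(1,3) cell_upd[OF assms(2), of s] unfolding spheroids_iff
 by (auto dest!: bspec[of _ _ "t(1 := s)"] bspec[of _ _ 1])

lemma concat_const:
 assumes f: "f:spheroids (Suc M) T p"
 shows "(spheroid_concat (Suc M) (\<lambda>t\<in>cell (Suc M). p) f, f):top_pi_rel (Suc M) T p"
proof -
 have l: "(\<lambda>t\<in>cell (Suc M). p) (t(1 := 2 * t 1)) = f (t(1 := max 0 (2 * t 1 - 1)))" if t: "t:cell (Suc M)" "t 1 <= 1 / 2" for t
 proof -
  have "max 0 (2 * t 1 - 1) = 0" using t(2) by simp
  thus ?thesis using spheroid_end[OF f t(1), of 0] cell_upd[OF t(1), of "2 * t 1"] cell_bounds[OF t(1), of 1] t(2) by simp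
 qed
 have "(spheroid_concat (Suc M) (\<lambda>t\<in>cell (Suc M). p) f, \<lambda>t\<in>cell (Suc M). f (t(1 := t 1))):top_pi_rel (Suc M) T p"
  by (rule concat_repar[OF f, of "%s. max 0 (2 * s - 1)" "%s. s", OF _ _ _ _ _ _ _ _ l]) (auto intro!: continuous_intros)
 thus ?thesis using repar_id[OF f] by simp
qed

lemma concat_inverse:
 assumes f: "f:spheroids (Suc M) T p"
 shows "(spheroid_concat (Suc M) (\<lambda>t\<in>cell (Suc M). f (t(1 := 1 - t 1))) f, \<lambda>t\<in>cell (Suc M). p):top_pi_rel (Suc M) T p"
proof -
 let ?l = "\<lambda>t\<in>cell (Suc M). f (t(1 := 1 - t 1))"
 have l: "?l (t(1 := 2 * t 1)) = f (t(1 := \<bar>1 - 2 * t 1\<bar>))" if t: "t:cell (Suc M)" "t 1 <= 1 / 2" for t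
  using cell_upd[OF t(1), of "2 * t 1"] cell_bounds[OF t(1), of 1] t(2) by simp
 have "(spheroid_concat (Suc M) ?l f, \<lambda>t\<in>cell (Suc M). f (t(1 := 1))):top_pi_rel (Suc M) T p"
  by (rule concat_repar[OF f, of "%s. \<bar>1 - 2 * s\<bar>" "%s. 1", OF _ _ _ _ _ _ _ _ l]) (auto intro!: continuous_intros)
 moreover have "(\<lambda>t\<in>cell (Suc M). f (t(1 := 1))) = (\<lambda>t\<in>cell (Suc M). p)"
  by (rule restrict_ext) (simp add: spheroid_end[OF f])
 ultimately show ?thesis by simp
qed

lemma inverse_spheroid:
 assumes f: "f:spheroids (Suc M) T p"
 shows "(\<lambda>t\<in>cell (Suc M). f (t(1 := 1 - t 1))):spheroids (Suc M) T p"
proof -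
 have "(\<lambda>t\<in>cell (Suc M). f (t(1 := 1 - t 1)), \<lambda>t\<in>cell (Suc M). f (t(1 := 1 - t 1))):top_pi_rel (Suc M) T p"
  by (rule repar[OF f, of "%s. 1 - s" "%s. 1 - s"]) (auto intro!: continuous_intros)
 thus ?thesis by (rule conjunct1[OF top_pi_relD])
qed

lemma group_top_pi:
 assumes p: "p:topspace T"
 shows "group (top_pi_group (Suc M) T p)"
proof (rule groupI)
 let ?G = "top_pi_group (Suc M) T p" and ?R = "top_pi_rel (Suc M) T p"
 let ?c = "carrier ?G"
 have c: "?c = top_pi (Suc M) T p" and o: "\<one>\<^bsub>?G\<^esub> = ?R `` {\<lambda>t\<in>cell (Suc M). p}" by (simp_all add: top_pi_group_def)
 note mult = top_mult[OF p]
 let ?s = "spheroids (Suc M) T p"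
 show "x \<otimes>\<^bsub>?G\<^esub> y:?c" if x: "x:?c" and y: "y:?c" for x y
 proof -
  obtain f where f: "f:?s" "x = ?R `` {f}" using top_pi_class[OF x[unfolded c]] by (elim exE conjE)
  obtain g where g: "g:?s" "y = ?R `` {g}" using top_pi_class[OF y[unfolded c]] by (elim exE conjE)
  show ?thesis unfolding f(2) g(2) mult[OF f(1) g(1)] c by (rule top_pi_classI[OF concat_spheroid[OF f(1) g(1)]])
 qed
 show "\<one>\<^bsub>?G\<^esub>:?c" unfolding c o by (rule top_pi_classI[OF const_spheroid[OF p]])
 show "x \<otimes>\<^bsub>?G\<^esub> y \<otimes>\<^bsub>?G\<^esub> z = x \<otimes>\<^bsub>?G\<^esub> (y \<otimes>\<^bsub>?G\<^esub> z)" if x: "x:?c" and y: "y:?c" and z: "z:?c" for x y z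
 proof -
  obtain f where f: "f:?s" "x = ?R `` {f}" using top_pi_class[OF x[unfolded c]] by (elim exE conjE)
  obtain g where g: "g:?s" "y = ?R `` {g}" using top_pi_class[OF y[unfolded c]] by (elim exE conjE)
  obtain h where h: "h:?s" "z = ?R `` {h}" using top_pi_class[OF z[unfolded c]] by (elim exE conjE)
  show ?thesis
   unfolding f(2) g(2) h(2) mult[OF f(1) g(1)] mult[OF g(1) h(1)] mult[OF concat_spheroid[OF f(1) g(1)] h(1)]
    mult[OF f(1) concat_spheroid[OF g(1) h(1)]]
   by (rule top_pi_class_eq[OF concat_assoc[OF f(1) g(1) h(1)]])
 qed
 show "\<one>\<^bsub>?G\<^esub> \<otimes>\<^bsub>?G\<^esub> x = x" if x: "x:?c" for x
 proof -
  obtain f where f: "f:?s" "x = ?R `` {f}" using top_pi_class[OF x[unfolded c]] by (elim exE conjE)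
  show ?thesis unfolding f(2) o mult[OF const_spheroid[OF p] f(1)] by (rule top_pi_class_eq[OF concat_const[OF f(1)]])
 qed
 show "EX y:carrier ?G. y \<otimes>\<^bsub>?G\<^esub> x = \<one>\<^bsub>?G\<^esub>" if x: "x:?c" for x
 proof -
  obtain f where f: "f:?s" "x = ?R `` {f}" using top_pi_class[OF x[unfolded c]] by (elim exE conjE)
  let ?i = "\<lambda>t\<in>cell (Suc M). f (t(1 := 1 - t 1))"
  note i = inverse_spheroid[OF f(1)]
  show ?thesis
  proof
   show "?R `` {?i}:?c" unfolding c by (rule top_pi_classI[OF i])
   show "?R `` {?i} \<otimes>\<^bsub>?G\<^esub> x = \<one>\<^bsub>?G\<^esub>"
    unfolding f(2) o mult[OF i f(1)] by (rule top_pi_class_eq[OF concat_inverse[OF f(1)]])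
  qed
 qed
qed

section \<open>The comparison map\<close>

text \<open>Being an involution that preserves the boundary, the swap is undone on spheroids by
  applying it again, so bijectivity is unaffected by it.\<close>

definition swp :: "nat => (nat => real) => nat => real" where
 "swp n t = (\<lambda>j\<in>{1..n}. t (if j = 1 then n else if j = n then 1 else j))"

lemma swp_index: "j:{1..n} ==> (if j = 1 then n else if j = n then 1 else j):{1..n}" for j n :: nat
 by auto

lemma swp_cell: "t:cell n ==> swp n t:cell n"
 unfolding swp_def
proof (rule cellI)
 fix j assume t: "t:cell n" and j: "j:{1..n}"
 let ?i = "if j = 1 then n else if j = n then 1 else j"
 show "0 <= t ?i & t ?i <= 1"
  by (rule cell_bounds[OF t swp_index[OF j]])
qed

lemma swp_swp: "t:cell n ==> swp n (swp n t) = t"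
 by (rule cell_eqI[OF swp_cell[OF swp_cell]]) (auto simp: swp_def)

lemma continuous_map_swp: "continuous_map (ct n) (ct n) (swp n)"
proof (rule cts_cellI)
 fix j assume j: "j:{1..n}"
 show "cts (ct n) (%t. swp n t j)"
  using cts_proj[OF swp_index[OF j]] by (simp add: swp_def)
qed (simp add: swp_cell)

lemma swp_bdry: "t:cell_bdry n ==> swp n t:cell_bdry n"
proof -
 assume "t:cell_bdry n"
 then obtain i where t: "t:cell n" and i: "i:{1..n}" "t i = 0 | t i = 1" by (auto simp: cell_bdry_iff)
 let ?j = "if i = 1 then n else if i = n then 1 else i"
 have e: "swp n t ?j = t i" using i(1) by (auto simp: swp_def)
 have "EX j:{1..n}. swp n t j = 0 | swp n t j = 1" by (rule bexI[of _ ?j], unfold e, rule i(2), rule swp_index[OF i(1)])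
 thus "swp n t:cell_bdry n" using swp_cell[OF t] by (simp only: cell_bdry_iff simp_thms)
qed

abbreviation "swpm n f == compose (cell n) f (swp n)"

lemma swpm_swpm: "f:extensional (cell n) ==> swpm n (swpm n f) = f"
 by (rule extensionalityI[of _ "cell n"]) (simp_all add: compose_eq swp_cell swp_swp)

lemma swpm_rel:
 assumes "(f, g):top_pi_rel n T p"
 shows "(swpm n f, swpm n g):top_pi_rel n T p"
proof -
 let ?P = "%h. ALL t:cell_bdry n. h t = p"
 have hm: "homotopic_with ?P (ct n) T f g" using assms by (simp add: top_pi_rel_iff)
 have "homotopic_with ?P (ct n) T (f \<circ> swp n) (g \<circ> swp n)"
  by (rule homotopic_with_compose_continuous_map_right[OF hm continuous_map_swp]) (simp add: swp_bdry)
 hence "homotopic_with ?P (ct n) T (swpm n f) (swpm n g)"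
  by (rule homotopic_with_eq) (auto simp: compose_eq cell_bdry_iff)
 thus ?thesis by (simp add: top_pi_rel_iff)
qed

lemma swpm_spheroid: "f:spheroids n T p ==> swpm n f:spheroids n T p"
 by (rule conjunct1[OF top_pi_relD[OF swpm_rel[OF top_pi_refl]]])

section \<open>The colimit relation and the iterated loop objects\<close>

lemma generated_equiv_invariant:
 assumes "(a, b):generated_equiv A r" "!!a b. a:A ==> b:A ==> r a b ==> f a = f b"
 shows "f a = f b"
proof -
 have "equivclp (%a b. a:A & b:A & r a b) a b" using assms(1) by (simp add: generated_equiv_def)
 thus ?thesis by (induction rule: equivclp_induct) (use assms(2) in metis)+
qed

lemma equiv_cs_pi0_rel: "equiv (SIGMA n:UNIV. cubes Z n) (cs_pi0_rel Z)"
 unfolding cs_pi0_rel_def by (rule equiv_generated_equiv)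

lemma cs_pi0_rel_act:
 assumes Z: "cubical_set Z" and f: "box_hom m n f" and s: "s:cubes Z n"
 shows "((m, act Z m n s f), (n, s)):cs_pi0_rel Z"
proof -
 have "(m, act Z m n s f):(SIGMA n:UNIV. cubes Z n)" "(n, s):(SIGMA n:UNIV. cubes Z n)"
  using act_in[OF Z f s] s by auto
 moreover have "EX m' n' f' x. box_hom m' n' f' & x:cubes Z n' & (m, act Z m n s f) = (m', act Z m' n' x f') & (n, s) = (n', x)"
  using f s by blast
 ultimately show ?thesis unfolding cs_pi0_rel_def generated_equiv_def by (auto intro!: r_into_equivclp)
qed

lemma cs_pi0_rel_sym: "(a, b):cs_pi0_rel Z ==> (b, a):cs_pi0_rel Z"
 using equiv_cs_pi0_rel[of Z] by (meson equiv_def symD)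

lemma cs_pi0_rel_trans: "(a, b):cs_pi0_rel Z ==> (b, c):cs_pi0_rel Z ==> (a, c):cs_pi0_rel Z"
 using equiv_cs_pi0_rel[of Z] by (meson equiv_def transD)

lemma cs_pi0_rel_refl: "s:cubes Z n ==> ((n, s), (n, s)):cs_pi0_rel Z"
 using equiv_cs_pi0_rel[of Z] by (auto simp: equiv_def refl_on_def)

lemma cs_pi0_rel_invariant:
 assumes "(a, b):cs_pi0_rel Z"
  and "!!m n p s. box_hom m n p ==> s:cubes Z n ==> f (m, act Z m n s p) = f (n, s)"
 shows "f a = f b"
 using assms(1) unfolding cs_pi0_rel_def by (rule generated_equiv_invariant) (use assms(2) in blast)

lemma lnk_cs_pi0_rel:
 assumes Z: "cubical_set Z" and s: "s:cubes Z 0" and l: "equivclp (lnk Z) s s'"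
 shows "((0, s), (0, s')):cs_pi0_rel Z"
proof -
 have f: "box_hom 0 1 (box_face 1 1 e)" for e by (rule face_hom) auto
 have step: "((0, u), (0, v)):cs_pi0_rel Z" if uv: "lnk Z u v" for u v
 proof -
  obtain H where H: "H:cubes Z 1" "act Z 0 1 H (box_face 1 1 False) = u" "act Z 0 1 H (box_face 1 1 True) = v"
   using uv unfolding lnk_def by (elim bexE conjE) simp
  show ?thesis
   using cs_pi0_rel_trans[OF cs_pi0_rel_act[OF Z f H(1), of False] cs_pi0_rel_sym[OF cs_pi0_rel_act[OF Z f H(1), of True]]] H(2,3)
   by simp
 qed
 show ?thesis
  using l
 proof (induction rule: equivclp_induct)
  case base
  show ?case by (rule cs_pi0_rel_refl[OF s])
 next
  case (step y z)
  thus ?case using \<open>!!v u. lnk Z u v ==> ((0, u), (0, v)) : cs_pi0_rel Z\<close> cs_pi0_rel_sym cs_pi0_rel_trans by metis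
 qed
qed

lemma cubical_set_LP: "cubical_set E ==> e:cubes E 0 ==> cubical_set (LP N E e)"
 by (induction N arbitrary: E e) (simp_all add: LP_0 LP_Suc loop_cset_cubical lbase_in)

lemma kanE_LP: "kanE E ==> e:cubes E 0 ==> kanE (LP N E e)"
 by (induction N arbitrary: E e) (simp_all add: LP_0 LP_Suc kanE_loop lbase_in kanE_cset)

lemma LP_map:
 assumes E: "cubical_set E" and F: "cubical_set F" and h: "cset_map E F h" and e: "e:cubes E 0"
 shows "cset_map (LP N E e) (LP N F (h 0 e)) (%n. h (N + n))"
proof -
 have he: "h 0 e:cubes F 0" by (rule cset_map_in[OF h e])
 have in': "h (N + n) s:cubes (LP N F (h 0 e)) n" if s: "s:cubes (LP N E e) n" for n s
  unfolding LP_cubes[OF F he]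
 proof (intro conjI allI impI)
  have s': "s:cubes E (N + n)" using s unfolding LP_cubes[OF E e] by simp
  show "h (N + n) s:cubes F (N + n)" by (rule cset_map_in[OF h s'])
  fix N' i c assume N: "N = Suc N'" and i: "i:{1..N}"
  let ?N = "N' + n"
  have "h ?N (fc E ?N s i c) = fc F ?N (h (N + n) s) i c"
   using cset_map_fc[OF h, of s ?N i c] s' i N by simp
  moreover have "fc E ?N s i c = konst E e ?N" using s N i unfolding LP_cubes[OF E e] by simp
  ultimately show "fc F ?N (h (N + n) s) i c = konst F (h 0 e) ?N" using konst_map[OF h e] by simp
 qed
 have "h (N + m) (act (LP N E e) m n s f) = act (LP N F (h 0 e)) m n (h (N + n) s) f"
  if "box_hom m n f" "s:cubes (LP N E e) n" for m n s f
  using LP_act[OF E e that(2,1)] LP_act[OF F he in'[OF that(2)] that(1)]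
   cset_map_act[OF h tens_hom[OF that(1), of N], of s] that(2) unfolding LP_cubes[OF E e] by simp
 thus ?thesis using in' by (auto simp: cset_map_def)
qed

lemma box_hom_0_ex: "EX d. box_hom 0 m d"
 using box_hom_embedding[of 0 "%j. j" m "%_. False"] by auto

text \<open>Some vertex of the \<open>m\<close>-cube; restriction to it represents the component of
  an \<open>m\<close>-cube by a \<open>0\<close>-cube.\<close>

definition vtx :: "nat => box_map" where
 "vtx m = (SOME d. box_hom 0 m d)"

lemma vtx: "box_hom 0 m (vtx m)"
 unfolding vtx_def using box_hom_0_ex by (rule someI_ex)

definition comparison :: "nat => 'a cset => 'a => (nat \<times> 'a) set => ((nat => real) => 'a real_pt) set" where
 "comparison n X x A = top_pi_rel n (realization X) (real_vertex X x) `` {swpm n (ch X n s) | s. (0, s):A}"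

locale based_kan =
 fixes X :: "'a cset" and x :: 'a
 assumes K: "kanE X" and x: "x:cubes X 0"
begin

abbreviation "RX == realization X"
abbreviation "px == real_vertex X x"

lemma X: "cubical_set X"
 by (rule kanE_cset[OF K])

lemma p: "px:topspace RX"
 by (rule real_vertex_in[OF x])

lemma chm: "cset_map X (SR X) (ch X)"
 using embed_ch[OF X] by (simp add: embed_def)

lemma LPc: "cubical_set (LP n X x)"
 by (rule cubical_set_LP[OF X x])

lemma ch_LP: "cset_map (LP n X x) (LP n (SR X) (\<lambda>t\<in>cell 0. px)) (%m. ch X (n + m))"
 using LP_map[OF X Sing_cset chm x, of n] by (simp add: ch_0)

lemma ch_spheroid: "s:cubes (LP n X x) 0 ==> ch X n s:spheroids n RX px"
 using cset_map_in[OF ch_LP, of s n 0] by (simp add: spheroids_LP[OF p])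

text \<open>For positive \<open>n\<close>, two pinches deform \<open>f\<close> to the map that
  \<open>surj_link\<close> compares with a cube of \<open>X\<close>. For \<open>n = 0\<close> a
  single homotopy \<open>h\<close> already joins the point to a vertex.\<close>

lemma surj_rel:
 assumes f: "f:spheroids n RX px"
 shows "EX s:cubes (LP n X x) 0. (f, ch X n s):top_pi_rel n RX px"
proof -
 let ?t = "top_pi_rel n RX px"
 let ?l = "(\<lambda>t\<in>cell n. rmap X pinch (f t)) t"
 obtain r h where L: "lifting X r h" by (rule lifting_ex[OF K])
 interpret lifting X r h by (rule L)
 show ?thesis
 proof (cases n)
  case 0
  have f0: "f:cubes (SR X) 0" using f 0 by (simp add: spheroids_iff)
  have u: "(%_. undefined):cell 0" by (simp add: cell_0)
  obtain m y t where y: "y:cubes X m" "t:cell m" "f (%_. undefined) = pt X m y t"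
   by (rule realization_cases[OF Sing_topspace[OF f0 u]])
  define g where "g = (\<lambda>v\<in>cell 0. t)"
  have g: "g:sc m 0" unfolding g_def by (rule const_Sing) (use y(2) in simp)
  have "ptm X m y 0 g = f"
   by (rule Sing_eqI[OF ptm_in[OF y(1) g] f0]) (use y(3) in \<open>simp add: ptm_def g_def cell_0 \<close>)
  hence "lnk (SR X) f (ch X 0 (r m y 0 g))"
   using h_face[OF y(1) g, of False] h_face[OF y(1) g, of True] h_in[OF y(1) g] by (intro lnkI[of "h m y 0 g"]) simp_all
  hence "(f, ch X 0 (r m y 0 g)):top_pi_rel 0 RX px"
   using lnk_top[OF p, of 0 f] by (simp add: LP_0)
  thus ?thesis using r_in[OF y(1) g] 0 by (auto simp: LP_0)
 next
  case (Suc M)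
  let ?F = "\<lambda>t\<in>cell n. rmap X pinch (rmap X pinch (f t))"
  let ?L = "LP (Suc M) (SR X) (\<lambda>t\<in>cell 0. px)"
  have 1: "(f, \<lambda>t\<in>cell n. rmap X pinch (f t)):?t" by (rule pinch_top_pi_rel[OF Xc x f])
  have "(\<lambda>t\<in>cell n. rmap X pinch (f t), \<lambda>t\<in>cell n. rmap X pinch ((\<lambda>t\<in>cell n. rmap X pinch (f t)) t)):?t"
   using top_pi_relD[OF 1] by (intro pinch_top_pi_rel[OF Xc x]) simp
  moreover have "(\<lambda>t\<in>cell n. rmap X pinch ((\<lambda>t\<in>cell n. rmap X pinch (f t)) t)) = ?F" by (rule restrict_ext) simp
  ultimately have 2: "(\<lambda>t\<in>cell n. rmap X pinch (f t), ?F):?t" by simp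
  have "f:cubes (LP (Suc M) (SR X) (ch X 0 x)) 0" using f Suc by (simp add: spheroids_LP[OF p] ch_0)
  from surj_link[OF x this] obtain s f' where s: "s:cubes (LP (Suc M) X x) 0"
   "lnk ?L f' ?F" "lnk ?L f' (ch X (Suc M) s)"
   unfolding ch_0 Suc by (elim bexE exE conjE)
  have 3: "(f', ?F):?t" and 4: "(f', ch X n s):?t"
   using lnk_top[OF p s(2)] lnk_top[OF p s(3)] Suc by simp_all
  have "(f, ch X n s):?t"
   using 1 2 3 4 top_pi_equiv[of n RX px] unfolding equiv_def by (meson symD transD)
  thus ?thesis using s(1) Suc by blast
 qed
qed

lemma inj_rel:
 assumes s: "s:cubes (LP n X x) 0" "s':cubes (LP n X x) 0" and r: "(ch X n s, ch X n s'):top_pi_rel n RX px"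
 shows "((0, s), (0, s')):cs_pi0_rel (LP n X x)"
proof -
 obtain r h where L: "lifting X r h" by (rule lifting_ex[OF K])
 interpret lifting X r h by (rule L)
 obtain H where H: "H:cubes (LP n (SR X) (\<lambda>t\<in>cell 0. px)) 1"
  "!!e. fc (SR X) n H (Suc n) e = (if e then ch X n s' else ch X n s)"
  by (rule htpyD[OF p assms(3)]) (rule that)
 have "equivclp (lnk (LP n X x)) ((%e. if e then s' else s) False) ((%e. if e then s' else s) True)"
  by (rule inj_link[OF x]) (use s H in \<open>auto simp: ch_0\<close>)
 thus ?thesis using lnk_cs_pi0_rel[OF LPc s(1)] by simp
qed

text \<open>An \<open>m\<close>-cube of the \<open>n\<close>-fold loop object is a family of
  spheroids parametrized by the topological \<open>m\<close>-cube; any two of its vertices are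
  joined by a straight segment.\<close>

lemma slices_rel:
 assumes s: "s:cubes (LP n X x) m" and d: "box_hom 0 m d" "box_hom 0 m d'"
 shows "(ch X n (act (LP n X x) 0 m s d), ch X n (act (LP n X x) 0 m s d')):top_pi_rel n RX px"
proof -
 let ?S = "Suc n"
 let ?n = "n + m"
 let ?L = "LP n X x"
 have s': "s:cubes X ?n" using s unfolding LP_cubes[OF X x] by simp
 let ?f = "ch X ?n s" and ?u = "(%_. undefined) :: nat => real"
 have f: "?f:cubes (SR X) ?n" by (rule ch_in[OF s'])
 have fb: "?f t = px" if "t:cell ?n" "i:{1..n}" "t i = 0 | t i = 1" for t i
  using cset_map_in[OF ch_LP s] that unfolding LP_Sing_iff[OF p] by blast
 have u: "?u:cell 0" by (simp add: cell_0)
 have v: "box_top 0 m b ?u:cell m" if "box_hom 0 m b" for b by (rule box_top_cell[OF that u])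
 let ?c = "%t. \<lambda>j\<in>{1..n + m}. if j <= n then t j
  else (1 - t ?S) * box_top 0 m d ?u (j - n) + t ?S * box_top 0 m d' ?u (j - n)"
 have cc: "continuous_map (ct ?S) (ct ?n) ?c"
 proof (rule cts_cellI)
  fix t assume "t:topspace (ct ?S)"
  hence t: "t:cell ?S" by simp
  show "?c t:cell ?n"
  proof (rule cellI)
   fix j assume j: "j:{1..n + m}"
   let ?i = "if j <= n then t j else (1 - t ?S) * box_top 0 m d ?u (j - n) + t ?S * box_top 0 m d' ?u (j - n)"
   show "0 <= ?i &
    ?i <= 1"
   proof (cases "j <= n")
    case True
    thus ?thesis using cell_bounds[OF t, of j] j by simp
   next
    case False
    hence j': "j - n:{1..m}" using j by (simp; arith)
    show ?thesis using False convex_01[of "t ?S" "box_top 0 m d ?u (j - n)" "box_top 0 m d' ?u (j - n)"]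
      cell_bounds[OF t, of ?S] cell_bounds[OF v[OF d(1)] j'] cell_bounds[OF v[OF d(2)] j'] by simp
   qed
  qed
 next
  fix j assume j: "j:{1..n + m}"
  have pl: "cts (ct ?S) (%t. t ?S)" by (rule cts_proj) simp
  show "cts (ct ?S) (%t. ?c t j)"
   using cts_proj[of j ?S] j pl
   by (cases "j <= n") (auto intro!: continuous_map_add continuous_map_real_mult continuous_map_diff)
 qed
 have sl: "ch X n (act ?L 0 m s b) t = ?f (\<lambda>j\<in>{1..n + m}. if j <= n then t j else box_top 0 m b ?u (j - n))"
  if b: "box_hom 0 m b" and t: "t:cell n" for b t
 proof -
  have t': "t:cell (n + 0)" using t by simp
  have dr: "drp n 0 t = ?u" by (auto simp: drp_def)
  have bt: "box_top n ?n (tens n 0 m b) t = (\<lambda>j\<in>{1..n + m}. if j <= n then t j else box_top 0 m b ?u (j - n))"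
   using box_top_tens[OF b t'] unfolding dr by simp
  have "ch X n (act ?L 0 m s b) = act (SR X) (n + 0) ?n ?f (tens n 0 m b)"
   using LP_act[OF X x s b] ch_act[OF X tens_hom[OF b, of n] s'] by simp
  thus ?thesis using t bt by (simp add: Sing_act_apply)
 qed
 have ex: "ch X n y:extensional (cell n)" for y by (simp add: ch_def)
 show ?thesis
 proof (rule htpyI)
  show "continuous_map (ct ?S) RX (%t. ?f (?c t))"
   using continuous_map_compose[OF cc, of RX ?f] f by (simp add: Sing_cubes o_def)
  show "?f (?c t) = px" if "t:cell ?S" "i:{1..n}" "t i = 0 | t i = 1" for t i
  proof (rule fb[OF _ that(2)])
   show "?c t:cell ?n" using continuous_map_image_subset_topspace[OF cc] that(1) by fastforce
  qed (use that in auto)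
  show "ch X n (act ?L 0 m s d) t = ?f (?c (snoc n t 0))" if t: "t:cell n" for t
  proof -
   have "?c (snoc n t 0) = (\<lambda>j\<in>{1..n + m}. if j <= n then t j else box_top 0 m d ?u (j - n))"
    by (rule restrict_ext) (auto simp: snoc_def)
   thus ?thesis by (simp only: sl[OF d(1) t])
  qed
  show "ch X n (act ?L 0 m s d') t = ?f (?c (snoc n t 1))" if t: "t:cell n" for t
  proof -
   have "?c (snoc n t 1) = (\<lambda>j\<in>{1..n + m}. if j <= n then t j else box_top 0 m d' ?u (j - n))"
    by (rule restrict_ext) (auto simp: snoc_def)
   thus ?thesis by (simp only: sl[OF d(2) t])
  qed
 qed (rule ex)+
qed

text \<open>Send an \<open>m\<close>-cube to the class of the spheroid at a chosen vertex. By
  \<open>slices_rel\<close> the vertex is immaterial, so this assignment is invariant under the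
  relation generating the colimit.\<close>

lemma rel_ch:
 assumes s: "s:cubes (LP n X x) 0" "s':cubes (LP n X x) 0" and r: "((0, s), (0, s')):cs_pi0_rel (LP n X x)"
 shows "(ch X n s, ch X n s'):top_pi_rel n RX px"
proof -
 let ?Z = "LP n X x"
 define t where "t q = (case q of (m, s) => top_pi_rel n RX px `` {ch X n (act ?Z 0 m s (vtx m))})" for q
 have "t (0, s) = t (0, s')"
  using r
 proof (rule cs_pi0_rel_invariant)
  fix m k f s assume f: "box_hom m k f" and s: "s:cubes ?Z k"
  have "act ?Z 0 m (act ?Z m k s f) (vtx m) = act ?Z 0 k s (vcomp 0 f (vtx m))"
   by (rule act_comp[OF LPc vtx f s])
  thus "t (m, act ?Z m k s f) = t (k, s)"
   using top_pi_class_eq[OF slices_rel[OF s box_hom.comp[OF vtx f] vtx]] by (simp add: t_def)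
 qed
 moreover have "t (0, s) = top_pi_rel n RX px `` {ch X n s}" if "s:cubes ?Z 0" for s
  using box_hom_0_unique[OF vtx box_hom.id] act_id[OF LPc that] by (simp add: t_def)
 ultimately have "top_pi_rel n RX px `` {ch X n s} = top_pi_rel n RX px `` {ch X n s'}" using s by simp
 thus ?thesis by (rule eq_equiv_class[OF _ top_pi_equiv ch_spheroid[OF s(2)]])
qed

lemma rel_iff:
 assumes s: "s:cubes (LP n X x) 0" "s':cubes (LP n X x) 0"
 shows "((0, s), (0, s')):cs_pi0_rel (LP n X x) \<longleftrightarrow> (swpm n (ch X n s), swpm n (ch X n s')):top_pi_rel n RX px"
proof
 assume "((0, s), (0, s')):cs_pi0_rel (LP n X x)"
 thus "(swpm n (ch X n s), swpm n (ch X n s')):top_pi_rel n RX px" by (rule swpm_rel[OF rel_ch[OF s]])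
next
 assume "(swpm n (ch X n s), swpm n (ch X n s')):top_pi_rel n RX px"
 hence "(swpm n (swpm n (ch X n s)), swpm n (swpm n (ch X n s'))):top_pi_rel n RX px" by (rule swpm_rel)
 thus "((0, s), (0, s')):cs_pi0_rel (LP n X x)"
  by (intro inj_rel[OF s]) (simp add: swpm_swpm ch_def)
qed

lemma cs_class:
 assumes "A:cs_pi0 (LP n X x)"
 obtains s where "s:cubes (LP n X x) 0" "A = cs_pi0_rel (LP n X x) `` {(0, s)}"
proof -
 obtain m s where s: "s:cubes (LP n X x) m" "A = cs_pi0_rel (LP n X x) `` {(m, s)}"
  using assms by (auto simp: cs_pi0_def quotient_def)
 show ?thesis
  by (rule that[OF act_in[OF LPc vtx s(1)]])
   (use equiv_class_eq[OF equiv_cs_pi0_rel cs_pi0_rel_act[OF LPc vtx s(1)]] s(2) in simp)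
qed

lemma cs_classI: "s:cubes (LP n X x) 0 ==> cs_pi0_rel (LP n X x) `` {(0, s)}:cs_pi0 (LP n X x)"
 by (auto simp: cs_pi0_def quotient_def)

lemma cs_rel_in: "((0, s), (0, s')):cs_pi0_rel (LP n X x) ==> s:cubes (LP n X x) 0 & s':cubes (LP n X x) 0"
 by (auto simp: cs_pi0_rel_def generated_equiv_def)

lemma comp_class:
 assumes s: "s:cubes (LP n X x) 0"
 shows "comparison n X x (cs_pi0_rel (LP n X x) `` {(0, s)}) = top_pi_rel n RX px `` {swpm n (ch X n s)}"
 unfolding comparison_def
proof (rule saturation_eq[OF top_pi_equiv swpm_spheroid[OF ch_spheroid[OF s]]])
 show "{swpm n (ch X n s') |s'. (0, s'):cs_pi0_rel (LP n X x) `` {(0, s)}} <= top_pi_rel n RX px `` {swpm n (ch X n s)}"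
  using rel_iff cs_rel_in by blast
 show "{swpm n (ch X n s') |s'. (0, s'):cs_pi0_rel (LP n X x) `` {(0, s)}} ~= {}"
  using cs_pi0_rel_refl[OF s] by blast
qed

lemma bij_comparison: "bij_betw (comparison n X x) (cs_pi0 (LP n X x)) (top_pi n RX px)"
proof (rule bij_betwI')
 let ?R = "cs_pi0_rel (LP n X x)"
 fix A B assume A: "A:cs_pi0 (LP n X x)" and B: "B:cs_pi0 (LP n X x)"
 obtain s where s: "s:cubes (LP n X x) 0" "A = ?R `` {(0, s)}" by (rule cs_class[OF A])
 obtain s' where s': "s':cubes (LP n X x) 0" "B = ?R `` {(0, s')}" by (rule cs_class[OF B])
 show "comparison n X x A = comparison n X x B \<longleftrightarrow> A = B"
 proof
  assume "comparison n X x A = comparison n X x B"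
  hence "top_pi_rel n RX px `` {swpm n (ch X n s)} = top_pi_rel n RX px `` {swpm n (ch X n s')}"
   using comp_class[OF s(1)] comp_class[OF s'(1)] s(2) s'(2) by simp
  hence "(swpm n (ch X n s), swpm n (ch X n s')):top_pi_rel n RX px"
   by (rule eq_equiv_class[OF _ top_pi_equiv swpm_spheroid[OF ch_spheroid[OF s'(1)]]])
  hence "((0, s), (0, s')):?R" using rel_iff[OF s(1) s'(1)] by simp
  thus "A = B" unfolding s(2) s'(2) by (rule equiv_class_eq[OF equiv_cs_pi0_rel])
 qed simp
next
 fix A assume A: "A:cs_pi0 (LP n X x)"
 obtain s where s: "s:cubes (LP n X x) 0" "A = cs_pi0_rel (LP n X x) `` {(0, s)}" by (rule cs_class[OF A])
 show "comparison n X x A:top_pi n RX px"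
  unfolding s(2) comp_class[OF s(1)] by (rule top_pi_classI[OF swpm_spheroid[OF ch_spheroid[OF s(1)]]])
next
 fix C assume C: "C:top_pi n RX px"
 obtain f where f: "f:spheroids n RX px" "C = top_pi_rel n RX px `` {f}" using top_pi_class[OF C] by (elim exE conjE)
 obtain s where s: "s:cubes (LP n X x) 0" "(swpm n f, ch X n s):top_pi_rel n RX px"
  using surj_rel[OF swpm_spheroid[OF f(1)]] by (elim bexE)
 have "f:extensional (cell n)" using f(1) by (simp add: spheroids_def)
 hence "(f, swpm n (ch X n s)):top_pi_rel n RX px" using swpm_rel[OF s(2)] by (simp add: swpm_swpm)
 hence "C = comparison n X x (cs_pi0_rel (LP n X x) `` {(0, s)})"
  unfolding comp_class[OF s(1)] f(2) by (rule top_pi_class_eq)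
 thus "EX A:cs_pi0 (LP n X x). C = comparison n X x A" using cs_classI[OF s(1)] by blast
qed

end

section \<open>Compatibility with the group structures\<close>

lemma snd_iter_loop: "cubical_set E ==> e:cubes E 0 ==> snd (iter_loop N (E, e)) = konst E e N"
proof (induction N arbitrary: E e)
 case 0
 thus ?case by (simp add: iter_loop_def konst_0)
next
 case (Suc N)
 thus ?case by (simp add: iter_loop_Suc loop_cset_cubical lbase_in konst_loop)
qed

lemma iter_loop_eq: "cubical_set E ==> e:cubes E 0 ==> iter_loop N (E, e) = (LP N E e, konst E e N)"
 by (simp add: LP_def snd_iter_loop prod_eq_iff)

lemma LP_Suc_loop: "cubical_set E ==> e:cubes E 0 ==> LP (Suc N) E e = loop_cset (LP N E e) (konst E e N)"
proof -
 assume "cubical_set E" "e:cubes E 0"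
 moreover have "iter_loop (Suc N) (E, e) = loop_pointed (iter_loop N (E, e))" by (simp add: iter_loop_def)
 ultimately show ?thesis unfolding LP_def[of "Suc N"] by (simp add: iter_loop_eq loop_pointed_def)
qed

lemma konst_LP:
 assumes E: "cubical_set E" and e: "e:cubes E 0"
 shows "konst E e N:cubes (LP N E e) 0"
 unfolding LP_cubes[OF E e] using konst_in[OF E e] fc_konst[OF E e] by auto

lemma lbase_LP:
 assumes E: "cubical_set E" and e: "e:cubes E 0"
 shows "lbase (LP N E e) (konst E e N) = konst E e (Suc N)"
 using LP_act[OF E e konst_LP[OF E e], of 1 "box_degen 1 1" N] degen_hom[of 1 1 0] tn_konst[OF E e, of 1 0 "box_degen 1 1" N]
 by simp

text \<open>The group axioms on the cubical side are not verified directly but pulled back along the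
  comparison bijection.\<close>

lemma group_transport:
 assumes H: "group H" and b: "bij_betw f (carrier G) (carrier H)"
  and m: "!!a b. a:carrier G ==> b:carrier G ==> a \<otimes>\<^bsub>G\<^esub> b:carrier G & f (a \<otimes>\<^bsub>G\<^esub> b) = f a \<otimes>\<^bsub>H\<^esub> f b"
  and o: "\<one>\<^bsub>G\<^esub>:carrier G" "f \<one>\<^bsub>G\<^esub> = \<one>\<^bsub>H\<^esub>"
 shows "group G" "f:iso G H"
proof -
 let ?c = "carrier G"
 interpret H: group H by (rule H)
 have inj: "a = b" if "a:?c" "b:?c" "f a = f b" for a b
  using b that by (meson bij_betw_def inj_onD)
 have c: "f a:carrier H" if "a:?c" for a using b that by (meson bij_betwE)
 show "group G"
 proof (rule groupI)
  fix x assume x: "x:?c"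
  show "\<one>\<^bsub>G\<^esub> \<otimes>\<^bsub>G\<^esub> x = x" by (rule inj) (use m[OF o(1) x] x o c[OF x] in simp_all)
  obtain y where y: "y:?c" "f y = inv\<^bsub>H\<^esub> f x"
   using b H.inv_closed[OF c[OF x]] unfolding bij_betw_def by (metis imageE)
  have "y \<otimes>\<^bsub>G\<^esub> x = \<one>\<^bsub>G\<^esub>" by (rule inj) (use m[OF y(1) x] o y(2) c[OF x] in simp_all)
  thus "EX y:carrier G. y \<otimes>\<^bsub>G\<^esub> x = \<one>\<^bsub>G\<^esub>" using y(1) by blast
 next
  fix x y z assume xyz: "x:?c" "y:?c" "z:?c"
  show "x \<otimes>\<^bsub>G\<^esub> y \<otimes>\<^bsub>G\<^esub> z = x \<otimes>\<^bsub>G\<^esub> (y \<otimes>\<^bsub>G\<^esub> z)"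
   by (rule inj) (use m xyz c in \<open>simp_all add: H.m_assoc\<close>)
 qed (use m o in auto)
 show "f:iso G H" using m c b by (auto simp: iso_def hom_def)
qed

context based_kan
begin

text \<open>In the square formed by the last two directions, the concatenation runs along the sides
  \<open>(1, False)\<close> and \<open>(2, True)\<close>, the product along
  \<open>(2, False)\<close>. A straight-line homotopy in the square connects these paths. Their end
  points differ, but the segment between them lies in the constant side
  \<open>(1, True)\<close>.\<close>

lemma square_rel:
 assumes s: "s:cubes (LP M X x) 2"
  and f: "f = fc X (Suc M) s (Suc M) False" "f:cubes (LP (Suc M) X x) 0"
  and g: "g = fc X (Suc M) s (Suc (Suc M)) True" "g:cubes (LP (Suc M) X x) 0"
  and k: "fc X (Suc M) s (Suc M) True = konst X x (Suc M)"
  and q: "q = fc X (Suc M) s (Suc (Suc M)) False"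
 shows "(spheroid_concat (Suc M) (swpm (Suc M) (ch X (Suc M) f)) (swpm (Suc M) (ch X (Suc M) g)), swpm (Suc M) (ch X (Suc M) q))
 :top_pi_rel (Suc M) RX px"
proof -
 let ?N = "Suc M" and ?S = "SR X"
 let ?c = "Suc ?N"
 let ?C = "cell ?N"
 let ?d = "ct ?c"
 let ?e = "{1..Suc ?N}"
 let ?f = "cell ?c"
 have s': "s:cubes X ?c" using s unfolding LP_cubes[OF X x] by simp
 let ?W = "ch X ?c s"
 have W: "?W:cubes ?S ?c" by (rule ch_in[OF s'])
 have i1: "1 <= Suc M" "Suc M <= ?c" "Suc M:?e" and i2: "1 <= ?c" "?c <= ?c" "?c:?e" by auto
 have fW: "ch X ?N (fc X ?N s i e) t = ?W (face_fun ?c i (of_bool e) t)"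
  if "1 <= i" "i <= ?c" "t:?C" for i e t
  using cset_map_fc[OF chm s' that(1,2), of e] Sing_fc[OF W that] by simp
 have Wb: "?W t = px" if "t:?f" "i:{1..M}" "t i = 0 | t i = 1" for t i
  using cset_map_in[OF ch_LP s] that unfolding LP_Sing_iff[OF p] by auto
 have Wf: "?W t = ch X ?N (fc X ?N s i e) (degen_fun ?c i t)" "degen_fun ?c i t:?C"
  if "t:?f" "t i = of_bool e" "i:?e" for t i e
 proof -
  show d: "degen_fun ?c i t:?C" by (rule degen_fun_cell[OF that(3,1)])
  show "?W t = ch X ?N (fc X ?N s i e) (degen_fun ?c i t)"
   using fW[OF _ _ d, of i e] that(3) face_degen_cell[OF that(3,1,2)] by simp
 qed
 have chk: "ch X ?N (konst X x ?N) t = px" if "t:?C" for t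
  using konst_map[OF chm x, of ?N] that by (simp add: ch_0 konst_Sing)
 have W1: "?W t = px" if "t:?f" "t ?N = 1" for t
  using Wf[of t ?N True] chk that k by simp
 have fb: "ch X ?N h t = px" if "h:cubes (LP ?N X x) 0" "t:?C" "t ?N = 0 | t ?N = 1" for h t
  by (rule conjunct2[OF ch_spheroid[OF that(1), unfolded spheroids_iff], rule_format, OF that(2) _ that(3)]) simp
 \<comment> \<open>The common starting corner of both paths is an end of \<open>f\<close>, hence the
   base point.\<close>
 have W0: "?W t = px" if "t:?f" "t ?N = 0" "t ?c = 0" for t
 proof -
  have "degen_fun ?c ?N t ?N = 0" using that(3) by (simp add: degen_fun_def)
  thus ?thesis using Wf[of t ?N False] that fb[OF f(2)] f(1) by simp
 qed
 \<comment> \<open>The swap puts the concatenation variable \<open>t 1\<close> into direction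
   \<open>?N\<close>; \<open>z\<close> replaces it by the point \<open>(a, b)\<close> of the
   square.\<close>
 define z where "z t a b = (\<lambda>j\<in>{1..Suc ?N}. if j < ?N then swp ?N t j else if j = ?N then a else b)" for t and a b :: real
 have z_cell: "z t a b:?f" if "t:?C" "0 <= a" "a <= 1" "0 <= b" "b <= 1" for t a b
  unfolding z_def
 proof (rule cellI)
  fix j assume j: "j:?e"
  let ?i = "if j < ?N then swp ?N t j else if j = ?N then a else b"
  show "0 <= ?i & ?i <= 1"
   using cell_bounds[OF swp_cell[OF that(1)], of j] j that by auto
 qed
 have upd: "swp ?N (t(1 := v)) j = (if j = ?N then v else swp ?N t j)" if "j:{1..?N}" for t v j
  by (auto simp: swp_def)
 have face: "face_fun ?c ?N a (swp ?N (t(1 := b))) = z t a b" "face_fun ?c ?c b (swp ?N (t(1 := a))) = z t a b"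
  if "t:?C" for t a b
 proof -
  show "face_fun ?c ?N a (swp ?N (t(1 := b))) = z t a b"
   unfolding face_fun_def z_def
  proof (rule restrict_ext)
   fix j assume j: "j:?e"
   consider "j < ?N" | "j = ?N" | "j = ?c" using j by (simp; arith)
   thus "(if j < ?N then swp ?N (t(1 := b)) j else if j = ?N then a else swp ?N (t(1 := b)) (j - 1)) =
     (if j < ?N then swp ?N t j else if j = ?N then a else b)"
    using j by cases (simp_all add: upd)
  qed
  show "face_fun ?c ?c b (swp ?N (t(1 := a))) = z t a b"
   unfolding face_fun_def z_def by (rule restrict_ext) (auto simp: upd)
 qed
 \<comment> \<open>At parameter \<open>0\<close> the point \<open>(?a, ?b)\<close> traverses one
   side of the square on each half of \<open>t 1\<close>; at parameter \<open>1\<close> it is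
   \<open>(t 1, 0)\<close>.\<close>
 let ?a = "%t. (1 - t ?c) * max 0 (2 * t 1 - 1) + t ?c * t 1"
 let ?b = "%t. (1 - t ?c) * min 1 (2 * t 1) + t ?c * 0"
 let ?r = "%t. restrict t {1..?N}"
 have ab: "0 <= ?a t & ?a t <= 1" "0 <= ?b t & ?b t <= 1" if t: "t:?f" for t :: "nat => real"
 proof -
  have b: "0 <= t 1" "t 1 <= 1" "0 <= t ?c" "t ?c <= 1"
   using cell_bounds[OF t, of 1] cell_bounds[OF t, of ?c] by auto
  show "0 <= ?a t & ?a t <= 1" by (rule convex_01) (use b in auto)
  show "0 <= ?b t & ?b t <= 1" by (rule convex_01) (use b in auto)
 qed
 have zc: "continuous_map ?d ?d (%t. z (?r t) (?a t) (?b t))"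
 proof (rule cts_cellI)
  fix t assume "t:topspace ?d"
  hence t: "t:?f" by simp
  show "z (?r t) (?a t) (?b t):?f" by (rule z_cell[OF restrict_cell[OF t]]) (use ab[OF t] in auto)
 next
  fix j assume j: "j:?e"
  have p1: "cts ?d (%t. t 1)"
   and pN: "cts ?d (%t. t ?c)"
   by (rule cts_proj, simp)+
  consider "j < ?N" | "j = ?N" | "j = ?c" using j by (simp; arith)
  thus "cts ?d (%t. z (?r t) (?a t) (?b t) j)"
  proof cases
   case 1
   hence jN: "j:{1..?N}" using j by auto
   let ?t = "if j = 1 then ?N else if j = ?N then 1 else j"
   have "?t:{1..?N}" by (rule swp_index[OF jN])
   hence "cts ?d (%t. t ?t)"
    by (intro cts_proj) auto
   thus ?thesis
    using 1 j by (simp add: z_def swp_def)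
  next
   case 2
   have "cts ?d ?a"
    using p1 pN by (intro continuous_map_add continuous_map_real_mult continuous_map_diff continuous_map_real_max) auto
   thus ?thesis using 2 by (simp add: z_def)
  next
   case 3
   have "cts ?d ?b"
    using p1 pN by (intro continuous_map_add continuous_map_real_mult continuous_map_diff continuous_map_real_min) auto
   thus ?thesis using 3 by (simp add: z_def)
  qed
 qed
 have snoc_r: "?r (snoc ?N t u) = t" "snoc ?N t u 1 = t 1" "snoc ?N t u ?c = u" if "t:?C" for t u
  using that by (auto simp: snoc_def cell_iff)
 have G: "swpm ?N (ch X ?N h) t = ch X ?N h (swp ?N t)" if "t:?C" for h t using that by (simp add: compose_eq)
 show ?thesis
 proof (rule htpyI)
  show "continuous_map ?d RX (%t. ?W (z (?r t) (?a t) (?b t)))"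
   using continuous_map_compose[OF zc, of RX ?W] W by (simp add: Sing_cubes o_def)
  show "?W (z (?r t) (?a t) (?b t)) = px" if t: "t:?f" and i: "i:{1..?N}" "t i = 0 | t i = 1" for t i
  proof -
   have zc: "z (?r t) (?a t) (?b t):?f" by (rule z_cell[OF restrict_cell[OF t]]) (use ab[OF t] in auto)
   consider "i = 1" "t 1 = 0" | "i = 1" "t 1 = 1" | "i ~= 1" using i(2) by auto
   thus ?thesis
   proof cases
    case 1
    show ?thesis by (rule W0[OF zc]) (simp_all add: z_def 1)
   next
    case 2
    show ?thesis by (rule W1[OF zc]) (simp add: z_def 2)
   next
    case 3
    let ?j = "if i = ?N then 1 else i"
    have j: "?j:{1..M}" using 3 i(1) by auto
    have "z (?r t) (?a t) (?b t) ?j = t i" using 3 i(1) by (auto simp: z_def swp_def)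
    thus ?thesis using Wb[OF zc j] i(2) by simp
   qed
  qed
  show "swpm ?N (ch X ?N q) t = ?W (z (?r (snoc ?N t 1)) (?a (snoc ?N t 1)) (?b (snoc ?N t 1)))" if t: "t:?C" for t
   unfolding snoc_r[OF t] G[OF t] q fW[OF i2(1,2) swp_cell[OF t]]
   using face(2)[OF t, of 0 "t 1"] by simp
  show "spheroid_concat ?N (swpm ?N (ch X ?N f)) (swpm ?N (ch X ?N g)) t = ?W (z (?r (snoc ?N t 0)) (?a (snoc ?N t 0)) (?b (snoc ?N t 0)))"
   if t: "t:?C" for t
  proof -
   let ?T = "2 * t 1 - 1"
   have b: "0 <= t 1" "t 1 <= 1" using cell_bounds[OF t, of 1] by auto
   show ?thesis
   proof (cases "t 1 <= 1 / 2")
    case True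
    have u: "t(1 := 2 * t 1):?C" by (rule cell_upd[OF t]) (use b True in auto)
    have "max 0 ?T = 0" "min 1 (2 * t 1) = 2 * t 1" using True by auto
    thus ?thesis
     unfolding snoc_r[OF t] concat_apply[OF t] if_P[OF True] G[OF u] f(1) fW[OF i1(1,2) swp_cell[OF u]]
     using face(1)[OF t, of 0 "2 * t 1"] by simp
   next
    case False
    have u: "t(1 := 2 * t 1 - 1):?C" by (rule cell_upd[OF t]) (use b False in auto)
    have "max 0 ?T = ?T" "min 1 (2 * t 1) = 1" using False by auto
    thus ?thesis
     unfolding snoc_r[OF t] concat_apply[OF t] if_not_P[OF False] G[OF u] g(1) fW[OF i2(1,2) swp_cell[OF u]]
     using face(2)[OF t, of 1 ?T] by simp
   qed
  qed
 qed (simp_all add: spheroid_concat_def)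
qed

lemma LP_face2:
 assumes s: "s:cubes (LP M X x) 2" and i: "i:{1, 2}"
 shows "act (LP M X x) 1 2 s (box_face 2 i e) = fc X (Suc M) s (M + i) e"
proof -
 have h: "box_hom 1 2 (box_face 2 i e)" using i by (intro face_hom) auto
 have "1 <= i" "i <= Suc 1" using i by auto
 hence "tn X M 1 (Suc 1) s (box_face (Suc 1) i e) = fc X (M + 1) s (M + i) e" by (rule tn_face)
 thus ?thesis using LP_act[OF X x s h] by simp
qed

text \<open>The product collects the composites of all admissible squares. Each of them corresponds
  to the concatenation of the two spheroids, which is well defined up to homotopy, so by
  \<open>rel_iff\<close> they form one class; a Kan filler supplies at least one square.\<close>

lemma cs_product:
 fixes M :: nat
 defines "R == cs_pi0_rel (LP (Suc M) X x)"
 assumes f: "f:cubes (LP (Suc M) X x) 0" and g: "g:cubes (LP (Suc M) X x) 0"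
 obtains q where "q:cubes (LP (Suc M) X x) 0"
  "R `` {(0, f)} \<otimes>\<^bsub>cs_pi_group (Suc M) X x\<^esub> R `` {(0, g)} = R `` {(0, q)}"
  "(spheroid_concat (Suc M) (swpm (Suc M) (ch X (Suc M) f)) (swpm (Suc M) (ch X (Suc M) g)), swpm (Suc M) (ch X (Suc M) q))
  :top_pi_rel (Suc M) RX px"
proof -
 let ?N = "Suc M" and ?Z = "LP M X x" and ?z = "konst X x M" and ?L = "LP (Suc M) X x"
 let ?b = "box_face 2 2 False"
 let ?t = "top_pi_rel ?N RX px"
 let ?T = "box_face 2 2 True"
 let ?c = "cubes ?L 0"
 have L: "?L = loop_cset ?Z ?z" by (rule LP_Suc_loop[OF X x])
 note Zc = cubical_set_LP[OF X x, of M] and z = konst_LP[OF X x, of M]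
 let ?k = "konst X x ?N"
 have lb: "lbase ?Z ?z = ?k" by (rule lbase_LP[OF X x])
 have z0: "konst ?Z ?z 0 = ?z" by (rule konst_0[OF Zc z])
 let ?P = "%s A B. s:cubes ?Z 2 & (0, act ?Z 1 2 s (box_face 2 1 False)):A & (0, act ?Z 1 2 s ?T):B &
  act ?Z 1 2 s (box_face 2 1 True) = ?k"
 define Q where "Q = {(0::nat, act ?Z 1 2 s ?b) | s. ?P s (R `` {(0, f)}) (R `` {(0, g)})}"
 have mult: "R `` {(0, f)} \<otimes>\<^bsub>cs_pi_group (Suc M) X x\<^esub> R `` {(0, g)} = R `` Q"
  unfolding Q_def by (simp add: cs_pi_group_def iter_loop_eq[OF X x] cs_pi1_group_def L[symmetric] R_def lb)
 have inL: "h:cubes ?L 0 \<longleftrightarrow> h:cubes ?Z 1 & (ALL e. fc ?Z 0 h 1 e = ?z)" for h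
  unfolding L by (simp add: loop_cubes z0)
 have prod: "act ?Z 1 2 s ?b:cubes ?L 0 &
  (spheroid_concat ?N (swpm ?N (ch X ?N f)) (swpm ?N (ch X ?N g)), swpm ?N (ch X ?N (act ?Z 1 2 s ?b))):?t"
  if P: "?P s (R `` {(0, f)}) (R `` {(0, g)})" for s
 proof -
  let ?f = "act ?Z 1 2 s (box_face 2 1 False)" and ?g = "act ?Z 1 2 s ?T" and ?q = "act ?Z 1 2 s ?b"
  have s: "s:cubes ?Z (Suc (Suc 0))" using P by simp
  have rf: "((0, f), (0, ?f)):R" and rg: "((0, g), (0, ?g)):R" and k: "act ?Z 1 2 s (box_face 2 1 True) = ?k"
   using P by blast+
  have fl: "?f:?c" "?g:?c" using cs_rel_in[OF rf[unfolded R_def]] cs_rel_in[OF rg[unfolded R_def]] by simp_all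
  have qz: "?q:cubes ?Z 1" using fc_in[OF Zc s, of 2 False] by simp
  have "fc ?Z 0 ?q 1 e = fc ?Z 0 (act ?Z 1 2 s (box_face 2 1 e)) 1 False" for e
   using fc_fc[OF Zc s, of 1 2 False e] by simp
  hence "fc ?Z 0 ?q 1 e = ?z" for e
   using fl(1)[unfolded inL] k konst_LP[OF X x, of ?N, unfolded inL] by (cases e) simp_all
  hence ql: "?q:?c" using qz unfolding inL by blast
  have s2: "s:cubes ?Z 2" using P by blast
  have F: "act ?Z 1 2 s (box_face 2 1 e) = fc X ?N s ?N e" "act ?Z 1 2 s (box_face 2 2 e) = fc X ?N s (Suc ?N) e" for e
   using LP_face2[OF s2, of 1 e] LP_face2[OF s2, of 2 e] by simp_all
  have "(spheroid_concat ?N (swpm ?N (ch X ?N ?f)) (swpm ?N (ch X ?N ?g)), swpm ?N (ch X ?N ?q)):?t"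
   by (rule square_rel[OF s2 F(1) fl(1) F(2) fl(2) _ F(2)]) (use k F(1)[of True] in simp)
  moreover have "(spheroid_concat ?N (swpm ?N (ch X ?N f)) (swpm ?N (ch X ?N g)), spheroid_concat ?N (swpm ?N (ch X ?N ?f)) (swpm ?N (ch X ?N ?g))):?t"
   by (rule concat_rel[OF p]) (use rel_iff[OF f fl(1)] rel_iff[OF g fl(2)] rf rg in \<open>simp_all add: R_def\<close>)
  ultimately show ?thesis using ql top_pi_equiv[of ?N RX px] unfolding equiv_def by (meson transD)
 qed
 have "EX s. ?P s (R `` {(0, f)}) (R `` {(0, g)})"
 proof -
  define v where "v j d = (if j = (1::nat) then (if d then konst X x ?N else f) else g)" for j d
  have kL: "?k:?c" by (rule konst_LP[OF X x])
  have vL: "v j d:?c" for j d using kL f g by (simp add: v_def)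
  have i: "2:{1..Suc 1}" by simp
  obtain s where s: "s:cubes ?Z (Suc 1)" "!!j d. j:{1..Suc 1} ==> (j, d) ~= (2, False) ==> fc ?Z 1 s j d = v j d"
  proof (rule kanE_fill[OF kanE_LP[OF K x, of M] i, of False v])
   show "v j d:cubes ?Z 1" for j d using vL[of j d] unfolding inL by blast
   fix n' j l d u assume n': "1 = Suc n'" and jl: "1 <= j" "j < l" "l <= Suc 1"
   hence "n' = 0" "j = 1" "l = 2" by auto
   thus "fc ?Z n' (v l u) j d = fc ?Z n' (v j d) (l - 1) u"
    using vL[of l u] vL[of j d] unfolding inL by simp
  qed (rule that)
  have "act ?Z 1 2 s (box_face 2 1 e) = (if e then konst X x ?N else f)" "act ?Z 1 2 s ?T = g" for e
   using s(2)[of 1 e] s(2)[of 2 True] by (simp_all add: v_def)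
  thus ?thesis
   using s(1) cs_pi0_rel_refl[OF f] cs_pi0_rel_refl[OF g] by (intro exI[of _ s]) (simp add: R_def)
 qed
 then obtain s where P: "?P s (R `` {(0, f)}) (R `` {(0, g)})" ..
 let ?q = "act ?Z 1 2 s ?b"
 note pq = prod[OF P]
 have "R `` Q = R `` {(0, ?q)}"
 proof (rule saturation_eq[OF equiv_cs_pi0_rel[of ?L, folded R_def]])
  show "(0, ?q):(SIGMA n:UNIV. cubes ?L n)" using pq by simp
  show "Q ~= {}" unfolding Q_def using P by blast
  show "Q <= R `` {(0, ?q)}"
  proof
   fix y assume "y:Q"
   then obtain s' where y: "y = (0, act ?Z 1 2 s' ?b)" and P': "?P s' (R `` {(0, f)}) (R `` {(0, g)})"
    unfolding Q_def by blast
   have "(swpm ?N (ch X ?N ?q), swpm ?N (ch X ?N (act ?Z 1 2 s' ?b))):?t"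
    using pq prod[OF P'] top_pi_equiv[of ?N RX px] unfolding equiv_def by (meson symD transD)
   thus "y:R `` {(0, ?q)}" using rel_iff[of ?q ?N] pq prod[OF P'] unfolding y R_def by blast
  qed
 qed
 thus ?thesis using that[of ?q] pq mult by simp
qed

lemma comparison_group:
 "group (cs_pi_group (Suc M) X x)" "comparison (Suc M) X x:iso (cs_pi_group (Suc M) X x) (top_pi_group (Suc M) RX px)"
proof -
 let ?N = "Suc M" and ?G = "cs_pi_group (Suc M) X x" and ?H = "top_pi_group (Suc M) RX px" and ?R = "cs_pi0_rel (LP (Suc M) X x)"
 let ?c = "cubes (LP ?N X x) 0"
 let ?C = "carrier ?G"
 have c: "?C = cs_pi0 (LP ?N X x)" and o: "\<one>\<^bsub>?G\<^esub> = ?R `` {(0, konst X x ?N)}"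
  using lbase_LP[OF X x, of M] LP_Suc_loop[OF X x, of M]
  by (simp_all add: cs_pi_group_def iter_loop_eq[OF X x] cs_pi1_group_def)
 have ch: "carrier ?H = top_pi ?N RX px" and oh: "\<one>\<^bsub>?H\<^esub> = top_pi_rel ?N RX px `` {\<lambda>t\<in>cell ?N. px}"
  by (simp_all add: top_pi_group_def)
 have kL: "konst X x ?N:?c" by (rule konst_LP[OF X x])
 have m: "A \<otimes>\<^bsub>?G\<^esub> B:?C & comparison ?N X x (A \<otimes>\<^bsub>?G\<^esub> B) = comparison ?N X x A \<otimes>\<^bsub>?H\<^esub> comparison ?N X x B"
  if A: "A:?C" and B: "B:?C" for A B
 proof -
  let ?A = "A \<otimes>\<^bsub>?G\<^esub> B"
  obtain f where f: "f:?c" "A = ?R `` {(0, f)}" by (rule cs_class[OF A[unfolded c]])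
  obtain g where g: "g:?c" "B = ?R `` {(0, g)}" by (rule cs_class[OF B[unfolded c]])
  obtain q where q: "q:?c" "?A = ?R `` {(0, q)}"
   "(spheroid_concat ?N (swpm ?N (ch X ?N f)) (swpm ?N (ch X ?N g)), swpm ?N (ch X ?N q)):top_pi_rel ?N RX px"
   unfolding f(2) g(2) by (rule cs_product[OF f(1) g(1)])
  have "comparison ?N X x ?A = top_pi_rel ?N RX px `` {swpm ?N (ch X ?N q)}" unfolding q(2) by (rule comp_class[OF q(1)])
  also have "\<dots> = top_pi_rel ?N RX px `` {spheroid_concat ?N (swpm ?N (ch X ?N f)) (swpm ?N (ch X ?N g))}"
   using top_pi_class_eq[OF q(3)] by simp
  also have "\<dots> = comparison ?N X x A \<otimes>\<^bsub>?H\<^esub> comparison ?N X x B"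
   unfolding f(2) g(2) comp_class[OF f(1)] comp_class[OF g(1)]
   using top_mult[OF p swpm_spheroid[OF ch_spheroid[OF f(1)]] swpm_spheroid[OF ch_spheroid[OF g(1)]]] by simp
  finally show ?thesis using cs_classI[OF q(1)] unfolding c q(2) by simp
 qed
 have "swpm ?N (ch X ?N (konst X x ?N)) = (\<lambda>t\<in>cell ?N. px)"
  unfolding compose_def
  by (rule restrict_ext) (use konst_map[OF chm x, of ?N] swp_cell in \<open>simp add: ch_0 konst_Sing\<close>)
 hence co: "comparison ?N X x \<one>\<^bsub>?G\<^esub> = \<one>\<^bsub>?H\<^esub>" unfolding o oh comp_class[OF kL] by simp
 have oc: "\<one>\<^bsub>?G\<^esub>:?C" unfolding c o by (rule cs_classI[OF kL])
 have b: "bij_betw (comparison ?N X x) ?C (carrier ?H)" unfolding c ch by (rule bij_comparison)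
 show "group ?G" "comparison ?N X x:iso ?G ?H" by (rule group_transport[OF group_top_pi[OF p] b m oc co]; assumption)+
qed

end

section \<open>Naturality\<close>

lemma real_map_pt:
 assumes Y: "cubical_set Y" and F: "cset_map X Y F" and y: "y:cubes X n" and t: "t:cell n"
 shows "real_map X Y F (pt X n y t) = pt Y n (F n y) t"
proof -
 let ?F = "%((n, x), t). ((n, F n x), t :: nat => real)"
 let ?t = "topspace (pre_real X)"
 have F_in: "?F a:topspace (pre_real Y)" if "a:?t" for a
  using that cset_map_in[OF F] by (auto simp: top_pre_real)
 have a: "((n, y), t):?t" using y t by (simp add: top_pre_real)
 have "real_rel Y `` (?F ` (real_rel X `` {((n, y), t)})) = real_rel Y `` {?F ((n, y), t)}"
 proof (rule saturation_eq[OF equiv_real_rel F_in[OF a]])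
  show "?F ` (real_rel X `` {((n, y), t)}) ~= {}" using equiv_real_rel[of X] a by (auto simp: equiv_def refl_on_def)
  show "?F ` (real_rel X `` {((n, y), t)}) <= real_rel Y `` {?F ((n, y), t)}"
  proof
   fix c assume "c:?F ` (real_rel X `` {((n, y), t)})"
   then obtain b where b: "c = ?F b" "(((n, y), t), b):real_rel X" by blast
   have "b:?t" using b(2) by (auto simp: real_rel_def generated_equiv_def)
   note bin = F_in[OF this]
   have "real_rel Y `` {?F ((n, y), t)} = real_rel Y `` {?F b}"
   proof (rule real_rel_invariant[OF b(2), of "%a. real_rel Y `` {?F a}"])
    fix m k f z and u :: "nat => real" assume "box_hom m k f" "z:cubes X k" "u:cell m"
    thus "real_rel Y `` {?F ((m, act X m k z f), u)} = real_rel Y `` {?F ((k, z), box_top m k f u)}"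
     using pt_act[OF Y, of m k f "F k z" u] cset_map_in[OF F, of z k] cset_map_act[OF F, of m k f z] by (simp add: pt_def)
   qed
   thus "c:real_rel Y `` {?F ((n, y), t)}" using eq_equiv_class[OF _ equiv_real_rel bin] b(1) by blast
  qed
 qed
 thus ?thesis by (simp add: real_map_def pt_def)
qed

lemma continuous_map_real_map:
 assumes Y: "cubical_set Y" and F: "cset_map X Y F"
 shows "continuous_map (realization X) (realization Y) (real_map X Y F)"
proof (rule cts_from_realization)
 fix n y assume y: "y:cubes X n"
 show "continuous_map (ct n) (realization Y) (%t. real_map X Y F (pt X n y t))"
  by (rule continuous_map_eq[OF cts_pt[OF cset_map_in[OF F y]]]) (simp add: real_map_pt[OF Y F y])
qed

lemma loop_map_iter: "(loop_map ^^ n) F k = F (n + k)"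
 by (induction n arbitrary: k) (simp_all add: loop_map_def)

text \<open>Both induced maps are saturations, hence determined by a single representing
  \<open>0\<close>-cube, and on its characteristic map the claim is
  \<open>real_map_pt\<close>.\<close>

lemma comparison_natural:
 fixes X :: "'a cset" and Y :: "'b cset"
 assumes X: "based_kan X x" and Y: "based_kan Y y" and F: "cset_map X Y F" "F 0 x = y"
  and A: "A:cs_pi0 (LP n X x)"
 shows "comparison n Y y (cs_pi_map n Y y F A) =
  top_pi_map n (realization Y) (real_vertex Y y) (real_map X Y F) (comparison n X x A)"
proof -
 let ?r = "realization Y"
 let ?n = "cell n"
 let ?A = "%h. ALL t:cell_bdry n. h t = real_vertex Y y"
 let ?L = "LP n X x"
 let ?X = "realization X"
 let ?S = "SIGMA n':UNIV. cubes (LP n Y y) n'"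
 let ?x = "real_vertex X x"
 let ?Y = "real_vertex Y y"
 interpret X: based_kan X x by (rule X)
 interpret Y: based_kan Y y by (rule Y)
 let ?RX = "cs_pi0_rel ?L" and ?RY = "cs_pi0_rel (LP n Y y)" and ?h = "real_map X Y F"
 let ?TX = "top_pi_rel n ?X ?x" and ?TY = "top_pi_rel n ?r ?Y"
 obtain s where s: "s:cubes ?L 0" "A = ?RX `` {(0, s)}" by (rule X.cs_class[OF A])
 have L: "cset_map ?L (LP n Y y) (%m. F (n + m))" using LP_map[OF X.X Y.X F(1) X.x, of n] F(2) by simp
 have Fs: "F n s:cubes (LP n Y y) 0" using cset_map_in[OF L s(1)] by simp
 let ?f = "%(k, u). (k, F (n + k) u)"
 have "?RY `` (?f ` A) = ?RY `` {(0, F n s)}"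
 proof (rule saturation_eq[OF equiv_cs_pi0_rel])
  show "(0, F n s):?S" using Fs by simp
  show "?f ` A ~= {}" unfolding s(2) using cs_pi0_rel_refl[OF s(1)] by blast
  show "?f ` A <= ?RY `` {(0, F n s)}"
  proof
   fix c assume "c:?f ` A"
   then obtain b where b: "c = ?f b" "((0, s), b):?RX" unfolding s(2) by blast
   have "b:(SIGMA n':UNIV. cubes ?L n')" using b(2) by (auto simp: cs_pi0_rel_def generated_equiv_def)
   hence bin: "?f b:?S" using cset_map_in[OF L] by auto
   have "?RY `` {?f (0, s)} = ?RY `` {?f b}"
   proof (rule cs_pi0_rel_invariant[OF b(2), of "%a. ?RY `` {?f a}"])
    fix m k p u assume p: "box_hom m k p" and u: "u:cubes ?L k"
    show "?RY `` {?f (m, act ?L m k u p)} = ?RY `` {?f (k, u)}"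
     using equiv_class_eq[OF equiv_cs_pi0_rel cs_pi0_rel_act[OF Y.LPc p cset_map_in[OF L u]]] cset_map_act[OF L p u] by simp
   qed
   thus "c:?RY `` {(0, F n s)}" using eq_equiv_class[OF _ equiv_cs_pi0_rel bin] b(1) by simp
  qed
 qed
 hence 1: "comparison n Y y (cs_pi_map n Y y F A) = ?TY `` {swpm n (ch Y n (F n s))}"
  using Y.comp_class[OF Fs] by (simp add: cs_pi_map_def loop_map_iter LP_def)
 have hc: "continuous_map ?X ?r ?h" by (rule continuous_map_real_map[OF Y.X F(1)])
 have hp: "?h ?x = ?Y"
  using real_map_pt[OF Y.X F(1) X.x, of "%_. undefined"] F(2) by (simp add: real_vertex_def pt_def cell_0)
 have hs: "(compose ?n ?h f, compose ?n ?h g):?TY" if fg: "(f, g):?TX" for f g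
 proof -
  have hm: "homotopic_with (%h. ALL t:cell_bdry n. h t = real_vertex X x) (ct n) ?X f g"
   using fg by (simp add: top_pi_rel_iff)
  have "homotopic_with ?A (ct n) ?r (?h \<circ> f) (?h \<circ> g)"
   by (rule homotopic_with_compose_continuous_map_left[OF hm hc]) (simp add: hp)
  hence "homotopic_with ?A (ct n) ?r
    (compose ?n ?h f) (compose ?n ?h g)"
   by (rule homotopic_with_eq) (auto simp: compose_eq cell_bdry_iff)
  thus ?thesis by (simp add: top_pi_rel_iff)
 qed
 let ?G = "swpm n (ch X n s)"
 let ?c = "(%f. compose ?n ?h f) ` (?TX `` {?G})"
 have G: "?G:spheroids n ?X ?x" by (rule swpm_spheroid[OF X.ch_spheroid[OF s(1)]])
 have s': "s:cubes X n" using s(1) unfolding LP_cubes[OF X.X X.x] by simp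
 have "compose ?n ?h ?G = swpm n (ch Y n (F n s))"
  unfolding compose_def
  by (rule restrict_ext) (simp add: swp_cell ch_apply real_map_pt[OF Y.X F(1) s'])
 moreover have "?TY `` ?c = ?TY `` {compose ?n ?h ?G}"
 proof (rule saturation_eq[OF top_pi_equiv])
  show "compose ?n ?h ?G:spheroids n ?r ?Y"
   by (rule conjunct1[OF top_pi_relD[OF hs[OF top_pi_refl[OF G]]]])
  show "?c ~= {}" using top_pi_refl[OF G] by blast
  show "?c <= ?TY `` {compose ?n ?h ?G}" using hs by blast
 qed
 ultimately show ?thesis unfolding 1 top_pi_map_def unfolding s(2) X.comp_class[OF s(1)] by simp
qed

theorem theorem3p25:
 fixes n :: nat
 shows "\<exists>\<Phi> :: 'a cset \<Rightarrow> 'a \<Rightarrow> (nat \<times> 'a) set \<Rightarrow> ((nat \<Rightarrow> real) \<Rightarrow> 'a real_pt) set.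
  (\<forall>X x. pointed_kan X x \<longrightarrow>
    (n = 0 \<longrightarrow> bij_betw (\<Phi> X x) (cs_pi n X x) (top_pi n (realization X) (real_vertex X x))) \<and>
    (n \<ge> 1 \<longrightarrow>
     group (cs_pi_group n X x) \<and>
     group (top_pi_group n (realization X) (real_vertex X x)) \<and>
     \<Phi> X x \<in> iso (cs_pi_group n X x) (top_pi_group n (realization X) (real_vertex X x)))) \<and>
  (\<forall>X x Y y F. pointed_kan X x \<longrightarrow> pointed_kan Y y \<longrightarrow> pointed_map X x Y y F \<longrightarrow>
    (\<forall>A\<in>cs_pi n X x.
     \<Phi> Y y (cs_pi_map n Y y F A) =
     top_pi_map n (realization Y) (real_vertex Y y) (real_map X Y F) (\<Phi> X x A)))"
proof (intro exI conjI allI impI ballI)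
 have b: "based_kan X x" if "pointed_kan X x" for X :: "'a cset" and x
  using that by (simp add: pointed_kan_def based_kan_def kan_complex_kanE)
 have c: "cs_pi n X x = cs_pi0 (LP n X x)" for X :: "'a cset" and x
  by (simp add: cs_pi_def LP_def)
 fix X :: "'a cset" and x assume Xx: "pointed_kan X x"
 let ?t = "top_pi_group n (realization X) (real_vertex X x)"
 interpret based_kan X x by (rule b[OF Xx])
 show "bij_betw (comparison n X x) (cs_pi n X x) (top_pi n (realization X) (real_vertex X x))"
  unfolding c by (rule bij_comparison)
 assume "n >= 1"
 then obtain M where M: "n = Suc M" by (cases n) auto
 show "group (cs_pi_group n X x)" "group ?t"
  "comparison n X x:iso (cs_pi_group n X x) ?t"
  unfolding M by (rule comparison_group group_top_pi[OF p])+
next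
 fix X Y :: "'a cset" and x y F A
 assume "pointed_kan X x" "pointed_kan Y y" "pointed_map X x Y y F" "A:cs_pi n X x"
 thus "comparison n Y y (cs_pi_map n Y y F A) =
   top_pi_map n (realization Y) (real_vertex Y y) (real_map X Y F) (comparison n X x A)"
  by (intro comparison_natural)
   (simp_all add: pointed_kan_def pointed_map_def based_kan_def kan_complex_kanE cs_pi_def LP_def)
qed

end
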